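(* Let $d\in\{2,3\}$ and let $\Omega\subset\mathbb{R}^d$ be an open, bounded, convex polytope. Let $P=P(d,\Omega)>2$ be the exponent described in the context and $P'$ its Hölder conjugate. Let $p\in(1,\infty)$ and let $\omega\in A_p$ be such that one of the following holds: (i) $p\in(2,\infty)$ and $\omega\in A_1$; (ii) $p=2$ and either $\omega\in A_1$ or $\omega^{-1}\in A_2(\Omega)\cap A_1$; (iii) $p\in(P',2]$ and $\omega'\in A_{p'}(\Omega)\cap A_1$. Let $\{\mathscr{T}_h\}_{h>0}$ be a family of conforming quasiuniform simplicial meshes of $\bar\Omega$, with finite element spaces $(\mathbf{V}_h,\mathcal{P}_h)$ as in the context, satisfying the discrete inf--sup conditions (LBB) and the Green's function estimate (G) of the context. Then there is a constant $C>0$ such that for every $h$ and every $(u,\pi)\in \mathbf{W}^{1,p}_0(\omega,\Omega)\times L^p(\omega,\Omega)/\mathbb{R}$ with $\operatorname{div}u=0$, the finite element Stokes projection $(u_h,\pi_h)\in\mathbf{V}_h\times\mathcal{P}_h$ of $(u,\pi)$ satisfies $$\|\nabla u_h\|_{\mathbf{L}^p(\omega,\Omega)}+\|\pi_h\|_{L^p(\omega,\Omega)}\le C\left(\|\nabla u\|_{\mathbf{L}^p(\omega,\Omega)}+\|\pi\|_{L^p(\omega,\Omega)}\right).$$ The constant $C$ is independent of $(u,\pi)$, $(u_h,\pi_h)$ and $h$.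
   Context: **Weights.** A weight is a nonnegative locally integrable function on $\mathbb{R}^d$. For $p\in(1,\infty)$, $p'$ is the Hölder conjugate, and $\omega\in A_p$ means $[\omega]_{A_p}:=\sup_B\left(\frac1{|B|}\int_B\omega\right)\left(\frac1{|B|}\int_B\omega^{1/(1-p)}\right)^{p-1}<\infty$; $\omega\in A_1$ means $[\omega]_{A_1}:=\sup_B\left(\frac1{|B|}\int_B\omega\right)\sup_{x\in B}\frac1{\omega(x)}<\infty$ (suprema over all balls $B\subset\mathbb{R}^d$). For $\omega\in A_p$ put $\omega':=\omega^{1/(1-p)}\in A_{p'}$ (for $p=2$, $\omega'=\omega^{-1}$). A weight $\omega\in A_p$ belongs to $A_p(\Omega)$ if there are an open set $\mathcal{G}\subset\Omega$ and constants $\varepsilon,\omega_l>0$ with $\{x\in\Omega:\operatorname{dist}(x,\partial\Omega)<\varepsilon\}\subset\mathcal{G}$, $\omega\in C(\bar{\mathcal{G}})$, and $\omega\ge\omega_l$ on $\bar{\mathcal{G}}$. **Spaces.** $L^p(\omega,\Omega)$ is the $L^p$ space for the measure $\omega\,dx$; $W^{1,p}(\omega,\Omega)$ is the corresponding Sobolev space; $W^{1,p}_0(\omega,\Omega)$ is the closure of $C_0^\infty(\Omega)$ in it. Boldface denotes $\mathbb{R}^d$-valued versions; $\mathbf{W}^{-1,p}(\omega,\Omega):=\mathbf{W}_0^{1,p'}(\omega',\Omega)'$. Quotients by $\mathbb{R}$ are identified with the subspaces of zero-mean functions. Set $a(\mathbf{v},\mathbf{w})=\int_\Omega\nabla\mathbf{v}:\nabla\mathbf{w}\,dx$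 and $b(\mathbf{v},q)=-\int_\Omega q\operatorname{div}\mathbf{v}\,dx$. **The exponent $P$.** $P=2+\epsilon$ with $\epsilon=\epsilon(d,\Omega)\in(0,1]$ such that (a known theorem guarantees existence) for all $p\in(P',P)$ and $\omega\in A_p(\Omega)$ the following holds: for every $\mathbf{f}\in\mathbf{W}^{-1,p}(\omega,\Omega)$ there is a unique $(u,\pi)\in\mathbf{W}^{1,p}_0(\omega,\Omega)\times L^p(\omega,\Omega)/\mathbb{R}$ with $a(u,\mathbf{v})+b(\mathbf{v},\pi)=\langle\mathbf{f},\mathbf{v}\rangle$ for all $\mathbf{v}\in\mathbf{W}^{1,p'}_0(\omega',\Omega)$ and $b(u,q)=0$ for all $q\in L^{p'}(\omega',\Omega)/\mathbb{R}$, and $\|\nabla u\|_{\mathbf{L}^p(\omega,\Omega)}+\|\pi\|_{L^p(\omega,\Omega)}\le C\|\mathbf{f}\|_{\mathbf{W}^{-1,p}(\omega,\Omega)}$. **Discrete setting.** $\{\mathscr{T}_h\}_{h>0}$ is a quasiuniform family of conforming meshes of $\bar\Omega$ into closed simplices $T$, $h_T=\operatorname{diam}T$, $h=\max_Th_T$. Over each $\mathscr{T}_h$ we have finite element (piecewise polynomial, of uniformly bounded degree) spaces $\mathbf{V}_h\subset\mathbf{W}^{1,\infty}_0(\Omega)$ and $\mathcal{P}_h\subset L^\infty(\Omega)/\mathbb{R}$; $\mathbf{V}_h$ contains the continuous piecewise linear vector fields vanishing on $\partial\Omega$, and $\mathcal{P}_h$ contains the zero-mean piecewise constants or the zero-mean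 continuous piecewise linears. **Stokes projection.** For $(u,\pi)\in\mathbf{W}_0^{1,1}(\Omega)\times L^1(\Omega)/\mathbb{R}$ with $\operatorname{div}u=0$, its Stokes projection is the pair $(u_h,\pi_h)\in\mathbf{V}_h\times\mathcal{P}_h$ with $a(u_h,\mathbf{v}_h)+b(\mathbf{v}_h,\pi_h)=a(u,\mathbf{v}_h)+b(\mathbf{v}_h,\pi)$ for all $\mathbf{v}_h\in\mathbf{V}_h$ and $b(u_h,q_h)=0$ for all $q_h\in\mathcal{P}_h$. **Condition (LBB).** For all $p\in(1,\infty)$ and $\omega\in A_p$ there is $\beta=\beta([\omega]_{A_p})>0$ such that for all meshes $\mathscr{T}_h$, $$\inf_{q_h\in\mathcal{P}_h}\sup_{\mathbf{v}_h\in\mathbf{V}_h}\frac{b(\mathbf{v}_h,q_h)}{\|\nabla\mathbf{v}_h\|_{\mathbf{L}^{p'}(\omega',\Omega)}\|q_h\|_{L^p(\omega,\Omega)}}\ge\beta,\qquad \inf_{q_h\in\mathcal{P}_h}\sup_{\mathbf{v}_h\in\mathbf{V}_h}\frac{b(\mathbf{v}_h,q_h)}{\|\nabla\mathbf{v}_h\|_{\mathbf{L}^{p}(\omega,\Omega)}\|q_h\|_{L^{p'}(\omega',\Omega)}}\ge\beta$$ (over nonzero functions). **Condition (G).** For $z\in\Omega$ in the interior of an element $T_z\in\mathscr{T}_h$, let $\tilde\delta_z\in C_0^\infty(T_z)$ be a regularized delta with $\int_\Omega\tilde\delta_z=1$, $\|\tilde\delta_z\|_{L^\infty}\le Ch_{T_z}^{-d}$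 ($C$ independent of $z,h$), $\int_\Omega\tilde\delta_z\mathbf{v}_h\,dx=\mathbf{v}_h(z)$ and $\int_\Omega\tilde\delta_z\partial_{x_i}\mathbf{v}_h^j\,dx=\partial_{x_i}\mathbf{v}_h^j(z)$ for all $\mathbf{v}_h\in\mathbf{V}_h$ and $1\le i,j\le d$. For $i,j\in\{1,\dots,d\}$ let $(\mathbf{G},Q)\in\mathbf{H}^1_0(\Omega)\times L^2(\Omega)/\mathbb{R}$ (depending on $z,i,j$) solve $a(\mathbf{G},\mathbf{v})+b(\mathbf{v},Q)=\int_\Omega\tilde\delta_z\partial_{x_i}\mathbf{v}^j\,dx$ for all $\mathbf{v}\in\mathbf{H}^1_0(\Omega)$, $b(\mathbf{G},q)=0$ for all $q\in L^2(\Omega)/\mathbb{R}$, and let $(\mathbf{G}_h,Q_h)\in\mathbf{V}_h\times\mathcal{P}_h$ be its Stokes projection. Let $R>0$ be fixed with $\Omega\subset B(x,R)$ for all $x\in\bar\Omega$, and for $\kappa>1$ set $\sigma_z(x)=(|x-z|^2+(\kappa h)^2)^{1/2}$. Condition (G): for all $\nu\in(0,1/2)$ and $0<\lambda<\nu/2$, with $\mu=d+\lambda$, there is $\kappa_1>1$ such that for all $\kappa\ge\kappa_1$ and all $h$ with $\kappa h\le R$, $\sup_z\|\sigma_z^{\mu/2}\nabla(\mathbf{G}-\mathbf{G}_h)\|_{\mathbf{L}^2(\Omega)}\le Ch^{\lambda/2}$ with $C$ independent of $h,z,i,j$. *)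

theory Defs
  imports "HOL-Analysis.Analysis" "HOL-Probability.Essential_Supremum"
begin

section \<open>Muckenhoupt weights\<close>

definition conj_exp :: "real \<Rightarrow> real" where
  "conj_exp p = p / (p - 1)"

definition dual_weight :: "real \<Rightarrow> ('a \<Rightarrow> real) \<Rightarrow> 'a \<Rightarrow> real" where
  "dual_weight p \<omega> = (\<lambda>x. \<omega> x powr (1 / (1 - p)))"

definition is_weight :: "(real^'n \<Rightarrow> real) \<Rightarrow> bool" where
  "is_weight \<omega> \<longleftrightarrow> (\<forall>x. 0 \<le> \<omega> x) \<and> (\<forall>K. compact K \<longrightarrow> set_integrable lebesgue K \<omega>)"

text \<open>Powers with positive exponent of extended nonnegative numbers.\<close>

definition ennpowr :: "ennreal \<Rightarrow> real \<Rightarrow> ennreal" where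
  "ennpowr x a = (if x = \<infinity> then \<infinity> else ennreal (enn2real x powr a))"

definition ball_avg :: "(real^'n) set \<Rightarrow> (real^'n \<Rightarrow> real) \<Rightarrow> ennreal" where
  "ball_avg B f = (\<integral>\<^sup>+x\<in>B. ennreal (f x) \<partial>lebesgue) / emeasure lebesgue B"

definition Ap_const :: "real \<Rightarrow> (real^'n \<Rightarrow> real) \<Rightarrow> ennreal" where
  "Ap_const p \<omega> = (SUP B\<in>{ball x r | x r. 0 < r}.
      ball_avg B \<omega> * ennpowr (ball_avg B (dual_weight p \<omega>)) (p - 1))"

text \<open>Weights are identified when they agree almost everywhere, so the supremum of \<open>1/\<omega>\<close>
  over a ball is the essential one. (With real-valued representatives a pointwise supremum
  would exclude \<open>\<bar>x\<bar>\<close> to a negative power.)\<close>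

definition A1_const :: "(real^'n \<Rightarrow> real) \<Rightarrow> ennreal" where
  "A1_const \<omega> = (SUP B\<in>{ball x r | x r. 0 < r}.
      ball_avg B \<omega> * esssup (lebesgue_on B) (\<lambda>x. inverse (ennreal (\<omega> x))))"

text \<open>Positivity almost everywhere follows from finiteness of the constants except for \<open>\<omega> = 0\<close>,
  which would slip in through \<open>0 * \<infinity> = 0\<close>; it also makes the convention
  \<open>0 powr a = 0\<close> in \<^const>\<open>dual_weight\<close> harmless.\<close>

definition Ap :: "real \<Rightarrow> (real^'n \<Rightarrow> real) set" where
  "Ap p = {\<omega>. is_weight \<omega> \<and> (AE x in lebesgue. 0 < \<omega> x) \<and> Ap_const p \<omega> < \<infinity>}"

definition A1 :: "(real^'n \<Rightarrow> real) set" where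
  "A1 = {\<omega>. is_weight \<omega> \<and> (AE x in lebesgue. 0 < \<omega> x) \<and> A1_const \<omega> < \<infinity>}"

definition Ap_dom :: "real \<Rightarrow> (real^'n) set \<Rightarrow> (real^'n \<Rightarrow> real) set" where
  "Ap_dom p \<Omega> = {\<omega> \<in> Ap p. \<exists>G \<epsilon> \<omega>\<^sub>l. open G \<and> G \<subseteq> \<Omega> \<and> 0 < \<epsilon> \<and> 0 < \<omega>\<^sub>l \<and>
      {x\<in>\<Omega>. infdist x (frontier \<Omega>) < \<epsilon>} \<subseteq> G \<and>
      continuous_on (closure G) \<omega> \<and> (\<forall>x\<in>closure G. \<omega>\<^sub>l \<le> \<omega> x)}"


section \<open>Weighted Lebesgue and Sobolev spaces\<close>

text \<open>Elements of function spaces are represented by functions on the whole space; only their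
  values almost everywhere on \<open>\<Omega>\<close> matter.\<close>

definition Lp :: "real \<Rightarrow> (real^'n \<Rightarrow> real) \<Rightarrow> (real^'n) set \<Rightarrow> (real^'n \<Rightarrow> 'b::euclidean_space) set" where
  "Lp p \<omega> \<Omega> = {f \<in> borel_measurable (lebesgue_on \<Omega>).
      set_integrable lebesgue \<Omega> (\<lambda>x. norm (f x) powr p * \<omega> x)}"

definition Lp_norm :: "real \<Rightarrow> (real^'n \<Rightarrow> real) \<Rightarrow> (real^'n) set \<Rightarrow> (real^'n \<Rightarrow> 'b::euclidean_space) \<Rightarrow> real" where
  "Lp_norm p \<omega> \<Omega> f = (LINT x:\<Omega>|lebesgue. norm (f x) powr p * \<omega> x) powr (1 / p)"

definition Linf :: "(real^'n) set \<Rightarrow> (real^'n \<Rightarrow> 'b::euclidean_space) set" where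
  "Linf \<Omega> = {f \<in> borel_measurable (lebesgue_on \<Omega>). \<exists>C. AE x\<in>\<Omega> in lebesgue. norm (f x) \<le> C}"

definition zero_mean :: "(real^'n) set \<Rightarrow> (real^'n \<Rightarrow> real) \<Rightarrow> bool" where
  "zero_mean \<Omega> q \<longleftrightarrow> (LINT x:\<Omega>|lebesgue. q x) = 0"

definition Lp_mod_R :: "real \<Rightarrow> (real^'n \<Rightarrow> real) \<Rightarrow> (real^'n) set \<Rightarrow> (real^'n \<Rightarrow> real) set" where
  "Lp_mod_R p \<omega> \<Omega> = {q \<in> Lp p \<omega> \<Omega>. zero_mean \<Omega> q}"

text \<open>The partial derivative in direction \<open>i\<close>.\<close>

definition pderivative :: "'n \<Rightarrow> (real^'n \<Rightarrow> 'b::real_normed_vector) \<Rightarrow> real^'n \<Rightarrow> 'b" where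
  "pderivative i f = (\<lambda>x. frechet_derivative f (at x) (axis i 1))"

primrec Ck :: "nat \<Rightarrow> (real^'n \<Rightarrow> 'b::real_normed_vector) \<Rightarrow> bool" where
  "Ck 0 f \<longleftrightarrow> continuous_on UNIV f"
| "Ck (Suc k) f \<longleftrightarrow> (\<forall>x. f differentiable (at x)) \<and> (\<forall>i. Ck k (pderivative i f))"

definition Cc_infinity :: "(real^'n) set \<Rightarrow> (real^'n \<Rightarrow> 'b::real_normed_vector) set" where
  "Cc_infinity \<Omega> = {\<phi>. (\<forall>k. Ck k \<phi>) \<and>
      compact (closure {x. \<phi> x \<noteq> 0}) \<and> closure {x. \<phi> x \<noteq> 0} \<subseteq> \<Omega>}"

definition loc_integrable :: "(real^'n) set \<Rightarrow> (real^'n \<Rightarrow> 'b::euclidean_space) \<Rightarrow> bool" where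
  "loc_integrable \<Omega> f \<longleftrightarrow> (\<forall>K. compact K \<and> K \<subseteq> \<Omega> \<longrightarrow> set_integrable lebesgue K f)"

text \<open>Gradients of vector fields are Jacobian matrices: \<open>G x $ j $ i\<close> is the \<open>i\<close>-th partial
  derivative of the \<open>j\<close>-th component, so that the inner product and the norm of
  \<^typ>\<open>real^'n^'n\<close> are those of Frobenius.\<close>

definition has_weak_grad :: "(real^'n) set \<Rightarrow> (real^'n \<Rightarrow> real^'n) \<Rightarrow> (real^'n \<Rightarrow> real^'n^'n) \<Rightarrow> bool" where
  "has_weak_grad \<Omega> u G \<longleftrightarrow> loc_integrable \<Omega> u \<and> loc_integrable \<Omega> G \<and>
     (\<forall>\<phi>::real^'n \<Rightarrow> real. \<phi> \<in> Cc_infinity \<Omega> \<longrightarrow> (\<forall>i.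
        (LINT x:\<Omega>|lebesgue. pderivative i \<phi> x *\<^sub>R u x) =
        - (LINT x:\<Omega>|lebesgue. \<phi> x *\<^sub>R column i (G x))))"

text \<open>A representative of the weak gradient, which is unique up to a null set if it exists.\<close>

definition wgrad :: "(real^'n) set \<Rightarrow> (real^'n \<Rightarrow> real^'n) \<Rightarrow> real^'n \<Rightarrow> real^'n^'n" where
  "wgrad \<Omega> u = (SOME G. has_weak_grad \<Omega> u G)"

definition wdiv :: "(real^'n) set \<Rightarrow> (real^'n \<Rightarrow> real^'n) \<Rightarrow> real^'n \<Rightarrow> real" where
  "wdiv \<Omega> u = (\<lambda>x. trace (wgrad \<Omega> u x))"

definition W1p :: "real \<Rightarrow> (real^'n \<Rightarrow> real) \<Rightarrow> (real^'n) set \<Rightarrow> (real^'n \<Rightarrow> real^'n) set" where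
  "W1p p \<omega> \<Omega> = {u \<in> Lp p \<omega> \<Omega>. (\<exists>G. has_weak_grad \<Omega> u G) \<and> wgrad \<Omega> u \<in> Lp p \<omega> \<Omega>}"

definition W1p_norm :: "real \<Rightarrow> (real^'n \<Rightarrow> real) \<Rightarrow> (real^'n) set \<Rightarrow> (real^'n \<Rightarrow> real^'n) \<Rightarrow> real" where
  "W1p_norm p \<omega> \<Omega> u =
     (Lp_norm p \<omega> \<Omega> u powr p + Lp_norm p \<omega> \<Omega> (wgrad \<Omega> u) powr p) powr (1 / p)"

definition W1p0 :: "real \<Rightarrow> (real^'n \<Rightarrow> real) \<Rightarrow> (real^'n) set \<Rightarrow> (real^'n \<Rightarrow> real^'n) set" where
  "W1p0 p \<omega> \<Omega> = {u \<in> W1p p \<omega> \<Omega>. \<exists>\<phi>::nat \<Rightarrow> real^'n \<Rightarrow> real^'n.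
      (\<forall>n. \<phi> n \<in> Cc_infinity \<Omega>) \<and> (\<lambda>n. W1p_norm p \<omega> \<Omega> (\<lambda>x. \<phi> n x - u x)) \<longlonglongrightarrow> 0}"

text \<open>Here the subscript 0 means zero boundary values; the closure of the test functions in the
  \<open>W\<^sup>1\<^sup>,\<^sup>\<infinity>\<close> norm would consist of continuously differentiable functions only.\<close>

definition W1inf0 :: "(real^'n) set \<Rightarrow> (real^'n \<Rightarrow> real^'n) set" where
  "W1inf0 \<Omega> = {u \<in> W1p0 1 (\<lambda>_. 1) \<Omega>. u \<in> Linf \<Omega> \<and> wgrad \<Omega> u \<in> Linf \<Omega>}"

text \<open>The dual of \<^term>\<open>W1p0 p \<omega> \<Omega>\<close> and its norm. Only the values of functionals on that space
  are relevant.\<close>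

definition W1p0_dual :: "real \<Rightarrow> (real^'n \<Rightarrow> real) \<Rightarrow> (real^'n) set \<Rightarrow> ((real^'n \<Rightarrow> real^'n) \<Rightarrow> real) set" where
  "W1p0_dual p \<omega> \<Omega> = {f.
      (\<forall>v\<in>W1p0 p \<omega> \<Omega>. \<forall>w\<in>W1p0 p \<omega> \<Omega>. f (\<lambda>x. v x + w x) = f v + f w) \<and>
      (\<forall>c. \<forall>v\<in>W1p0 p \<omega> \<Omega>. f (\<lambda>x. c *\<^sub>R v x) = c * f v) \<and>
      (\<exists>K. \<forall>v\<in>W1p0 p \<omega> \<Omega>. \<bar>f v\<bar> \<le> K * W1p_norm p \<omega> \<Omega> v)}"

definition W1p0_dual_norm :: "real \<Rightarrow> (real^'n \<Rightarrow> real) \<Rightarrow> (real^'n) set \<Rightarrow> ((real^'n \<Rightarrow> real^'n) \<Rightarrow> real) \<Rightarrow> real" where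
  "W1p0_dual_norm p \<omega> \<Omega> f = (SUP v\<in>{v \<in> W1p0 p \<omega> \<Omega>. W1p_norm p \<omega> \<Omega> v \<le> 1}. \<bar>f v\<bar>)"


section \<open>The Stokes problem\<close>

definition a_form :: "(real^'n) set \<Rightarrow> (real^'n \<Rightarrow> real^'n) \<Rightarrow> (real^'n \<Rightarrow> real^'n) \<Rightarrow> real" where
  "a_form \<Omega> v w = (LINT x:\<Omega>|lebesgue. wgrad \<Omega> v x \<bullet> wgrad \<Omega> w x)"

definition b_form :: "(real^'n) set \<Rightarrow> (real^'n \<Rightarrow> real^'n) \<Rightarrow> (real^'n \<Rightarrow> real) \<Rightarrow> real" where
  "b_form \<Omega> v q = - (LINT x:\<Omega>|lebesgue. q x * wdiv \<Omega> v x)"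

definition stokes_solution ::
  "real \<Rightarrow> (real^'n \<Rightarrow> real) \<Rightarrow> (real^'n) set \<Rightarrow> ((real^'n \<Rightarrow> real^'n) \<Rightarrow> real)
    \<Rightarrow> (real^'n \<Rightarrow> real^'n) \<Rightarrow> (real^'n \<Rightarrow> real) \<Rightarrow> bool" where
  "stokes_solution p \<omega> \<Omega> f u \<pi> \<longleftrightarrow>
     u \<in> W1p0 p \<omega> \<Omega> \<and> \<pi> \<in> Lp_mod_R p \<omega> \<Omega> \<and>
     (\<forall>v\<in>W1p0 (conj_exp p) (dual_weight p \<omega>) \<Omega>. a_form \<Omega> u v + b_form \<Omega> v \<pi> = f v) \<and>
     (\<forall>q\<in>Lp_mod_R (conj_exp p) (dual_weight p \<omega>) \<Omega>. b_form \<Omega> u q = 0)"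

definition stokes_well_posed :: "real \<Rightarrow> (real^'n \<Rightarrow> real) \<Rightarrow> (real^'n) set \<Rightarrow> bool" where
  "stokes_well_posed p \<omega> \<Omega> \<longleftrightarrow> (\<exists>C. \<forall>f\<in>W1p0_dual (conj_exp p) (dual_weight p \<omega>) \<Omega>.
     (\<exists>u \<pi>. stokes_solution p \<omega> \<Omega> f u \<pi> \<and>
        (\<forall>u' \<pi>'. stokes_solution p \<omega> \<Omega> f u' \<pi>' \<longrightarrow>
           (AE x\<in>\<Omega> in lebesgue. u' x = u x) \<and> (AE x\<in>\<Omega> in lebesgue. \<pi>' x = \<pi> x)) \<and>
        Lp_norm p \<omega> \<Omega> (wgrad \<Omega> u) + Lp_norm p \<omega> \<Omega> \<pi>
          \<le> C * W1p0_dual_norm (conj_exp p) (dual_weight p \<omega>) \<Omega> f))"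

definition stokes_exponent :: "(real^'n) set \<Rightarrow> real \<Rightarrow> bool" where
  "stokes_exponent \<Omega> P \<longleftrightarrow> 2 < P \<and> P \<le> 3 \<and>
     (\<forall>p \<omega>. conj_exp P < p \<and> p < P \<and> \<omega> \<in> Ap_dom p \<Omega> \<longrightarrow> stokes_well_posed p \<omega> \<Omega>)"


section \<open>Meshes and finite element spaces\<close>

text \<open>The index set \<open>H\<close> collects the mesh sizes that occur in the family.\<close>

definition conforming_mesh :: "(real^'n) set \<Rightarrow> (real^'n) set set \<Rightarrow> bool" where
  "conforming_mesh \<Omega> \<T> \<longleftrightarrow> triangulation \<T> \<and> (\<forall>T\<in>\<T>. int CARD('n) simplex T) \<and> \<Union>\<T> = closure \<Omega>"

definition quasiuniform_meshes :: "(real^'n) set \<Rightarrow> real set \<Rightarrow> (real \<Rightarrow> (real^'n) set set) \<Rightarrow> bool" where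
  "quasiuniform_meshes \<Omega> H \<T> \<longleftrightarrow>
     (\<forall>h\<in>H. 0 < h \<and> conforming_mesh \<Omega> (\<T> h) \<and> h = Max (diameter ` \<T> h)) \<and>
     (\<exists>\<sigma>>0. \<forall>h\<in>H. \<forall>T\<in>\<T> h. \<exists>x. cball x (\<sigma> * diameter T) \<subseteq> T) \<and>
     (\<exists>c>0. \<forall>h\<in>H. \<forall>T\<in>\<T> h. c * h \<le> diameter T)"

definition poly_degree_le :: "nat \<Rightarrow> (real^'n \<Rightarrow> 'b::real_vector) \<Rightarrow> bool" where
  "poly_degree_le k g \<longleftrightarrow> (\<exists>c :: ('n \<Rightarrow> nat) \<Rightarrow> 'b. \<forall>x.
     g x = (\<Sum>\<alpha> | sum \<alpha> UNIV \<le> k. (\<Prod>i\<in>UNIV. (x $ i) ^ \<alpha> i) *\<^sub>R c \<alpha>))"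

definition piecewise_poly :: "nat \<Rightarrow> (real^'n) set set \<Rightarrow> (real^'n \<Rightarrow> 'b::real_vector) \<Rightarrow> bool" where
  "piecewise_poly k \<T> f \<longleftrightarrow>
     (\<forall>T\<in>\<T>. \<exists>g. poly_degree_le k g \<and> (\<forall>x\<in>interior T. f x = g x))"

definition function_subspace :: "('a \<Rightarrow> 'b::real_vector) set \<Rightarrow> bool" where
  "function_subspace S \<longleftrightarrow> (\<lambda>x. 0) \<in> S \<and> (\<forall>f\<in>S. \<forall>g\<in>S. (\<lambda>x. f x + g x) \<in> S) \<and>
     (\<forall>c. \<forall>f\<in>S. (\<lambda>x. c *\<^sub>R f x) \<in> S)"

text \<open>Velocities are represented by their continuous representatives, extended by zero outside
  \<open>\<Omega>\<close>. Pressures may jump across faces, so membership of given pressures is up to a null set.\<close>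

definition velocity_space :: "(real^'n) set \<Rightarrow> (real^'n) set set \<Rightarrow> nat \<Rightarrow> (real^'n \<Rightarrow> real^'n) set \<Rightarrow> bool" where
  "velocity_space \<Omega> \<T> k V \<longleftrightarrow> function_subspace V \<and>
     (\<forall>v\<in>V. continuous_on UNIV v \<and> (\<forall>x. x \<notin> \<Omega> \<longrightarrow> v x = 0) \<and> piecewise_poly k \<T> v \<and> v \<in> W1inf0 \<Omega>) \<and>
     {v. continuous_on UNIV v \<and> (\<forall>x. x \<notin> \<Omega> \<longrightarrow> v x = 0) \<and> piecewise_poly 1 \<T> v} \<subseteq> V"

definition pressure_space :: "(real^'n) set \<Rightarrow> (real^'n) set set \<Rightarrow> nat \<Rightarrow> (real^'n \<Rightarrow> real) set \<Rightarrow> bool" where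
  "pressure_space \<Omega> \<T> k Q \<longleftrightarrow> function_subspace Q \<and>
     (\<forall>q\<in>Q. q \<in> Linf \<Omega> \<and> zero_mean \<Omega> q \<and> piecewise_poly k \<T> q) \<and>
     ((\<forall>q. piecewise_poly 0 \<T> q \<and> zero_mean \<Omega> q \<longrightarrow>
         (\<exists>q'\<in>Q. AE x\<in>\<Omega> in lebesgue. q' x = q x)) \<or>
      (\<forall>q. continuous_on (closure \<Omega>) q \<and> piecewise_poly 1 \<T> q \<and> zero_mean \<Omega> q \<longrightarrow>
         (\<exists>q'\<in>Q. AE x\<in>\<Omega> in lebesgue. q' x = q x)))"

definition fe_spaces ::
  "(real^'n) set \<Rightarrow> real set \<Rightarrow> (real \<Rightarrow> (real^'n) set set)
    \<Rightarrow> (real \<Rightarrow> (real^'n \<Rightarrow> real^'n) set) \<Rightarrow> (real \<Rightarrow> (real^'n \<Rightarrow> real) set) \<Rightarrow> bool" where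
  "fe_spaces \<Omega> H \<T> V Q \<longleftrightarrow>
     (\<exists>k. \<forall>h\<in>H. velocity_space \<Omega> (\<T> h) k (V h) \<and> pressure_space \<Omega> (\<T> h) k (Q h))"

definition is_stokes_projection ::
  "(real^'n) set \<Rightarrow> (real^'n \<Rightarrow> real^'n) set \<Rightarrow> (real^'n \<Rightarrow> real) set
    \<Rightarrow> (real^'n \<Rightarrow> real^'n) \<Rightarrow> (real^'n \<Rightarrow> real) \<Rightarrow> (real^'n \<Rightarrow> real^'n) \<Rightarrow> (real^'n \<Rightarrow> real) \<Rightarrow> bool" where
  "is_stokes_projection \<Omega> V Q u \<pi> u\<^sub>h \<pi>\<^sub>h \<longleftrightarrow> u\<^sub>h \<in> V \<and> \<pi>\<^sub>h \<in> Q \<and>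
     (\<forall>v\<in>V. a_form \<Omega> u\<^sub>h v + b_form \<Omega> v \<pi>\<^sub>h = a_form \<Omega> u v + b_form \<Omega> v \<pi>) \<and>
     (\<forall>q\<in>Q. b_form \<Omega> u\<^sub>h q = 0)"


section \<open>The discrete inf-sup condition\<close>

definition nonzero_on :: "(real^'n) set \<Rightarrow> (real^'n \<Rightarrow> 'b::zero) \<Rightarrow> bool" where
  "nonzero_on \<Omega> f \<longleftrightarrow> \<not> (AE x\<in>\<Omega> in lebesgue. f x = 0)"

text \<open>Velocity gradients are measured in \<open>L\<^sup>r(\<rho>)\<close>, pressures in \<open>L\<^sup>s(\<tau>)\<close>.\<close>

definition inf_sup_const ::
  "(real^'n) set \<Rightarrow> (real^'n \<Rightarrow> real^'n) set \<Rightarrow> (real^'n \<Rightarrow> real) set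
    \<Rightarrow> real \<Rightarrow> (real^'n \<Rightarrow> real) \<Rightarrow> real \<Rightarrow> (real^'n \<Rightarrow> real) \<Rightarrow> ereal" where
  "inf_sup_const \<Omega> V Q r \<rho> s \<tau> =
     (INF q\<in>{q \<in> Q. nonzero_on \<Omega> q}. SUP v\<in>{v \<in> V. nonzero_on \<Omega> v}.
        ereal (b_form \<Omega> v q / (Lp_norm r \<rho> \<Omega> (wgrad \<Omega> v) * Lp_norm s \<tau> \<Omega> q)))"

text \<open>Apart from \<open>p\<close>, the constant depends on the weight only through its \<open>A\<^sub>p\<close> constant.\<close>

definition LBB ::
  "(real^'n) set \<Rightarrow> real set \<Rightarrow> (real \<Rightarrow> (real^'n \<Rightarrow> real^'n) set) \<Rightarrow> (real \<Rightarrow> (real^'n \<Rightarrow> real) set) \<Rightarrow> bool" where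
  "LBB \<Omega> H V Q \<longleftrightarrow> (\<exists>\<beta> :: real \<Rightarrow> ennreal \<Rightarrow> real. \<forall>p>1. \<forall>\<omega>\<in>Ap p.
     0 < \<beta> p (Ap_const p \<omega>) \<and>
     (\<forall>h\<in>H.
        ereal (\<beta> p (Ap_const p \<omega>))
          \<le> inf_sup_const \<Omega> (V h) (Q h) (conj_exp p) (dual_weight p \<omega>) p \<omega> \<and>
        ereal (\<beta> p (Ap_const p \<omega>))
          \<le> inf_sup_const \<Omega> (V h) (Q h) p \<omega> (conj_exp p) (dual_weight p \<omega>)))"


section \<open>Regularized Green's functions\<close>

text \<open>\<open>\<delta> h z\<close> is the regularized delta at \<open>z\<close> for the mesh of size \<open>h\<close>; it is constrained only if
  \<open>z\<close> is interior to an element, which is then unique.\<close>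

definition regularized_deltas ::
  "(real^'n) set \<Rightarrow> real set \<Rightarrow> (real \<Rightarrow> (real^'n) set set) \<Rightarrow> (real \<Rightarrow> (real^'n \<Rightarrow> real^'n) set)
    \<Rightarrow> (real \<Rightarrow> real^'n \<Rightarrow> real^'n \<Rightarrow> real) \<Rightarrow> bool" where
  "regularized_deltas \<Omega> H \<T> V \<delta> \<longleftrightarrow> (\<exists>C. \<forall>h\<in>H. \<forall>T\<in>\<T> h. \<forall>z\<in>interior T.
     \<delta> h z \<in> Cc_infinity (interior T) \<and>
     (LINT x:\<Omega>|lebesgue. \<delta> h z x) = 1 \<and>
     (\<forall>x. \<bar>\<delta> h z x\<bar> \<le> C * diameter T powr (- real CARD('n))) \<and>
     (\<forall>v\<in>V h. (LINT x:\<Omega>|lebesgue. \<delta> h z x *\<^sub>R v x) = v z \<and>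
        (\<forall>i j. (LINT x:\<Omega>|lebesgue. \<delta> h z x * wgrad \<Omega> v x $ j $ i) = pderivative i v z $ j)))"

definition is_green_pair ::
  "(real^'n) set \<Rightarrow> (real^'n \<Rightarrow> real) \<Rightarrow> 'n \<Rightarrow> 'n \<Rightarrow> (real^'n \<Rightarrow> real^'n) \<Rightarrow> (real^'n \<Rightarrow> real) \<Rightarrow> bool" where
  "is_green_pair \<Omega> d i j G S \<longleftrightarrow>
     G \<in> W1p0 2 (\<lambda>_. 1) \<Omega> \<and> S \<in> Lp_mod_R 2 (\<lambda>_. 1) \<Omega> \<and>
     (\<forall>v\<in>W1p0 2 (\<lambda>_. 1) \<Omega>.
        a_form \<Omega> G v + b_form \<Omega> v S = (LINT x:\<Omega>|lebesgue. d x * wgrad \<Omega> v x $ j $ i)) \<and>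
     (\<forall>q\<in>Lp_mod_R 2 (\<lambda>_. 1) \<Omega>. b_form \<Omega> G q = 0)"

definition sigma :: "real \<Rightarrow> real \<Rightarrow> real^'n \<Rightarrow> real^'n \<Rightarrow> real" where
  "sigma \<kappa> h z x = sqrt ((norm (x - z))\<^sup>2 + (\<kappa> * h)\<^sup>2)"

definition green_estimate ::
  "(real^'n) set \<Rightarrow> real set \<Rightarrow> (real \<Rightarrow> (real^'n) set set) \<Rightarrow> (real \<Rightarrow> (real^'n \<Rightarrow> real^'n) set)
    \<Rightarrow> (real \<Rightarrow> (real^'n \<Rightarrow> real) set) \<Rightarrow> (real \<Rightarrow> real^'n \<Rightarrow> real^'n \<Rightarrow> real) \<Rightarrow> real \<Rightarrow> bool" where
  "green_estimate \<Omega> H \<T> V Q \<delta> R \<longleftrightarrow>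
     (\<forall>\<nu> l \<mu>. 0 < \<nu> \<and> \<nu> < 1/2 \<and> 0 < l \<and> l < \<nu> / 2 \<and> \<mu> = real CARD('n) + l \<longrightarrow>
       (\<exists>\<kappa>\<^sub>1>1. \<forall>\<kappa>\<ge>\<kappa>\<^sub>1. \<exists>C. \<forall>h\<in>H. \<kappa> * h \<le> R \<longrightarrow>
         (\<forall>T\<in>\<T> h. \<forall>z\<in>interior T. \<forall>i j G S G\<^sub>h S\<^sub>h.
            is_green_pair \<Omega> (\<delta> h z) i j G S \<and>
            is_stokes_projection \<Omega> (V h) (Q h) G S G\<^sub>h S\<^sub>h \<longrightarrow>
            Lp_norm 2 (\<lambda>_. 1) \<Omega>
              (\<lambda>x. sigma \<kappa> h z x powr (\<mu> / 2) *\<^sub>R wgrad \<Omega> (\<lambda>y. G y - G\<^sub>h y) x)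
              \<le> C * h powr (l / 2))))"

end

theory Submission
  imports Defs
begin

text \<open>The Green's function estimate (G), in which \<open>\<mu> = d + \<lambda>\<close>, bounds every entry of \<open>\<nabla>u\<^sub>h(z)\<close>: writing it as
  \<open>\<integral> \<delta>\<^sub>z \<partial>\<^sub>i u\<^sup>j + a(u, G\<^sub>h - G) + b(G\<^sub>h - G, \<pi>)\<close> and using Cauchy--Schwarz with the weight \<open>\<sigma>\<^sub>z\<close>, one gets
  \<open>\<bar>\<nabla>u\<^sub>h(z)\<bar>\<^sup>2 \<le> C \<integral> k\<^sub>h(z, x) (\<bar>\<nabla>u(x)\<bar> + \<bar>\<pi>(x)\<bar>)\<^sup>2 dx\<close> with the kernel \<open>k\<^sub>h(z, x) = h\<^sup>\<lambda> \<sigma>\<^sub>z(x)\<^sup>-\<^sup>d\<^sup>-\<^sup>\<lambda>\<close>, which has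
  bounded mass. Since \<open>k\<^sub>h\<close> is a dyadic sum of normalised indicator functions of balls, \<open>\<integral> k\<^sub>h(z, x) \<omega>(z) dz \<le> C \<omega>(x)\<close>
  for \<open>\<omega> \<in> A\<^sub>1\<close>. Jensen's inequality in \<open>x\<close> and Tonelli's theorem then give the velocity bound for \<open>p \<ge> 2\<close> and \<open>\<omega> \<in> A\<^sub>1\<close>.
  For \<open>p \<le> 2\<close> and \<open>\<omega>' \<in> A\<^sub>1\<close> it follows by duality, from the bound for \<open>(p', \<omega>')\<close> and the well-posedness of the
  weighted Stokes problem. The pressure is controlled by the velocity through the inf-sup condition.\<close>

section \<open>Smooth functions of compact support\<close>

text \<open>The bound is sought in a weighted space, whereas the Green's functions live in H^1_0;
  the two meet through one-sided bounds. On the bounded set \<Omega> a weight in A_1 is bounded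
  below, so for p \<ge> 2 the data lie in H^1_0 and L^2. If instead \<omega>' is in A_1, then
  \<omega> is bounded above, so every L^2 pressure is an admissible test function in L^p(\<omega>).
  The threshold 2 stems from (G) being an L^2 estimate: Jensen's inequality is applied to the power
  p/2. Two facts that are easily taken for granted need an argument. Condition (G) speaks of a Green
  pair and of its Stokes projection, so both must exist: the first by well-posedness for p = 2 and
  \<omega> = 1, the second by finite dimensionality. And a discrete velocity may be inserted into a
  continuous problem only if it is a limit of smooth functions of compact support in the weighted
  norm. This rests on the convexity of \<Omega> and accounts for the theory of smooth functions,
  weak gradients and mollifiers.\<close>

lemma pderivative_eq:
  assumes "(f has_derivative D) (at x)"
  shows "pderivative i f x = D (axis i 1)"
  using frechet_derivative_at[OF assms] by (simp add: pderivative_def)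

lemma has_derivative_frechet:
  assumes "f differentiable at x"
  shows "(f has_derivative frechet_derivative f (at x)) (at x)"
  using assms frechet_derivative_works by blast

lemma Ck_continuous: "Ck k f \<Longrightarrow> continuous_on UNIV f"
  by (cases k) (auto intro!: continuous_at_imp_continuous_on differentiable_imp_continuous_within)

lemma Ck_Suc_imp_Ck: "Ck (Suc k) f \<Longrightarrow> Ck k f"
proof (induction k arbitrary: f)
  case 0
  then show ?case by (metis Ck.simps(1) Ck_continuous)
next
  case (Suc k)
  then show ?case by (metis Ck.simps(2))
qed

lemma Ck_const [simp]: "Ck k (\<lambda>x::real^'n. c)"
proof (induction k arbitrary: c)
  case (Suc k)
  have "pderivative i (\<lambda>x::real^'n. c) = (\<lambda>x. 0)" for i
    by (rule ext, subst pderivative_eq[where D = "\<lambda>_. 0"]) auto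
  with Suc show ?case by simp
qed simp

lemma Ck_add:
  assumes "Ck k f" "Ck k g"
  shows "Ck k (\<lambda>x. f x + g x)"
  using assms
proof (induction k arbitrary: f g)
  case 0
  then show ?case by (auto intro: continuous_on_add)
next
  case (Suc k)
  have d: "((\<lambda>x. f x + g x) has_derivative
      (\<lambda>h. frechet_derivative f (at x) h + frechet_derivative g (at x) h)) (at x)" for x
    using Suc.prems by (intro has_derivative_add has_derivative_frechet) auto
  have "pderivative i (\<lambda>x. f x + g x) = (\<lambda>x. pderivative i f x + pderivative i g x)" for i
    by (rule ext, subst pderivative_eq[OF d]) (simp add: pderivative_def)
  moreover have "(\<lambda>x. f x + g x) differentiable at x" for x
    using d differentiable_def by blast
  ultimately show ?case using Suc by auto
qed

lemma pderivative_scaleR: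
  assumes "f differentiable at x" "g differentiable at x"
  shows "pderivative i (\<lambda>x. f x *\<^sub>R g x) x = f x *\<^sub>R pderivative i g x + pderivative i f x *\<^sub>R g x"
proof -
  have "((\<lambda>x. f x *\<^sub>R g x) has_derivative
      (\<lambda>h. f x *\<^sub>R frechet_derivative g (at x) h + frechet_derivative f (at x) h *\<^sub>R g x)) (at x)"
    using assms by (intro has_derivative_scaleR has_derivative_frechet)
  from pderivative_eq[OF this] show ?thesis by (simp add: pderivative_def)
qed

lemma Ck_scaleR:
  fixes f :: "real^'n \<Rightarrow> real"
  assumes "Ck k f" "Ck k g"
  shows "Ck k (\<lambda>x. f x *\<^sub>R g x)"
  using assms
proof (induction k arbitrary: f g)
  case 0
  then show ?case by (auto intro: continuous_on_scaleR)
next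
  case (Suc k)
  have "pderivative i (\<lambda>x. f x *\<^sub>R g x)
      = (\<lambda>x. f x *\<^sub>R pderivative i g x + pderivative i f x *\<^sub>R g x)" for i
    using Suc.prems by (intro ext pderivative_scaleR) auto
  moreover have "Ck k f" "Ck k g" using Suc.prems Ck_Suc_imp_Ck by blast+
  ultimately show ?case using Suc by (auto intro!: Ck_add differentiable_scaleR)
qed

lemma Ck_mult:
  fixes f g :: "real^'n \<Rightarrow> real"
  assumes "Ck k f" "Ck k g"
  shows "Ck k (\<lambda>x. f x * g x)"
  using Ck_scaleR[OF assms] by simp

lemma Ck_linear:
  assumes L: "bounded_linear (L :: real^'n \<Rightarrow> 'b::real_normed_vector)"
  shows "Ck k L"
proof (cases k)
  case 0
  then show ?thesis using L linear_continuous_on by auto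
next
  case (Suc j)
  have d: "(L has_derivative L) (at x)" for x
    using L by (rule bounded_linear_imp_has_derivative)
  have "pderivative i L = (\<lambda>x. L (axis i 1))" for i
    by (rule ext, subst pderivative_eq[OF d]) simp
  with d Suc show ?thesis by (auto simp: differentiable_def)
qed

lemma Ck_prod:
  fixes f :: "'i \<Rightarrow> real^'n \<Rightarrow> real"
  assumes "finite I" "\<And>i. i \<in> I \<Longrightarrow> Ck k (f i)"
  shows "Ck k (\<lambda>x. \<Prod>i\<in>I. f i x)"
  using assms by (induction I rule: finite_induct) (auto intro!: Ck_mult)

text \<open>The induction on the order must treat all members of the family \<open>D\<close> at
  once, because differentiating one member leads to others; the second premise says that
  \<open>D'\<close> is built from the family in a way that preserves regularity. A constant family
  handles the exponential, the family \<open>flat\<close> handles exp(-1/t).\<close>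

lemma Ck_compose_real:
  assumes "\<And>n t. (D n has_real_derivative D' n t) (at t)"
    and "\<And>k n. (\<And>m. Ck k (\<lambda>x. D m (g x))) \<Longrightarrow> Ck k (\<lambda>x. D' n (g x))"
    and "Ck k g"
  shows "Ck k (\<lambda>x. D (n::nat) (g x))"
  using assms(3)
proof (induction k arbitrary: n)
  case 0
  have "continuous_on UNIV (D n)"
    using assms(1) by (intro continuous_at_imp_continuous_on ballI DERIV_isCont)
  then show ?case using 0 by (auto intro: continuous_on_compose2)
next
  case (Suc k)
  have d: "((\<lambda>x. D n (g x)) has_derivative (\<lambda>h. D' n (g x) * frechet_derivative g (at x) h)) (at x)" for x
    using Suc.prems assms(1)[of n "g x"]
    by (auto intro!: has_derivative_compose[OF has_derivative_frechet, of g x, unfolded has_field_derivative_def]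
        simp: has_field_derivative_def)
  have "pderivative i (\<lambda>x. D n (g x)) = (\<lambda>x. D' n (g x) * pderivative i g x)" for i
    by (rule ext, subst pderivative_eq[OF d]) (simp add: pderivative_def)
  moreover have "(\<lambda>x. D n (g x)) differentiable at x" for x
    using d differentiable_def by blast
  moreover have "Ck k g" using Suc.prems Ck_Suc_imp_Ck by blast
  then have "Ck k (\<lambda>x. D' n (g x))" by (intro assms(2) Suc.IH)
  ultimately show ?case using Suc.prems by (auto intro!: Ck_mult)
qed

lemma Ck_exp: "Ck k g \<Longrightarrow> Ck k (\<lambda>x. exp (g x :: real))"
  using Ck_compose_real[of "\<lambda>_. exp" "\<lambda>_. exp" g k] DERIV_exp by auto

section \<open>The flat function exp(-1/t) and bump functions on boxes\<close>

definition flat :: "nat \<Rightarrow> real \<Rightarrow> real" where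
  "flat m t = (if 0 < t then (1 / t) ^ m * exp (- (1 / t)) else 0)"

lemma flat_nonneg: "0 \<le> flat m t"
  by (simp add: flat_def)

lemma flat_0_pos_iff: "0 < flat 0 t \<longleftrightarrow> 0 < t"
  by (simp add: flat_def)

lemma power_le_fact_exp:
  assumes "0 \<le> (x::real)"
  shows "x ^ n \<le> fact n * exp x"
proof -
  have "(\<Sum>k\<in>{n}. x ^ k /\<^sub>R fact k) \<le> (\<Sum>k. x ^ k /\<^sub>R fact k)"
    using assms by (intro sum_le_suminf summable_exp_generic) auto
  then show ?thesis by (simp add: exp_def field_simps)
qed

text \<open>For t > 0 put x = 1/t in x^(m+2) \<le> (m+2)! exp x. The two powers beyond m turn into
  t^2, so that the difference quotient at the origin is O(|t|) and the derivative there
  vanishes.\<close>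

lemma flat_le_square: "flat m t \<le> fact (m + 2) * t\<^sup>2"
proof (cases "0 < t")
  case True
  have "(1 / t) ^ (m + 2) \<le> fact (m + 2) * exp (1 / t)"
    using True by (intro power_le_fact_exp) auto
  then have "(1 / t) ^ (m + 2) * exp (- (1 / t)) \<le> fact (m + 2) * exp (1 / t) * exp (- (1 / t))"
    by (intro mult_right_mono) auto
  then have "(1 / t) ^ (m + 2) * exp (- (1 / t)) \<le> fact (m + 2)"
    by (simp add: mult.assoc flip: exp_add)
  then have "((1 / t) ^ (m + 2) * exp (- (1 / t))) * t\<^sup>2 \<le> fact (m + 2) * t\<^sup>2"
    by (intro mult_right_mono) auto
  moreover have "((1 / t) ^ (m + 2) * exp (- (1 / t))) * t\<^sup>2 = flat m t"
    using True by (simp add: flat_def power_add power2_eq_square)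
  ultimately show ?thesis by simp
qed (simp add: flat_def)

text \<open>The factor t^(-m) is carried along because it closes the family under differentiation:
  t^(-m) exp(-1/t) has the derivative t^(-m-2) exp(-1/t) - m t^(-m-1) exp(-1/t). At the gluing point
  the quadratic bound replaces the computation.\<close>

lemma flat_deriv:
  "(flat m has_real_derivative (flat (m + 2) t - real m * flat (m + 1) t)) (at t)"
proof (cases t "0::real" rule: linorder_cases)
  case less
  have "(flat m has_real_derivative 0) (at t)"
    by (rule has_field_derivative_transform_within_open[of "\<lambda>_. 0" _ _ "{..<0}"])
       (use less in \<open>auto simp: flat_def\<close>)
  with less show ?thesis by (simp add: flat_def)
next
  case equal
  have "((\<lambda>h. flat m h / h) \<longlongrightarrow> 0) (at 0)"
  proof (rule Lim_null_comparison)
    show "\<forall>\<^sub>F h in at 0. norm (flat m h / h) \<le> fact (m + 2) * \<bar>h\<bar>"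
    proof (rule always_eventually, rule allI)
      fix h :: real
      have "\<bar>flat m h\<bar> / \<bar>h\<bar> \<le> (fact (m + 2) * h\<^sup>2) / \<bar>h\<bar>"
        using flat_le_square[of m h] flat_nonneg[of m h] by (intro divide_right_mono) auto
      also have "\<dots> = fact (m + 2) * \<bar>h\<bar>"
        by (cases "h = 0") (auto simp: power2_eq_square abs_if)
      finally show "norm (flat m h / h) \<le> fact (m + 2) * \<bar>h\<bar>" by simp
    qed
    show "((\<lambda>h::real. fact (m + 2) * \<bar>h\<bar>) \<longlongrightarrow> 0) (at 0)"
      by (auto intro!: tendsto_eq_intros)
  qed
  then show ?thesis
    using equal by (simp add: DERIV_def flat_def)
next
  case greater
  have inv: "((\<lambda>t. 1 / t) has_real_derivative (- ((1 / t)\<^sup>2))) (at t)"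
    using greater by (auto intro!: derivative_eq_intros simp: power2_eq_square)
  have "real m * (1 / t) ^ (m - Suc 0) * (1 / t)\<^sup>2 = real m * (1 / t) ^ (m + 1)"
    by (cases m) (simp_all add: power2_eq_square)
  moreover have "((\<lambda>t. (1 / t) ^ m) has_real_derivative
      real m * (1 / t) ^ (m - Suc 0) * (- ((1 / t)\<^sup>2))) (at t)"
    using DERIV_power[OF inv, of m] by (simp add: mult_ac)
  moreover have "((\<lambda>t. exp (- (1 / t))) has_real_derivative exp (- (1 / t)) * (1 / t)\<^sup>2) (at t)"
    using DERIV_chain2[OF DERIV_exp DERIV_minus[OF inv]] by simp
  ultimately have "((\<lambda>t. (1 / t) ^ m * exp (- (1 / t))) has_real_derivative
      - (real m * (1 / t) ^ (m + 1)) * exp (- (1 / t)) + exp (- (1 / t)) * (1 / t)\<^sup>2 * (1 / t) ^ m) (at t)"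
    using DERIV_mult by fastforce
  then have "((\<lambda>t. (1 / t) ^ m * exp (- (1 / t))) has_real_derivative
      (flat (m + 2) t - real m * flat (m + 1) t)) (at t)"
    using greater by (simp add: flat_def power_add power2_eq_square algebra_simps)
  then show ?thesis
    by (rule has_field_derivative_transform_within_open[of _ _ _ "{0<..}"])
       (use greater in \<open>auto simp: flat_def\<close>)
qed

lemma Ck_flat:
  assumes "Ck k g"
  shows "Ck k (\<lambda>x. flat m (g x))"
proof (rule Ck_compose_real[of flat "\<lambda>m t. flat (m + 2) t - real m * flat (m + 1) t"])
  fix j n assume *: "\<And>m. Ck j (\<lambda>x. flat m (g x))"
  have "Ck j (\<lambda>x. flat (n + 2) (g x) + (- real n) * flat (n + 1) (g x))"
    by (intro Ck_add Ck_mult Ck_const *)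
  then show "Ck j (\<lambda>x. flat (n + 2) (g x) - real n * flat (n + 1) (g x))" by simp
qed (use assms flat_deriv in auto)

text \<open>One pair of factors for each coordinate, so that the function is positive exactly on the
  open box (\<open>bump_pos_iff\<close>) and smooth factor by factor. Boxes are convenient because
  they generate the Borel sets and exhaust open sets countably.\<close>

definition bump :: "real^'n \<Rightarrow> real^'n \<Rightarrow> real^'n \<Rightarrow> real" where
  "bump a b x = (\<Prod>i\<in>UNIV. flat 0 (x $ i - a $ i) * flat 0 (b $ i - x $ i))"

lemma Ck_bump:
  fixes a b :: "real^'n"
  shows "Ck k (bump a b)"
proof -
  have 1: "Ck k (\<lambda>x. x $ i - a $ i)" for i
    using Ck_add[OF Ck_linear[OF bounded_linear_vec_nth[of i]] Ck_const[of _ "- (a $ i)"], of k] by simp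
  have "Ck k (\<lambda>x::real^'n. (-1) *\<^sub>R (x $ i))" for i
    by (intro Ck_scaleR Ck_const Ck_linear bounded_linear_vec_nth)
  then have 2: "Ck k (\<lambda>x. b $ i - x $ i)" for i
    using Ck_add[OF Ck_const[of _ "b $ i"], of k "\<lambda>x. (-1) *\<^sub>R (x $ i)"] by (simp del: Ck_const)
  show ?thesis
    unfolding bump_def[abs_def] by (intro Ck_prod Ck_mult Ck_flat 1 2) auto
qed

lemma bump_nonneg: "0 \<le> bump a b x"
  unfolding bump_def by (intro prod_nonneg) (simp add: flat_nonneg)

lemma bump_pos_iff: "0 < bump a b x \<longleftrightarrow> x \<in> box a b"
proof
  assume "0 < bump a b x"
  then have "bump a b x \<noteq> 0" by simp
  then have "flat 0 (x $ i - a $ i) * flat 0 (b $ i - x $ i) \<noteq> 0" for i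
    unfolding bump_def by (subst (asm) prod_zero_iff) auto
  then have "0 < flat 0 (x $ i - a $ i) \<and> 0 < flat 0 (b $ i - x $ i)" for i
    using flat_nonneg[of 0 "x $ i - a $ i"] flat_nonneg[of 0 "b $ i - x $ i"] less_eq_real_def by auto
  then show "x \<in> box a b" unfolding flat_0_pos_iff by (auto simp: mem_box_cart)
next
  assume "x \<in> box a b"
  then show "0 < bump a b x" unfolding bump_def mem_box_cart
    by (intro prod_pos) (auto simp: flat_0_pos_iff)
qed

section \<open>Test functions\<close>

lemma Cc_infinityI:
  assumes "\<And>k. Ck k \<phi>" "\<And>x. x \<notin> K \<Longrightarrow> \<phi> x = 0" "compact K" "K \<subseteq> \<Omega>"
  shows "\<phi> \<in> Cc_infinity \<Omega>"
proof -
  have "closure {x. \<phi> x \<noteq> 0} \<subseteq> K"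
    using assms by (intro closure_minimal) (auto dest: compact_imp_closed)
  moreover have "compact (closure {x. \<phi> x \<noteq> 0})"
    using calculation assms(3) by (metis closed_closure compact_Int_closed inf.absorb_iff2)
  ultimately show ?thesis using assms by (auto simp: Cc_infinity_def)
qed

lemma Cc_infinityE:
  assumes "\<phi> \<in> Cc_infinity \<Omega>"
  obtains K where "compact K" "K \<subseteq> \<Omega>" "\<And>x. x \<notin> K \<Longrightarrow> \<phi> x = 0" "\<And>x i. x \<notin> K \<Longrightarrow> pderivative i \<phi> x = 0"
proof
  let ?K = "closure {x. \<phi> x \<noteq> 0}"
  show "compact ?K" "?K \<subseteq> \<Omega>" using assms by (auto simp: Cc_infinity_def)
  show "\<And>x. x \<notin> ?K \<Longrightarrow> \<phi> x = 0"
    using closure_subset[of "{x. \<phi> x \<noteq> 0}"] by blast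
  show "pderivative i \<phi> x = 0" if "x \<notin> ?K" for x i
  proof -
    have "(\<phi> has_derivative (\<lambda>_. 0)) (at x)"
    proof (rule has_derivative_transform_within_open)
      show "((\<lambda>_. 0) has_derivative (\<lambda>_. 0)) (at x)" by simp
      show "open (- ?K)" "x \<in> - ?K" using that by auto
      show "\<And>y. y \<in> - ?K \<Longrightarrow> 0 = \<phi> y" using closure_subset[of "{x. \<phi> x \<noteq> 0}"] by fastforce
    qed
    then show ?thesis using pderivative_eq by fastforce
  qed
qed

lemma Cc_infinity_mono: "\<Omega> \<subseteq> \<Omega>' \<Longrightarrow> Cc_infinity \<Omega> \<subseteq> Cc_infinity \<Omega>'"
  by (auto simp: Cc_infinity_def)

lemma Cc_infinity_Ck: "\<phi> \<in> Cc_infinity \<Omega> \<Longrightarrow> Ck k \<phi>"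
  by (simp add: Cc_infinity_def)

lemma Cc_infinity_differentiable: "\<phi> \<in> Cc_infinity \<Omega> \<Longrightarrow> \<phi> differentiable at x"
  using Cc_infinity_Ck[of \<phi> \<Omega> "Suc 0"] by auto

lemma Cc_infinity_continuous: "\<phi> \<in> Cc_infinity \<Omega> \<Longrightarrow> continuous_on UNIV \<phi>"
  using Cc_infinity_Ck Ck_continuous by blast

lemma Cc_infinity_pderivative:
  assumes "\<phi> \<in> Cc_infinity \<Omega>"
  shows "pderivative i \<phi> \<in> Cc_infinity \<Omega>"
proof -
  obtain K where "compact K" "K \<subseteq> \<Omega>" "\<And>x i. x \<notin> K \<Longrightarrow> pderivative i \<phi> x = 0"
    using Cc_infinityE[OF assms] by metis
  moreover have "Ck k (pderivative i \<phi>)" for k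
    using Cc_infinity_Ck[OF assms, of "Suc k"] by auto
  ultimately show ?thesis by (intro Cc_infinityI)
qed

lemma Cc_infinity_bounded:
  assumes "\<phi> \<in> Cc_infinity \<Omega>"
  obtains B where "0 \<le> B" "\<And>x. norm (\<phi> x) \<le> B"
proof -
  obtain K where K: "compact K" "\<And>x. x \<notin> K \<Longrightarrow> \<phi> x = 0"
    using Cc_infinityE[OF assms] by metis
  have "compact (\<phi> ` K)"
    using K Cc_infinity_continuous[OF assms]
    by (meson compact_continuous_image continuous_on_subset subset_UNIV)
  from compact_imp_bounded[OF this] obtain B where "\<And>y. y \<in> \<phi> ` K \<Longrightarrow> norm y \<le> B"
    unfolding bounded_iff by auto
  then have "norm (\<phi> x) \<le> max 0 B" for x
    using K(2)[of x] by (cases "x \<in> K") (auto intro: max.coboundedI2)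
  then show ?thesis using that[of "max 0 B"] by auto
qed

text \<open>Where \<open>bump\<close> is positive, exp(-n bump) tends to 0; elsewhere it equals 1.
  So the indicator of the open box is a pointwise limit of test functions with values in [0,1],
  without the construction of a plateau.\<close>

lemma box_indicator_approx:
  fixes a b :: "real^'n" and \<phi> :: "nat \<Rightarrow> real^'n \<Rightarrow> real"
  defines "\<phi> \<equiv> \<lambda>n x. 1 - exp (- (real n * bump a b x))"
  shows "cbox a b \<subseteq> \<Omega> \<Longrightarrow> \<phi> n \<in> Cc_infinity \<Omega>"
    and "0 \<le> \<phi> n x" and "\<phi> n x \<le> 1"
    and "x \<notin> box a b \<Longrightarrow> \<phi> n x = 0"
    and "(\<lambda>n. \<phi> n x) \<longlonglongrightarrow> indicator (box a b) x"
proof -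
  show 0: "\<phi> n x = 0" if "x \<notin> box a b" for n x
    using that bump_pos_iff[of a b x] bump_nonneg[of a b x] by (auto simp: \<phi>_def)
  show "\<phi> n \<in> Cc_infinity \<Omega>" if "cbox a b \<subseteq> \<Omega>"
  proof (rule Cc_infinityI[where K = "cbox a b"])
    fix k
    have "Ck k (\<lambda>x. 1 + (-1) * exp ((- real n) * bump a b x))"
      by (intro Ck_add Ck_mult Ck_exp Ck_const Ck_bump)
    then show "Ck k (\<phi> n)" by (simp add: \<phi>_def)
    show "\<phi> n x = 0" if "x \<notin> cbox a b" for x
      using that box_subset_cbox[of a b] by (intro 0) auto
  qed (use that in auto)
  show "0 \<le> \<phi> n x" "\<phi> n x \<le> 1" using bump_nonneg[of a b x] by (auto simp: \<phi>_def)
  show "(\<lambda>n. \<phi> n x) \<longlonglongrightarrow> indicator (box a b) x"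
  proof (cases "x \<in> box a b")
    case True
    then have "0 < bump a b x" by (simp add: bump_pos_iff)
    then have "(\<lambda>n. exp (- bump a b x) ^ n) \<longlonglongrightarrow> 0"
      by (intro LIMSEQ_realpow_zero) auto
    then have "(\<lambda>n. exp (- (real n * bump a b x))) \<longlonglongrightarrow> 0"
      by (simp add: exp_of_nat_mult[symmetric])
    from tendsto_diff[OF tendsto_const[of 1] this] True show ?thesis by (simp add: \<phi>_def)
  qed (simp add: 0)
qed

section \<open>Integration by parts for smooth functions\<close>

lemma integrable_compact_support:
  fixes f :: "real^'n \<Rightarrow> 'b::euclidean_space"
  assumes "continuous_on UNIV f" "compact K" "\<And>x. x \<notin> K \<Longrightarrow> f x = 0"
  shows "integrable lborel f" "integrable lebesgue f"
proof -
  have "f = (\<lambda>x. indicator K x *\<^sub>R f x)"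
    using assms(3) by (auto simp: indicator_def)
  then show 1: "integrable lborel f"
    using borel_integrable_compact[of K f] assms continuous_on_subset by fastforce
  then show "integrable lebesgue f" by (subst integrable_completion) auto
qed

text \<open>By translation invariance the integral of f(x + t e) does not depend on t;
  differentiating under the integral sign at t = 0 gives the claim. No iterated integrals are
  involved.\<close>

lemma integral_pderivative_eq_0:
  fixes f :: "real^'n \<Rightarrow> 'b::euclidean_space"
  assumes d: "\<And>x. f differentiable at x" and c: "continuous_on UNIV (pderivative i f)"
    and K: "compact K" "\<And>x. x \<notin> K \<Longrightarrow> f x = 0"
  shows "(LINT x|lebesgue. pderivative i f x) = 0"
proof -
  define e :: "real^'n" where "e = axis i 1"
  have e: "norm e = 1" by (simp add: e_def)
  have cf: "continuous_on UNIV f"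
    using d by (auto intro!: continuous_at_imp_continuous_on differentiable_imp_continuous_within)
  obtain r where r: "\<And>x. x \<in> K \<Longrightarrow> norm x \<le> r"
    using compact_imp_bounded[OF K(1)] unfolding bounded_iff by auto
  \<comment> \<open>The margin 1 keeps every translate by t e with |t| \<le> 1 supported in one
    fixed box, over which Leibniz's rule is then applied.\<close>
  obtain a where a: "cball 0 (r + 1) \<subseteq> cbox (- a) (a :: real^'n)"
    using bounded_subset_cbox_symmetric[OF bounded_cball] by metis
  have supp: "f (x + t *\<^sub>R e) = 0" if "x \<notin> cbox (- a) a" "\<bar>t\<bar> \<le> 1" for x t
  proof (rule K(2), rule notI)
    assume "x + t *\<^sub>R e \<in> K"
    then have "norm (x + t *\<^sub>R e) \<le> r" by (rule r)
    then have "norm x \<le> r + norm (t *\<^sub>R e)"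
      using norm_triangle_ineq2[of x "- (t *\<^sub>R e)"] by simp
    then have "norm x \<le> r + 1" using that(2) e by simp
    then show False using a that(1) by auto
  qed
  have pd0: "pderivative i f x = 0" if "x \<notin> K" for x
  proof -
    have "(f has_derivative (\<lambda>_. 0)) (at x)"
    proof (rule has_derivative_transform_within_open)
      show "((\<lambda>_. 0) has_derivative (\<lambda>_. 0)) (at x)" by simp
      show "open (- K)" using K(1) by (simp add: compact_imp_closed open_Compl)
    qed (use that K in auto)
    then show ?thesis using pderivative_eq by fastforce
  qed
  have pd0': "pderivative i f x = 0" if "x \<notin> cbox (- a) a" for x
  proof (rule pd0)
    have "x \<notin> cball 0 (r + 1)" using that a by blast
    then show "x \<notin> K" using r[of x] by auto
  qed
  have shift: "integral (cbox (- a) a) (\<lambda>x. f (x + t *\<^sub>R e)) = (LINT x|lborel. f x)" if "\<bar>t\<bar> \<le> 1" for t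
  proof -
    have 1: "continuous_on UNIV (\<lambda>x. f (x + t *\<^sub>R e))"
      by (rule continuous_on_compose2[OF cf]) (auto intro!: continuous_intros)
    have "integral (cbox (- a) a) (\<lambda>x. f (x + t *\<^sub>R e)) = integral UNIV (\<lambda>x. f (x + t *\<^sub>R e))"
      using supp that by (subst integral_restrict_UNIV[symmetric]) (auto intro!: arg_cong[of _ _ "integral UNIV"])
    also have "\<dots> = (LINT x|lborel. f (x + t *\<^sub>R e))"
      using supp that by (intro integral_lborel integrable_compact_support(1)[OF 1, of "cbox (- a) a"]) auto
    also have "\<dots> = (LINT x|distr lborel borel ((+) (t *\<^sub>R e)). f x)"
      using cf by (subst integral_distr) (auto simp: add.commute intro!: borel_measurable_continuous_onI)
    also have "\<dots> = (LINT x|lborel. f x)" by (simp only: lborel_distr_plus)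
    finally show ?thesis .
  qed
  let ?U = "{-1<..<1::real}"
  have "((\<lambda>t. integral (cbox (- a) a) (\<lambda>x. f (x + t *\<^sub>R e))) has_vector_derivative
      integral (cbox (- a) a) (\<lambda>x. pderivative i f (x + 0 *\<^sub>R e))) (at 0 within ?U)"
  proof (rule leibniz_rule_vector_derivative)
    fix t x
    have "((\<lambda>t. f (x + t *\<^sub>R e)) has_derivative (\<lambda>h. frechet_derivative f (at (x + t *\<^sub>R e)) (h *\<^sub>R e))) (at t within ?U)"
      by (rule has_derivative_compose[OF _ has_derivative_frechet[OF d]])
         (auto intro!: derivative_eq_intros)
    moreover have "frechet_derivative f (at (x + t *\<^sub>R e)) (h *\<^sub>R e) = h *\<^sub>R pderivative i f (x + t *\<^sub>R e)" for h
      unfolding pderivative_def e_def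
      by (simp add: linear_frechet_derivative[OF d] linear_scale)
    ultimately show "((\<lambda>t. f (x + t *\<^sub>R e)) has_vector_derivative pderivative i f (x + t *\<^sub>R e)) (at t within ?U)"
      by (simp add: has_vector_derivative_def)
  next
    show "(\<lambda>x. f (x + t *\<^sub>R e)) integrable_on cbox (- a) a" for t
      by (intro integrable_continuous continuous_on_compose2[OF cf]) (auto intro!: continuous_intros)
    show "continuous_on (?U \<times> cbox (- a) a) (\<lambda>(t, x). pderivative i f (x + t *\<^sub>R e))"
      unfolding case_prod_unfold
      by (intro continuous_on_compose2[OF c]) (auto intro!: continuous_intros)
  qed auto
  then have "((\<lambda>t. LINT x|lborel. f x) has_vector_derivative
      integral (cbox (- a) a) (\<lambda>x. pderivative i f (x + 0 *\<^sub>R e))) (at 0)"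
    unfolding at_within_open[of 0 ?U, simplified]
    by (rule has_vector_derivative_transform_within_open[where S = ?U]) (auto simp: shift)
  moreover have "((\<lambda>t. LINT x|lborel. f x) has_vector_derivative 0) (at 0)"
    by (rule has_vector_derivative_const)
  ultimately have "integral (cbox (- a) a) (\<lambda>x. pderivative i f (x + 0 *\<^sub>R e)) = 0"
    by (rule vector_derivative_unique_at)
  then have "integral (cbox (- a) a) (pderivative i f) = 0" by simp
  moreover have "integral (cbox (- a) a) (pderivative i f) = integral UNIV (pderivative i f)"
    using pd0' by (subst integral_restrict_UNIV[symmetric]) (auto intro!: arg_cong[of _ _ "integral UNIV"])
  moreover have "integral UNIV (pderivative i f) = (LINT x|lborel. pderivative i f x)"
    by (intro integral_lborel integrable_compact_support(1)[OF c K(1)] pd0)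
  moreover have "(LINT x|lborel. pderivative i f x) = (LINT x|lebesgue. pderivative i f x)"
    using c by (subst integral_completion) (auto intro!: borel_measurable_continuous_onI)
  ultimately show ?thesis by simp
qed

text \<open>Only \<phi> has compact support; the vanishing of the integral is applied to the product
  \<phi> g, which inherits it. So \<open>g\<close> may be any C^1 function.\<close>

lemma integration_by_parts:
  fixes g :: "real^'n \<Rightarrow> 'b::euclidean_space"
  assumes \<phi>: "\<phi> \<in> Cc_infinity \<Omega>" and g: "Ck (Suc 0) g"
  shows "integrable lebesgue (\<lambda>x. pderivative i \<phi> x *\<^sub>R g x)"
    and "integrable lebesgue (\<lambda>x. \<phi> x *\<^sub>R pderivative i g x)"
    and "(LINT x|lebesgue. pderivative i \<phi> x *\<^sub>R g x) = - (LINT x|lebesgue. \<phi> x *\<^sub>R pderivative i g x)"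
proof -
  obtain K where K: "compact K" "\<And>x. x \<notin> K \<Longrightarrow> \<phi> x = 0" "\<And>x i. x \<notin> K \<Longrightarrow> pderivative i \<phi> x = 0"
    using Cc_infinityE[OF \<phi>] by metis
  have cp: "continuous_on UNIV \<phi>" "continuous_on UNIV (pderivative i \<phi>)"
    using \<phi> Cc_infinity_pderivative Cc_infinity_continuous by blast+
  have cg: "continuous_on UNIV g" "continuous_on UNIV (pderivative i g)"
    using g Ck_continuous[OF g] Ck_continuous[of 0] by auto
  show 1: "integrable lebesgue (\<lambda>x. pderivative i \<phi> x *\<^sub>R g x)"
    using cp cg K by (intro integrable_compact_support(2)[of _ K] continuous_on_scaleR) auto
  show 2: "integrable lebesgue (\<lambda>x. \<phi> x *\<^sub>R pderivative i g x)"
    using cp cg K by (intro integrable_compact_support(2)[of _ K] continuous_on_scaleR) auto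
  have pd: "pderivative i (\<lambda>x. \<phi> x *\<^sub>R g x) = (\<lambda>x. \<phi> x *\<^sub>R pderivative i g x + pderivative i \<phi> x *\<^sub>R g x)"
    using g by (intro ext pderivative_scaleR Cc_infinity_differentiable[OF \<phi>]) auto
  have "(LINT x|lebesgue. pderivative i (\<lambda>x. \<phi> x *\<^sub>R g x) x) = 0"
  proof (rule integral_pderivative_eq_0)
    show "(\<lambda>x. \<phi> x *\<^sub>R g x) differentiable at x" for x
      using g by (intro differentiable_scaleR Cc_infinity_differentiable[OF \<phi>]) auto
    show "continuous_on UNIV (pderivative i (\<lambda>x. \<phi> x *\<^sub>R g x))"
      unfolding pd using cp cg by (intro continuous_intros)
  qed (use K in auto)
  with 1 2 show "(LINT x|lebesgue. pderivative i \<phi> x *\<^sub>R g x) = - (LINT x|lebesgue. \<phi> x *\<^sub>R pderivative i g x)"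
    unfolding pd by (simp add: add_eq_0_iff)
qed

text \<open>The positive and the negative part are densities of two finite measures that agree on
  boxes. Boxes form an intersection-stable generator, so the measures and then their densities
  coincide. The argument is run on \<open>lborel\<close>, hence the passage from \<open>f\<close> to
  a Borel representative \<open>g\<close>.\<close>

lemma AE_eq_0_if_box_integrals_eq_0:
  fixes f :: "'a::euclidean_space \<Rightarrow> real"
  assumes f: "integrable lebesgue f" and box: "\<And>a b. (LINT x:box a b|lebesgue. f x) = 0"
  shows "AE x in lebesgue. f x = 0"
proof -
  obtain g where g[measurable]: "g \<in> borel_measurable lborel" and fg: "AE x in lborel. f x = g x"
    using completion_ex_borel_measurable_real[of f lborel] f by auto
  have fg': "AE x in lebesgue. f x = g x" using fg by (rule AE_completion)
  have "integrable lebesgue g"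
    using f fg' by (subst integrable_cong_AE[of g _ f]) (auto intro: measurable_completion)
  then have ig: "integrable lborel g" by (simp add: integrable_completion)
  \<comment> \<open>\<open>ennreal\<close> maps negative reals to 0, so the two densities are the
    positive and the negative part of \<open>g\<close>.\<close>
  let ?M = "density lborel (\<lambda>x. ennreal (g x))" and ?N = "density lborel (\<lambda>x. ennreal (- g x))"
  have fin: "(\<integral>\<^sup>+x\<in>A. ennreal (g x) \<partial>lborel) < \<infinity>" "(\<integral>\<^sup>+x\<in>A. ennreal (- g x) \<partial>lborel) < \<infinity>"
    if "A \<in> sets borel" for A
  proof -
    have "(\<integral>\<^sup>+x. ennreal (norm (g x)) \<partial>lborel) < \<infinity>" using ig by (simp add: integrable_iff_bounded)
    moreover have "(\<integral>\<^sup>+x\<in>A. ennreal (g x) \<partial>lborel) \<le> (\<integral>\<^sup>+x. ennreal (norm (g x)) \<partial>lborel)"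
      "(\<integral>\<^sup>+x\<in>A. ennreal (- g x) \<partial>lborel) \<le> (\<integral>\<^sup>+x. ennreal (norm (g x)) \<partial>lborel)"
      by (auto intro!: nn_integral_mono ennreal_leI split: split_indicator)
    ultimately show "(\<integral>\<^sup>+x\<in>A. ennreal (g x) \<partial>lborel) < \<infinity>" "(\<integral>\<^sup>+x\<in>A. ennreal (- g x) \<partial>lborel) < \<infinity>"
      by auto
  qed
  have "?M = ?N"
  proof (rule measure_eqI_generator_eq)
    let ?E = "range (\<lambda>(a, b). box a b::'a set)"
    show "Int_stable ?E" by (auto simp: Int_stable_def box_Int_box)
    show "?E \<subseteq> Pow UNIV" "sets ?M = sigma_sets UNIV ?E" "sets ?N = sigma_sets UNIV ?E"
      by (simp_all add: borel_eq_box)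
    let ?A = "\<lambda>n::nat. box (- (real n *\<^sub>R One)) (real n *\<^sub>R One) :: 'a set"
    show "range ?A \<subseteq> ?E" "(\<Union>i. ?A i) = UNIV" unfolding UN_box_eq_UNIV by auto
    show "emeasure ?M (?A i) \<noteq> \<infinity>" for i using fin(1)[of "?A i"] by (simp add: emeasure_density)
    fix X assume XE: "X \<in> ?E"
    show "emeasure ?M X = emeasure ?N X"
    proof -
      obtain a b where X: "X = box a b" using XE by (metis (mono_tags, lifting) case_prod_conv imageE surj_pair)
      let ?h = "\<lambda>x. indicator X x * g x"
      have ih: "integrable lborel ?h"
        using integrable_mult_indicator[OF _ ig, of X] X by simp
      have "(LINT x|lborel. ?h x) = (LINT x:X|lebesgue. g x)"
        unfolding set_lebesgue_integral_def using X by (subst integral_completion) auto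
      also have "\<dots> = (LINT x:X|lebesgue. f x)"
        unfolding set_lebesgue_integral_def
      proof (rule integral_cong_AE)
        show "(\<lambda>x. indicator X x *\<^sub>R g x) \<in> borel_measurable lebesgue"
          using X by (intro measurable_completion) auto
        show "(\<lambda>x. indicator X x *\<^sub>R f x) \<in> borel_measurable lebesgue"
          using X by (intro borel_measurable_scaleR[OF _ borel_measurable_integrable[OF f]] borel_measurable_indicator) auto
        show "AE x in lebesgue. indicat_real X x *\<^sub>R g x = indicat_real X x *\<^sub>R f x"
          using fg' by eventually_elim simp
      qed
      finally have 0: "(LINT x|lborel. ?h x) = 0" using box X by simp
      have eq: "(\<integral>\<^sup>+x\<in>X. ennreal (g x) \<partial>lborel) = (\<integral>\<^sup>+x. ennreal (?h x) \<partial>lborel)"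
         "(\<integral>\<^sup>+x\<in>X. ennreal (- g x) \<partial>lborel) = (\<integral>\<^sup>+x. ennreal (- ?h x) \<partial>lborel)"
        by (auto intro!: nn_integral_cong split: split_indicator)
      have "enn2real (\<integral>\<^sup>+x. ennreal (?h x) \<partial>lborel) = enn2real (\<integral>\<^sup>+x. ennreal (- ?h x) \<partial>lborel)"
        using real_lebesgue_integral_def[OF ih] 0 by simp
      moreover have "(\<integral>\<^sup>+x. ennreal (?h x) \<partial>lborel) < \<infinity>" "(\<integral>\<^sup>+x. ennreal (- ?h x) \<partial>lborel) < \<infinity>"
        using fin[of X] X unfolding eq by auto
      ultimately have "(\<integral>\<^sup>+x. ennreal (?h x) \<partial>lborel) = (\<integral>\<^sup>+x. ennreal (- ?h x) \<partial>lborel)"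
        by (metis ennreal_enn2real infinity_ennreal_def)
      then show ?thesis using X eq by (simp add: emeasure_density)
    qed
  qed
  then have "emeasure ?M A = emeasure ?N A" for A by simp
  then have "(\<integral>\<^sup>+x\<in>A. ennreal (g x) \<partial>lborel) = (\<integral>\<^sup>+x\<in>A. ennreal (- g x) \<partial>lborel)" if "A \<in> sets borel" for A
    using emeasure_density[of "\<lambda>x. ennreal (g x)" lborel A] emeasure_density[of "\<lambda>x. ennreal (- g x)" lborel A] that
    by simp
  then have "AE x in lborel. ennreal (g x) = ennreal (- g x)"
    by (intro sigma_finite_measure.density_unique2[OF sigma_finite_lborel]) auto
  then have "AE x in lborel. f x = 0"
    using fg
  proof eventually_elim
    case (elim x)
    then show ?case by (cases "0 \<le> g x") (auto simp: ennreal_neg dest: sym)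
  qed
  then show ?thesis by (rule AE_completion)
qed

section \<open>The fundamental lemma of the calculus of variations\<close>

lemma borel_lebesgue_measurable_Cc:
  "\<phi> \<in> Cc_infinity \<Omega> \<Longrightarrow> \<phi> \<in> borel_measurable lebesgue"
  by (auto intro!: measurable_completion borel_measurable_continuous_onI dest!: Cc_infinity_continuous)

lemma set_integrable_Cc_mult:
  fixes f :: "real^'n \<Rightarrow> 'b::euclidean_space"
  assumes \<phi>: "\<phi> \<in> Cc_infinity \<Omega>" and f: "loc_integrable \<Omega> f"
  shows "set_integrable lebesgue \<Omega> (\<lambda>x. \<phi> x *\<^sub>R f x)"
proof -
  obtain K where K: "compact K" "K \<subseteq> \<Omega>" "\<And>x. x \<notin> K \<Longrightarrow> \<phi> x = 0"
    using Cc_infinityE[OF \<phi>] by metis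
  obtain B where B: "0 \<le> B" "\<And>x. norm (\<phi> x) \<le> B" using Cc_infinity_bounded[OF \<phi>] by metis
  have iK: "integrable lebesgue (\<lambda>x. indicator K x *\<^sub>R f x)"
    using f K by (auto simp: loc_integrable_def set_integrable_def)
  have "integrable lebesgue (\<lambda>x. \<phi> x *\<^sub>R (indicator K x *\<^sub>R f x))"
  proof (rule Bochner_Integration.integrable_bound)
    show "integrable lebesgue (\<lambda>x. B *\<^sub>R (indicator K x *\<^sub>R f x))"
      using iK by (rule integrable_scaleR_right)
    show "(\<lambda>x. \<phi> x *\<^sub>R (indicator K x *\<^sub>R f x)) \<in> borel_measurable lebesgue"
      by (rule borel_measurable_scaleR[OF borel_lebesgue_measurable_Cc[OF \<phi>] borel_measurable_integrable[OF iK]])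
    show "AE x in lebesgue. norm (\<phi> x *\<^sub>R indicat_real K x *\<^sub>R f x) \<le> norm (B *\<^sub>R indicat_real K x *\<^sub>R f x)"
      using B by (auto intro!: AE_I2 mult_right_mono simp: abs_mult)
  qed
  moreover have "(\<lambda>x. \<phi> x *\<^sub>R (indicator K x *\<^sub>R f x)) = (\<lambda>x. indicator \<Omega> x *\<^sub>R (\<phi> x *\<^sub>R f x))"
    by (rule ext) (use K in \<open>auto simp: indicator_def\<close>)
  ultimately show ?thesis by (simp add: set_integrable_def)
qed

text \<open>Cover \<Omega> by countably many closed boxes. Integrals over open boxes are limits of
  integrals against test functions, hence zero, and vanishing box integrals force the function to
  vanish almost everywhere on each member of the cover.\<close>

lemma fundamental_lemma_real:
  fixes f :: "real^'n \<Rightarrow> real"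
  assumes "open \<Omega>" and f: "loc_integrable \<Omega> f"
    and z: "\<And>\<phi>. \<phi> \<in> Cc_infinity \<Omega> \<Longrightarrow> (LINT x:\<Omega>|lebesgue. \<phi> x *\<^sub>R f x) = 0"
  shows "AE x\<in>\<Omega> in lebesgue. f x = 0"
proof -
  obtain \<D> where D: "countable \<D>" "\<D> \<subseteq> Pow \<Omega>" "\<And>X. X \<in> \<D> \<Longrightarrow> \<exists>a b. X = cbox a b" "\<Union>\<D> = \<Omega>"
    using open_countable_Union_open_cbox[OF \<open>open \<Omega>\<close>] by metis
  have box0: "(LINT x:box a b|lebesgue. f x) = 0" if ab: "cbox a b \<subseteq> \<Omega>" for a b
  proof -
    define \<phi> where "\<phi> = (\<lambda>(n::nat) x. 1 - exp (- (real n * bump a b x)))"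
    note phi = box_indicator_approx[where a = a and b = b, folded fun_cong[OF fun_cong[OF \<phi>_def]]]
    have i: "integrable lebesgue (\<lambda>x. indicator (cbox a b) x *\<^sub>R f x)"
      using f ab by (auto simp: loc_integrable_def set_integrable_def)
    have "(\<lambda>n. LINT x|lebesgue. \<phi> n x * (indicator (cbox a b) x *\<^sub>R f x))
        \<longlonglongrightarrow> (LINT x|lebesgue. indicator (box a b) x * (indicator (cbox a b) x *\<^sub>R f x))"
    proof (rule integral_dominated_convergence)
      show "integrable lebesgue (\<lambda>x. norm (indicator (cbox a b) x *\<^sub>R f x))" using i by (rule integrable_norm)
      show "(\<lambda>x. indicator (box a b) x * (indicator (cbox a b) x *\<^sub>R f x)) \<in> borel_measurable lebesgue"
        by (intro borel_measurable_times[OF _ borel_measurable_integrable[OF i]] borel_measurable_indicator) auto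
      show "(\<lambda>x. \<phi> n x * (indicator (cbox a b) x *\<^sub>R f x)) \<in> borel_measurable lebesgue" for n
        by (rule borel_measurable_times[OF borel_lebesgue_measurable_Cc[OF phi(1)[OF ab]] borel_measurable_integrable[OF i]])
      show "AE x in lebesgue. (\<lambda>n. \<phi> n x * (indicator (cbox a b) x *\<^sub>R f x))
          \<longlonglongrightarrow> indicator (box a b) x * (indicator (cbox a b) x *\<^sub>R f x)"
        using phi(5) by (auto intro!: AE_I2 tendsto_mult_right)
      show "AE x in lebesgue. norm (\<phi> n x * (indicator (cbox a b) x *\<^sub>R f x)) \<le> norm (indicator (cbox a b) x *\<^sub>R f x)" for n
        using phi(2,3) by (auto intro!: AE_I2 mult_left_le_one_le simp: abs_mult)
    qed
    moreover have "(LINT x|lebesgue. \<phi> n x * (indicator (cbox a b) x *\<^sub>R f x)) = 0" for n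
    proof -
      have "(\<lambda>x. \<phi> n x * (indicator (cbox a b) x *\<^sub>R f x)) = (\<lambda>x. indicator \<Omega> x *\<^sub>R (\<phi> n x *\<^sub>R f x))"
      proof
        fix x
        show "\<phi> n x * (indicator (cbox a b) x *\<^sub>R f x) = indicator \<Omega> x *\<^sub>R (\<phi> n x *\<^sub>R f x)"
          using phi(4)[of x n] ab box_subset_cbox[of a b] by (cases "x \<in> box a b") (auto simp: indicator_def)
      qed
      then show ?thesis using z[OF phi(1)[OF ab], of n] by (simp add: set_lebesgue_integral_def)
    qed
    ultimately have "(LINT x|lebesgue. indicator (box a b) x * (indicator (cbox a b) x *\<^sub>R f x)) = 0"
      by (simp add: LIMSEQ_const_iff)
    moreover have "(\<lambda>x. indicator (box a b) x * (indicator (cbox a b) x *\<^sub>R f x)) = (\<lambda>x. indicator (box a b) x *\<^sub>R f x)"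
      using box_subset_cbox[of a b] by (auto simp: indicator_def fun_eq_iff)
    ultimately show ?thesis by (simp add: set_lebesgue_integral_def)
  qed
  have "AE x\<in>X in lebesgue. f x = 0" if "X \<in> \<D>" for X
  proof -
    obtain a b where X: "X = cbox a b" using D(3)[OF \<open>X \<in> \<D>\<close>] by blast
    have XO: "cbox a b \<subseteq> \<Omega>" using D(2) \<open>X \<in> \<D>\<close> X by auto
    have "box a b \<subseteq> \<Omega>" using XO box_subset_cbox by blast
    have i: "integrable lebesgue (\<lambda>x. indicator (cbox a b) x *\<^sub>R f x)"
      using f XO by (auto simp: loc_integrable_def set_integrable_def)
    have "integrable lebesgue (\<lambda>x. indicator (box a b) x *\<^sub>R (indicator (cbox a b) x *\<^sub>R f x))"
      by (rule integrable_mult_indicator[OF _ i]) simp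
    moreover have e: "(\<lambda>x. indicator (box a b) x *\<^sub>R (indicator (cbox a b) x *\<^sub>R f x)) = (\<lambda>x. indicator (box a b) x *\<^sub>R f x)"
      using box_subset_cbox[of a b] by (auto simp: indicator_def fun_eq_iff)
    ultimately have i': "integrable lebesgue (\<lambda>x. indicator (box a b) x *\<^sub>R f x)" by simp
    have "AE x in lebesgue. indicator (box a b) x *\<^sub>R f x = 0"
    proof (rule AE_eq_0_if_box_integrals_eq_0[OF i'])
      fix u v
      obtain c d where cd: "box u v \<inter> box a b = box c d" by (simp add: box_Int_box)
      have "(LINT x:box u v|lebesgue. indicator (box a b) x *\<^sub>R f x) = (LINT x:box c d|lebesgue. f x)"
        unfolding set_lebesgue_integral_def cd[symmetric]
        by (intro Bochner_Integration.integral_cong) (auto simp: indicator_def)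
      also have "\<dots> = 0"
      \<comment> \<open>For an empty \<open>box c d\<close> the set \<open>cbox c d\<close> need not
        lie in \<Omega>; otherwise it is the closure of the open box.\<close>
      proof (cases "box c d = {}")
        case False
        have "box c d \<subseteq> cbox a b" using cd box_subset_cbox[of a b] by blast
        then have "closure (box c d) \<subseteq> cbox a b" by (rule closure_minimal) auto
        then have "cbox c d \<subseteq> \<Omega>" using XO False by auto
        then show ?thesis by (rule box0)
      qed (simp add: set_lebesgue_integral_def)
      finally show "(LINT x:box u v|lebesgue. indicator (box a b) x *\<^sub>R f x) = 0" .
    qed
    moreover have "AE x in lebesgue. x \<notin> cbox a b - box a b"
      using negligible_frontier_interval[of a b] by (intro AE_not_in) (simp add: negligible_iff_null_sets)
    ultimately show ?thesis unfolding X by eventually_elim (auto simp: indicator_def split: if_splits)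
  qed
  then have "AE x in lebesgue. \<forall>X\<in>\<D>. x \<in> X \<longrightarrow> f x = 0"
    by (subst AE_ball_countable[OF D(1)]) simp
  then show ?thesis by eventually_elim (use D(4) in blast)
qed

lemma fundamental_lemma:
  fixes f :: "real^'n \<Rightarrow> 'b::euclidean_space"
  assumes "open \<Omega>" and f: "loc_integrable \<Omega> f"
    and z: "\<And>\<phi>. \<phi> \<in> Cc_infinity \<Omega> \<Longrightarrow> (LINT x:\<Omega>|lebesgue. \<phi> x *\<^sub>R f x) = 0"
  shows "AE x\<in>\<Omega> in lebesgue. f x = 0"
proof -
  have "AE x in lebesgue. \<forall>b\<in>Basis. x \<in> \<Omega> \<longrightarrow> f x \<bullet> b = 0"
  proof (rule AE_finite_allI[OF finite_Basis])
    fix b :: 'b assume "b \<in> Basis"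
    show "AE x\<in>\<Omega> in lebesgue. f x \<bullet> b = 0"
    proof (rule fundamental_lemma_real[OF \<open>open \<Omega>\<close>])
      show "loc_integrable \<Omega> (\<lambda>x. f x \<bullet> b)"
        unfolding loc_integrable_def set_integrable_def
      proof (intro allI impI)
        fix K assume "compact K \<and> K \<subseteq> \<Omega>"
        then have "integrable lebesgue (\<lambda>x. indicat_real K x *\<^sub>R f x)"
          using f by (simp add: loc_integrable_def set_integrable_def)
        from integrable_inner_left[OF this, of b] show "integrable lebesgue (\<lambda>x. indicat_real K x *\<^sub>R (f x \<bullet> b))" by simp
      qed
      fix \<phi> :: "real^'n \<Rightarrow> real" assume p: "\<phi> \<in> Cc_infinity \<Omega>"
      have "(LINT x:\<Omega>|lebesgue. \<phi> x *\<^sub>R (f x \<bullet> b)) = (LINT x|lebesgue. (indicator \<Omega> x *\<^sub>R (\<phi> x *\<^sub>R f x)) \<bullet> b)"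
        by (simp add: set_lebesgue_integral_def mult.assoc)
      also have "\<dots> = (LINT x:\<Omega>|lebesgue. \<phi> x *\<^sub>R f x) \<bullet> b"
        using set_integrable_Cc_mult[OF p f] unfolding set_lebesgue_integral_def set_integrable_def
        by (intro integral_inner_left)
      finally show "(LINT x:\<Omega>|lebesgue. \<phi> x *\<^sub>R (f x \<bullet> b)) = 0" using z[OF p] by simp
    qed
  qed
  then show ?thesis by eventually_elim (auto intro: euclidean_eqI)
qed

section \<open>Weak gradients\<close>

lemma set_lint_eq:
  fixes f :: "real^'n \<Rightarrow> 'b::euclidean_space"
  assumes "\<Omega> \<in> sets lebesgue"
  shows "(LINT x:\<Omega>|lebesgue. f x) = (LINT x|lebesgue_on \<Omega>. f x)"
  using assms by (simp add: set_lebesgue_integral_def integral_restrict_space)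

lemma set_integrable_eq_on:
  fixes f :: "real^'n \<Rightarrow> 'b::euclidean_space"
  assumes "\<Omega> \<in> sets lebesgue"
  shows "set_integrable lebesgue \<Omega> f \<longleftrightarrow> integrable (lebesgue_on \<Omega>) f"
  using assms by (simp add: set_integrable_def integrable_restrict_space)

lemma AE_on_eq:
  assumes "\<Omega> \<in> sets lebesgue"
  shows "(AE x\<in>\<Omega> in lebesgue. P x) \<longleftrightarrow> (AE x in lebesgue_on \<Omega>. P x)"
  using assms by (subst AE_restrict_space_iff) auto

lemma loc_integrable_bounded_linear:
  assumes "bounded_linear L" "loc_integrable \<Omega> f"
  shows "loc_integrable \<Omega> (\<lambda>x. L (f x))"
  unfolding loc_integrable_def
proof (intro allI impI)
  fix K assume "compact K \<and> K \<subseteq> \<Omega>"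
  then have "integrable lebesgue (\<lambda>x. indicator K x *\<^sub>R f x)"
    using assms by (auto simp: loc_integrable_def set_integrable_def)
  then have "integrable lebesgue (\<lambda>x. L (indicator K x *\<^sub>R f x))"
    by (rule integrable_bounded_linear[OF assms(1)])
  then show "set_integrable lebesgue K (\<lambda>x. L (f x))"
    using linear_scale[OF bounded_linear.linear[OF assms(1)]] by (simp add: set_integrable_def)
qed

lemma loc_integrable_add:
  "loc_integrable \<Omega> f \<Longrightarrow> loc_integrable \<Omega> g \<Longrightarrow> loc_integrable \<Omega> (\<lambda>x. f x + g x)"
  by (auto simp: loc_integrable_def intro!: set_integral_add)

lemma loc_integrable_scaleR:
  "loc_integrable \<Omega> f \<Longrightarrow> loc_integrable \<Omega> (\<lambda>x. c *\<^sub>R f x)"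
  by (rule loc_integrable_bounded_linear[OF bounded_linear_scaleR_right])

lemma loc_integrable_continuous:
  fixes f :: "real^'n \<Rightarrow> 'b::euclidean_space"
  assumes "continuous_on UNIV f"
  shows "loc_integrable \<Omega> f"
  unfolding loc_integrable_def set_integrable_def
proof (intro allI impI)
  fix K assume K: "compact K \<and> K \<subseteq> \<Omega>"
  then have "integrable lborel (\<lambda>x. indicator K x *\<^sub>R f x)"
    using assms by (auto intro!: borel_integrable_compact continuous_on_subset[of UNIV f])
  then show "integrable lebesgue (\<lambda>x. indicator K x *\<^sub>R f x)"
    by (subst integrable_completion) auto
qed

lemma loc_integrable_subset: "loc_integrable \<Omega> f \<Longrightarrow> U \<subseteq> \<Omega> \<Longrightarrow> loc_integrable U f"
  by (auto simp: loc_integrable_def)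

lemma bounded_linear_column: "bounded_linear (column i :: real^'n^'m \<Rightarrow> real^'m)"
  by (rule linear_conv_bounded_linear[THEN iffD1], rule linearI)
     (simp_all add: column_def vec_eq_iff)

lemma has_weak_grad_wgrad: "has_weak_grad \<Omega> u G \<Longrightarrow> has_weak_grad \<Omega> u (wgrad \<Omega> u)"
  unfolding wgrad_def by (rule someI[where P = "has_weak_grad \<Omega> u"])

lemma has_weak_gradD:
  fixes u :: "real^'n \<Rightarrow> real^'n" and \<phi> :: "real^'n \<Rightarrow> real"
  shows "has_weak_grad \<Omega> u G \<Longrightarrow> \<phi> \<in> Cc_infinity \<Omega> \<Longrightarrow>
    (LINT x:\<Omega>|lebesgue. pderivative i \<phi> x *\<^sub>R u x) = - (LINT x:\<Omega>|lebesgue. \<phi> x *\<^sub>R column i (G x))"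
  unfolding has_weak_grad_def by blast

lemma set_lint_add:
  fixes f g :: "'a \<Rightarrow> 'b::{banach, second_countable_topology}"
  shows "set_integrable M A f \<Longrightarrow> set_integrable M A g \<Longrightarrow>
    (LINT x:A|M. f x + g x) = (LINT x:A|M. f x) + (LINT x:A|M. g x)"
  by (rule set_integral_add(2))

text \<open>The difference of two gradients integrates to zero against all test functions, column by
  column. This licenses every later identity for \<open>wgrad\<close>, which is only a choice among
  the gradients.\<close>

lemma has_weak_grad_unique:
  fixes u :: "real^'n \<Rightarrow> real^'n"
  assumes "open \<Omega>" "has_weak_grad \<Omega> u G" "has_weak_grad \<Omega> u G'"
  shows "AE x\<in>\<Omega> in lebesgue. G x = G' x"
proof -
  have l: "loc_integrable \<Omega> (\<lambda>x. column i (G x))" "loc_integrable \<Omega> (\<lambda>x. column i (G' x))" for i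
    using assms by (auto simp: has_weak_grad_def intro!: loc_integrable_bounded_linear[OF bounded_linear_column])
  have l': "loc_integrable \<Omega> (\<lambda>x. (-1) *\<^sub>R column i (G' x))" for i
    by (rule loc_integrable_scaleR[OF l(2)])
  have "AE x in lebesgue. \<forall>i\<in>UNIV. x \<in> \<Omega> \<longrightarrow> column i (G x) + (-1) *\<^sub>R column i (G' x) = 0"
  proof (rule AE_finite_allI[OF finite])
    fix i :: 'n
    show "AE x\<in>\<Omega> in lebesgue. column i (G x) + (-1) *\<^sub>R column i (G' x) = 0"
    proof (rule fundamental_lemma[OF \<open>open \<Omega>\<close> loc_integrable_add[OF l(1) l']])
      fix \<phi> :: "real^'n \<Rightarrow> real" assume p: "\<phi> \<in> Cc_infinity \<Omega>"
      have "(LINT x:\<Omega>|lebesgue. \<phi> x *\<^sub>R (column i (G x) + (-1) *\<^sub>R column i (G' x)))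
        = (LINT x:\<Omega>|lebesgue. \<phi> x *\<^sub>R column i (G x) + (-1) *\<^sub>R (\<phi> x *\<^sub>R column i (G' x)))"
        by (simp add: scaleR_right_diff_distrib)
      also have "\<dots> = (LINT x:\<Omega>|lebesgue. \<phi> x *\<^sub>R column i (G x)) + (LINT x:\<Omega>|lebesgue. (-1) *\<^sub>R (\<phi> x *\<^sub>R column i (G' x)))"
        by (intro set_lint_add set_integrable_scaleR_right set_integrable_Cc_mult[OF p] l)
      also have "\<dots> = 0"
        unfolding set_integral_scaleR_right
        using has_weak_gradD[OF assms(2) p, of i] has_weak_gradD[OF assms(3) p, of i] by simp
      finally show "(LINT x:\<Omega>|lebesgue. \<phi> x *\<^sub>R (column i (G x) + (-1) *\<^sub>R column i (G' x))) = 0" .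
    qed
  qed
  then show ?thesis
    by eventually_elim (simp add: vec_eq_iff column_def)
qed

lemma has_weak_grad_add:
  assumes "has_weak_grad \<Omega> u G" "has_weak_grad \<Omega> v G'"
  shows "has_weak_grad \<Omega> (\<lambda>x. u x + v x) (\<lambda>x. G x + G' x)"
proof -
  have l: "loc_integrable \<Omega> u" "loc_integrable \<Omega> v" "loc_integrable \<Omega> G" "loc_integrable \<Omega> G'"
    using assms by (auto simp: has_weak_grad_def)
  note lc = l(3,4)[THEN loc_integrable_bounded_linear[OF bounded_linear_column]]
  have "(LINT x:\<Omega>|lebesgue. pderivative i \<phi> x *\<^sub>R (u x + v x)) =
     - (LINT x:\<Omega>|lebesgue. \<phi> x *\<^sub>R column i (G x + G' x))" if p: "\<phi> \<in> Cc_infinity \<Omega>" for \<phi> i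
  proof -
    note p' = Cc_infinity_pderivative[OF p, of i]
    have "(LINT x:\<Omega>|lebesgue. pderivative i \<phi> x *\<^sub>R (u x + v x)) =
      (LINT x:\<Omega>|lebesgue. pderivative i \<phi> x *\<^sub>R u x) + (LINT x:\<Omega>|lebesgue. pderivative i \<phi> x *\<^sub>R v x)"
      unfolding scaleR_add_right by (intro set_lint_add set_integrable_Cc_mult[OF p'] l)
    moreover have "(LINT x:\<Omega>|lebesgue. \<phi> x *\<^sub>R column i (G x + G' x)) =
      (LINT x:\<Omega>|lebesgue. \<phi> x *\<^sub>R column i (G x)) + (LINT x:\<Omega>|lebesgue. \<phi> x *\<^sub>R column i (G' x))"
      unfolding scaleR_add_right linear_add[OF bounded_linear.linear[OF bounded_linear_column]]
      by (intro set_lint_add set_integrable_Cc_mult[OF p] lc)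
    ultimately show ?thesis
      using has_weak_gradD[OF assms(1) p, of i] has_weak_gradD[OF assms(2) p, of i] by simp
  qed
  then show ?thesis using l by (auto simp: has_weak_grad_def intro!: loc_integrable_add)
qed

lemma has_weak_grad_scaleR:
  assumes "has_weak_grad \<Omega> u G"
  shows "has_weak_grad \<Omega> (\<lambda>x. c *\<^sub>R u x) (\<lambda>x. c *\<^sub>R G x)"
proof -
  have "(LINT x:\<Omega>|lebesgue. pderivative i \<phi> x *\<^sub>R (c *\<^sub>R u x)) =
     - (LINT x:\<Omega>|lebesgue. \<phi> x *\<^sub>R column i (c *\<^sub>R G x))" if "\<phi> \<in> Cc_infinity \<Omega>" for \<phi> i
  proof -
    have "(LINT x:\<Omega>|lebesgue. pderivative i \<phi> x *\<^sub>R (c *\<^sub>R u x)) = c *\<^sub>R (LINT x:\<Omega>|lebesgue. pderivative i \<phi> x *\<^sub>R u x)"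
      by (subst set_integral_scaleR_right[symmetric]) (simp add: mult.commute)
    moreover have "(LINT x:\<Omega>|lebesgue. \<phi> x *\<^sub>R column i (c *\<^sub>R G x)) = c *\<^sub>R (LINT x:\<Omega>|lebesgue. \<phi> x *\<^sub>R column i (G x))"
      by (subst set_integral_scaleR_right[symmetric])
         (simp add: linear_scale[OF bounded_linear.linear[OF bounded_linear_column]] mult.commute)
    ultimately show ?thesis using has_weak_gradD[OF assms that, of i] by simp
  qed
  then show ?thesis using assms by (auto simp: has_weak_grad_def intro!: loc_integrable_scaleR)
qed

lemma has_weak_grad_diff:
  assumes "has_weak_grad \<Omega> u G" "has_weak_grad \<Omega> v G'"
  shows "has_weak_grad \<Omega> (\<lambda>x. u x - v x) (\<lambda>x. G x - G' x)"
  using has_weak_grad_add[OF assms(1) has_weak_grad_scaleR[OF assms(2), of "-1"]] by simp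

lemma AE_wgrad_eq:
  assumes "open \<Omega>" "has_weak_grad \<Omega> u G"
  shows "AE x\<in>\<Omega> in lebesgue. wgrad \<Omega> u x = G x"
  by (rule has_weak_grad_unique[OF assms(1) has_weak_grad_wgrad[OF assms(2)] assms(2)])

text \<open>Local integrability and the test integrals see only almost everywhere classes. It is
  used to exchange a finite element function for its polynomial inside an element, and to make null
  functions drop out of the forms.\<close>

lemma has_weak_grad_AE_cong:
  fixes u v :: "real^'n \<Rightarrow> real^'n"
  assumes \<Omega>: "open \<Omega>" and u: "has_weak_grad \<Omega> u G" and eq: "AE x\<in>\<Omega> in lebesgue. v x = u x"
    and v: "v \<in> borel_measurable (lebesgue_on \<Omega>)"
  shows "has_weak_grad \<Omega> v G"
proof -
  have S: "\<Omega> \<in> sets lebesgue" using \<Omega> by simp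
  have meas: "(\<lambda>x. indicator \<Omega> x *\<^sub>R v x) \<in> borel_measurable lebesgue"
    using v S by (simp add: borel_measurable_restrict_space_iff)
  have "loc_integrable \<Omega> v"
    unfolding loc_integrable_def set_integrable_def
  proof (intro allI impI)
    fix K assume K: "compact K \<and> K \<subseteq> \<Omega>"
    then have "K \<in> sets lebesgue" by (simp add: compact_imp_closed)
    have e: "(\<lambda>x. indicator K x *\<^sub>R v x) = (\<lambda>x. indicator K x *\<^sub>R (indicator \<Omega> x *\<^sub>R v x))"
      using K by (auto simp: indicator_def fun_eq_iff)
    have "(\<lambda>x. indicator K x *\<^sub>R v x) \<in> borel_measurable lebesgue"
      unfolding e using meas \<open>K \<in> sets lebesgue\<close>
      by (intro borel_measurable_scaleR[OF _ meas] borel_measurable_indicator)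
    moreover have "integrable lebesgue (\<lambda>x. indicator K x *\<^sub>R u x)"
      using u K by (auto simp: has_weak_grad_def loc_integrable_def set_integrable_def)
    moreover have "AE x in lebesgue. indicator K x *\<^sub>R v x = indicator K x *\<^sub>R u x"
      using eq by eventually_elim (use K in \<open>auto simp: indicator_def\<close>)
    ultimately show "integrable lebesgue (\<lambda>x. indicator K x *\<^sub>R v x)"
      by (subst integrable_cong_AE[of _ _ "\<lambda>x. indicator K x *\<^sub>R u x"]) auto
  qed
  moreover have "(LINT x:\<Omega>|lebesgue. pderivative i \<phi> x *\<^sub>R v x) = (LINT x:\<Omega>|lebesgue. pderivative i \<phi> x *\<^sub>R u x)"
    if "\<phi> \<in> Cc_infinity \<Omega>" for \<phi> i
    unfolding set_lebesgue_integral_def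
  proof (rule integral_cong_AE)
    have p': "pderivative i \<phi> \<in> borel_measurable lebesgue"
      using that Cc_infinity_pderivative borel_lebesgue_measurable_Cc by blast
    have "(\<lambda>x. pderivative i \<phi> x *\<^sub>R (indicator \<Omega> x *\<^sub>R v x)) \<in> borel_measurable lebesgue"
      using p' meas by (rule borel_measurable_scaleR)
    then show "(\<lambda>x. indicator \<Omega> x *\<^sub>R pderivative i \<phi> x *\<^sub>R v x) \<in> borel_measurable lebesgue"
      by (simp add: mult.commute)
    show "(\<lambda>x. indicator \<Omega> x *\<^sub>R pderivative i \<phi> x *\<^sub>R u x) \<in> borel_measurable lebesgue"
      using set_integrable_Cc_mult[OF Cc_infinity_pderivative[OF that], of u i] u
      by (auto simp: set_integrable_def has_weak_grad_def intro: borel_measurable_integrable)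
    show "AE x in lebesgue. indicat_real \<Omega> x *\<^sub>R pderivative i \<phi> x *\<^sub>R v x =
        indicat_real \<Omega> x *\<^sub>R pderivative i \<phi> x *\<^sub>R u x"
      using eq by eventually_elim (auto simp: indicator_def)
  qed
  ultimately show ?thesis using u by (auto simp: has_weak_grad_def)
qed

lemma set_lint_Cc_subset:
  fixes f :: "real^'n \<Rightarrow> 'b::euclidean_space" and \<phi> :: "real^'n \<Rightarrow> real"
  assumes "\<phi> \<in> Cc_infinity U" "U \<subseteq> \<Omega>"
  shows "(LINT x:\<Omega>|lebesgue. \<phi> x *\<^sub>R f x) = (LINT x:U|lebesgue. \<phi> x *\<^sub>R f x)"
proof -
  obtain K where K: "K \<subseteq> U" "\<And>x. x \<notin> K \<Longrightarrow> \<phi> x = 0" using Cc_infinityE[OF assms(1)] by metis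
  have "(\<lambda>x. indicator \<Omega> x *\<^sub>R (\<phi> x *\<^sub>R f x)) = (\<lambda>x. indicator U x *\<^sub>R (\<phi> x *\<^sub>R f x))"
    by (rule ext) (use K assms(2) in \<open>auto simp: indicator_def\<close>)
  then show ?thesis by (simp add: set_lebesgue_integral_def)
qed

lemma has_weak_grad_subset:
  fixes u :: "real^'n \<Rightarrow> real^'n"
  assumes "has_weak_grad \<Omega> u G" "U \<subseteq> \<Omega>"
  shows "has_weak_grad U u G"
  unfolding has_weak_grad_def
proof (intro conjI allI impI)
  show "loc_integrable U u" "loc_integrable U G"
    using assms loc_integrable_subset by (auto simp: has_weak_grad_def)
  fix \<phi> :: "real^'n \<Rightarrow> real" and i assume p: "\<phi> \<in> Cc_infinity U"
  then have "\<phi> \<in> Cc_infinity \<Omega>" using assms(2) Cc_infinity_mono by blast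
  then have "(LINT x:\<Omega>|lebesgue. pderivative i \<phi> x *\<^sub>R u x) = - (LINT x:\<Omega>|lebesgue. \<phi> x *\<^sub>R column i (G x))"
    using assms(1) by (auto simp: has_weak_grad_def)
  then show "(LINT x:U|lebesgue. pderivative i \<phi> x *\<^sub>R u x) = - (LINT x:U|lebesgue. \<phi> x *\<^sub>R column i (G x))"
    using set_lint_Cc_subset[OF p assms(2), of "\<lambda>x. column i (G x)"]
      set_lint_Cc_subset[OF Cc_infinity_pderivative[OF p] assms(2), of i u] by simp
qed

text \<open>The Jacobian in the arrangement of \<open>wgrad\<close>. Where the function is not
  differentiable the value is arbitrary; for finite element functions this can happen only on the
  null set of element boundaries.\<close>

definition cgrad :: "(real^'n \<Rightarrow> real^'n) \<Rightarrow> real^'n \<Rightarrow> real^'n^'n" where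
  "cgrad g x = (\<chi> j i. pderivative i g x $ j)"

lemma column_cgrad [simp]: "column i (cgrad g x) = pderivative i g x"
  by (simp add: column_def cgrad_def)

lemma continuous_cgrad:
  assumes "Ck (Suc 0) g"
  shows "continuous_on UNIV (cgrad g)"
  unfolding cgrad_def[abs_def]
  by (intro continuous_on_vec_lambda continuous_on_component) (use assms in auto)

lemma has_weak_grad_cgrad:
  fixes g :: "real^'n \<Rightarrow> real^'n"
  assumes "Ck (Suc 0) g"
  shows "has_weak_grad \<Omega> g (cgrad g)"
  unfolding has_weak_grad_def
proof (intro conjI allI impI)
  show "loc_integrable \<Omega> g" "loc_integrable \<Omega> (cgrad g)"
    using assms continuous_cgrad Ck_continuous by (auto intro!: loc_integrable_continuous simp del: Ck.simps)
  fix \<phi> :: "real^'n \<Rightarrow> real" and i assume p: "\<phi> \<in> Cc_infinity \<Omega>"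
  have 1: "(LINT x:\<Omega>|lebesgue. \<psi> x *\<^sub>R f x) = (LINT x|lebesgue. \<psi> x *\<^sub>R f x)"
    if "\<psi> \<in> Cc_infinity \<Omega>" for \<psi> :: "real^'n \<Rightarrow> real" and f :: "real^'n \<Rightarrow> real^'n"
    using set_lint_Cc_subset[OF that, of UNIV f] by (simp add: set_lebesgue_integral_def)
  show "(LINT x:\<Omega>|lebesgue. pderivative i \<phi> x *\<^sub>R g x) = - (LINT x:\<Omega>|lebesgue. \<phi> x *\<^sub>R column i (cgrad g x))"
    unfolding 1[OF p] 1[OF Cc_infinity_pderivative[OF p]] column_cgrad
    by (rule integration_by_parts(3)[OF p assms])
qed

section \<open>Weighted Lebesgue spaces\<close>

text \<open>Integrability follows from Young's inequality as it stands, the sharp bound from Young's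
  inequality for F/A and G/B with A and B the two norms. Normalising fails if a norm is 0, but then
  the product vanishes almost everywhere.\<close>

lemma Holder_powr:
  fixes F G :: "'a \<Rightarrow> real"
  assumes p: "1 < p" and q: "q = conj_exp p"
    and F: "F \<in> borel_measurable M" "\<And>x. 0 \<le> F x" "integrable M (\<lambda>x. F x powr p)"
    and G: "G \<in> borel_measurable M" "\<And>x. 0 \<le> G x" "integrable M (\<lambda>x. G x powr q)"
  shows "integrable M (\<lambda>x. F x * G x)"
    and "(LINT x|M. F x * G x) \<le> (LINT x|M. F x powr p) powr (1/p) * (LINT x|M. G x powr q) powr (1/q)"
proof -
  have q1: "1 < q" "1/p + 1/q = 1" using p by (auto simp: q conj_exp_def field_simps)
  have m: "(\<lambda>x. F x * G x) \<in> borel_measurable M" using F G by auto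
  have young: "F x * G x \<le> F x powr p / p + G x powr q / q" for x
    using Youngs_inequality[OF p q1] F G by auto
  show i: "integrable M (\<lambda>x. F x * G x)"
    by (rule Bochner_Integration.integrable_bound[of _ "\<lambda>x. F x powr p / p + G x powr q / q"])
       (use F G m young p q1 in \<open>auto intro!: AE_I2 Bochner_Integration.integrable_add\<close>)
  define A where "A = (LINT x|M. F x powr p) powr (1/p)"
  define B where "B = (LINT x|M. G x powr q) powr (1/q)"
  have A0: "0 \<le> (LINT x|M. F x powr p)" "0 \<le> (LINT x|M. G x powr q)"
    by (auto intro: Bochner_Integration.integral_nonneg)
  show "(LINT x|M. F x * G x) \<le> A * B"
  proof (cases "A = 0 \<or> B = 0")
    case True
    then have "(LINT x|M. F x powr p) = 0 \<or> (LINT x|M. G x powr q) = 0"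
      by (auto simp: A_def B_def)
    then have "(AE x in M. F x powr p = 0) \<or> (AE x in M. G x powr q = 0)"
      using integral_nonneg_eq_0_iff_AE[OF F(3)] integral_nonneg_eq_0_iff_AE[OF G(3)] by auto
    then have "AE x in M. F x * G x = 0" by auto
    then have "(LINT x|M. F x * G x) = 0" using m by (subst integral_cong_AE[of _ _ "\<lambda>_. 0"]) auto
    then show ?thesis by (simp add: A_def B_def)
  next
    case False
    then have AB: "0 < A" "0 < B" by (auto simp: A_def B_def)
    have Ap: "A powr p = (LINT x|M. F x powr p)" "B powr q = (LINT x|M. G x powr q)"
      using p q1 A0 by (auto simp: A_def B_def powr_powr)
    have le: "F x * G x \<le> A * B * (F x powr p / (p * A powr p) + G x powr q / (q * B powr q))" for x
    proof -
      have "(F x / A) * (G x / B) \<le> (F x / A) powr p / p + (G x / B) powr q / q"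
        using F G AB by (intro Youngs_inequality[OF p q1]) auto
      also have "\<dots> = F x powr p / (p * A powr p) + G x powr q / (q * B powr q)"
        using F G AB by (simp add: powr_divide mult.commute)
      finally show ?thesis using AB by (simp add: field_simps)
    qed
    have "(LINT x|M. F x * G x) \<le> (LINT x|M. A * B * (F x powr p / (p * A powr p) + G x powr q / (q * B powr q)))"
      using le by (intro integral_mono i) (use F G in auto)
    also have "\<dots> = A * B * (A powr p / (p * A powr p) + B powr q / (q * B powr q))"
      using F(3) G(3) by (simp add: Ap)
    also have "\<dots> = A * B * (1 / p + 1 / q)"
      using AB by simp
    finally show ?thesis using q1 by simp
  qed
qed

section \<open>Function spaces on a bounded open set\<close>

locale bounded_open =
  fixes \<Omega> :: "(real^'n) set"
  assumes open_dom: "open \<Omega>" and bounded_dom: "bounded \<Omega>"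
begin

abbreviation M :: "(real^'n) measure" where "M \<equiv> lebesgue_on \<Omega>"

lemma dom_sets [simp]: "\<Omega> \<in> sets lebesgue"
  using open_dom by simp

lemma dom_lmeasurable: "\<Omega> \<in> lmeasurable"
  using bounded_dom open_dom by (simp add: bounded_set_imp_lmeasurable)

lemma finite_M: "finite_measure M"
  using dom_lmeasurable by (rule finite_measure_lebesgue_on)

lemma const_integrable: "integrable M (\<lambda>x. c :: real)"
  using finite_measure.integrable_const[OF finite_M] by blast

lemma measurable_M: "f \<in> borel_measurable lebesgue \<Longrightarrow> f \<in> borel_measurable M"
  by (rule measurable_restrict_space1)

lemma Lp_iff:
  "f \<in> Lp p \<omega> \<Omega> \<longleftrightarrow> f \<in> borel_measurable M \<and> integrable M (\<lambda>x. norm (f x) powr p * \<omega> x)"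
  by (simp add: Lp_def set_integrable_eq_on)

lemma Lp_norm_eq: "Lp_norm p \<omega> \<Omega> f = (LINT x|M. norm (f x) powr p * \<omega> x) powr (1 / p)"
  by (simp add: Lp_norm_def set_lint_eq)

lemma Lp_norm_nonneg: "0 \<le> Lp_norm p \<omega> \<Omega> f"
  by (simp add: Lp_norm_def)

lemma Lp_norm_norm: "Lp_norm p \<omega> \<Omega> (\<lambda>x. norm (f x)) = Lp_norm p \<omega> \<Omega> f"
  by (simp add: Lp_norm_def)

lemma Lp_iff_norm: "f \<in> Lp p \<omega> \<Omega> \<longleftrightarrow> f \<in> borel_measurable M \<and> (\<lambda>x. norm (f x)) \<in> Lp p \<omega> \<Omega>"
  by (auto simp: Lp_iff)

text \<open>The common ground of the weight 1, the members of \<open>Ap p\<close> and their dual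
  weights: enough for Hoelder's inequality and for density by dominated convergence. Finer
  properties of A_1 weights enter separately, through their lower bound and through the
  kernel.\<close>

definition weight_on :: "(real^'n \<Rightarrow> real) \<Rightarrow> bool" where
  "weight_on \<omega> \<longleftrightarrow> (\<forall>x. 0 \<le> \<omega> x) \<and> \<omega> \<in> borel_measurable lebesgue \<and> integrable M \<omega> \<and> (AE x in M. 0 < \<omega> x)"

lemma weight_onD:
  assumes "weight_on \<omega>"
  shows "0 \<le> \<omega> x" "\<omega> \<in> borel_measurable M" "integrable M \<omega>" "AE x in M. 0 < \<omega> x"
  using assms by (auto simp: weight_on_def intro: measurable_M)

lemma weight_on_one: "weight_on (\<lambda>_. 1)"
  by (auto simp: weight_on_def const_integrable)

lemma Lp_norm_powr:
  assumes "weight_on \<omega>" "0 < p"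
  shows "Lp_norm p \<omega> \<Omega> f powr p = (LINT x|M. norm (f x) powr p * \<omega> x)"
proof -
  have "0 \<le> (LINT x|M. norm (f x) powr p * \<omega> x)"
    using weight_onD(1)[OF assms(1)] by (intro Bochner_Integration.integral_nonneg) auto
  then show ?thesis using assms(2) by (simp add: Lp_norm_eq powr_powr)
qed

lemma Lp_integrand_measurable:
  assumes "weight_on \<omega>" "f \<in> borel_measurable M"
  shows "(\<lambda>x. norm (f x) powr p * \<omega> x) \<in> borel_measurable M"
  using assms weight_onD(2)[OF assms(1)] by measurable

lemma Lp_dominated:
  fixes f :: "real^'n \<Rightarrow> 'b::euclidean_space" and g :: "real^'n \<Rightarrow> 'c::euclidean_space"
  assumes w: "weight_on \<omega>" and "0 < p" "0 \<le> c" and f: "f \<in> borel_measurable M" and g: "g \<in> Lp p \<omega> \<Omega>"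
    and le: "AE x in M. norm (f x) \<le> c * norm (g x)"
  shows "f \<in> Lp p \<omega> \<Omega>" "Lp_norm p \<omega> \<Omega> f \<le> c * Lp_norm p \<omega> \<Omega> g"
proof -
  have le': "AE x in M. norm (f x) powr p * \<omega> x \<le> c powr p * (norm (g x) powr p * \<omega> x)"
    using le
  proof eventually_elim
    case (elim x)
    then have "norm (f x) powr p \<le> (c * norm (g x)) powr p" using assms by (intro powr_mono2) auto
    then show ?case
      using weight_onD(1)[OF w, of x] assms by (simp add: powr_mult mult.assoc[symmetric] mult_right_mono)
  qed
  have gi: "integrable M (\<lambda>x. norm (g x) powr p * \<omega> x)" using g by (simp add: Lp_iff)
  have fi: "integrable M (\<lambda>x. norm (f x) powr p * \<omega> x)"
  proof (rule Bochner_Integration.integrable_bound)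
    show "integrable M (\<lambda>x. c powr p * (norm (g x) powr p * \<omega> x))" using gi by simp
    show "AE x in M. norm (norm (f x) powr p * \<omega> x) \<le> norm (c powr p * (norm (g x) powr p * \<omega> x))"
      using le' by eventually_elim (use weight_onD(1)[OF w] in \<open>simp add: abs_mult\<close>)
  qed (rule Lp_integrand_measurable[OF w f])
  then show "f \<in> Lp p \<omega> \<Omega>" using f by (simp add: Lp_iff)
  have "(LINT x|M. norm (f x) powr p * \<omega> x) \<le> (LINT x|M. c powr p * (norm (g x) powr p * \<omega> x))"
    using le' fi gi by (intro integral_mono_AE) auto
  then have "(LINT x|M. norm (f x) powr p * \<omega> x) powr (1/p) \<le> (c powr p * (LINT x|M. norm (g x) powr p * \<omega> x)) powr (1/p)"
    using \<open>0 < p\<close> weight_onD(1)[OF w] by (intro powr_mono2 Bochner_Integration.integral_nonneg) auto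
  also have "\<dots> = c * Lp_norm p \<omega> \<Omega> g"
    using assms by (simp add: powr_mult powr_powr Lp_norm_eq)
  finally show "Lp_norm p \<omega> \<Omega> f \<le> c * Lp_norm p \<omega> \<Omega> g" by (simp add: Lp_norm_eq)
qed

lemma Lp_AE_cong:
  fixes f g :: "real^'n \<Rightarrow> 'b::euclidean_space"
  assumes w: "weight_on \<omega>" "0 < p" and f: "f \<in> borel_measurable M" and g: "g \<in> Lp p \<omega> \<Omega>"
    and eq: "AE x in M. f x = g x"
  shows "f \<in> Lp p \<omega> \<Omega>" "Lp_norm p \<omega> \<Omega> f = Lp_norm p \<omega> \<Omega> g"
proof -
  have le: "AE x in M. norm (f x) \<le> 1 * norm (g x)" "AE x in M. norm (g x) \<le> 1 * norm (f x)"
    using eq by auto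
  show 1: "f \<in> Lp p \<omega> \<Omega>" by (rule Lp_dominated(1)[OF w zero_le_one f g le(1)])
  have "g \<in> borel_measurable M" using g by (simp add: Lp_iff)
  from Lp_dominated(2)[OF w zero_le_one f g le(1)] Lp_dominated(2)[OF w zero_le_one this 1 le(2)]
  show "Lp_norm p \<omega> \<Omega> f = Lp_norm p \<omega> \<Omega> g" by simp
qed

lemma powr_add_le:
  fixes a b :: real
  assumes "0 \<le> a" "0 \<le> b" "0 < p"
  shows "(a + b) powr p \<le> 2 powr p * (a powr p + b powr p)"
proof -
  have "(a + b) powr p \<le> (2 * max a b) powr p" using assms by (intro powr_mono2) auto
  also have "\<dots> = 2 powr p * max a b powr p" using assms by (simp add: powr_mult)
  also have "max a b powr p \<le> a powr p + b powr p" using assms by (auto simp: max_def)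
  finally show ?thesis by simp
qed

text \<open>Constants do not matter, so Minkowski's inequality is bypassed: (a + b)^p \<le> 2^p (a^p
  + b^p), then A^p + B^p \<le> 2 (A + B)^p, and 2 \<le> 2^p because p \<ge> 1. Together this gives
  4^p.\<close>

lemma Lp_norm_add:
  fixes f g :: "real^'n \<Rightarrow> real"
  assumes w: "weight_on \<omega>" and p: "1 \<le> p" and f: "f \<in> Lp p \<omega> \<Omega>" and g: "g \<in> Lp p \<omega> \<Omega>"
    and nn: "\<And>x. 0 \<le> f x" "\<And>x. 0 \<le> g x"
  shows "(\<lambda>x. f x + g x) \<in> Lp p \<omega> \<Omega>"
    and "Lp_norm p \<omega> \<Omega> (\<lambda>x. f x + g x) \<le> 4 * (Lp_norm p \<omega> \<Omega> f + Lp_norm p \<omega> \<Omega> g)"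
proof -
  have m: "(\<lambda>x. f x + g x) \<in> borel_measurable M" using f g by (auto simp: Lp_iff)
  have le: "norm (f x + g x) powr p * \<omega> x \<le> 2 powr p * (norm (f x) powr p * \<omega> x + norm (g x) powr p * \<omega> x)" for x
    using mult_right_mono[OF powr_add_le[of "f x" "g x" p] weight_onD(1)[OF w, of x]] nn[of x] p
    by (simp add: algebra_simps)
  have i: "integrable M (\<lambda>x. 2 powr p * (norm (f x) powr p * \<omega> x + norm (g x) powr p * \<omega> x))"
    using f g by (intro integrable_mult_right Bochner_Integration.integrable_add) (auto simp: Lp_iff)
  have fi: "integrable M (\<lambda>x. norm (f x + g x) powr p * \<omega> x)"
  proof (rule Bochner_Integration.integrable_bound[OF i])
    show "AE x in M. norm (norm (f x + g x) powr p * \<omega> x)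
        \<le> norm (2 powr p * (norm (f x) powr p * \<omega> x + norm (g x) powr p * \<omega> x))"
      using le weight_onD(1)[OF w] by (intro AE_I2) (simp add: abs_mult)
  qed (rule Lp_integrand_measurable[OF w m])
  then show "(\<lambda>x. f x + g x) \<in> Lp p \<omega> \<Omega>" using m by (simp add: Lp_iff)
  let ?A = "Lp_norm p \<omega> \<Omega> f" and ?B = "Lp_norm p \<omega> \<Omega> g"
  have "(LINT x|M. norm (f x + g x) powr p * \<omega> x)
      \<le> (LINT x|M. 2 powr p * (norm (f x) powr p * \<omega> x + norm (g x) powr p * \<omega> x))"
    by (intro integral_mono fi i le)
  also have "\<dots> = 2 powr p * (?A powr p + ?B powr p)"
    using f g p by (simp add: Lp_norm_powr[OF w] Lp_iff)
  also have "\<dots> \<le> 2 powr p * ((?A + ?B) powr p + (?A + ?B) powr p)"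
    using Lp_norm_nonneg[of p \<omega> f] Lp_norm_nonneg[of p \<omega> g] p
    by (intro mult_left_mono add_mono powr_mono2) auto
  also have "\<dots> = 2 powr p * 2 * (?A + ?B) powr p" by simp
  also have "\<dots> \<le> 2 powr p * 2 powr p * (?A + ?B) powr p"
  proof (intro mult_right_mono mult_left_mono)
    show "2 \<le> (2::real) powr p" using powr_mono[of 1 p "2::real"] p by simp
  qed auto
  also have "\<dots> = (4 * (?A + ?B)) powr p"
    using Lp_norm_nonneg[of p \<omega> f] Lp_norm_nonneg[of p \<omega> g] by (simp add: powr_mult[symmetric])
  finally have "(LINT x|M. norm (f x + g x) powr p * \<omega> x) powr (1/p) \<le> ((4 * (?A + ?B)) powr p) powr (1/p)"
    using p weight_onD(1)[OF w] by (intro powr_mono2 Bochner_Integration.integral_nonneg) auto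
  then show "Lp_norm p \<omega> \<Omega> (\<lambda>x. f x + g x) \<le> 4 * (?A + ?B)"
    using p Lp_norm_nonneg[of p \<omega> f] Lp_norm_nonneg[of p \<omega> g] by (simp add: Lp_norm_eq powr_powr)
qed

lemma Lp_diff:
  fixes f g :: "real^'n \<Rightarrow> 'b::euclidean_space"
  assumes w: "weight_on \<omega>" and p: "1 \<le> p" and f: "f \<in> Lp p \<omega> \<Omega>" and g: "g \<in> Lp p \<omega> \<Omega>"
  shows "(\<lambda>x. f x - g x) \<in> Lp p \<omega> \<Omega>"
proof -
  have "(\<lambda>x. norm (f x) + norm (g x)) \<in> Lp p \<omega> \<Omega>"
    using f g by (intro Lp_norm_add[OF w p]) (auto simp: Lp_iff intro: borel_measurable_norm)
  then show ?thesis
    by (rule Lp_dominated(1)[OF w, rotated 3, where c = 1])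
       (use p f g in \<open>auto simp: Lp_iff norm_triangle_ineq4\<close>)
qed

lemma Lp_bounded:
  fixes f :: "real^'n \<Rightarrow> 'b::euclidean_space"
  assumes w: "weight_on \<omega>" and p: "0 < p" and f: "f \<in> borel_measurable M" and B: "AE x in M. norm (f x) \<le> B"
  shows "f \<in> Lp p \<omega> \<Omega>"
proof -
  have "(\<lambda>x. 1::real) \<in> Lp p \<omega> \<Omega>" using weight_onD(3)[OF w] by (simp add: Lp_iff)
  then show ?thesis
  proof (rule Lp_dominated(1)[OF w p _ f, of "max 0 B", rotated])
    show "AE x in M. norm (f x) \<le> max 0 B * norm (1::real)" using B by eventually_elim auto
  qed auto
qed

text \<open>Hoelder's inequality with exponent p/q against the constant 1 on a set of finite
  measure, after trading \<omega> for its lower bound and \<tau> for its upper bound. It serves both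
  to pass from L^p(\<omega>) to L^2 for p \<ge> 2 and from L^2 to L^p(\<omega>) for p \<le>
  2.\<close>

lemma Lp_embed:
  assumes q: "1 \<le> q" "q \<le> p" and w: "weight_on \<omega>" "weight_on \<tau>"
    and k: "0 < k" "AE x in M. k \<le> \<omega> x" and K: "AE x in M. \<tau> x \<le> K"
  obtains C where "0 \<le> C" "\<And>f::real^'n \<Rightarrow> real. f \<in> Lp p \<omega> \<Omega> \<Longrightarrow> f \<in> Lp q \<tau> \<Omega>"
    "\<And>f::real^'n \<Rightarrow> real. f \<in> Lp p \<omega> \<Omega> \<Longrightarrow> Lp_norm q \<tau> \<Omega> f \<le> C * Lp_norm p \<omega> \<Omega> f"
proof -
  define K' where "K' = max 0 K"
  define m where "m = measure M (space M)"
  have K': "0 \<le> K'" "AE x in M. \<tau> x \<le> K'" using K by (auto simp: K'_def)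
  have m0: "0 \<le> m" by (simp add: m_def)
  have key: "f \<in> Lp q \<tau> \<Omega> \<and> (LINT x|M. norm (f x) powr q * \<tau> x) \<le>
      K' * (1 / k) powr (q/p) * m powr (1 - q/p) * Lp_norm p \<omega> \<Omega> f powr q" if f: "f \<in> Lp p \<omega> \<Omega>" for f :: "real^'n \<Rightarrow> real"
  proof -
    have fm: "f \<in> borel_measurable M" and fi: "integrable M (\<lambda>x. norm (f x) powr p * \<omega> x)"
      using f by (auto simp: Lp_iff)
    have p0: "0 < p" using q by simp
    have fp_le: "AE x in M. norm (f x) powr p \<le> (1/k) * (norm (f x) powr p * \<omega> x)"
      using k(2) by eventually_elim (use k(1) in \<open>simp add: field_simps mult_right_mono\<close>)
    have fpi: "integrable M (\<lambda>x. norm (f x) powr p)"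
    proof (rule Bochner_Integration.integrable_bound)
      show "integrable M (\<lambda>x. (1/k) * (norm (f x) powr p * \<omega> x))" using fi by simp
      show "AE x in M. norm (norm (f x) powr p) \<le> norm ((1/k) * (norm (f x) powr p * \<omega> x))"
        using fp_le by eventually_elim (use k(1) weight_onD(1)[OF w(1)] in \<open>simp add: abs_mult\<close>)
    qed (use fm in measurable)
    have Ip: "(LINT x|M. norm (f x) powr p) \<le> (1/k) * Lp_norm p \<omega> \<Omega> f powr p"
    proof -
      have "(LINT x|M. norm (f x) powr p) \<le> (LINT x|M. (1/k) * (norm (f x) powr p * \<omega> x))"
        using fi by (intro integral_mono_AE fpi fp_le) auto
      then show ?thesis by (simp add: Lp_norm_powr[OF w(1) p0])
    qed
    have Iq: "integrable M (\<lambda>x. norm (f x) powr q) \<and>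
      (LINT x|M. norm (f x) powr q) \<le> (LINT x|M. norm (f x) powr p) powr (q/p) * m powr (1 - q/p)"
    proof (cases "q = p")
      case True
      have "0 \<le> (LINT x|M. norm (f x) powr p)" by (intro Bochner_Integration.integral_nonneg) auto
      \<comment> \<open>Since \<open>0 powr 0 = 0\<close>, the factor
        \<open>m powr (1 - q/p)\<close> equals 1 for q = p only if the measure is positive; on a
        null domain the integral is zero as well.\<close>
      moreover have "m powr 0 = 1 \<or> (LINT x|M. norm (f x) powr p) = 0"
      proof (cases "m = 0")
        case True
        then have "emeasure M (space M) = 0"
          using finite_measure.emeasure_eq_measure[OF finite_M] by (simp add: m_def)
        then have "AE x in M. norm (f x) powr p = 0"
          by (intro AE_I'[of "space M"]) (auto simp: null_sets_def)
        then have "(LINT x|M. norm (f x) powr p) = 0"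
          using fpi by (subst integral_cong_AE[of _ _ "\<lambda>_. 0"]) auto
        then show ?thesis by simp
      qed simp
      ultimately show ?thesis using fpi True q by auto
    next
      case False
      then have r: "1 < p/q" using q by (simp add: field_simps)
      have c: "conj_exp (p/q) = p/(p - q)" using q False by (simp add: conj_exp_def field_simps)
      have *: "1 / conj_exp (p/q) = 1 - q/p" unfolding c using q False by (simp add: field_simps)
      have pq: "(norm (f x) powr q) powr (p/q) = norm (f x) powr p" for x
        using q by (simp add: powr_powr)
      have i: "integrable M (\<lambda>x. (norm (f x) powr q) powr (p/q))" unfolding pq by (rule fpi)
      have i1: "integrable M (\<lambda>x. (1::real) powr conj_exp (p/q))" by (simp add: const_integrable)
      note H = Holder_powr[OF r refl, of "\<lambda>x. norm (f x) powr q" M "\<lambda>_. 1", OF _ _ i _ _ i1]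
      have "integrable M (\<lambda>x. norm (f x) powr q * 1)"
        using fm by (intro H(1)) auto
      moreover have "(LINT x|M. norm (f x) powr q * 1) \<le> (LINT x|M. (norm (f x) powr q) powr (p/q)) powr (1/(p/q)) *
           (LINT x|M. 1 powr conj_exp (p/q)) powr (1 / conj_exp (p/q))"
        using fm by (intro H(2)) auto
      ultimately show ?thesis unfolding pq * by (simp add: m_def)
    qed
    have le: "AE x in M. norm (f x) powr q * \<tau> x \<le> K' * norm (f x) powr q"
      using K'(2) by eventually_elim (simp add: mult.commute mult_right_mono)
    have qi: "integrable M (\<lambda>x. norm (f x) powr q * \<tau> x)"
    proof (rule Bochner_Integration.integrable_bound)
      show "integrable M (\<lambda>x. K' * norm (f x) powr q)" using Iq by simp
      show "AE x in M. norm (norm (f x) powr q * \<tau> x) \<le> norm (K' * norm (f x) powr q)"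
        using le by eventually_elim (use K'(1) weight_onD(1)[OF w(2)] in \<open>simp add: abs_mult\<close>)
    qed (rule Lp_integrand_measurable[OF w(2) fm])
    have "(LINT x|M. norm (f x) powr q * \<tau> x) \<le> (LINT x|M. K' * norm (f x) powr q)"
      using Iq by (intro integral_mono_AE qi le) auto
    also have "\<dots> = K' * (LINT x|M. norm (f x) powr q)" by simp
    also have "\<dots> \<le> K' * ((LINT x|M. norm (f x) powr p) powr (q/p) * m powr (1 - q/p))"
      using Iq K'(1) by (intro mult_left_mono) auto
    also have "\<dots> \<le> K' * (((1/k) * Lp_norm p \<omega> \<Omega> f powr p) powr (q/p) * m powr (1 - q/p))"
      using Ip K'(1) q by (intro mult_left_mono mult_right_mono powr_mono2 Bochner_Integration.integral_nonneg) auto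
    also have "\<dots> = K' * (1 / k) powr (q/p) * m powr (1 - q/p) * Lp_norm p \<omega> \<Omega> f powr q"
      using k(1) q Lp_norm_nonneg[of p \<omega> f] by (simp add: powr_mult powr_powr powr_divide)
    finally show ?thesis using qi fm by (simp add: Lp_iff)
  qed
  define C where "C = (K' * (1 / k) powr (q/p) * m powr (1 - q/p)) powr (1/q)"
  show thesis
  proof (rule that[of C])
    show "0 \<le> C" by (simp add: C_def)
    fix f :: "real^'n \<Rightarrow> real" assume f: "f \<in> Lp p \<omega> \<Omega>"
    show "f \<in> Lp q \<tau> \<Omega>" using key[OF f] by simp
    have "Lp_norm q \<tau> \<Omega> f \<le> (K' * (1 / k) powr (q/p) * m powr (1 - q/p) * Lp_norm p \<omega> \<Omega> f powr q) powr (1/q)"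
      unfolding Lp_norm_eq[of q] using key[OF f] q weight_onD(1)[OF w(2)]
      by (intro powr_mono2 Bochner_Integration.integral_nonneg) auto
    also have "\<dots> = C * Lp_norm p \<omega> \<Omega> f"
      using K'(1) k(1) q Lp_norm_nonneg[of p \<omega> f] by (simp add: C_def powr_mult powr_powr)
    finally show "Lp_norm q \<tau> \<Omega> f \<le> C * Lp_norm p \<omega> \<Omega> f" .
  qed
qed

lemma dual_weight_pos: "0 < \<omega> x \<Longrightarrow> 0 < dual_weight p \<omega> x"
  by (simp add: dual_weight_def)

text \<open>Where \<omega> is positive, \<omega>^(1/p) times \<omega>'^(1/p') equals 1, so the
  weights may be distributed over the two factors before the unweighted inequality is
  applied.\<close>

lemma Holder_weighted:
  fixes f :: "real^'n \<Rightarrow> 'b::euclidean_space" and g :: "real^'n \<Rightarrow> 'c::euclidean_space"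
  assumes p: "1 < p" and w: "weight_on \<omega>"
    and f: "f \<in> Lp p \<omega> \<Omega>" and g: "g \<in> Lp (conj_exp p) (dual_weight p \<omega>) \<Omega>"
  shows "integrable M (\<lambda>x. norm (f x) * norm (g x))"
    and "(LINT x|M. norm (f x) * norm (g x)) \<le> Lp_norm p \<omega> \<Omega> f * Lp_norm (conj_exp p) (dual_weight p \<omega>) \<Omega> g"
proof -
  let ?q = "conj_exp p"
  let ?F = "\<lambda>x. norm (f x) * \<omega> x powr (1/p)" and ?G = "\<lambda>x. norm (g x) * dual_weight p \<omega> x powr (1/?q)"
  have q: "1 < ?q" using p by (simp add: conj_exp_def)
  have [measurable]: "\<omega> \<in> borel_measurable M" "f \<in> borel_measurable M" "g \<in> borel_measurable M"
    using w f g by (auto simp: weight_onD Lp_iff)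
  have [measurable]: "dual_weight p \<omega> \<in> borel_measurable M" unfolding dual_weight_def by measurable
  have Fp: "?F x powr p = norm (f x) powr p * \<omega> x" for x
    using p weight_onD(1)[OF w, of x] by (simp add: powr_mult powr_powr)
  have Gq: "?G x powr ?q = norm (g x) powr ?q * dual_weight p \<omega> x" for x
    using q by (simp add: powr_mult powr_powr dual_weight_def)
  have Fi: "integrable M (\<lambda>x. ?F x powr p)" unfolding Fp using f by (simp add: Lp_iff)
  have Gi: "integrable M (\<lambda>x. ?G x powr ?q)" unfolding Gq using g by (simp add: Lp_iff)
  have eq: "AE x in M. ?F x * ?G x = norm (f x) * norm (g x)"
    using weight_onD(4)[OF w]
  proof eventually_elim
    case (elim x)
    have "1/p + (1/(1 - p)) * (1/?q) = 0" using p by (simp add: conj_exp_def field_simps)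
    then have "\<omega> x powr (1/p) * dual_weight p \<omega> x powr (1/?q) = 1"
      using elim by (simp add: dual_weight_def powr_powr flip: powr_add)
    then show ?case by (simp add: algebra_simps)
  qed
  have H1: "integrable M (\<lambda>x. ?F x * ?G x)"
    by (rule Holder_powr(1)[OF p refl _ _ Fi _ _ Gi]) auto
  have H2: "(LINT x|M. ?F x * ?G x) \<le> (LINT x|M. ?F x powr p) powr (1/p) * (LINT x|M. ?G x powr ?q) powr (1/?q)"
    by (rule Holder_powr(2)[OF p refl _ _ Fi _ _ Gi]) auto
  show "integrable M (\<lambda>x. norm (f x) * norm (g x))"
    using H1 eq by (subst integrable_cong_AE[of _ _ "\<lambda>x. ?F x * ?G x"]) auto
  have "(LINT x|M. norm (f x) * norm (g x)) = (LINT x|M. ?F x * ?G x)"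
    using eq by (intro integral_cong_AE) auto
  with H2 show "(LINT x|M. norm (f x) * norm (g x)) \<le> Lp_norm p \<omega> \<Omega> f * Lp_norm ?q (dual_weight p \<omega>) \<Omega> g"
    by (simp add: Fp Gq Lp_norm_eq)
qed

lemma Lp_inner_le:
  fixes f g :: "real^'n \<Rightarrow> 'b::euclidean_space"
  assumes p: "1 < p" and w: "weight_on \<omega>"
    and f: "f \<in> Lp p \<omega> \<Omega>" and g: "g \<in> Lp (conj_exp p) (dual_weight p \<omega>) \<Omega>"
  shows "integrable M (\<lambda>x. f x \<bullet> g x)"
    and "\<bar>LINT x|M. f x \<bullet> g x\<bar> \<le> Lp_norm p \<omega> \<Omega> f * Lp_norm (conj_exp p) (dual_weight p \<omega>) \<Omega> g"
proof -
  note H = Holder_weighted[OF p w f g]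
  have [measurable]: "f \<in> borel_measurable M" "g \<in> borel_measurable M" using f g by (auto simp: Lp_iff)
  show i: "integrable M (\<lambda>x. f x \<bullet> g x)"
    by (rule Bochner_Integration.integrable_bound[OF H(1)]) (auto intro!: AE_I2 Cauchy_Schwarz_ineq2)
  have "\<bar>LINT x|M. f x \<bullet> g x\<bar> \<le> (LINT x|M. norm (f x \<bullet> g x))"
    using integral_norm_bound[of M "\<lambda>x. f x \<bullet> g x"] by simp
  also have "\<dots> \<le> (LINT x|M. norm (f x) * norm (g x))"
    using i H(1) by (intro integral_mono) (auto intro: Cauchy_Schwarz_ineq2)
  finally show "\<bar>LINT x|M. f x \<bullet> g x\<bar> \<le> Lp_norm p \<omega> \<Omega> f * Lp_norm (conj_exp p) (dual_weight p \<omega>) \<Omega> g"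
    using H(2) by simp
qed

lemma conj_exp_2 [simp]: "conj_exp 2 = 2"
  by (simp add: conj_exp_def)

lemma dual_weight_one [simp]: "dual_weight p (\<lambda>_. 1) = (\<lambda>_. 1)"
  by (simp add: dual_weight_def)

lemma conj_exp_conj_exp: "1 < p \<Longrightarrow> conj_exp (conj_exp p) = p"
  by (simp add: conj_exp_def field_simps)

lemma conj_exp_gt_1: "1 < p \<Longrightarrow> 1 < conj_exp p"
  by (simp add: conj_exp_def)

text \<open>The exponents 1/(1-p) and 1/(1-p') are inverse to each other, and zeros of \<omega> are
  preserved because \<open>0 powr a = 0\<close>. Being an identity of functions and not only almost
  everywhere, it can be used to rewrite inside the spaces.\<close>

lemma dual_weight_dual:
  assumes "1 < p" "\<And>x. 0 \<le> \<omega> x"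
  shows "dual_weight (conj_exp p) (dual_weight p \<omega>) = \<omega>"
proof -
  have "(1 / (1 - p)) * (1 / (1 - conj_exp p)) = 1"
    using assms(1) by (simp add: conj_exp_def field_simps)
  then show ?thesis using assms(2) by (simp add: dual_weight_def powr_powr fun_eq_iff)
qed

end

section \<open>The kernel and Muckenhoupt weights\<close>

text \<open>Symmetric in the two points (\<open>kern_commute\<close>). Hence one dyadic estimate
  serves both for the mass in \<open>x\<close>, needed for Jensen's inequality, and for the integral
  of the weight in \<open>z\<close>, needed after Tonelli's theorem.\<close>

definition kern :: "real \<Rightarrow> real \<Rightarrow> real \<Rightarrow> real^'n \<Rightarrow> real^'n \<Rightarrow> real" where
  "kern \<kappa> h l z x = h powr l * sigma \<kappa> h z x powr (- (real CARD('n) + l))"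

lemma kern_nonneg: "0 \<le> kern \<kappa> h l z x"
  by (simp add: kern_def)

lemma kern_commute: "kern \<kappa> h l z x = kern \<kappa> h l x z"
  by (simp add: kern_def sigma_def norm_minus_commute)

lemma sigma_ge:
  assumes "0 < \<kappa>" "0 < h"
  shows "\<kappa> * h \<le> sigma \<kappa> h z x" "norm (x - z) \<le> sigma \<kappa> h z x"
  using assms by (auto simp: sigma_def intro!: real_le_rsqrt)

text \<open>Take the least m for which z lies in the ball of radius 2^m \<kappa> h about x. By
  minimality |x - z| is at least half that radius if m > 0, and for m = 0 the regularisation gives
  \<sigma> \<ge> \<kappa> h; either way \<sigma> \<ge> 2^m \<kappa> h / 2. The factor \<sigma>^(-d)
  normalises the ball, the remaining \<sigma>^(-l) yields the geometric factor 2^(-lm) and cancels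
  h^l.\<close>

lemma kern_dyadic:
  fixes x z :: "real^'n"
  assumes k: "0 < \<kappa>" and h: "0 < h" and l: "0 < l"
  obtains m :: nat where "z \<in> ball x (2 ^ m * (\<kappa> * h))"
    "kern \<kappa> h l z x \<le> 2 powr (real CARD('n) + l) * \<kappa> powr (- l) * (2 powr (- l)) ^ m * (2 ^ m * (\<kappa> * h)) powr (- real CARD('n))"
proof -
  let ?d = "real CARD('n)"
  define \<rho> where "\<rho> = \<kappa> * h"
  have r: "0 < \<rho>" using k h by (simp add: \<rho>_def)
  have "\<exists>m::nat. norm (x - z) < 2 ^ m * \<rho>"
  proof -
    obtain m where "norm (x - z) / \<rho> < 2 ^ m" using real_arch_pow[of 2] by auto
    then show ?thesis using r by (auto simp: field_simps)
  qed
  define m where "m = (LEAST m::nat. norm (x - z) < 2 ^ m * \<rho>)"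
  have m: "norm (x - z) < 2 ^ m * \<rho>"
    unfolding m_def by (rule LeastI_ex) fact
  have lower: "2 ^ m * \<rho> / 2 \<le> sigma \<kappa> h z x"
  proof (cases m)
    case 0
    then show ?thesis using sigma_ge(1)[OF k h, of z x] r by (simp add: \<rho>_def)
  next
    case (Suc n)
    then have "\<not> norm (x - z) < 2 ^ n * \<rho>" unfolding m_def using not_less_Least by (metis lessI)
    then have "2 ^ m * \<rho> / 2 \<le> norm (x - z)" using Suc by simp
    then show ?thesis using sigma_ge(2)[OF k h, of x z] by linarith
  qed
  have "kern \<kappa> h l z x \<le> h powr l * (2 ^ m * \<rho> / 2) powr (- (?d + l))"
    unfolding kern_def using lower r l by (intro mult_left_mono powr_mono2') auto
  also have "(2 ^ m * \<rho> / 2) powr (- (?d + l)) = 2 powr (?d + l) * (2 ^ m * \<rho>) powr (- (?d + l))"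
    using r powr_minus_divide[of "2::real" "?d + l"] by (simp add: powr_divide del: minus_add_distrib)
  also have "(2 ^ m * \<rho>) powr (- (?d + l)) = (2 ^ m * \<rho>) powr (- l) * (2 ^ m * \<rho>) powr (- ?d)"
    by (simp add: add.commute flip: powr_add)
  also have "(2 ^ m * \<rho>) powr (- l) = (2 powr (- l)) ^ m * (\<kappa> powr (- l) * h powr (- l))"
  proof -
    have "(2 ^ m) powr (- l) = (2 powr real m) powr (- l)" by (simp add: powr_realpow)
    also have "\<dots> = (2 powr (- l)) ^ m" by (simp add: powr_powr powr_power)
    finally show ?thesis using k h by (simp add: \<rho>_def powr_mult)
  qed
  also have "h powr l * (2 powr (?d + l) * ((2 powr (- l)) ^ m * (\<kappa> powr (- l) * h powr (- l)) * (2 ^ m * \<rho>) powr (- ?d)))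
    = (h powr l * h powr (- l)) * (2 powr (?d + l) * \<kappa> powr (- l) * (2 powr (- l)) ^ m * (2 ^ m * \<rho>) powr (- ?d))"
    by (simp add: mult_ac)
  also have "h powr l * h powr (- l) = 1" using h by (simp flip: powr_add)
  finally show thesis using m by (intro that[of m]) (auto simp: \<rho>_def dist_norm)
qed

lemma sigma_measurable [measurable]:
  "f \<in> borel_measurable N \<Longrightarrow> g \<in> borel_measurable N \<Longrightarrow>
    (\<lambda>y. sigma \<kappa> h (f y) (g y :: real^'n)) \<in> borel_measurable N"
proof -
  assume "f \<in> borel_measurable N" "g \<in> borel_measurable N"
  then have "(\<lambda>y. (norm (g y - f y))\<^sup>2 + (\<kappa> * h)\<^sup>2) \<in> borel_measurable N"
    by (intro borel_measurable_add borel_measurable_power measurable_compose[OF _ borel_measurable_norm]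
        borel_measurable_diff borel_measurable_const)
  then show ?thesis
    unfolding sigma_def by (rule borel_measurable_continuous_on[rotated]) (intro continuous_intros)
qed

lemma kern_measurable [measurable]:
  "f \<in> borel_measurable N \<Longrightarrow> g \<in> borel_measurable N \<Longrightarrow> (\<lambda>y. kern \<kappa> h l (f y) (g y :: real^'n)) \<in> borel_measurable N"
  unfolding kern_def by measurable

lemma id_borel_lebesgue [measurable]: "(\<lambda>x. x) \<in> lebesgue \<rightarrow>\<^sub>M borel"
  by (rule measurable_completion) simp

text \<open>The growth r^d in the hypothesis cancels the normalisation of each dyadic ball, so only
  A and the geometric factors remain; the series converges because l > 0, and h has disappeared.
  With \<tau> = 1 this bounds the mass, with \<tau> = \<omega> and A = K \<omega>(x) it is the A_1
  estimate for the kernel.\<close>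

lemma kern_nn_integral:
  fixes \<tau> :: "real^'n \<Rightarrow> real" and x :: "real^'n"
  assumes k: "0 < \<kappa>" and h: "0 < h" and l: "0 < l" and A: "0 \<le> A"
    and t: "\<tau> \<in> borel_measurable lebesgue" "\<And>x. 0 \<le> \<tau> x"
    and ball: "\<And>r. 0 < r \<Longrightarrow> (\<integral>\<^sup>+z\<in>ball x r. ennreal (\<tau> z) \<partial>lebesgue) \<le> ennreal (A * r powr real CARD('n))"
  shows "(\<integral>\<^sup>+z. ennreal (kern \<kappa> h l z x * \<tau> z) \<partial>lebesgue)
    \<le> ennreal (2 powr (real CARD('n) + l) * \<kappa> powr (- l) * A / (1 - 2 powr (- l)))"
proof -
  let ?d = "real CARD('n)"
  define \<rho> where "\<rho> = \<kappa> * h"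
  define c where "c = 2 powr (?d + l) * \<kappa> powr (- l)"
  define b where "b m = c * (2 powr (- l)) ^ m * (2 ^ m * \<rho>) powr (- ?d)" for m :: nat
  have r: "0 < \<rho>" using k h by (simp add: \<rho>_def)
  have b0: "0 \<le> b m" for m by (simp add: b_def c_def)
  have meas: "(\<lambda>z. ennreal (\<tau> z) * indicator (ball x s) z) \<in> borel_measurable lebesgue" for s
    by (intro borel_measurable_times_ennreal borel_measurable_indicator measurable_compose[OF t(1) measurable_ennreal]) simp
  have pw: "ennreal (kern \<kappa> h l z x * \<tau> z) \<le> (\<Sum>m. ennreal (b m) * (ennreal (\<tau> z) * indicator (ball x (2 ^ m * \<rho>)) z))" for z
  proof -
    obtain m where m: "z \<in> ball x (2 ^ m * \<rho>)" "kern \<kappa> h l z x \<le> b m"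
      using kern_dyadic[OF k h l, of z x] unfolding b_def c_def \<rho>_def by metis
    have "ennreal (kern \<kappa> h l z x * \<tau> z) \<le> ennreal (b m * \<tau> z)"
      using m(2) t(2) by (intro ennreal_leI mult_right_mono)
    also have "\<dots> = ennreal (b m) * (ennreal (\<tau> z) * indicator (ball x (2 ^ m * \<rho>)) z)"
      using m(1) t(2) b0 by (simp add: ennreal_mult)
    also have "\<dots> \<le> (\<Sum>m. ennreal (b m) * (ennreal (\<tau> z) * indicator (ball x (2 ^ m * \<rho>)) z))"
      using sum_le_suminf[of "\<lambda>m. ennreal (b m) * (ennreal (\<tau> z) * indicator (ball x (2 ^ m * \<rho>)) z)" "{m}"] by simp
    finally show ?thesis .
  qed
  have "(\<integral>\<^sup>+z. ennreal (kern \<kappa> h l z x * \<tau> z) \<partial>lebesgue)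
    \<le> (\<integral>\<^sup>+z. (\<Sum>m. ennreal (b m) * (ennreal (\<tau> z) * indicator (ball x (2 ^ m * \<rho>)) z)) \<partial>lebesgue)"
    by (intro nn_integral_mono pw)
  also have "\<dots> = (\<Sum>m. \<integral>\<^sup>+z. ennreal (b m) * (ennreal (\<tau> z) * indicator (ball x (2 ^ m * \<rho>)) z) \<partial>lebesgue)"
    by (intro nn_integral_suminf borel_measurable_times_ennreal[OF borel_measurable_const] meas)
  also have "\<dots> = (\<Sum>m. ennreal (b m) * (\<integral>\<^sup>+z\<in>ball x (2 ^ m * \<rho>). ennreal (\<tau> z) \<partial>lebesgue))"
    by (intro arg_cong[of _ _ suminf] ext nn_integral_cmult meas)
  also have "\<dots> \<le> (\<Sum>m. ennreal (c * A * (2 powr (- l)) ^ m))"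
  proof (rule suminf_le)
    fix m
    have "ennreal (b m) * (\<integral>\<^sup>+z\<in>ball x (2 ^ m * \<rho>). ennreal (\<tau> z) \<partial>lebesgue)
      \<le> ennreal (b m) * ennreal (A * (2 ^ m * \<rho>) powr ?d)"
      using ball[of "2 ^ m * \<rho>"] r by (intro mult_left_mono) auto
    also have "\<dots> = ennreal (b m * (A * (2 ^ m * \<rho>) powr ?d))"
      using b0 A by (simp add: ennreal_mult)
    also have "b m * (A * (2 ^ m * \<rho>) powr ?d) = c * A * (2 powr (- l)) ^ m * ((2 ^ m * \<rho>) powr (- ?d) * (2 ^ m * \<rho>) powr ?d)"
      by (simp add: b_def)
    also have "(2 ^ m * \<rho>) powr (- ?d) * (2 ^ m * \<rho>) powr ?d = 1"
      using r by (simp flip: powr_add)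
    finally show "ennreal (b m) * (\<integral>\<^sup>+z\<in>ball x (2 ^ m * \<rho>). ennreal (\<tau> z) \<partial>lebesgue) \<le> ennreal (c * A * (2 powr (- l)) ^ m)"
      by simp
  qed auto
  also have "\<dots> = ennreal (c * A / (1 - 2 powr (- l)))"
  proof (rule suminf_ennreal_eq)
    have "norm ((2::real) powr (- l)) < 1" using l powr_less_mono[of "- l" 0 "2::real"] by simp
    from geometric_sums[OF this] have "(\<lambda>m. c * A * (2 powr (- l)) ^ m) sums (c * A * (1 / (1 - 2 powr (- l))))"
      by (rule sums_mult)
    then show "(\<lambda>m. c * A * (2 powr (- l)) ^ m) sums (c * A / (1 - 2 powr (- l)))" by simp
  qed (use A in \<open>simp add: c_def\<close>)
  finally show ?thesis by (simp add: c_def)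
qed

section \<open>The A_1 condition as a pointwise maximal estimate\<close>

lemma emeasure_ball_powr:
  assumes "0 < r"
  shows "emeasure lborel (ball (x::real^'n) r) = ennreal (unit_ball_vol (real CARD('n)) * r powr real CARD('n))"
    and "emeasure lebesgue (ball (x::real^'n) r) = ennreal (unit_ball_vol (real CARD('n)) * r powr real CARD('n))"
  using assms by (simp_all add: emeasure_ball powr_realpow)

lemma unit_ball_vol_pos: "0 < unit_ball_vol (real n)"
  by simp

text \<open>The function 1/\<omega> lies below its essential supremum almost everywhere, so the A_1
  bound on the ball holds with 1/\<omega>(y) in place of the supremum; multiplying by \<omega>(y)
  and by the volume clears both quotients.\<close>

lemma A1_on_ball:
  fixes \<omega> :: "real^'n \<Rightarrow> real"
  assumes w: "\<omega> \<in> A1" and r: "0 < r"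
  shows "AE y in lebesgue. y \<in> ball x r \<longrightarrow>
    (\<integral>\<^sup>+z\<in>ball x r. ennreal (\<omega> z) \<partial>lebesgue) \<le> ennreal (enn2real (A1_const \<omega>) * unit_ball_vol (real CARD('n)) * r powr real CARD('n) * \<omega> y)"
proof -
  let ?B = "ball x r" and ?K = "A1_const \<omega>"
  let ?v = "unit_ball_vol (real CARD('n)) * r powr real CARD('n)"
  define e where "e = esssup (lebesgue_on ?B) (\<lambda>x. inverse (ennreal (\<omega> x)))"
  have v: "0 < ?v" using r by simp
  have fin: "?K < \<infinity>" using w by (simp add: A1_def)
  have "ball_avg ?B \<omega> * e \<le> ?K"
    unfolding A1_const_def e_def by (rule SUP_upper) (use r in blast)
  have "AE y in lebesgue_on ?B. inverse (ennreal (\<omega> y)) \<le> e"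
    unfolding e_def by (rule esssup_AE)
  then have "AE y in lebesgue. y \<in> ?B \<longrightarrow> inverse (ennreal (\<omega> y)) \<le> e"
    by (simp add: AE_restrict_space_iff)
  moreover have "AE y in lebesgue. 0 < \<omega> y" using w by (simp add: A1_def)
  ultimately show ?thesis
  proof eventually_elim
    case (elim y)
    show ?case
    proof
      assume "y \<in> ?B"
      then have "ball_avg ?B \<omega> * inverse (ennreal (\<omega> y)) \<le> ?K"
        using elim \<open>ball_avg ?B \<omega> * e \<le> ?K\<close> by (meson mult_left_mono order_trans zero_le)
      then have "ball_avg ?B \<omega> * inverse (ennreal (\<omega> y)) * ennreal (\<omega> y) \<le> ?K * ennreal (\<omega> y)"
        by (rule mult_right_mono) simp
      moreover have "inverse (ennreal (\<omega> y)) * ennreal (\<omega> y) = 1"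
        using elim by (simp add: inverse_ennreal ennreal_mult[symmetric])
      ultimately have "ball_avg ?B \<omega> \<le> ?K * ennreal (\<omega> y)" by (simp add: mult.assoc)
      then have "ball_avg ?B \<omega> * ennreal ?v \<le> ?K * ennreal (\<omega> y) * ennreal ?v"
        by (rule mult_right_mono) simp
      moreover have "ball_avg ?B \<omega> * ennreal ?v = (\<integral>\<^sup>+z\<in>?B. ennreal (\<omega> z) \<partial>lebesgue)"
        unfolding ball_avg_def emeasure_ball_powr(2)[OF r]
      proof -
        have "ennreal ?v / ennreal ?v = 1" using v by (intro ennreal_divide_self) (auto simp: ennreal_eq_0_iff not_le)
        then show "(\<integral>\<^sup>+z\<in>?B. ennreal (\<omega> z) \<partial>lebesgue) / ennreal ?v * ennreal ?v = (\<integral>\<^sup>+z\<in>?B. ennreal (\<omega> z) \<partial>lebesgue)"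
          by (simp only: ennreal_divide_times mult_1_right)
      qed
      moreover have "?K * ennreal (\<omega> y) * ennreal ?v = ennreal (enn2real ?K * unit_ball_vol (real CARD('n)) * r powr real CARD('n) * \<omega> y)"
      proof -
        have "?K = ennreal (enn2real ?K)" using fin by simp
        then have "?K * ennreal (\<omega> y) * ennreal ?v = ennreal (enn2real ?K) * ennreal (\<omega> y) * ennreal ?v" by simp
        also have "\<dots> = ennreal (enn2real ?K * \<omega> y * ?v)"
          using elim v by (simp add: ennreal_mult del: ennreal_enn2real)
        finally show ?thesis by (simp add: mult_ac)
      qed
      ultimately show "(\<integral>\<^sup>+z\<in>?B. ennreal (\<omega> z) \<partial>lebesgue)
        \<le> ennreal (enn2real ?K * unit_ball_vol (real CARD('n)) * r powr real CARD('n) * \<omega> y)" by simp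
    qed
  qed
qed

text \<open>The exceptional null set in the \<open>A\<^sub>1\<close> condition depends on the ball. Centres in a countable dense set and rational
  radii make it uniform.\<close>

lemma A1_maximal:
  fixes \<omega> :: "real^'n \<Rightarrow> real"
  assumes w: "\<omega> \<in> A1"
  obtains K where "0 \<le> K"
    "AE y in lebesgue. \<forall>r>0. (\<integral>\<^sup>+z\<in>ball y r. ennreal (\<omega> z) \<partial>lebesgue) \<le> ennreal (K * \<omega> y * r powr real CARD('n))"
proof -
  let ?d = "real CARD('n)"
  obtain D :: "(real^'n) set" where D: "countable D" "\<And>X. open X \<Longrightarrow> X \<noteq> {} \<Longrightarrow> \<exists>d\<in>D. d \<in> X"
    using countable_dense_setE by blast
  define K0 where "K0 = enn2real (A1_const \<omega>) * unit_ball_vol ?d"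
  have K0: "0 \<le> K0" by (simp add: K0_def)
  let ?I = "D \<times> ({0<..} \<inter> \<rat>)"
  have "AE y in lebesgue. \<forall>(q, s)\<in>?I. y \<in> ball q s \<longrightarrow>
    (\<integral>\<^sup>+z\<in>ball q s. ennreal (\<omega> z) \<partial>lebesgue) \<le> ennreal (K0 * s powr ?d * \<omega> y)"
  proof (subst AE_ball_countable)
    show "countable ?I" using D(1) countable_rat by auto
    show "\<forall>i\<in>?I. AE y in lebesgue. case i of (q, s) \<Rightarrow> y \<in> ball q s \<longrightarrow>
        (\<integral>\<^sup>+z\<in>ball q s. ennreal (\<omega> z) \<partial>lebesgue) \<le> ennreal (K0 * s powr ?d * \<omega> y)"
      using A1_on_ball[OF w] by (auto simp: K0_def)
  qed
  moreover have "AE y in lebesgue. 0 < \<omega> y" using w by (simp add: A1_def)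
  ultimately have "AE y in lebesgue. \<forall>r>0. (\<integral>\<^sup>+z\<in>ball y r. ennreal (\<omega> z) \<partial>lebesgue) \<le> ennreal ((K0 * 2 powr ?d) * \<omega> y * r powr ?d)"
  proof eventually_elim
    case (elim y)
    show ?case
    proof (intro allI impI)
      fix r :: real assume r: "0 < r"
      \<comment> \<open>A centre within r/2 of y and a rational radius s in (3r/2, 2r) put
        \<open>ball y r\<close> inside a ball from the countable family. Its radius is less than 2r,
        which costs the factor 2^d.\<close>
      obtain q where q: "q \<in> D" "q \<in> ball y (r/2)" using D(2)[of "ball y (r/2)"] r by auto
      obtain s where s: "s \<in> \<rat>" "3 * r / 2 < s" "s < 2 * r" using Rats_dense_in_real[of "3 * r / 2" "2 * r"] r by auto
      have sub: "ball y r \<subseteq> ball q s"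
      proof
        fix z assume "z \<in> ball y r"
        then have "dist q z < r/2 + r" using q(2) dist_triangle[of q z y] by (auto simp: dist_commute)
        then show "z \<in> ball q s" using s by simp
      qed
      have yq: "y \<in> ball q s" using subsetD[OF sub, of y] r by simp
      have "(\<integral>\<^sup>+z\<in>ball y r. ennreal (\<omega> z) \<partial>lebesgue) \<le> (\<integral>\<^sup>+z\<in>ball q s. ennreal (\<omega> z) \<partial>lebesgue)"
        using sub by (intro nn_integral_mono) (auto split: split_indicator)
      also have "\<dots> \<le> ennreal (K0 * s powr ?d * \<omega> y)"
        using elim(1) q s r yq by auto
      also have "\<dots> \<le> ennreal (K0 * (2 * r) powr ?d * \<omega> y)"
        using K0 s r elim(2) by (intro ennreal_leI mult_right_mono mult_left_mono powr_mono2) auto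
      finally show "(\<integral>\<^sup>+z\<in>ball y r. ennreal (\<omega> z) \<partial>lebesgue) \<le> ennreal ((K0 * 2 powr ?d) * \<omega> y * r powr ?d)"
        using r by (simp add: powr_mult mult_ac)
    qed
  qed
  with that[of "K0 * 2 powr ?d"] K0 show thesis by simp
qed

section \<open>Weighted Sobolev spaces\<close>

lemma is_weight_measurable:
  fixes \<omega> :: "real^'n \<Rightarrow> real"
  assumes "is_weight \<omega>"
  shows "\<omega> \<in> borel_measurable lebesgue"
proof (rule borel_measurable_LIMSEQ_real)
  show "(\<lambda>x. indicator (cball 0 (real n)) x *\<^sub>R \<omega> x) \<in> borel_measurable lebesgue" for n
    using assms by (auto simp: is_weight_def set_integrable_def intro!: borel_measurable_integrable)
  fix x :: "real^'n"
  show "(\<lambda>n. indicator (cball 0 (real n)) x *\<^sub>R \<omega> x) \<longlonglongrightarrow> \<omega> x"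
  proof (rule tendsto_eventually)
    obtain N :: nat where "norm x \<le> real N" using real_arch_simple by blast
    then show "\<forall>\<^sub>F n in sequentially. indicator (cball 0 (real n)) x *\<^sub>R \<omega> x = \<omega> x"
      by (intro eventually_sequentiallyI[of N]) (auto simp: indicator_def)
  qed
qed

lemma ball_avg_pos:
  fixes \<omega> :: "real^'n \<Rightarrow> real"
  assumes "\<omega> \<in> borel_measurable lebesgue" "AE x in lebesgue. 0 < \<omega> x" "0 < r"
  shows "0 < ball_avg (ball x r) \<omega>"
proof -
  have "(\<integral>\<^sup>+z\<in>ball x r. ennreal (\<omega> z) \<partial>lebesgue) \<noteq> 0"
  proof
    assume "(\<integral>\<^sup>+z\<in>ball x r. ennreal (\<omega> z) \<partial>lebesgue) = 0"
    then have "AE z in lebesgue. ennreal (\<omega> z) * indicator (ball x r) z = 0"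
      by (subst (asm) nn_integral_0_iff_AE)
         (intro borel_measurable_times_ennreal borel_measurable_indicator measurable_compose[OF assms(1) measurable_ennreal], auto)
    with assms(2) have "AE z in lebesgue. z \<notin> ball x r"
      by eventually_elim (auto simp: indicator_def)
    then have "emeasure lebesgue (ball x r) = 0"
      by (subst (asm) AE_iff_measurable[where N = "ball x r"]) auto
    then show False using assms(3) unit_ball_vol_pos[of "CARD('n)"] by (simp add: emeasure_ball_powr)
  qed
  then show ?thesis using assms(3)
    by (simp add: ball_avg_def emeasure_ball_powr ennreal_zero_less_divide zero_less_iff_neq_zero)
qed

lemma ball_avg_finiteD:
  assumes "ball_avg (ball (x::real^'n) r) f \<noteq> \<infinity>" "0 < r"
  shows "(\<integral>\<^sup>+z\<in>ball x r. ennreal (f z) \<partial>lebesgue) < \<infinity>"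
proof -
  have "0 < unit_ball_vol (real CARD('n)) * r powr real CARD('n)" using assms by simp
  then show ?thesis
    using assms(1) unfolding ball_avg_def emeasure_ball_powr(2)[OF assms(2)]
    by (auto simp: ennreal_divide_eq_top_iff less_top)
qed

text \<open>Were the average of the dual weight infinite, its product with the positive average of
  \<omega> would be infinite too, against the finiteness of the A_p constant.\<close>

lemma dual_weight_ball_finite:
  fixes \<omega> :: "real^'n \<Rightarrow> real"
  assumes w: "\<omega> \<in> Ap p" and r: "0 < r"
  shows "(\<integral>\<^sup>+z\<in>ball x r. ennreal (dual_weight p \<omega> z) \<partial>lebesgue) < \<infinity>"
proof (rule ball_avg_finiteD[OF _ r], rule notI)
  assume inf: "ball_avg (ball x r) (dual_weight p \<omega>) = \<infinity>"
  have "ball_avg (ball x r) \<omega> * ennpowr (ball_avg (ball x r) (dual_weight p \<omega>)) (p - 1) \<le> Ap_const p \<omega>"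
    unfolding Ap_const_def by (rule SUP_upper) (use r in blast)
  also have "\<dots> < \<infinity>" using w by (simp add: Ap_def)
  finally have "ball_avg (ball x r) \<omega> * \<infinity> < \<infinity>" using inf by (simp add: ennpowr_def)
  moreover have "0 < ball_avg (ball x r) \<omega>"
    using w by (intro ball_avg_pos[OF is_weight_measurable _ r]) (auto simp: Ap_def)
  ultimately show False by (simp add: ennreal_mult_top split: if_splits)
qed

lemma one_in_Ap: "(\<lambda>_::real^'n. 1) \<in> Ap 2"
proof -
  have avg: "ball_avg (ball x r) (\<lambda>_::real^'n. 1) = 1" if "0 < r" for x r
  proof -
    have "0 < unit_ball_vol (real CARD('n)) * r powr real CARD('n)" using that by simp
    then show ?thesis using that by (simp add: ball_avg_def emeasure_ball_powr(1) divide_ennreal less_imp_neq[OF unit_ball_vol_pos, symmetric])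
  qed
  have "Ap_const 2 (\<lambda>_::real^'n. 1) \<le> 1"
    unfolding Ap_const_def
    by (rule SUP_least) (auto simp: avg dual_weight_def ennpowr_def)
  then have "Ap_const 2 (\<lambda>_::real^'n. 1) < \<infinity>" by (rule order.strict_trans1) simp
  moreover have "is_weight (\<lambda>_::real^'n. 1)"
  proof -
    have "loc_integrable UNIV (\<lambda>_::real^'n. 1::real)" by (intro loc_integrable_continuous) auto
    then show ?thesis by (simp add: is_weight_def loc_integrable_def)
  qed
  ultimately show ?thesis by (simp add: Ap_def)
qed

text \<open>Makes the unweighted problem an instance of the assumed well-posedness, which is where
  the Green pairs come from. The whole of \<Omega> serves as the neighbourhood of the
  boundary.\<close>

lemma one_in_Ap_dom: "open \<Omega> \<Longrightarrow> (\<lambda>_::real^'n. 1) \<in> Ap_dom 2 \<Omega>"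
  unfolding Ap_dom_def using one_in_Ap
  by (auto intro!: exI[of _ \<Omega>] exI[of _ "1::real"])

section \<open>Weighted Sobolev spaces on the domain and embeddings between them\<close>

context bounded_open begin

lemma AE_M_iff: "(AE x\<in>\<Omega> in lebesgue. P x) \<longleftrightarrow> (AE x in M. P x)"
  by (rule AE_on_eq) simp

text \<open>Local integrability controls \<open>G\<close> only on compact subsets; a countable cover
  of \<Omega> by closed boxes glues the pieces.\<close>

lemma loc_integrable_measurable:
  fixes G :: "real^'n \<Rightarrow> 'b::euclidean_space"
  assumes "loc_integrable \<Omega> G"
  shows "G \<in> borel_measurable M"
proof -
  obtain \<D> where D: "countable \<D>" "\<D> \<subseteq> Pow \<Omega>" "\<And>X. X \<in> \<D> \<Longrightarrow> \<exists>a b. X = cbox a b" "\<Union>\<D> = \<Omega>"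
    using open_countable_Union_open_cbox[OF open_dom] by metis
  show ?thesis
  proof (rule measurable_piecewise_restrict[OF D(1)])
    fix X assume X: "X \<in> \<D>"
    obtain a b where ab: "X = cbox a b" using D(3)[OF X] by blast
    have sub: "X \<subseteq> \<Omega>" using D(2) X by auto
    show "X \<inter> space M \<in> sets M" using ab sub by (auto simp: sets_restrict_space image_iff intro!: bexI[of _ X])
    have "integrable lebesgue (\<lambda>x. indicator X x *\<^sub>R G x)"
      using assms sub ab by (auto simp: loc_integrable_def set_integrable_def)
    then have "G \<in> borel_measurable (restrict_space lebesgue X)"
      using ab by (subst borel_measurable_restrict_space_iff) (auto intro: borel_measurable_integrable)
    moreover have "restrict_space M X = restrict_space lebesgue X"
      using sub ab by (simp add: restrict_restrict_space inf.absorb2)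
    ultimately show "G \<in> borel_measurable (restrict_space M X)" by simp
  qed (use D(4) in auto)
qed

lemma wgrad_measurable:
  assumes "has_weak_grad \<Omega> u G"
  shows "wgrad \<Omega> u \<in> borel_measurable M"
  using has_weak_grad_wgrad[OF assms] by (intro loc_integrable_measurable) (simp add: has_weak_grad_def)

lemma W1pD:
  assumes "u \<in> W1p p \<omega> \<Omega>"
  shows "has_weak_grad \<Omega> u (wgrad \<Omega> u)" "u \<in> Lp p \<omega> \<Omega>" "wgrad \<Omega> u \<in> Lp p \<omega> \<Omega>"
  using assms has_weak_grad_wgrad by (auto simp: W1p_def)

lemma W1pI:
  assumes "has_weak_grad \<Omega> u G" "u \<in> Lp p \<omega> \<Omega>" "wgrad \<Omega> u \<in> Lp p \<omega> \<Omega>"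
  shows "u \<in> W1p p \<omega> \<Omega>"
  using assms by (auto simp: W1p_def)

lemma W1p0_W1p: "u \<in> W1p0 p \<omega> \<Omega> \<Longrightarrow> u \<in> W1p p \<omega> \<Omega>"
  by (simp add: W1p0_def)

lemma wgrad_eq_AE:
  assumes "has_weak_grad \<Omega> u G"
  shows "AE x in M. wgrad \<Omega> u x = G x"
  using AE_wgrad_eq[OF open_dom assms] by (simp add: AE_M_iff)

lemma Cc_W1p:
  fixes \<phi> :: "real^'n \<Rightarrow> real^'n"
  assumes \<phi>: "\<phi> \<in> Cc_infinity \<Omega>" and w: "weight_on \<omega>" "0 < p"
  shows "\<phi> \<in> W1p p \<omega> \<Omega>"
proof -
  note wg = has_weak_grad_cgrad[OF Cc_infinity_Ck[OF \<phi>], of \<Omega>]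
  have m: "\<phi> \<in> borel_measurable M"
    using borel_lebesgue_measurable_Cc[OF \<phi>] by (rule measurable_M)
  obtain B where B: "\<And>x. norm (\<phi> x) \<le> B" using Cc_infinity_bounded[OF \<phi>] by metis
  have "\<exists>b. \<forall>x. norm (pderivative i \<phi> x) \<le> b" for i
    using Cc_infinity_bounded[OF Cc_infinity_pderivative[OF \<phi>], of i] by metis
  then obtain b where b: "\<And>i x. norm (pderivative i \<phi> x) \<le> b i" by metis
  have c: "norm (cgrad \<phi> x) \<le> (\<Sum>j\<in>(UNIV::'n set). \<Sum>i\<in>UNIV. b i)" for x
  proof -
    have "norm (cgrad \<phi> x) \<le> (\<Sum>j\<in>UNIV. norm (cgrad \<phi> x $ j))" by (simp add: norm_vec_def L2_set_le_sum)
    also have "\<dots> \<le> (\<Sum>j\<in>UNIV. \<Sum>i\<in>UNIV. norm (cgrad \<phi> x $ j $ i))"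
      by (intro sum_mono) (simp add: norm_vec_def L2_set_le_sum)
    also have "\<dots> \<le> (\<Sum>j\<in>(UNIV::'n set). \<Sum>i\<in>UNIV. b i)"
      by (intro sum_mono) (use b component_le_norm_cart order_trans in \<open>fastforce simp: cgrad_def\<close>)
    finally show ?thesis .
  qed
  have "AE x in M. norm (wgrad \<Omega> \<phi> x) \<le> (\<Sum>j\<in>(UNIV::'n set). \<Sum>i\<in>UNIV. b i)"
    using wgrad_eq_AE[OF wg] by eventually_elim (metis c)
  then show ?thesis
    by (intro W1pI[OF wg] Lp_bounded[OF w m AE_I2[OF B]] Lp_bounded[OF w wgrad_measurable[OF wg]])
qed

lemma W1p_diff:
  assumes w: "weight_on \<omega>" "1 \<le> p" and u: "u \<in> W1p p \<omega> \<Omega>" and v: "v \<in> W1p p \<omega> \<Omega>"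
  shows "(\<lambda>x. u x - v x) \<in> W1p p \<omega> \<Omega>"
    and "AE x in M. wgrad \<Omega> (\<lambda>x. u x - v x) x = wgrad \<Omega> u x - wgrad \<Omega> v x"
proof -
  note wg = has_weak_grad_diff[OF W1pD(1)[OF u] W1pD(1)[OF v]]
  show eq: "AE x in M. wgrad \<Omega> (\<lambda>x. u x - v x) x = wgrad \<Omega> u x - wgrad \<Omega> v x"
    by (rule wgrad_eq_AE[OF wg])
  have "wgrad \<Omega> (\<lambda>x. u x - v x) \<in> Lp p \<omega> \<Omega>"
    using w(2) by (intro Lp_AE_cong(1)[OF w(1) _ wgrad_measurable[OF wg] Lp_diff[OF w W1pD(3)[OF u] W1pD(3)[OF v]] eq]) auto
  then show "(\<lambda>x. u x - v x) \<in> W1p p \<omega> \<Omega>"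
    using wg Lp_diff[OF w W1pD(2)[OF u] W1pD(2)[OF v]] by (intro W1pI)
qed

lemma W1p_norm_ge:
  assumes "0 < p"
  shows "Lp_norm p \<omega> \<Omega> u \<le> W1p_norm p \<omega> \<Omega> u" "Lp_norm p \<omega> \<Omega> (wgrad \<Omega> u) \<le> W1p_norm p \<omega> \<Omega> u"
proof -
  have *: "a \<le> (a powr p + b powr p) powr (1/p)" if "0 \<le> a" for a b :: real
  proof -
    have "a = (a powr p) powr (1/p)" using that assms by (simp add: powr_powr)
    also have "\<dots> \<le> (a powr p + b powr p) powr (1/p)" using assms by (intro powr_mono2) auto
    finally show ?thesis .
  qed
  show "Lp_norm p \<omega> \<Omega> u \<le> W1p_norm p \<omega> \<Omega> u"
    unfolding W1p_norm_def by (rule *[OF Lp_norm_nonneg])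
  show "Lp_norm p \<omega> \<Omega> (wgrad \<Omega> u) \<le> W1p_norm p \<omega> \<Omega> u"
    unfolding W1p_norm_def by (subst add.commute) (rule *[OF Lp_norm_nonneg])
qed

lemma W1p_norm_le:
  assumes q: "1 \<le> q" and "Lp_norm q \<tau> \<Omega> u \<le> A" "Lp_norm q \<tau> \<Omega> (wgrad \<Omega> u) \<le> A"
  shows "W1p_norm q \<tau> \<Omega> u \<le> 2 * A"
proof -
  have A: "0 \<le> A" using assms(2) Lp_norm_nonneg order_trans by blast
  have "W1p_norm q \<tau> \<Omega> u \<le> (A powr q + A powr q) powr (1/q)"
    unfolding W1p_norm_def using assms by (intro powr_mono2 add_mono) (auto simp: Lp_norm_nonneg)
  also have "\<dots> = 2 powr (1/q) * A"
    using A q by (simp add: powr_mult powr_powr flip: mult_2)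
  also have "\<dots> \<le> 2 * A"
    using powr_mono[of "1/q" 1 "2::real"] q A by (intro mult_right_mono) auto
  finally show ?thesis .
qed

lemma W1p_norm_nonneg: "0 \<le> W1p_norm p \<omega> \<Omega> u"
  by (simp add: W1p_norm_def)

text \<open>Stated for scalar functions, since a definition cannot quantify over the codomain;
  \<open>embedsD\<close> extends it to vectors and matrices through their norms. A field and its
  gradient are thus covered by one constant.\<close>

definition embeds :: "real \<Rightarrow> (real^'n \<Rightarrow> real) \<Rightarrow> real \<Rightarrow> (real^'n \<Rightarrow> real) \<Rightarrow> real \<Rightarrow> bool" where
  "embeds p \<omega> q \<tau> C \<longleftrightarrow> 0 \<le> C \<and> (\<forall>f::real^'n \<Rightarrow> real. f \<in> Lp p \<omega> \<Omega> \<longrightarrow> f \<in> Lp q \<tau> \<Omega> \<and> Lp_norm q \<tau> \<Omega> f \<le> C * Lp_norm p \<omega> \<Omega> f)"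

lemma embedsD:
  fixes f :: "real^'n \<Rightarrow> 'b::euclidean_space"
  assumes "embeds p \<omega> q \<tau> C" "f \<in> Lp p \<omega> \<Omega>"
  shows "f \<in> Lp q \<tau> \<Omega>" "Lp_norm q \<tau> \<Omega> f \<le> C * Lp_norm p \<omega> \<Omega> f"
proof -
  have "(\<lambda>x. norm (f x)) \<in> Lp p \<omega> \<Omega>" using assms(2) Lp_iff_norm by blast
  with assms(1) have *: "(\<lambda>x. norm (f x)) \<in> Lp q \<tau> \<Omega>"
    "Lp_norm q \<tau> \<Omega> (\<lambda>x. norm (f x)) \<le> C * Lp_norm p \<omega> \<Omega> (\<lambda>x. norm (f x))"
    by (auto simp: embeds_def)
  show "f \<in> Lp q \<tau> \<Omega>" using * assms(2) Lp_iff_norm[of f] by blast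
  show "Lp_norm q \<tau> \<Omega> f \<le> C * Lp_norm p \<omega> \<Omega> f" using *(2) by (simp add: Lp_norm_norm)
qed

lemma W1p_embed:
  assumes "embeds p \<omega> q \<tau> C" "u \<in> W1p p \<omega> \<Omega>"
  shows "u \<in> W1p q \<tau> \<Omega>"
  by (intro W1pI[OF W1pD(1)[OF assms(2)]] W1pD[OF assms(2)] embedsD(1)[OF assms(1)])

text \<open>The same smooth approximants work in the target space, since the embedding controls both
  the field and its gradient.\<close>

lemma W1p0_embed:
  assumes e: "embeds p \<omega> q \<tau> C" and w: "weight_on \<omega>" "1 \<le> p" and q: "1 \<le> q"
    and u: "u \<in> W1p0 p \<omega> \<Omega>"
  shows "u \<in> W1p0 q \<tau> \<Omega>"
proof -
  obtain \<phi> where \<phi>: "\<And>n. \<phi> n \<in> Cc_infinity \<Omega>" "(\<lambda>n. W1p_norm p \<omega> \<Omega> (\<lambda>x. \<phi> n x - u x)) \<longlonglongrightarrow> 0"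
    using u by (auto simp: W1p0_def)
  have u1: "u \<in> W1p p \<omega> \<Omega>" using u by (rule W1p0_W1p)
  have le: "W1p_norm q \<tau> \<Omega> (\<lambda>x. \<phi> n x - u x) \<le> 2 * (C * W1p_norm p \<omega> \<Omega> (\<lambda>x. \<phi> n x - u x))" for n
  proof (rule W1p_norm_le[OF q])
    have C: "0 \<le> C" using e by (simp add: embeds_def)
    have d: "(\<lambda>x. \<phi> n x - u x) \<in> W1p p \<omega> \<Omega>"
      using w by (intro W1p_diff(1) Cc_W1p \<phi> u1) auto
    note [simp] = W1p_norm_ge[of p \<omega> "\<lambda>x. \<phi> n x - u x"]
    have "C * Lp_norm p \<omega> \<Omega> (\<lambda>x. \<phi> n x - u x) \<le> C * W1p_norm p \<omega> \<Omega> (\<lambda>x. \<phi> n x - u x)"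
      "C * Lp_norm p \<omega> \<Omega> (wgrad \<Omega> (\<lambda>x. \<phi> n x - u x)) \<le> C * W1p_norm p \<omega> \<Omega> (\<lambda>x. \<phi> n x - u x)"
      using C w by (intro mult_left_mono; simp)+
    then show "Lp_norm q \<tau> \<Omega> (\<lambda>x. \<phi> n x - u x) \<le> C * W1p_norm p \<omega> \<Omega> (\<lambda>x. \<phi> n x - u x)"
      "Lp_norm q \<tau> \<Omega> (wgrad \<Omega> (\<lambda>x. \<phi> n x - u x)) \<le> C * W1p_norm p \<omega> \<Omega> (\<lambda>x. \<phi> n x - u x)"
      using embedsD(2)[OF e W1pD(2)[OF d]] embedsD(2)[OF e W1pD(3)[OF d]] by linarith+
  qed
  have "(\<lambda>n. W1p_norm q \<tau> \<Omega> (\<lambda>x. \<phi> n x - u x)) \<longlonglongrightarrow> 0"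
  proof (rule real_tendsto_sandwich[OF _ _ tendsto_const])
    show "(\<lambda>n. 2 * (C * W1p_norm p \<omega> \<Omega> (\<lambda>x. \<phi> n x - u x))) \<longlonglongrightarrow> 0"
      using \<phi>(2) by (auto intro!: tendsto_eq_intros)
  qed (use le W1p_norm_nonneg in auto)
  then show ?thesis using \<phi>(1) W1p_embed[OF e u1] by (auto simp: W1p0_def)
qed

lemma embedsI:
  assumes "1 \<le> q" "q \<le> p" "weight_on \<omega>" "weight_on \<tau>"
    "0 < k" "AE x in M. k \<le> \<omega> x" "AE x in M. \<tau> x \<le> K"
  obtains C where "embeds p \<omega> q \<tau> C"
proof -
  obtain C where "0 \<le> C" "\<And>f::real^'n \<Rightarrow> real. f \<in> Lp p \<omega> \<Omega> \<Longrightarrow> f \<in> Lp q \<tau> \<Omega>"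
    "\<And>f::real^'n \<Rightarrow> real. f \<in> Lp p \<omega> \<Omega> \<Longrightarrow> Lp_norm q \<tau> \<Omega> f \<le> C * Lp_norm p \<omega> \<Omega> f"
    by (rule Lp_embed[OF assms]) blast
  then show thesis by (intro that[of C]) (simp add: embeds_def)
qed

lemma dom_in_ball: obtains x r where "0 < r" "\<Omega> \<subseteq> ball x r"
  using bounded_subset_ballD[OF bounded_dom, of 0] by (meson that)

lemma weight_on_Ap:
  assumes w: "\<omega> \<in> Ap p"
  shows "weight_on \<omega>"
proof -
  have i: "is_weight \<omega>" and pos: "AE x in lebesgue. 0 < \<omega> x" using w by (auto simp: Ap_def)
  have m: "\<omega> \<in> borel_measurable lebesgue" using i by (rule is_weight_measurable)
  obtain x r where "0 < r" "\<Omega> \<subseteq> ball x r" by (rule dom_in_ball)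
  then have "\<Omega> \<subseteq> cball x r" using ball_subset_cball[of x r] by (rule_tac order_trans)
  moreover have "set_integrable lebesgue (cball x r) \<omega>" using i by (simp add: is_weight_def)
  ultimately have "set_integrable lebesgue \<Omega> \<omega>" by (intro set_integrable_subset[OF _ dom_sets])
  then have "integrable M \<omega>" by (simp add: set_integrable_eq_on)
  moreover have "AE x in M. 0 < \<omega> x" using pos by (subst AE_M_iff[symmetric]) auto
  ultimately show ?thesis using i m by (simp add: weight_on_def is_weight_def)
qed

lemma weight_on_dual_Ap:
  assumes w: "\<omega> \<in> Ap p"
  shows "weight_on (dual_weight p \<omega>)"
proof -
  have i: "is_weight \<omega>" and pos: "AE x in M. 0 < \<omega> x"
    using w weight_onD(4)[OF weight_on_Ap[OF w]] by (auto simp: Ap_def)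
  have m: "dual_weight p \<omega> \<in> borel_measurable lebesgue"
    using is_weight_measurable[OF i] unfolding dual_weight_def by measurable
  obtain x r where B: "0 < r" "\<Omega> \<subseteq> ball x r" by (rule dom_in_ball)
  have nn: "0 \<le> dual_weight p \<omega> x" for x by (simp add: dual_weight_def)
  have "set_integrable lebesgue (ball x r) (dual_weight p \<omega>)"
    unfolding set_integrable_def
  proof (rule integrableI_nonneg)
    have "(\<integral>\<^sup>+ y. ennreal (indicator (ball x r) y *\<^sub>R dual_weight p \<omega> y) \<partial>lebesgue)
      = (\<integral>\<^sup>+z\<in>ball x r. ennreal (dual_weight p \<omega> z) \<partial>lebesgue)"
      by (intro nn_integral_cong) (auto simp: indicator_def)
    then show "(\<integral>\<^sup>+ y. ennreal (indicator (ball x r) y *\<^sub>R dual_weight p \<omega> y) \<partial>lebesgue) < \<infinity>"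
      using dual_weight_ball_finite[OF w B(1), of x] by simp
    show "(\<lambda>y. indicator (ball x r) y *\<^sub>R dual_weight p \<omega> y) \<in> borel_measurable lebesgue"
      using m by (intro borel_measurable_scaleR borel_measurable_indicator) auto
  qed (simp add: nn)
  then have "set_integrable lebesgue \<Omega> (dual_weight p \<omega>)"
    by (rule set_integrable_subset[OF _ dom_sets B(2)])
  then have "integrable M (dual_weight p \<omega>)" by (simp add: set_integrable_eq_on)
  moreover have "AE x in M. 0 < dual_weight p \<omega> x" using pos by eventually_elim (rule dual_weight_pos)
  ultimately show ?thesis using m nn by (simp add: weight_on_def)
qed

text \<open>A single ball containing \<Omega> suffices: the positive integral of \<omega> over it is
  at most a constant times \<omega>(y) for almost every y in it.\<close>

lemma A1_bounded_below:
  assumes w: "\<omega> \<in> A1"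
  obtains c where "0 < c" "AE x in M. c \<le> \<omega> x"
proof -
  obtain x r where B: "0 < r" "\<Omega> \<subseteq> ball x r" by (rule dom_in_ball)
  define I where "I = (\<integral>\<^sup>+z\<in>ball x r. ennreal (\<omega> z) \<partial>lebesgue)"
  define K where "K = enn2real (A1_const \<omega>) * unit_ball_vol (real CARD('n)) * r powr real CARD('n)"
  have K: "0 \<le> K" by (simp add: K_def)
  have "0 < ball_avg (ball x r) \<omega>"
    using w B(1) by (intro ball_avg_pos is_weight_measurable) (auto simp: A1_def)
  then have I0: "I \<noteq> 0" by (auto simp: I_def ball_avg_def)
  \<comment> \<open>The minimum with 1 makes the numerator finite without discussing the integral,
    and K + 1 excludes a zero denominator.\<close>
  define c where "c = enn2real (min I 1) / (K + 1)"
  have fin: "min I 1 < top" by (rule order.strict_trans1[of _ 1]) auto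
  have "0 < c" using I0 fin K by (simp add: c_def enn2real_positive_iff zero_less_iff_neq_zero)
  moreover have "AE y in M. c \<le> \<omega> y"
  proof (subst AE_M_iff[symmetric])
    have pos: "AE x in lebesgue. 0 < \<omega> x" using w by (simp add: A1_def)
    show "AE y\<in>\<Omega> in lebesgue. c \<le> \<omega> y"
      using A1_on_ball[OF w B(1), of x] pos
    proof eventually_elim
      case (elim y)
      show ?case
      proof
        assume "y \<in> \<Omega>"
        then have "I \<le> ennreal (K * \<omega> y)" using elim B by (auto simp: I_def K_def)
        then have "ennreal (enn2real (min I 1)) \<le> ennreal (K * \<omega> y)"
          using fin by (simp add: min.coboundedI1)
        then have "enn2real (min I 1) \<le> K * \<omega> y" using K elim by (subst (asm) ennreal_le_iff) auto
        also have "\<dots> \<le> (K + 1) * \<omega> y" using elim by simp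
        finally show "c \<le> \<omega> y" using K by (simp add: c_def field_simps)
      qed
    qed
  qed
  ultimately show thesis by (rule that)
qed

text \<open>Here \<omega> = \<omega>'^(1/(1-p')) with a negative exponent, so the lower bound for
  \<omega>' becomes an upper bound for \<omega>.\<close>

lemma dual_A1_bounded_above:
  assumes p: "1 < p" and w: "\<omega> \<in> Ap p" "dual_weight p \<omega> \<in> A1"
  obtains c where "AE x in M. \<omega> x \<le> c"
proof -
  obtain c where c: "0 < c" "AE x in M. c \<le> dual_weight p \<omega> x" using A1_bounded_below[OF w(2)] by metis
  have eq: "\<omega> = dual_weight (conj_exp p) (dual_weight p \<omega>)"
    using weight_onD(1)[OF weight_on_Ap[OF w(1)]] p by (simp add: dual_weight_dual)
  have "1 / (1 - conj_exp p) \<le> 0" using conj_exp_gt_1[OF p] by simp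
  have "AE x in M. \<omega> x \<le> c powr (1 / (1 - conj_exp p))"
    using c(2)
  proof eventually_elim
    case (elim x)
    have "\<omega> x = dual_weight p \<omega> x powr (1 / (1 - conj_exp p))"
      by (subst eq) (simp only: dual_weight_def)
    also have "\<dots> \<le> c powr (1 / (1 - conj_exp p))"
      using elim c(1) \<open>1 / (1 - conj_exp p) \<le> 0\<close> by (intro powr_mono2') auto
    finally show ?case .
  qed
  then show thesis by (rule that)
qed

section \<open>The forms a and b in weighted norms\<close>

lemma a_form_eq: "a_form \<Omega> v w = (LINT x|M. wgrad \<Omega> v x \<bullet> wgrad \<Omega> w x)"
  by (simp add: a_form_def set_lint_eq)

lemma b_form_eq: "b_form \<Omega> v q = - (LINT x|M. q x * wdiv \<Omega> v x)"
  by (simp add: b_form_def set_lint_eq)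

lemma W1inf0D:
  assumes "v \<in> W1inf0 \<Omega>"
  shows "v \<in> borel_measurable M" "\<exists>B. AE x in M. norm (v x) \<le> B"
    "wgrad \<Omega> v \<in> borel_measurable M" "\<exists>B. AE x in M. norm (wgrad \<Omega> v x) \<le> B"
    "has_weak_grad \<Omega> v (wgrad \<Omega> v)" "v \<in> W1p0 1 (\<lambda>_. 1) \<Omega>"
proof -
  have v: "v \<in> W1p0 1 (\<lambda>_. 1) \<Omega>" "v \<in> Linf \<Omega>" "wgrad \<Omega> v \<in> Linf \<Omega>"
    using assms by (simp_all add: W1inf0_def)
  show "v \<in> W1p0 1 (\<lambda>_. 1) \<Omega>" "has_weak_grad \<Omega> v (wgrad \<Omega> v)"
    using v(1) W1pD(1)[OF W1p0_W1p[OF v(1)]] by simp_all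
  show "v \<in> borel_measurable M" "\<exists>B. AE x in M. norm (v x) \<le> B"
    "wgrad \<Omega> v \<in> borel_measurable M" "\<exists>B. AE x in M. norm (wgrad \<Omega> v x) \<le> B"
    using v(2,3) by (simp_all add: Linf_def AE_M_iff)
qed

lemma W1inf0_W1p:
  assumes "v \<in> W1inf0 \<Omega>" "weight_on \<omega>" "0 < p"
  shows "v \<in> W1p p \<omega> \<Omega>"
proof -
  obtain B C where B: "AE x in M. norm (v x) \<le> B" "AE x in M. norm (wgrad \<Omega> v x) \<le> C"
    using W1inf0D(2,4)[OF assms(1)] by blast
  show ?thesis
    by (intro W1pI[OF W1inf0D(5)[OF assms(1)]] Lp_bounded[OF assms(2,3) _ B(1)] Lp_bounded[OF assms(2,3) _ B(2)]
        W1inf0D[OF assms(1)])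
qed

lemma trace_le_norm: "\<bar>trace (A :: real^'n^'n)\<bar> \<le> real CARD('n) * norm A"
proof -
  have "\<bar>trace A\<bar> \<le> (\<Sum>i\<in>UNIV. \<bar>A $ i $ i\<bar>)" unfolding trace_def by (rule sum_abs)
  also have "\<dots> \<le> (\<Sum>i\<in>(UNIV :: 'n set). norm A)"
    by (intro sum_mono order_trans[OF component_le_norm_cart Finite_Cartesian_Product.norm_nth_le])
  finally show ?thesis by simp
qed

lemma wdiv_Lp:
  assumes w: "weight_on \<omega>" "0 < p" and v: "wgrad \<Omega> v \<in> Lp p \<omega> \<Omega>"
  shows "wdiv \<Omega> v \<in> Lp p \<omega> \<Omega>" "Lp_norm p \<omega> \<Omega> (wdiv \<Omega> v) \<le> real CARD('n) * Lp_norm p \<omega> \<Omega> (wgrad \<Omega> v)"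
proof -
  have "(\<lambda>x. trace (wgrad \<Omega> v x)) \<in> borel_measurable M"
    unfolding trace_def
  proof (rule borel_measurable_sum)
    fix i :: 'n
    have "wgrad \<Omega> v \<in> borel_measurable M" using v by (simp add: Lp_iff)
    then show "(\<lambda>x. wgrad \<Omega> v x $ i $ i) \<in> borel_measurable M"
      by (rule borel_measurable_continuous_on[rotated, where f = "\<lambda>A. A $ i $ i"]) (intro continuous_intros)
  qed
  then have m: "wdiv \<Omega> v \<in> borel_measurable M" by (simp add: wdiv_def[abs_def])
  have "AE x in M. norm (wdiv \<Omega> v x) \<le> real CARD('n) * norm (wgrad \<Omega> v x)"
    by (auto simp: wdiv_def trace_le_norm intro!: AE_I2)
  from Lp_dominated[OF w _ m v this]
  show "wdiv \<Omega> v \<in> Lp p \<omega> \<Omega>" "Lp_norm p \<omega> \<Omega> (wdiv \<Omega> v) \<le> real CARD('n) * Lp_norm p \<omega> \<Omega> (wgrad \<Omega> v)" by auto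
qed

lemma a_form_le:
  assumes p: "1 < p" and w: "weight_on \<omega>" and u: "wgrad \<Omega> u \<in> Lp p \<omega> \<Omega>"
    and v: "wgrad \<Omega> v \<in> Lp (conj_exp p) (dual_weight p \<omega>) \<Omega>"
  shows "\<bar>a_form \<Omega> u v\<bar> \<le> Lp_norm p \<omega> \<Omega> (wgrad \<Omega> u) * Lp_norm (conj_exp p) (dual_weight p \<omega>) \<Omega> (wgrad \<Omega> v)"
  unfolding a_form_eq by (rule Lp_inner_le(2)[OF p w u v])

lemma b_form_le:
  assumes p: "1 < p" and w: "weight_on \<omega>" "weight_on (dual_weight p \<omega>)" and q: "q \<in> Lp p \<omega> \<Omega>"
    and v: "wgrad \<Omega> v \<in> Lp (conj_exp p) (dual_weight p \<omega>) \<Omega>"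
  shows "\<bar>b_form \<Omega> v q\<bar> \<le> real CARD('n) * (Lp_norm p \<omega> \<Omega> q * Lp_norm (conj_exp p) (dual_weight p \<omega>) \<Omega> (wgrad \<Omega> v))"
proof -
  have c0: "0 < conj_exp p" using conj_exp_gt_1[OF p] by simp
  note d = wdiv_Lp[OF w(2) c0 v]
  have "\<bar>b_form \<Omega> v q\<bar> \<le> Lp_norm p \<omega> \<Omega> q * Lp_norm (conj_exp p) (dual_weight p \<omega>) \<Omega> (wdiv \<Omega> v)"
    using Lp_inner_le(2)[OF p w(1) q d(1)] by (simp add: b_form_eq)
  also have "\<dots> \<le> Lp_norm p \<omega> \<Omega> q * (real CARD('n) * Lp_norm (conj_exp p) (dual_weight p \<omega>) \<Omega> (wgrad \<Omega> v))"
    by (intro mult_left_mono d Lp_norm_nonneg)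
  finally show ?thesis by (simp add: mult_ac)
qed

lemma a_form_commute: "a_form \<Omega> u v = a_form \<Omega> v u"
  by (simp add: a_form_def inner_commute)

end

section \<open>Mollification\<close>

lemma lint_reflect:
  fixes f :: "real^'n \<Rightarrow> 'b::euclidean_space"
  assumes f: "f \<in> borel_measurable borel"
  shows "(LINT y|lebesgue. f (c - y)) = (LINT y|lebesgue. f y)"
    and "integrable lebesgue f \<Longrightarrow> integrable lebesgue (\<lambda>y. f (c - y))"
proof -
  have d: "distr lborel borel (\<lambda>y. c - y) = (lborel :: (real^'n) measure)"
    using lborel_affine[of "-1" c] by (simp add: density_1)
  have f': "(\<lambda>y. f (c - y)) \<in> borel_measurable borel"
    using f by (rule measurable_compose[rotated]) measurable
  have "(LINT y|lborel. f (c - y)) = (LINT y|distr lborel borel (\<lambda>y. c - y). f y)"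
    using f by (subst integral_distr) auto
  then show "(LINT y|lebesgue. f (c - y)) = (LINT y|lebesgue. f y)"
    using f f' d by (simp add: integral_completion)
  assume "integrable lebesgue f"
  then have "integrable (distr lborel borel (\<lambda>y. c - y)) f"
    using f d by (simp add: integrable_completion)
  then have "integrable lborel (\<lambda>y. f (c - y))"
    using f by (subst (asm) integrable_distr_eq) auto
  then show "integrable lebesgue (\<lambda>y. f (c - y))" using f' by (simp add: integrable_completion)
qed

lemma Ck_affine:
  fixes f :: "real^'n \<Rightarrow> 'b::real_normed_vector"
  assumes "Ck k f"
  shows "Ck k (\<lambda>x. f (c + s *\<^sub>R x))"
  using assms
proof (induction k arbitrary: f)
  case 0
  then show ?case by (auto intro!: continuous_on_compose2[of UNIV f] continuous_intros)
next
  case (Suc k)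
  have d: "((\<lambda>x. f (c + s *\<^sub>R x)) has_derivative (\<lambda>h. frechet_derivative f (at (c + s *\<^sub>R x)) (s *\<^sub>R h))) (at x)" for x
    by (rule has_derivative_compose[OF _ has_derivative_frechet]) (use Suc.prems in \<open>auto intro!: derivative_eq_intros\<close>)
  have l: "linear (frechet_derivative f (at x))" for x using Suc.prems by (intro linear_frechet_derivative) auto
  have p: "pderivative i (\<lambda>x. f (c + s *\<^sub>R x)) = (\<lambda>x. s *\<^sub>R pderivative i f (c + s *\<^sub>R x))" for i
    by (rule ext, subst pderivative_eq[OF d]) (simp add: pderivative_def linear_scale[OF l])
  have "(\<lambda>x. f (c + s *\<^sub>R x)) differentiable at x" for x using d differentiable_def by blast
  moreover have "Ck k (\<lambda>x. s *\<^sub>R pderivative i f (c + s *\<^sub>R x))" for i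
    using Suc by (intro Ck_scaleR Ck_const) auto
  ultimately show ?case using p by simp
qed

lemma pderivative_affine:
  fixes f :: "real^'n \<Rightarrow> 'b::real_normed_vector"
  assumes "f differentiable at (c + s *\<^sub>R x)"
  shows "pderivative i (\<lambda>x. f (c + s *\<^sub>R x)) x = s *\<^sub>R pderivative i f (c + s *\<^sub>R x)"
proof -
  have d: "((\<lambda>x. f (c + s *\<^sub>R x)) has_derivative (\<lambda>h. frechet_derivative f (at (c + s *\<^sub>R x)) (s *\<^sub>R h))) (at x)"
    by (rule has_derivative_compose[where f = "\<lambda>x. c + s *\<^sub>R x", OF _ has_derivative_frechet[OF assms]])
       (auto intro!: derivative_eq_intros)
  show ?thesis
    by (subst pderivative_eq[OF d]) (simp add: pderivative_def linear_scale[OF linear_frechet_derivative[OF assms]])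
qed

lemma frechet_eq_sum_pderivative:
  assumes "f differentiable at x"
  shows "frechet_derivative f (at x) h = (\<Sum>i\<in>UNIV. (h $ i) *\<^sub>R pderivative i f x)"
proof -
  have l: "linear (frechet_derivative f (at x))" using assms by (rule linear_frechet_derivative)
  have "h = (\<Sum>i\<in>UNIV. (h $ i) *\<^sub>R axis i 1)"
    using basis_expansion[of h] by (simp add: scalar_mult_eq_scaleR)
  then have "frechet_derivative f (at x) h = frechet_derivative f (at x) (\<Sum>i\<in>UNIV. (h $ i) *\<^sub>R axis i 1)" by simp
  also have "\<dots> = (\<Sum>i\<in>UNIV. (h $ i) *\<^sub>R pderivative i f x)"
    by (simp add: linear_sum[OF l] linear_scale[OF l] pderivative_def)
  finally show ?thesis .
qed

definition conv :: "(real^'n \<Rightarrow> real) \<Rightarrow> (real^'n \<Rightarrow> 'b::euclidean_space) \<Rightarrow> real^'n \<Rightarrow> 'b" where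
  "conv \<rho> v x = (LINT y|lebesgue. \<rho> (x - y) *\<^sub>R v y)"

text \<open>The derivative falls on the smooth kernel, so \<open>v\<close> need only be continuous.
  Leibniz's rule for Frechet derivatives wants a continuous map into the bounded linear operators,
  which is why \<open>fx\<close> is built as a \<open>Blinfun\<close> from the partial
  derivatives.\<close>

lemma conv_deriv:
  fixes v :: "real^'n \<Rightarrow> 'b::euclidean_space"
  assumes r: "\<rho> \<in> Cc_infinity UNIV" and v: "continuous_on UNIV v" "compact K" "\<And>x. x \<notin> K \<Longrightarrow> v x = 0"
  shows "conv \<rho> v differentiable at x" and "pderivative i (conv \<rho> v) x = conv (pderivative i \<rho>) v x"
proof -
  obtain a where a: "K \<subseteq> cbox (- a) (a :: real^'n)"
    using bounded_subset_cbox_symmetric[OF compact_imp_bounded[OF v(2)]] by metis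
  have cr: "continuous_on UNIV \<rho>" using r by (rule Cc_infinity_continuous)
  have cp: "continuous_on UNIV (pderivative i \<rho>)" for i
    using r by (intro Cc_infinity_continuous Cc_infinity_pderivative)
  have eq: "conv \<psi> v x = integral (cbox (- a) a) (\<lambda>y. \<psi> (x - y) *\<^sub>R v y)" if c: "continuous_on UNIV \<psi>" for \<psi> x
  proof -
    have c': "continuous_on UNIV (\<lambda>y. \<psi> (x - y) *\<^sub>R v y)"
      by (intro continuous_on_scaleR v(1) continuous_on_compose2[OF c]) (auto intro!: continuous_intros)
    have "integral (cbox (- a) a) (\<lambda>y. \<psi> (x - y) *\<^sub>R v y) = integral UNIV (\<lambda>y. \<psi> (x - y) *\<^sub>R v y)"
      by (subst integral_restrict_UNIV[symmetric], rule arg_cong[of _ _ "integral UNIV"]) (use a v(3) in \<open>auto simp: fun_eq_iff\<close>)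
    also have "\<dots> = (LINT y|lborel. \<psi> (x - y) *\<^sub>R v y)"
      by (intro integral_lborel integrable_compact_support(1)[OF c' v(2)]) (simp add: v(3))
    also have "\<dots> = conv \<psi> v x"
      unfolding conv_def using c' by (subst integral_completion) (auto intro!: borel_measurable_continuous_onI)
    finally show ?thesis by simp
  qed
  define fx where "fx x y = Blinfun (\<lambda>h. (\<Sum>i\<in>UNIV. (h $ i) * pderivative i \<rho> (x - y)) *\<^sub>R v y)" for x y
  have bl: "bounded_linear (\<lambda>h::real^'n. (\<Sum>i\<in>UNIV. (h $ i) * pderivative i \<rho> (x - y)) *\<^sub>R v y)" for x y
    by (intro bounded_linear_scaleR_const bounded_linear_sum bounded_linear_mult_const bounded_linear_vec_nth)
  have fx: "blinfun_apply (fx x y) h = (\<Sum>i\<in>UNIV. (h $ i) * pderivative i \<rho> (x - y)) *\<^sub>R v y" for x y h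
    unfolding fx_def by (simp add: bounded_linear_Blinfun_apply[OF bl])
  have fxa: "blinfun_apply (fx x y) (axis i 1) = pderivative i \<rho> (x - y) *\<^sub>R v y" for x y i
  proof -
    have "(\<Sum>j\<in>UNIV. (axis i 1 :: real^'n) $ j * pderivative j \<rho> (x - y)) = pderivative i \<rho> (x - y)"
      by (simp add: axis_def if_distrib[of "\<lambda>t. t * _"] cong: if_cong)
    then show ?thesis by (simp add: fx)
  qed
  have cfx: "continuous_on (UNIV \<times> cbox (- a) a) (\<lambda>(x, y). fx x y)"
  proof (rule continuous_on_blinfun_componentwise)
    fix h :: "real^'n"
    show "continuous_on (UNIV \<times> cbox (- a) a) (\<lambda>xy. blinfun_apply (case xy of (x, y) \<Rightarrow> fx x y) h)"
      unfolding case_prod_unfold fx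
      by (intro continuous_on_scaleR continuous_on_sum continuous_on_mult continuous_on_const
          continuous_on_compose2[OF v(1)] continuous_on_compose2[OF cp]) (auto intro!: continuous_intros)
  qed
  have "((\<lambda>x. integral (cbox (- a) a) (\<lambda>y. \<rho> (x - y) *\<^sub>R v y)) has_derivative
      integral (cbox (- a) a) (fx x)) (at x within UNIV)"
  proof (rule leibniz_rule[OF _ _ cfx])
    fix x y :: "real^'n"
    have "((\<lambda>x. \<rho> (x - y)) has_derivative (\<lambda>h. frechet_derivative \<rho> (at (x - y)) h)) (at x)"
      by (rule has_derivative_compose[OF _ has_derivative_frechet[OF Cc_infinity_differentiable[OF r]]])
         (auto intro!: derivative_eq_intros)
    then have "((\<lambda>x. \<rho> (x - y) *\<^sub>R v y) has_derivative (\<lambda>h. frechet_derivative \<rho> (at (x - y)) h *\<^sub>R v y)) (at x)"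
      by (rule has_derivative_scaleR_left)
    moreover have "(\<lambda>h. frechet_derivative \<rho> (at (x - y)) h *\<^sub>R v y) = blinfun_apply (fx x y)"
      by (rule ext) (simp add: fx frechet_eq_sum_pderivative[OF Cc_infinity_differentiable[OF r]])
    ultimately show "((\<lambda>x. \<rho> (x - y) *\<^sub>R v y) has_derivative blinfun_apply (fx x y)) (at x within UNIV)" by simp
    show "(\<lambda>y. \<rho> (x - y) *\<^sub>R v y) integrable_on cbox (- a) a"
      by (intro integrable_continuous continuous_on_scaleR continuous_on_subset[OF v(1)] continuous_on_compose2[OF cr])
         (auto intro!: continuous_intros)
  qed auto
  then have d: "(conv \<rho> v has_derivative integral (cbox (- a) a) (fx x)) (at x)"
    by (simp add: eq[OF cr, abs_def])
  show "conv \<rho> v differentiable at x" using d differentiable_def by blast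
  have cfx1: "continuous_on (cbox (- a) a) (fx x)"
  proof -
    have "continuous_on (cbox (- a) a) (\<lambda>y. (x, y))" by (intro continuous_intros)
    from continuous_on_compose2[OF cfx this] show ?thesis by (simp add: image_subset_iff)
  qed
  show "pderivative i (conv \<rho> v) x = conv (pderivative i \<rho>) v x"
    unfolding pderivative_eq[OF d] eq[OF cp]
    by (subst blinfun_apply_integral[OF integrable_continuous[OF cfx1]]) (simp add: fxa)
qed

lemma Ck_conv:
  fixes v :: "real^'n \<Rightarrow> 'b::euclidean_space"
  assumes r: "\<rho> \<in> Cc_infinity UNIV" and v: "continuous_on UNIV v" "compact K" "\<And>x. x \<notin> K \<Longrightarrow> v x = 0"
  shows "Ck k (conv \<rho> v)"
  using r
proof (induction k arbitrary: \<rho>)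
  case 0
  have "continuous_on UNIV (conv \<rho> v)"
    using conv_deriv(1)[OF 0 v] by (auto intro!: continuous_at_imp_continuous_on differentiable_imp_continuous_within)
  then show ?case by simp
next
  case (Suc k)
  have "pderivative i (conv \<rho> v) = conv (pderivative i \<rho>) v" for i
    using conv_deriv(2)[OF Suc.prems v] by (intro ext)
  then show ?case using Suc.IH[OF Cc_infinity_pderivative[OF Suc.prems]] conv_deriv(1)[OF Suc.prems v] by simp
qed

lemma mollifier:
  assumes "0 < e"
  obtains \<rho> :: "real^'n \<Rightarrow> real" where "\<rho> \<in> Cc_infinity UNIV" "\<And>y. 0 \<le> \<rho> y" "\<And>y. e \<le> norm y \<Longrightarrow> \<rho> y = 0"
    "(LINT y|lebesgue. \<rho> y) = 1"
proof -
  \<comment> \<open>On this open cube the l^1 norm, and with it the Euclidean norm, stays below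
    e.\<close>
  define a :: "real^'n" where "a = (\<chi> i. e / real CARD('n))"
  let ?b = "bump (- a) a"
  have z: "?b y = 0" if "y \<notin> cbox (- a) a" for y
    using that bump_pos_iff[of "- a" a y] bump_nonneg[of "- a" a y] box_subset_cbox[of "-a" a] by fastforce
  have cc: "?b \<in> Cc_infinity UNIV" by (rule Cc_infinityI[OF Ck_bump z]) auto
  have supp: "?b y = 0" if "e \<le> norm y" for y
  proof -
    have "y \<notin> box (- a) a"
    proof
      assume "y \<in> box (- a) a"
      then have "\<bar>y $ i\<bar> < e / real CARD('n)" for i by (auto simp: mem_box_cart a_def abs_less_iff minus_less_iff)
      then have "(\<Sum>i\<in>UNIV. \<bar>y $ i\<bar>) < (\<Sum>i\<in>(UNIV::'n set). e / real CARD('n))" by (intro sum_strict_mono) auto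
      then show False using norm_le_l1_cart[of y] that by simp
    qed
    then show ?thesis using bump_pos_iff[of "- a" a y] bump_nonneg[of "- a" a y] by fastforce
  qed
  have i: "integrable lebesgue ?b"
    by (rule integrable_compact_support(2)[OF Cc_infinity_continuous[OF cc] compact_cbox z])
  have ne: "(LINT y|lebesgue. ?b y) \<noteq> 0"
  proof
    assume "(LINT y|lebesgue. ?b y) = 0"
    then have "AE y in lebesgue. ?b y = 0"
      using integral_nonneg_eq_0_iff_AE[OF i] bump_nonneg by auto
    then have "AE y in lebesgue. y \<notin> box (- a) a"
      by eventually_elim (metis bump_pos_iff less_irrefl)
    then have "emeasure lebesgue (box (- a) a) = 0"
      by (subst (asm) AE_iff_measurable[where N = "box (- a) a"]) auto
    then have "negligible (box (- a) a)" by (simp add: negligible_iff_null_sets null_sets_def)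
    then have "box (- a) a = {}" by (simp add: negligible_interval)
    moreover have "0 \<in> box (- a) a" using assms by (auto simp: mem_box_cart a_def)
    ultimately show False by blast
  qed
  then have pos: "0 < (LINT y|lebesgue. ?b y)"
    using bump_nonneg[of "- a" a] by (metis Bochner_Integration.integral_nonneg less_eq_real_def)
  define I where "I = (LINT y|lebesgue. ?b y)"
  show thesis
  proof (rule that[of "\<lambda>y. (1 / I) * ?b y"])
    show "(\<lambda>y. (1 / I) * ?b y) \<in> Cc_infinity UNIV"
      by (rule Cc_infinityI[OF Ck_mult[OF Ck_const Ck_bump], of "cbox (- a) a"]) (auto simp: z)
    show "0 \<le> (1 / I) * ?b y" for y using pos bump_nonneg[of "-a" a y] by (simp add: I_def)
    show "(1 / I) * ?b y = 0" if "e \<le> norm y" for y using supp[OF that] by simp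
    show "(LINT y|lebesgue. (1 / I) * ?b y) = 1" using ne by (simp add: I_def)
  qed
qed

lemma conv_integrable:
  fixes w :: "real^'n \<Rightarrow> 'b::euclidean_space"
  assumes r: "\<rho> \<in> Cc_infinity UNIV" and w: "w \<in> borel_measurable lebesgue" "\<And>y. norm (w y) \<le> B"
  shows "integrable lebesgue (\<lambda>y. \<rho> (c - y) *\<^sub>R w y)" "integrable lebesgue (\<lambda>y. \<rho> (c - y))"
proof -
  have cr: "continuous_on UNIV \<rho>" using r by (rule Cc_infinity_continuous)
  obtain K where K: "compact K" "\<And>x. x \<notin> K \<Longrightarrow> \<rho> x = 0" using Cc_infinityE[OF r] by metis
  have ir: "integrable lebesgue \<rho>" by (rule integrable_compact_support(2)[OF cr K])
  show i: "integrable lebesgue (\<lambda>y. \<rho> (c - y))"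
    using cr by (intro lint_reflect(2) ir borel_measurable_continuous_onI)
  show "integrable lebesgue (\<lambda>y. \<rho> (c - y) *\<^sub>R w y)"
  proof (rule Bochner_Integration.integrable_bound)
    show "integrable lebesgue (\<lambda>y. B * \<rho> (c - y))" using i by simp
    show "(\<lambda>y. \<rho> (c - y) *\<^sub>R w y) \<in> borel_measurable lebesgue"
      by (rule borel_measurable_scaleR[OF borel_measurable_integrable[OF i] w(1)])
    have "0 \<le> B" using w(2)[of 0] norm_ge_zero order_trans by blast
    then show "AE y in lebesgue. norm (\<rho> (c - y) *\<^sub>R w y) \<le> norm (B * \<rho> (c - y))"
      using w(2) by (intro AE_I2) (simp add: abs_mult mult.commute[of B] mult_left_mono)
  qed
qed

text \<open>The convolution is an average with respect to a probability density that sees only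
  points within distance e of c. The centre c and the target z are kept apart because the later
  approximants are evaluated at dilated points.\<close>

lemma conv_close:
  fixes w :: "real^'n \<Rightarrow> 'b::euclidean_space"
  assumes r: "\<rho> \<in> Cc_infinity UNIV" "\<And>y. 0 \<le> \<rho> y" "(LINT y|lebesgue. \<rho> y) = 1" "\<And>y. e \<le> norm y \<Longrightarrow> \<rho> y = 0"
    and w: "w \<in> borel_measurable lebesgue" "\<And>y. norm (w y) \<le> B"
    and near: "\<And>y. norm (c - y) < e \<Longrightarrow> norm (w y - z) \<le> \<eta>"
  shows "norm (conv \<rho> w c - z) \<le> \<eta>"
proof -
  note i = conv_integrable[OF r(1) w, of c]
  have "(LINT y|lebesgue. \<rho> (c - y)) = 1"
    using lint_reflect(1)[of \<rho> c] Cc_infinity_continuous[OF r(1)] r(3) by (simp add: borel_measurable_continuous_onI)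
  then have "conv \<rho> w c - z = (LINT y|lebesgue. \<rho> (c - y) *\<^sub>R w y) - (LINT y|lebesgue. \<rho> (c - y) *\<^sub>R z)"
    using i by (simp add: conv_def)
  also have "\<dots> = (LINT y|lebesgue. \<rho> (c - y) *\<^sub>R (w y - z))"
    using i by (subst Bochner_Integration.integral_diff[symmetric]) (simp_all add: scaleR_diff_right)
  also have "norm \<dots> \<le> (LINT y|lebesgue. \<eta> * \<rho> (c - y))"
  proof (rule Bochner_Integration.integral_norm_bound_integral)
    show "integrable lebesgue (\<lambda>y. \<rho> (c - y) *\<^sub>R (w y - z))" using i by (simp add: scaleR_diff_right)
    show "integrable lebesgue (\<lambda>y. \<eta> * \<rho> (c - y))" using i by simp
    fix y
    show "norm (\<rho> (c - y) *\<^sub>R (w y - z)) \<le> \<eta> * \<rho> (c - y)"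
      using near[of y] r(2)[of "c - y"] r(4)[of "c - y"]
      by (cases "norm (c - y) < e") (auto simp: mult.commute[of \<eta>] intro: mult_left_mono)
  qed
  also have "\<dots> = \<eta>" using \<open>(LINT y|lebesgue. \<rho> (c - y)) = 1\<close> by simp
  finally show ?thesis .
qed

lemma conv_norm_le:
  fixes w :: "real^'n \<Rightarrow> 'b::euclidean_space"
  assumes r: "\<rho> \<in> Cc_infinity UNIV" "\<And>y. 0 \<le> \<rho> y" "(LINT y|lebesgue. \<rho> y) = 1"
    and w: "w \<in> borel_measurable lebesgue" "\<And>y. norm (w y) \<le> B"
  shows "norm (conv \<rho> w c) \<le> B"
proof -
  obtain K where K: "compact K" "\<And>x. x \<notin> K \<Longrightarrow> \<rho> x = 0" using Cc_infinityE[OF r(1)] by metis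
  obtain e where "\<And>x. x \<in> K \<Longrightarrow> norm x \<le> e" using compact_imp_bounded[OF K(1)] unfolding bounded_iff by auto
  then have "\<rho> y = 0" if "e + 1 \<le> norm y" for y using that K(2)[of y] by force
  from conv_close[OF r this w, where c = c and z = 0 and \<eta> = B] w(2) show ?thesis by simp
qed

lemma conv_tendsto:
  fixes w :: "real^'n \<Rightarrow> 'b::euclidean_space"
  assumes r: "\<And>n. \<rho> n \<in> Cc_infinity UNIV" "\<And>n y. 0 \<le> \<rho> n y" "\<And>n. (LINT y|lebesgue. \<rho> n y) = 1"
      "\<And>n y. e n \<le> norm y \<Longrightarrow> \<rho> n y = 0"
    and w: "w \<in> borel_measurable lebesgue" "\<And>y. norm (w y) \<le> B"
    and e: "e \<longlonglongrightarrow> 0" and c: "c \<longlonglongrightarrow> x" and cont: "isCont w x"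
  shows "(\<lambda>n. conv (\<rho> n) w (c n)) \<longlonglongrightarrow> w x"
proof (rule LIMSEQ_I)
  fix \<eta> :: real assume "0 < \<eta>"
  then have h: "0 < \<eta>/2" by simp
  then obtain d where d: "0 < d" "\<And>y. norm (y - x) < d \<Longrightarrow> norm (w y - w x) < \<eta>/2"
    using cont unfolding isCont_def LIM_def dist_norm by (metis (no_types, lifting) cancel_comm_monoid_add_class.diff_cancel norm_zero)
  have "\<forall>\<^sub>F n in sequentially. e n < d/2" using order_tendstoD(2)[OF e, of "d/2"] d(1) by simp
  moreover have "\<forall>\<^sub>F n in sequentially. dist (c n) x < d/2" using tendstoD[OF c, of "d/2"] d(1) by simp
  ultimately have "\<forall>\<^sub>F n in sequentially. norm (conv (\<rho> n) w (c n) - w x) < \<eta>"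
  proof eventually_elim
    case (elim n)
    have "norm (conv (\<rho> n) w (c n) - w x) \<le> \<eta>/2"
    proof (rule conv_close[OF r w])
      fix y assume "norm (c n - y) < e n"
      then have "norm (y - x) < d"
        using elim norm_triangle_ineq[of "y - c n" "c n - x"] by (simp add: dist_norm norm_minus_commute)
      then show "norm (w y - w x) \<le> \<eta>/2" using d(2) by fastforce
    qed
    then show ?case using h by simp
  qed
  then show "\<exists>no. \<forall>n\<ge>no. norm (conv (\<rho> n) w (c n) - w x) < \<eta>"
    by (simp add: eventually_sequentially)
qed

lemma norm_column_le: "norm (column i (A :: real^'n^'n)) \<le> norm A"
proof -
  have "norm (column i A) = L2_set (\<lambda>j. \<bar>A $ j $ i\<bar>) UNIV" by (simp add: norm_vec_def column_def)
  also have "\<dots> \<le> L2_set (\<lambda>j. norm (A $ j)) UNIV" by (intro L2_set_mono component_le_norm_cart) auto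
  finally show ?thesis by (simp add: norm_vec_def)
qed

lemma norm_matrix_le: "norm (A :: real^'n^'n) \<le> (\<Sum>j\<in>UNIV. \<Sum>i\<in>UNIV. \<bar>A $ j $ i\<bar>)"
proof -
  have "norm A \<le> (\<Sum>j\<in>UNIV. norm (A $ j))" by (simp add: norm_vec_def L2_set_le_sum)
  also have "\<dots> \<le> (\<Sum>j\<in>UNIV. \<Sum>i\<in>UNIV. \<bar>A $ j $ i\<bar>)"
    by (intro sum_mono norm_le_l1_cart)
  finally show ?thesis .
qed

section \<open>Approximation by test functions in a convex domain\<close>

context bounded_open begin

lemma Lp_1D:
  assumes "f \<in> Lp 1 (\<lambda>_. 1) \<Omega>"
  shows "integrable M f" "(LINT x|M. norm (f x)) = Lp_norm 1 (\<lambda>_. 1) \<Omega> f"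
  using assms by (auto simp: Lp_iff Lp_norm_eq intro: integrable_norm_cancel)

lemma lint_M_supp:
  fixes f :: "real^'n \<Rightarrow> 'b::euclidean_space"
  assumes "\<And>x. x \<notin> \<Omega> \<Longrightarrow> f x = 0"
  shows "(LINT x|M. f x) = (LINT x|lebesgue. f x)"
proof -
  have "(\<lambda>x. indicator \<Omega> x *\<^sub>R f x) = f" using assms by (auto simp: indicator_def)
  then show ?thesis by (simp add: integral_restrict_space)
qed

lemma Cc_mult_integrable_M:
  fixes f :: "real^'n \<Rightarrow> 'b::euclidean_space"
  assumes t: "\<theta> \<in> Cc_infinity UNIV" and f: "integrable M f"
  shows "integrable M (\<lambda>x. \<theta> x *\<^sub>R f x)"
proof -
  obtain B where B: "0 \<le> B" "\<And>x. norm (\<theta> x) \<le> B" using Cc_infinity_bounded[OF t] by metis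
  show ?thesis
  proof (rule Bochner_Integration.integrable_bound)
    show "integrable M (\<lambda>x. B *\<^sub>R f x)" using f by (rule integrable_scaleR_right)
    show "(\<lambda>x. \<theta> x *\<^sub>R f x) \<in> borel_measurable M"
      by (rule borel_measurable_scaleR[OF measurable_M[OF borel_lebesgue_measurable_Cc[OF t]] borel_measurable_integrable[OF f]])
    show "AE x in M. norm (\<theta> x *\<^sub>R f x) \<le> norm (B *\<^sub>R f x)"
      using B by (intro AE_I2) (auto intro: mult_right_mono)
  qed
qed

lemma integral_Cc_mult_le:
  fixes f :: "real^'n \<Rightarrow> 'b::euclidean_space"
  assumes t: "\<theta> \<in> Cc_infinity UNIV" "\<And>x. norm (\<theta> x) \<le> B" and f: "integrable M f"
  shows "norm (LINT x|M. \<theta> x *\<^sub>R f x) \<le> B * (LINT x|M. norm (f x))"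
proof -
  have "norm (LINT x|M. \<theta> x *\<^sub>R f x) \<le> (LINT x|M. B * norm (f x))"
    using f by (intro Bochner_Integration.integral_norm_bound_integral Cc_mult_integrable_M t(1))
       (auto intro: mult_right_mono t(2)[simplified])
  then show ?thesis by simp
qed

lemma integrable_column:
  fixes G :: "real^'n \<Rightarrow> real^'n^'n"
  assumes "integrable M G"
  shows "integrable M (\<lambda>x. column i (G x))"
  by (rule integrable_bounded_linear[OF bounded_linear_column assms])

text \<open>The identity is exact for the smooth approximants, which vanish near the boundary, and
  both sides are continuous in W^{1,1}. The zero boundary values of \<open>v\<close> are what allows
  a \<theta> whose support is not contained in \<Omega>.\<close>

lemma W1p0_integration_by_parts:
  fixes \<theta> :: "real^'n \<Rightarrow> real"
  assumes v: "v \<in> W1p0 1 (\<lambda>_. 1) \<Omega>" and t: "\<theta> \<in> Cc_infinity UNIV"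
  shows "(LINT x|M. pderivative i \<theta> x *\<^sub>R v x) = - (LINT x|M. \<theta> x *\<^sub>R column i (wgrad \<Omega> v x))"
proof -
  obtain \<phi> where \<phi>: "\<And>n. \<phi> n \<in> Cc_infinity \<Omega>" "(\<lambda>n. W1p_norm 1 (\<lambda>_. 1) \<Omega> (\<lambda>x. \<phi> n x - v x)) \<longlonglongrightarrow> 0"
    using v by (auto simp: W1p0_def)
  have vW: "v \<in> W1p 1 (\<lambda>_. 1) \<Omega>" using v by (rule W1p0_W1p)
  have pW: "\<phi> n \<in> W1p 1 (\<lambda>_. 1) \<Omega>" for n by (rule Cc_W1p[OF \<phi>(1) weight_on_one]) simp
  note t' = Cc_infinity_pderivative[OF t, of i]
  obtain B1 where B1: "0 \<le> B1" "\<And>x. norm (\<theta> x) \<le> B1" using Cc_infinity_bounded[OF t] by metis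
  obtain B2 where B2: "0 \<le> B2" "\<And>x. norm (pderivative i \<theta> x) \<le> B2" using Cc_infinity_bounded[OF t'] by metis
  \<comment> \<open>This defect does not depend on n. Since the identity holds for
    \<open>\<phi> n\<close>, it is minus the defect of \<open>\<phi> n - v\<close>, which is as
    small as the W^{1,1} distance.\<close>
  define E where "E = (LINT x|M. pderivative i \<theta> x *\<^sub>R v x) + (LINT x|M. \<theta> x *\<^sub>R column i (wgrad \<Omega> v x))"
  have bound: "norm E \<le> (B1 + B2) * W1p_norm 1 (\<lambda>_. 1) \<Omega> (\<lambda>x. \<phi> n x - v x)" for n
  proof -
    let ?d = "\<lambda>x. \<phi> n x - v x"
    note dW = W1p_diff[OF weight_on_one order_refl pW[of n] vW]
    note iv = Lp_1D(1)[OF W1pD(2)[OF vW]] and ip = Lp_1D(1)[OF W1pD(2)[OF pW[of n]]]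
    note gv = integrable_column[OF Lp_1D(1)[OF W1pD(3)[OF vW]], of i]
      and gp = integrable_column[OF Lp_1D(1)[OF W1pD(3)[OF pW[of n]]], of i]
    note gd = integrable_column[OF Lp_1D(1)[OF W1pD(3)[OF dW(1)]], of i]
    obtain K where K: "K \<subseteq> \<Omega>" "\<And>x. x \<notin> K \<Longrightarrow> \<phi> n x = 0" "\<And>x i. x \<notin> K \<Longrightarrow> pderivative i (\<phi> n) x = 0"
      using Cc_infinityE[OF \<phi>(1)[of n]] by metis
    have "(LINT x|M. pderivative i \<theta> x *\<^sub>R \<phi> n x) = (LINT x|lebesgue. pderivative i \<theta> x *\<^sub>R \<phi> n x)"
      using K by (intro lint_M_supp) auto
    also have "\<dots> = - (LINT x|lebesgue. \<theta> x *\<^sub>R pderivative i (\<phi> n) x)"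
      by (rule integration_by_parts(3)[OF t Cc_infinity_Ck[OF \<phi>(1)]])
    also have "(LINT x|lebesgue. \<theta> x *\<^sub>R pderivative i (\<phi> n) x) = (LINT x|M. \<theta> x *\<^sub>R pderivative i (\<phi> n) x)"
      using K by (intro lint_M_supp[symmetric]) auto
    also have "\<dots> = (LINT x|M. \<theta> x *\<^sub>R column i (wgrad \<Omega> (\<phi> n) x))"
    proof (rule integral_cong_AE)
      show "(\<lambda>x. \<theta> x *\<^sub>R pderivative i (\<phi> n) x) \<in> borel_measurable M"
        by (intro measurable_M borel_measurable_scaleR borel_lebesgue_measurable_Cc[OF t]
            borel_lebesgue_measurable_Cc[OF Cc_infinity_pderivative[OF \<phi>(1)]])
      show "(\<lambda>x. \<theta> x *\<^sub>R column i (wgrad \<Omega> (\<phi> n) x)) \<in> borel_measurable M"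
        by (rule borel_measurable_integrable[OF Cc_mult_integrable_M[OF t gp]])
      show "AE x in M. \<theta> x *\<^sub>R pderivative i (\<phi> n) x = \<theta> x *\<^sub>R column i (wgrad \<Omega> (\<phi> n) x)"
        using wgrad_eq_AE[OF has_weak_grad_cgrad[OF Cc_infinity_Ck[OF \<phi>(1)[of n]]]]
        by eventually_elim simp
    qed
    finally have p0: "(LINT x|M. pderivative i \<theta> x *\<^sub>R \<phi> n x) + (LINT x|M. \<theta> x *\<^sub>R column i (wgrad \<Omega> (\<phi> n) x)) = 0" by simp
    have e1: "(LINT x|M. pderivative i \<theta> x *\<^sub>R ?d x) = (LINT x|M. pderivative i \<theta> x *\<^sub>R \<phi> n x) - (LINT x|M. pderivative i \<theta> x *\<^sub>R v x)"
      unfolding scaleR_diff_right by (intro Bochner_Integration.integral_diff Cc_mult_integrable_M[OF t'] iv ip)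
    have "(LINT x|M. \<theta> x *\<^sub>R column i (wgrad \<Omega> ?d x)) = (LINT x|M. \<theta> x *\<^sub>R column i (wgrad \<Omega> (\<phi> n) x) - \<theta> x *\<^sub>R column i (wgrad \<Omega> v x))"
    proof (rule integral_cong_AE)
      show "AE x in M. \<theta> x *\<^sub>R column i (wgrad \<Omega> ?d x) = \<theta> x *\<^sub>R column i (wgrad \<Omega> (\<phi> n) x) - \<theta> x *\<^sub>R column i (wgrad \<Omega> v x)"
        using dW(2) by eventually_elim (simp add: linear_diff[OF bounded_linear.linear[OF bounded_linear_column]] scaleR_diff_right)
    qed (intro borel_measurable_integrable Bochner_Integration.integrable_diff Cc_mult_integrable_M[OF t] gd gp gv)+
    also have "\<dots> = (LINT x|M. \<theta> x *\<^sub>R column i (wgrad \<Omega> (\<phi> n) x)) - (LINT x|M. \<theta> x *\<^sub>R column i (wgrad \<Omega> v x))"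
      by (intro Bochner_Integration.integral_diff Cc_mult_integrable_M[OF t] gp gv)
    finally have e2: "(LINT x|M. \<theta> x *\<^sub>R column i (wgrad \<Omega> ?d x)) = (LINT x|M. \<theta> x *\<^sub>R column i (wgrad \<Omega> (\<phi> n) x)) - (LINT x|M. \<theta> x *\<^sub>R column i (wgrad \<Omega> v x))" .
    have "E = - ((LINT x|M. pderivative i \<theta> x *\<^sub>R ?d x) + (LINT x|M. \<theta> x *\<^sub>R column i (wgrad \<Omega> ?d x)))"
      using p0 unfolding e1 e2 E_def by (simp add: algebra_simps)
    then have "norm E = norm ((LINT x|M. pderivative i \<theta> x *\<^sub>R ?d x) + (LINT x|M. \<theta> x *\<^sub>R column i (wgrad \<Omega> ?d x)))"
      by (simp only: norm_minus_cancel)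
    also have "\<dots> \<le> norm (LINT x|M. pderivative i \<theta> x *\<^sub>R ?d x) + norm (LINT x|M. \<theta> x *\<^sub>R column i (wgrad \<Omega> ?d x))"
      by (rule norm_triangle_ineq)
    also have "\<dots> \<le> B2 * (LINT x|M. norm (?d x)) + B1 * (LINT x|M. norm (column i (wgrad \<Omega> ?d x)))"
      by (intro add_mono integral_Cc_mult_le t t' B1 B2 gd Lp_1D(1)[OF W1pD(2)[OF dW(1)]])
    also have "\<dots> \<le> B2 * (LINT x|M. norm (?d x)) + B1 * (LINT x|M. norm (wgrad \<Omega> ?d x))"
      using B1 by (intro add_left_mono mult_left_mono integral_mono integrable_norm gd Lp_1D(1)[OF W1pD(3)[OF dW(1)]] norm_column_le)
    also have "\<dots> \<le> B2 * W1p_norm 1 (\<lambda>_. 1) \<Omega> ?d + B1 * W1p_norm 1 (\<lambda>_. 1) \<Omega> ?d"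
      unfolding Lp_1D(2)[OF W1pD(2)[OF dW(1)]] Lp_1D(2)[OF W1pD(3)[OF dW(1)]]
      using B1 B2 by (intro add_mono mult_left_mono W1p_norm_ge) auto
    finally show ?thesis by (simp add: algebra_simps)
  qed
  have "(\<lambda>n. (B1 + B2) * W1p_norm 1 (\<lambda>_. 1) \<Omega> (\<lambda>x. \<phi> n x - v x)) \<longlonglongrightarrow> (B1 + B2) * 0"
    by (intro tendsto_mult tendsto_const \<phi>(2))
  then have "norm E \<le> (B1 + B2) * 0" by (rule LIMSEQ_le_const) (use bound in auto)
  then have "E = 0" by simp
  then show ?thesis by (simp add: E_def add_eq_0_iff)
qed

text \<open>Dominated convergence with the majorant B^p \<omega>: for uniformly bounded functions
  the integrability of the weight is all that is asked of it.\<close>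

lemma Lp_norm_tendsto_0:
  fixes f :: "nat \<Rightarrow> real^'n \<Rightarrow> 'b::euclidean_space"
  assumes w: "weight_on \<omega>" "0 < p" and f: "\<And>n. f n \<in> borel_measurable M" "\<And>n. AE x in M. norm (f n x) \<le> B"
    and lim: "AE x in M. (\<lambda>n. f n x) \<longlonglongrightarrow> 0"
  shows "(\<lambda>n. Lp_norm p \<omega> \<Omega> (f n)) \<longlonglongrightarrow> 0"
proof -
  have "(\<lambda>n. LINT x|M. norm (f n x) powr p * \<omega> x) \<longlonglongrightarrow> (LINT x|M. 0)"
  proof (rule integral_dominated_convergence)
    show "integrable M (\<lambda>x. max 0 B powr p * \<omega> x)" using weight_onD(3)[OF w(1)] by simp
    show "(\<lambda>x. norm (f n x) powr p * \<omega> x) \<in> borel_measurable M" for n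
      by (rule Lp_integrand_measurable[OF w(1) f(1)])
    show "AE x in M. (\<lambda>n. norm (f n x) powr p * \<omega> x) \<longlonglongrightarrow> 0"
      using lim
    proof eventually_elim
      case (elim x)
      then have "(\<lambda>n. norm (f n x)) \<longlonglongrightarrow> 0" by (rule tendsto_norm_zero)
      then have "(\<lambda>n. norm (f n x) powr p) \<longlonglongrightarrow> 0 powr p"
        using w(2) by (intro tendsto_powr') auto
      then show ?case using w(2) by (auto intro: tendsto_mult_left_zero)
    qed
    show "AE x in M. norm (norm (f n x) powr p * \<omega> x) \<le> max 0 B powr p * \<omega> x" for n
      using f(2)[of n]
    proof eventually_elim
      case (elim x)
      then have "norm (f n x) powr p \<le> max 0 B powr p" using w(2) by (intro powr_mono2) auto
      then show ?case using weight_onD(1)[OF w(1), of x] by (simp add: abs_mult mult_right_mono)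
    qed
  qed auto
  then have "(\<lambda>n. (LINT x|M. norm (f n x) powr p * \<omega> x) powr (1/p)) \<longlonglongrightarrow> 0 powr (1/p)"
    using w(2) weight_onD(1)[OF w(1)]
    by (intro tendsto_powr') (auto intro!: always_eventually Bochner_Integration.integral_nonneg)
  then show ?thesis using w(2) by (simp add: Lp_norm_eq)
qed

text \<open>A proper convex combination of a point of the closure with a point of an interior ball
  is an interior point of a convex set. The set \<open>K\<close> is made to contain the support of a
  dilated and mollified field.\<close>

lemma shrunk_support:
  fixes x0 :: "real^'n"
  assumes cvx: "convex \<Omega>" and x0: "cball x0 r \<subseteq> \<Omega>" and t: "0 < t" "t < 1"
  defines "K \<equiv> (\<lambda>(y, z). t *\<^sub>R y + (1 - t) *\<^sub>R z) ` (closure \<Omega> \<times> cball x0 r)"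
  shows "compact K" "K \<subseteq> \<Omega>"
proof -
  have "compact (closure \<Omega> \<times> cball x0 r)" using bounded_dom by (intro compact_Times) auto
  then show "compact K" unfolding K_def
    by (intro compact_continuous_image) (auto simp: case_prod_unfold intro!: continuous_intros)
  show "K \<subseteq> \<Omega>"
  proof
    fix x assume "x \<in> K"
    then obtain y z where yz: "y \<in> closure \<Omega>" "z \<in> cball x0 r" "x = t *\<^sub>R y + (1 - t) *\<^sub>R z" by (auto simp: K_def)
    have "y - (1 - t) *\<^sub>R (y - z) \<in> interior \<Omega>"
      using yz x0 t open_dom by (intro mem_interior_closure_convex_shrink[OF cvx]) (auto simp: interior_open)
    moreover have "y - (1 - t) *\<^sub>R (y - z) = x" by (simp add: yz(3) algebra_simps)
    ultimately show "x \<in> \<Omega>" using open_dom by (simp add: interior_open)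
  qed
qed

text \<open>Dilating \<open>v\<close> by the factor \<open>s\<close> about an interior point before mollifying keeps the support inside the convex set \<open>\<Omega>\<close>.
  The approximants have uniformly bounded gradients that converge almost everywhere, which is why any weight is admissible.\<close>

lemma mollification_W1p0:
  assumes cvx: "convex \<Omega>" "\<Omega> \<noteq> {}" and v: "continuous_on UNIV v" "\<And>x. x \<notin> \<Omega> \<Longrightarrow> v x = 0" "v \<in> W1inf0 \<Omega>"
    and U: "open U" "AE x in M. x \<in> U" "continuous_on U G" "AE x in M. wgrad \<Omega> v x = G x"
    and w: "weight_on \<omega>" "1 \<le> p"
  shows "v \<in> W1p0 p \<omega> \<Omega>"
proof -
  obtain x0 where "x0 \<in> \<Omega>" using cvx by blast
  then obtain r where r: "0 < r" "cball x0 r \<subseteq> \<Omega>" using open_dom open_contains_cball by blast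
  \<comment> \<open>The dilation factor exceeds 1 by 1/(n+1) and the mollification radius is
    r/(n+1). They are matched, as s (1 - 1/s) = 1/(n+1), so that the gap opened by the dilation
    absorbs the mollification.\<close>
  define s where "s n = 1 + 1 / (real n + 1)" for n :: nat
  define e where "e n = r / (real n + 1)" for n :: nat
  have e0: "0 < e n" for n using r by (simp add: e_def)
  have s1: "1 < s n" "s n \<le> 2" for n by (auto simp: s_def field_simps)
  have "\<exists>\<rho>::real^'n \<Rightarrow> real. \<rho> \<in> Cc_infinity UNIV \<and> (\<forall>y. 0 \<le> \<rho> y) \<and> (\<forall>y. e n \<le> norm y \<longrightarrow> \<rho> y = 0) \<and> (LINT y|lebesgue. \<rho> y) = 1" for n
    using mollifier[OF e0[of n]] by metis
  then obtain \<rho> :: "nat \<Rightarrow> real^'n \<Rightarrow> real" where \<rho>: "\<And>n. \<rho> n \<in> Cc_infinity UNIV" "\<And>n y. 0 \<le> \<rho> n y"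
      "\<And>n y. e n \<le> norm y \<Longrightarrow> \<rho> n y = 0" "\<And>n. (LINT y|lebesgue. \<rho> n y) = 1"
    by metis
  define c where "c n x = (x0 - s n *\<^sub>R x0) + s n *\<^sub>R x" for n x
  define \<phi> where "\<phi> n x = conv (\<rho> n) v (c n x)" for n x
  have K: "compact (closure \<Omega>)" "\<And>x. x \<notin> closure \<Omega> \<Longrightarrow> v x = 0"
    using bounded_dom v(2) closure_subset by (auto)
  note conv_v = conv_deriv[OF _ v(1) K] and Ck_v = Ck_conv[OF _ v(1) K]
  have tend: "c' \<longlonglongrightarrow> x" if "\<And>n. c' n = c n x" for c' x
  proof -
    have "(\<lambda>n. 1 / (real n + 1)) \<longlonglongrightarrow> 0" using LIMSEQ_inverse_real_of_nat by (simp add: inverse_eq_divide add.commute)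
    then have "s \<longlonglongrightarrow> 1 + 0" unfolding s_def[abs_def] by (intro tendsto_add tendsto_const)
    then have "(\<lambda>n. (x0 - s n *\<^sub>R x0) + s n *\<^sub>R x) \<longlonglongrightarrow> (x0 - (1 + 0) *\<^sub>R x0) + (1 + 0) *\<^sub>R x"
      by (intro tendsto_intros)
    moreover have "c' = (\<lambda>n. (x0 - s n *\<^sub>R x0) + s n *\<^sub>R x)" by (rule ext) (simp add: that c_def)
    ultimately show ?thesis by simp
  qed
  have e_lim: "e \<longlonglongrightarrow> 0"
  proof -
    have "(\<lambda>n. r * (1 / (real n + 1))) \<longlonglongrightarrow> r * 0"
      using LIMSEQ_inverse_real_of_nat by (intro tendsto_mult tendsto_const) (simp add: inverse_eq_divide add.commute)
    then show ?thesis by (simp add: e_def[abs_def])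
  qed
  have \<phi>Cc: "\<phi> n \<in> Cc_infinity \<Omega>" for n
  proof -
    let ?t = "1 / s n"
    have t: "0 < ?t" "?t < 1" using s1[of n] by auto
    show ?thesis
    proof (rule Cc_infinityI)
      show "Ck k (\<phi> n)" for k
        unfolding \<phi>_def[abs_def] c_def by (intro Ck_affine Ck_v \<rho>(1))
      show "\<phi> n x = 0" if x: "x \<notin> (\<lambda>(y, z). ?t *\<^sub>R y + (1 - ?t) *\<^sub>R z) ` (closure \<Omega> \<times> cball x0 r)" for x
      proof -
        have "\<rho> n (c n x - y) *\<^sub>R v y = 0" for y
        proof (rule ccontr)
          assume "\<rho> n (c n x - y) *\<^sub>R v y \<noteq> 0"
          then have ne: "\<rho> n (c n x - y) \<noteq> 0" "v y \<noteq> 0" by auto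
          then have y: "y \<in> closure \<Omega>" "norm (c n x - y) < e n" using K(2) \<rho>(3) by (auto simp: not_le[symmetric])
          define w where "w = c n x - y"
          \<comment> \<open>The mollification shift \<open>w\<close>, rescaled to the ball around
            \<open>x0\<close>, so that x becomes the convex combination of y and z with weight 1/s
            on y.\<close>
          define z where "z = x0 + (real n + 1) *\<^sub>R w"
          have "(real n + 1) * norm w < r" using y(2) by (simp add: w_def e_def pos_less_divide_eq mult.commute)
          then have "norm ((real n + 1) *\<^sub>R w) < r" by simp
          then have "z \<in> cball x0 r" by (simp add: z_def dist_norm norm_minus_commute)
          moreover have "x = ?t *\<^sub>R y + (1 - ?t) *\<^sub>R z"
          proof -
            have s0: "s n \<noteq> 0" using s1[of n] by simp
            have st: "s n * (1 - ?t) = 1 / (real n + 1)" using s0 by (simp add: s_def field_simps)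
            have "s n *\<^sub>R x = y + w - (x0 - s n *\<^sub>R x0)" by (simp add: w_def c_def)
            also have "\<dots> = y + ((s n - 1) *\<^sub>R x0 + w)" by (simp add: algebra_simps)
            also have "(s n - 1) *\<^sub>R x0 + w = (1 / (real n + 1)) *\<^sub>R z" by (simp add: z_def s_def scaleR_add_right)
            also have "\<dots> = s n *\<^sub>R ((1 - ?t) *\<^sub>R z)" using st by simp
            also have "y = s n *\<^sub>R (?t *\<^sub>R y)" using s0 by simp
            finally have "s n *\<^sub>R x = s n *\<^sub>R (?t *\<^sub>R y + (1 - ?t) *\<^sub>R z)" by (simp add: scaleR_add_right)
            then show ?thesis using s0 by (metis scaleR_left_imp_eq)
          qed
          ultimately show False using x y(1) by auto
        qed
        then have "(\<lambda>y. \<rho> n (c n x - y) *\<^sub>R v y) = (\<lambda>_. 0)" by (intro ext)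
        then show ?thesis by (simp only: \<phi>_def conv_def) simp
      qed
    qed (use shrunk_support[OF cvx(1) r(2) t] in auto)
  qed
  obtain Bv where Bv: "\<And>y. norm (v y) \<le> Bv"
  proof -
    have "compact (v ` closure \<Omega>)" using K(1) v(1) by (meson compact_continuous_image continuous_on_subset subset_UNIV)
    from compact_imp_bounded[OF this] obtain B where "\<And>y. y \<in> v ` closure \<Omega> \<Longrightarrow> norm y \<le> B" unfolding bounded_iff by auto
    then have "norm (v y) \<le> max 0 B" for y using K(2)[of y] by (cases "y \<in> closure \<Omega>") (auto intro: max.coboundedI2)
    then show thesis by (rule that)
  qed
  have vm: "v \<in> borel_measurable lebesgue" using v(1) by (intro measurable_completion) (auto intro: borel_measurable_continuous_onI)
  obtain Bg where Bg: "AE x in M. norm (wgrad \<Omega> v x) \<le> Bg" using W1inf0D(4)[OF v(3)] by blast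
  \<comment> \<open>On this open set, which has full measure in \<Omega>, G is continuous and
    uniformly bounded. Cutting off its columns outside gives fields that are bounded everywhere and
    continuous at almost every point of \<Omega>.\<close>
  define U' where "U' = U \<inter> \<Omega> \<inter> {x \<in> U. norm (G x) < max 0 Bg + 1}"
  have oU': "open U'"
  proof -
    have "continuous_on U (\<lambda>x. norm (G x))" using U(3) by (intro continuous_intros)
    then have "open (U \<inter> (\<lambda>x. norm (G x)) -` {..<max 0 Bg + 1})" by (rule continuous_open_preimage[OF _ U(1)]) simp
    moreover have "U' = \<Omega> \<inter> (U \<inter> (\<lambda>x. norm (G x)) -` {..<max 0 Bg + 1})" by (auto simp: U'_def)
    ultimately show ?thesis using open_dom by auto
  qed
  have AU': "AE x in M. x \<in> U'"
    using U(2,4) Bg AE_space[of M] by eventually_elim (auto simp: U'_def)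
  define Gi where "Gi i y = (if y \<in> U' then column i (G y) else 0)" for i y
  have Gi_cont: "isCont (Gi i) x" if "x \<in> U'" for i x
  proof -
    have "continuous_on U' (\<lambda>y. column i (G y))"
      using U(3) by (intro continuous_on_compose2[OF linear_continuous_on[OF bounded_linear_column]]) (auto simp: U'_def intro: continuous_on_subset)
    then have "continuous_on U' (Gi i)" by (rule continuous_on_eq) (simp add: Gi_def)
    then show ?thesis using oU' that by (simp add: continuous_on_eq_continuous_at)
  qed
  have Gi_meas: "Gi i \<in> borel_measurable lebesgue" for i
  proof -
    have "continuous_on U' (\<lambda>y. column i (G y))"
      using U(3) by (intro continuous_on_compose2[OF linear_continuous_on[OF bounded_linear_column]]) (auto simp: U'_def intro: continuous_on_subset)
    then have "(\<lambda>y. indicator U' y *\<^sub>R column i (G y)) \<in> borel_measurable borel"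
      using oU' by (intro borel_measurable_continuous_on_indicator) auto
    moreover have "Gi i = (\<lambda>y. indicator U' y *\<^sub>R column i (G y))" by (auto simp: Gi_def indicator_def)
    ultimately show ?thesis by (intro measurable_completion) simp
  qed
  have Gi_bd: "norm (Gi i y) \<le> max 0 Bg + 1" for i y
    using norm_column_le[of i "G y"] by (auto simp: Gi_def U'_def)
  have pd: "pderivative i (\<phi> n) x = s n *\<^sub>R conv (\<rho> n) (Gi i) (c n x)" for i n x
  proof -
    have "pderivative i (\<phi> n) x = s n *\<^sub>R pderivative i (conv (\<rho> n) v) (c n x)"
      unfolding \<phi>_def[abs_def] c_def by (intro pderivative_affine conv_v \<rho>(1))
    also have "pderivative i (conv (\<rho> n) v) (c n x) = conv (pderivative i (\<rho> n)) v (c n x)"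
      by (intro conv_v \<rho>(1))
    also have "\<dots> = conv (\<rho> n) (Gi i) (c n x)"
    proof -
      \<comment> \<open>As a function of y the kernel is a test function on the whole space, in
        general not supported in \<Omega>; moving the derivative onto v therefore uses the zero
        boundary values of v.\<close>
      define \<theta> where "\<theta> y = \<rho> n (c n x + (-1) *\<^sub>R y)" for y
      obtain k where k: "compact k" "\<And>x. x \<notin> k \<Longrightarrow> \<rho> n x = 0" using Cc_infinityE[OF \<rho>(1)[of n]] by metis
      have th: "\<theta> \<in> Cc_infinity UNIV"
      proof (rule Cc_infinityI)
        show "Ck j \<theta>" for j unfolding \<theta>_def[abs_def] by (intro Ck_affine Cc_infinity_Ck[OF \<rho>(1)])
        show "compact ((\<lambda>y. c n x - y) ` k)" by (intro compact_continuous_image continuous_intros k)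
        show "\<theta> y = 0" if "y \<notin> (\<lambda>y. c n x - y) ` k" for y
        proof -
          have "c n x - y \<notin> k" using that by (metis image_eqI diff_diff_eq2 add_diff_cancel_left')
          then show ?thesis using k(2) by (simp add: \<theta>_def)
        qed
      qed auto
      have pt: "pderivative i \<theta> y = - pderivative i (\<rho> n) (c n x - y)" for y
        unfolding \<theta>_def[abs_def] using pderivative_affine[where f = "\<rho> n" and c = "c n x" and s = "-1" and x = y, OF Cc_infinity_differentiable[OF \<rho>(1)], of i] by simp
      have "conv (pderivative i (\<rho> n)) v (c n x) = - (LINT y|M. pderivative i \<theta> y *\<^sub>R v y)"
        unfolding conv_def pt using v(2) by (subst lint_M_supp) auto
      also have "\<dots> = (LINT y|M. \<theta> y *\<^sub>R column i (wgrad \<Omega> v y))"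
        using W1p0_integration_by_parts[OF W1inf0D(6)[OF v(3)] th, of i] by simp
      also have "\<dots> = (LINT y|M. \<theta> y *\<^sub>R Gi i y)"
      proof (rule integral_cong_AE)
        show "AE y in M. \<theta> y *\<^sub>R column i (wgrad \<Omega> v y) = \<theta> y *\<^sub>R Gi i y"
          using AU' U(4) by eventually_elim (simp add: Gi_def)
        show "(\<lambda>y. \<theta> y *\<^sub>R Gi i y) \<in> borel_measurable M"
          by (intro measurable_M borel_measurable_scaleR borel_lebesgue_measurable_Cc[OF th] Gi_meas)
        have "integrable M (wgrad \<Omega> v)" by (intro Lp_1D(1) W1pD(3)[OF W1p0_W1p] W1inf0D(6)[OF v(3)])
        then show "(\<lambda>y. \<theta> y *\<^sub>R column i (wgrad \<Omega> v y)) \<in> borel_measurable M"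
          by (intro borel_measurable_integrable Cc_mult_integrable_M[OF th] integrable_column)
      qed
      also have "\<dots> = (LINT y|lebesgue. \<theta> y *\<^sub>R Gi i y)" by (rule lint_M_supp) (simp add: Gi_def U'_def)
      finally show ?thesis by (simp add: conv_def \<theta>_def)
    qed
    finally show ?thesis .
  qed
  define B where "B = (\<Sum>j\<in>(UNIV::'n set). \<Sum>i\<in>(UNIV::'n set). 2 * (max 0 Bg + 1))"
  have pdn: "norm (pderivative i (\<phi> n) x) \<le> 2 * (max 0 Bg + 1)" for i n x
  proof -
    have "norm (conv (\<rho> n) (Gi i) (c n x)) \<le> max 0 Bg + 1"
      by (rule conv_norm_le[OF \<rho>(1) \<rho>(2) \<rho>(4) Gi_meas Gi_bd])
    then have "s n * norm (conv (\<rho> n) (Gi i) (c n x)) \<le> 2 * (max 0 Bg + 1)"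
      using s1[of n] by (intro mult_mono) auto
    then show ?thesis unfolding pd using s1[of n] by simp
  qed
  have cgn: "norm (cgrad (\<phi> n) x) \<le> B" for n x
  proof -
    have "norm (cgrad (\<phi> n) x) \<le> (\<Sum>j\<in>UNIV. \<Sum>i\<in>UNIV. \<bar>cgrad (\<phi> n) x $ j $ i\<bar>)" by (rule norm_matrix_le)
    also have "\<dots> \<le> B" unfolding B_def
    proof (intro sum_mono)
      fix j i
      have "\<bar>cgrad (\<phi> n) x $ j $ i\<bar> \<le> norm (pderivative i (\<phi> n) x)" by (simp add: cgrad_def component_le_norm_cart)
      then show "\<bar>cgrad (\<phi> n) x $ j $ i\<bar> \<le> 2 * (max 0 Bg + 1)" using pdn[of i n x] by linarith
    qed
    finally show ?thesis .
  qed
  have vW: "v \<in> W1p p \<omega> \<Omega>" using w by (intro W1inf0_W1p[OF v(3)]) auto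
  have \<phi>W: "\<phi> n \<in> W1p p \<omega> \<Omega>" for n using w by (intro Cc_W1p[OF \<phi>Cc]) auto
  have wg\<phi>: "AE x in M. wgrad \<Omega> (\<phi> n) x = cgrad (\<phi> n) x" for n
    by (rule wgrad_eq_AE[OF has_weak_grad_cgrad[OF Cc_infinity_Ck[OF \<phi>Cc]]])
  have wgd: "AE x in M. wgrad \<Omega> (\<lambda>x. \<phi> n x - v x) x = cgrad (\<phi> n) x - G x" for n
    using W1p_diff(2)[OF w \<phi>W[of n] vW] wg\<phi>[of n] U(4) by eventually_elim simp
  have N1: "(\<lambda>n. Lp_norm p \<omega> \<Omega> (\<lambda>x. \<phi> n x - v x)) \<longlonglongrightarrow> 0"
  proof (rule Lp_norm_tendsto_0[OF w(1)])
    show "0 < p" using w by simp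
    show "(\<lambda>x. \<phi> n x - v x) \<in> borel_measurable M" for n
      by (intro measurable_M borel_measurable_diff vm borel_lebesgue_measurable_Cc[OF \<phi>Cc])
    show "AE x in M. norm (\<phi> n x - v x) \<le> Bv + Bv" for n
    proof (rule AE_I2)
      fix x
      have "norm (\<phi> n x) \<le> Bv" unfolding \<phi>_def by (rule conv_norm_le[OF \<rho>(1) \<rho>(2) \<rho>(4) vm Bv])
      then show "norm (\<phi> n x - v x) \<le> Bv + Bv" using Bv[of x] norm_triangle_ineq4[of "\<phi> n x" "v x"] by linarith
    qed
    show "AE x in M. (\<lambda>n. \<phi> n x - v x) \<longlonglongrightarrow> 0"
    proof (rule AE_I2)
      fix x
      have "(\<lambda>n. conv (\<rho> n) v (c n x)) \<longlonglongrightarrow> v x"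
        using v(1) by (intro conv_tendsto[OF \<rho>(1) \<rho>(2) \<rho>(4) \<rho>(3) vm Bv e_lim tend]) (auto simp: continuous_on_eq_continuous_at)
      then show "(\<lambda>n. \<phi> n x - v x) \<longlonglongrightarrow> 0" unfolding \<phi>_def by (rule LIM_zero)
    qed
  qed
  have N2: "(\<lambda>n. Lp_norm p \<omega> \<Omega> (wgrad \<Omega> (\<lambda>x. \<phi> n x - v x))) \<longlonglongrightarrow> 0"
  proof (rule Lp_norm_tendsto_0[OF w(1)])
    show "0 < p" using w by simp
    show "wgrad \<Omega> (\<lambda>x. \<phi> n x - v x) \<in> borel_measurable M" for n
      by (rule wgrad_measurable[OF W1pD(1)[OF W1p_diff(1)[OF w \<phi>W vW]]])
    show "AE x in M. norm (wgrad \<Omega> (\<lambda>x. \<phi> n x - v x) x) \<le> B + (max 0 Bg + 1)" for n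
      using wgd[of n] AU'
    proof eventually_elim
      case (elim x)
      then have "norm (G x) \<le> max 0 Bg + 1" by (simp add: U'_def)
      then show ?case using elim cgn[of n x] norm_triangle_ineq4[of "cgrad (\<phi> n) x" "G x"] by simp
    qed
    have "AE x in M. \<forall>n. wgrad \<Omega> (\<lambda>x. \<phi> n x - v x) x = cgrad (\<phi> n) x - G x"
      using wgd by (simp add: AE_all_countable)
    then show "AE x in M. (\<lambda>n. wgrad \<Omega> (\<lambda>x. \<phi> n x - v x) x) \<longlonglongrightarrow> 0"
      using AU'
    proof eventually_elim
      case (elim x)
      have cp: "(\<lambda>n. pderivative i (\<phi> n) x) \<longlonglongrightarrow> column i (G x)" for i
      proof -
        have "(\<lambda>n. 1 / (real n + 1)) \<longlonglongrightarrow> 0" using LIMSEQ_inverse_real_of_nat by (simp add: inverse_eq_divide add.commute)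
        then have "s \<longlonglongrightarrow> 1 + 0" unfolding s_def[abs_def] by (intro tendsto_add tendsto_const)
        then have "(\<lambda>n. s n *\<^sub>R conv (\<rho> n) (Gi i) (c n x)) \<longlonglongrightarrow> (1 + 0) *\<^sub>R Gi i x"
          by (intro tendsto_scaleR conv_tendsto[OF \<rho>(1) \<rho>(2) \<rho>(4) \<rho>(3) Gi_meas Gi_bd e_lim tend] Gi_cont) (use elim in auto)
        then show ?thesis unfolding pd using elim by (simp add: Gi_def)
      qed
      have "(\<lambda>n. cgrad (\<phi> n) x) \<longlonglongrightarrow> G x"
      proof (intro vec_tendstoI)
        fix j i
        have "(\<lambda>n. pderivative i (\<phi> n) x $ j) \<longlonglongrightarrow> column i (G x) $ j" by (intro tendsto_vec_nth cp)
        then show "(\<lambda>n. cgrad (\<phi> n) x $ j $ i) \<longlonglongrightarrow> G x $ j $ i" by (simp add: cgrad_def column_def)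
      qed
      then have "(\<lambda>n. cgrad (\<phi> n) x - G x) \<longlonglongrightarrow> 0" by (rule LIM_zero)
      then show ?case using elim by simp
    qed
  qed
  have "(\<lambda>n. W1p_norm p \<omega> \<Omega> (\<lambda>x. \<phi> n x - v x)) \<longlonglongrightarrow> 0"
  proof (rule real_tendsto_sandwich[OF _ _ tendsto_const])
    let ?A = "\<lambda>n. Lp_norm p \<omega> \<Omega> (\<lambda>x. \<phi> n x - v x) + Lp_norm p \<omega> \<Omega> (wgrad \<Omega> (\<lambda>x. \<phi> n x - v x))"
    show "(\<lambda>n. 2 * ?A n) \<longlonglongrightarrow> 0" using tendsto_mult[OF tendsto_const[of 2] tendsto_add[OF N1 N2]] by simp
    show "\<forall>\<^sub>F n in sequentially. W1p_norm p \<omega> \<Omega> (\<lambda>x. \<phi> n x - v x) \<le> 2 * ?A n"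
      by (intro always_eventually allI W1p_norm_le w) (auto simp: Lp_norm_nonneg)
    show "\<forall>\<^sub>F n in sequentially. 0 \<le> W1p_norm p \<omega> \<Omega> (\<lambda>x. \<phi> n x - v x)" by (simp add: W1p_norm_nonneg)
  qed
  then show ?thesis using vW \<phi>Cc by (auto simp: W1p0_def)
qed

end

section \<open>The discrete Stokes problem\<close>

lemma function_subspaceD:
  assumes "function_subspace V"
  shows "(\<lambda>x. 0) \<in> V" "f \<in> V \<Longrightarrow> g \<in> V \<Longrightarrow> (\<lambda>x. f x + g x) \<in> V" "f \<in> V \<Longrightarrow> (\<lambda>x. c *\<^sub>R f x) \<in> V"
  using assms by (simp_all add: function_subspace_def)

text \<open>Induction on the functionals: if the new one does not vanish on V, a normalised element
  \<open>v0\<close> is split off and the hypothesis is applied to its kernel. Instead of a basis one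
  gets a spanning set up to a remainder invisible to the functionals, which suits functions that
  matter only almost everywhere.\<close>

lemma finite_dim_modulo:
  fixes V :: "('a \<Rightarrow> 'b::real_vector) set"
  assumes "finite I" and "function_subspace V"
    and "\<And>i f g. i \<in> I \<Longrightarrow> f \<in> V \<Longrightarrow> g \<in> V \<Longrightarrow> L i (\<lambda>x. f x + g x) = L i f + (L i g :: real)"
    and "\<And>i c f. i \<in> I \<Longrightarrow> f \<in> V \<Longrightarrow> L i (\<lambda>x. c *\<^sub>R f x) = c * L i f"
  shows "\<exists>(e :: nat \<Rightarrow> 'a \<Rightarrow> 'b) N. (\<forall>j<N. e j \<in> V) \<and>
    (\<forall>v\<in>V. \<exists>c. \<exists>z\<in>V. (\<forall>i\<in>I. L i z = 0) \<and> v = (\<lambda>y. (\<Sum>j<N. c j *\<^sub>R e j y) + z y))"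
  using assms
proof (induction I arbitrary: V rule: finite_induct)
  case empty
  show ?case by (rule exI, rule exI[of _ 0]) auto
next
  case (insert i I)
  show ?case
  proof (cases "\<forall>v\<in>V. L i v = 0")
    case True
    have "\<exists>(e :: nat \<Rightarrow> 'a \<Rightarrow> 'b) N. (\<forall>j<N. e j \<in> V) \<and>
      (\<forall>v\<in>V. \<exists>c. \<exists>z\<in>V. (\<forall>i\<in>I. L i z = 0) \<and> v = (\<lambda>y. (\<Sum>j<N. c j *\<^sub>R e j y) + z y))"
      by (rule insert.IH[OF insert.prems(1)]) (use insert.prems(2,3) in auto)
    then obtain e :: "nat \<Rightarrow> 'a \<Rightarrow> 'b" and N where e: "\<forall>j<N. e j \<in> V"
      "\<forall>v\<in>V. \<exists>c. \<exists>z\<in>V. (\<forall>i\<in>I. L i z = 0) \<and> v = (\<lambda>y. (\<Sum>j<N. c j *\<^sub>R e j y) + z y)"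
      by (elim exE conjE)
    have "\<exists>c. \<exists>z\<in>V. (\<forall>i\<in>insert i I. L i z = 0) \<and> v = (\<lambda>y. (\<Sum>j<N. c j *\<^sub>R e j y) + z y)" if v: "v \<in> V" for v
    proof -
      from bspec[OF e(2) v] obtain c z where z: "z \<in> V" "\<forall>i\<in>I. L i z = 0" "v = (\<lambda>y. (\<Sum>j<N. c j *\<^sub>R e j y) + z y)"
        by (elim exE bexE conjE)
      show ?thesis by (rule exI[of _ c], rule bexI[OF _ z(1)]) (use z True in auto)
    qed
    then show ?thesis using e(1) by (intro exI[of _ e] exI[of _ N]) simp
  next
    case False
    then obtain u where u: "u \<in> V" "L i u \<noteq> 0" by blast
    define v0 where "v0 = (\<lambda>x. (1 / L i u) *\<^sub>R u x)"
    have sub: "\<And>f g. f \<in> V \<Longrightarrow> g \<in> V \<Longrightarrow> (\<lambda>x. f x + g x) \<in> V" "\<And>c f. f \<in> V \<Longrightarrow> (\<lambda>x. c *\<^sub>R f x) \<in> V"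
      "(\<lambda>x. 0) \<in> V"
      by (rule function_subspaceD[OF insert.prems(1)]; assumption)+
    have v0: "v0 \<in> V" "L i v0 = 1"
      unfolding v0_def using u sub(2)[OF u(1), of "1 / L i u"] insert.prems(3)[of i u "1 / L i u"] by simp_all
    define V1 where "V1 = {v \<in> V. L i v = 0}"
    have L0: "L i (\<lambda>x. 0) = 0" using insert.prems(3)[of i "\<lambda>x. 0" 0] sub(3) by simp
    have "function_subspace V1"
      unfolding function_subspace_def V1_def using sub insert.prems(2,3)[of i] L0 by auto
    moreover have "\<And>i f g. i \<in> I \<Longrightarrow> f \<in> V1 \<Longrightarrow> g \<in> V1 \<Longrightarrow> L i (\<lambda>x. f x + g x) = L i f + (L i g :: real)"
      "\<And>i c f. i \<in> I \<Longrightarrow> f \<in> V1 \<Longrightarrow> L i (\<lambda>x. c *\<^sub>R f x) = c * L i f"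
      using insert.prems(2,3) by (auto simp: V1_def)
    ultimately have "\<exists>(e :: nat \<Rightarrow> 'a \<Rightarrow> 'b) N. (\<forall>j<N. e j \<in> V1) \<and>
      (\<forall>v\<in>V1. \<exists>c. \<exists>z\<in>V1. (\<forall>i\<in>I. L i z = 0) \<and> v = (\<lambda>y. (\<Sum>j<N. c j *\<^sub>R e j y) + z y))"
      by (rule insert.IH)
    then obtain e :: "nat \<Rightarrow> 'a \<Rightarrow> 'b" and N where e: "\<forall>j<N. e j \<in> V1"
      "\<forall>v\<in>V1. \<exists>c. \<exists>z\<in>V1. (\<forall>i\<in>I. L i z = 0) \<and> v = (\<lambda>y. (\<Sum>j<N. c j *\<^sub>R e j y) + z y)"
      by (elim exE conjE)
    define e' where "e' = e(N := v0)"
    have "\<exists>c. \<exists>z\<in>V. (\<forall>i\<in>insert i I. L i z = 0) \<and> v = (\<lambda>y. (\<Sum>j<Suc N. c j *\<^sub>R e' j y) + z y)" if v: "v \<in> V" for v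
    proof -
      define v1 where "v1 = (\<lambda>x. v x + (- L i v) *\<^sub>R v0 x)"
      have "(\<lambda>x. (- L i v) *\<^sub>R v0 x) \<in> V" by (rule sub(2)[OF v0(1)])
      then have "v1 \<in> V" unfolding v1_def by (rule sub(1)[OF v])
      moreover have "L i v1 = 0"
        unfolding v1_def using insert.prems(2)[of i v "\<lambda>x. (- L i v) *\<^sub>R v0 x"] insert.prems(3)[of i v0 "- L i v"] sub(2)[OF v0(1), of "- L i v"] v v0
        by simp
      ultimately have "v1 \<in> V1" by (simp add: V1_def)
      then obtain c z where z: "z \<in> V1" "\<forall>i\<in>I. L i z = 0" "v1 = (\<lambda>y. (\<Sum>j<N. c j *\<^sub>R e j y) + z y)"
        using e(2) by blast
      have "v y = (\<Sum>j<Suc N. (c(N := L i v)) j *\<^sub>R e' j y) + z y" for y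
        using fun_cong[OF z(3), of y] by (simp add: v1_def e'_def algebra_simps)
      then show ?thesis using z by (intro exI[of _ "c(N := L i v)"] bexI[of _ z]) (auto simp: V1_def)
    qed
    moreover have "\<forall>j<Suc N. e' j \<in> V" using e(1) v0 by (auto simp: e'_def V1_def less_Suc_eq)
    ultimately show ?thesis by blast
  qed
qed

text \<open>Gaussian elimination of the last coordinate. This is the alternative behind the
  solvability of linear systems, a separating linear form taking the place of a dimension
  count.\<close>

lemma subspace_alternative:
  fixes K :: "(nat \<Rightarrow> real) set"
  assumes "function_subspace K"
  shows "(\<exists>k\<in>K. \<forall>i<N. k i = l i) \<or> (\<exists>x. (\<forall>k\<in>K. (\<Sum>i<N. x i * k i) = 0) \<and> (\<Sum>i<N. x i * l i) \<noteq> 0)"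
  using assms
proof (induction N arbitrary: K l)
  case 0
  then show ?case by (auto simp: function_subspace_def)
next
  case (Suc N)
  have sub: "\<And>f g. f \<in> K \<Longrightarrow> g \<in> K \<Longrightarrow> (\<lambda>x. f x + g x) \<in> K" "\<And>c f. f \<in> K \<Longrightarrow> (\<lambda>x. c * f x) \<in> K"
    "(\<lambda>x. 0) \<in> K"
    using Suc.prems by (auto simp: function_subspace_def)
  show ?case
  proof (cases "\<forall>k\<in>K. k N = 0")
    case True
    show ?thesis
    proof (cases "l N = 0")
      case False
      then show ?thesis using True by (intro disjI2 exI[of _ "\<lambda>i. if i = N then 1 else 0"]) auto
    next
      case l: True
      from Suc.IH[OF Suc.prems, of l] show ?thesis
      proof
        assume "\<exists>k\<in>K. \<forall>i<N. k i = l i"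
        then show ?thesis using True l by (metis less_Suc_eq)
      next
        assume "\<exists>x. (\<forall>k\<in>K. (\<Sum>i<N. x i * k i) = 0) \<and> (\<Sum>i<N. x i * l i) \<noteq> 0"
        then obtain x where "\<forall>k\<in>K. (\<Sum>i<N. x i * k i) = 0" "(\<Sum>i<N. x i * l i) \<noteq> 0" by blast
        then show ?thesis using True l by (intro disjI2 exI[of _ x]) simp
      qed
    qed
  next
    case False
    then obtain k where k: "k \<in> K" "k N \<noteq> 0" by blast
    define k0 where "k0 = (\<lambda>i. (1 / k N) * k i)"
    have k0: "k0 \<in> K" "k0 N = 1" using k sub(2)[OF k(1), of "1 / k N"] by (auto simp: k0_def)
    define K1 where "K1 = {k \<in> K. k N = 0}"
    define l1 where "l1 i = l i - l N * k0 i" for i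
    have "function_subspace K1" using sub by (auto simp: function_subspace_def K1_def)
    from Suc.IH[OF this, of l1] show ?thesis
    proof
      assume "\<exists>k\<in>K1. \<forall>i<N. k i = l1 i"
      then obtain k1 where k1: "k1 \<in> K" "k1 N = 0" "\<forall>i<N. k1 i = l1 i" by (auto simp: K1_def)
      have "(\<lambda>i. k1 i + l N * k0 i) \<in> K" by (intro sub k1 k0)
      moreover have "\<forall>i<Suc N. k1 i + l N * k0 i = l i" using k1 k0 by (auto simp: l1_def less_Suc_eq)
      ultimately show ?thesis by (intro disjI1 bexI[of _ "\<lambda>i. k1 i + l N * k0 i"])
    next
      assume "\<exists>x. (\<forall>k\<in>K1. (\<Sum>i<N. x i * k i) = 0) \<and> (\<Sum>i<N. x i * l1 i) \<noteq> 0"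
      then obtain x where x: "\<And>k. k \<in> K1 \<Longrightarrow> (\<Sum>i<N. x i * k i) = 0" "(\<Sum>i<N. x i * l1 i) \<noteq> 0" by auto
      define s where "s = (\<Sum>i<N. x i * k0 i)"
      \<comment> \<open>The new last coefficient is chosen so that the form annihilates
        \<open>k0\<close>, which complements \<open>K1\<close> in K.\<close>
      define x' where "x' = x(N := - s)"
      have "(\<Sum>i<Suc N. x' i * k i) = 0" if "k \<in> K" for k
      proof -
        have "(\<lambda>i. k i + (- k N) * k0 i) \<in> K" by (intro sub that k0)
        then have "(\<lambda>i. k i + (- k N) * k0 i) \<in> K1" using k0 by (simp add: K1_def)
        from x(1)[OF this] have "(\<Sum>i<N. x i * k i) = k N * s"
          by (simp add: s_def algebra_simps sum.distrib sum_distrib_left sum_subtractf)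
        then show ?thesis by (simp add: x'_def)
      qed
      moreover have "(\<Sum>i<Suc N. x' i * l i) = (\<Sum>i<N. x i * l1 i)"
        by (simp add: x'_def l1_def s_def algebra_simps sum.distrib sum_distrib_left sum_subtractf)
      ultimately show ?thesis using x(2) by (intro disjI2 exI[of _ x']) auto
    qed
  qed
qed

lemma function_subspace_sum:
  assumes "function_subspace V" "\<And>j. j < N \<Longrightarrow> e j \<in> V"
  shows "(\<lambda>y. \<Sum>j<(N::nat). c j *\<^sub>R e j y) \<in> V"
  using assms(2)
proof (induction N)
  case 0
  then show ?case using assms(1) by (simp add: function_subspace_def)
next
  case (Suc N)
  have "(\<lambda>y. \<Sum>j<N. c j *\<^sub>R e j y) \<in> V" using Suc by simp
  moreover have "(\<lambda>y. c N *\<^sub>R e N y) \<in> V" using assms(1) Suc.prems by (simp add: function_subspace_def)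
  ultimately have "(\<lambda>y. (\<Sum>j<N. c j *\<^sub>R e j y) + c N *\<^sub>R e N y) \<in> V"
    by (rule function_subspaceD(2)[OF assms(1)])
  then show ?case by simp
qed

lemma linear_functional_sum:
  fixes F :: "('a \<Rightarrow> 'b::real_vector) \<Rightarrow> real"
  assumes V: "function_subspace V" and e: "\<And>j. j < N \<Longrightarrow> e j \<in> V"
    and add: "\<And>f g. f \<in> V \<Longrightarrow> g \<in> V \<Longrightarrow> F (\<lambda>x. f x + g x) = F f + F g"
    and scale: "\<And>c f. f \<in> V \<Longrightarrow> F (\<lambda>x. c *\<^sub>R f x) = c * F f"
  shows "F (\<lambda>y. \<Sum>j<(N::nat). c j *\<^sub>R e j y) = (\<Sum>j<N. c j * F (e j))"
  using e
proof (induction N)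
  case 0
  have "(\<lambda>x. 0) \<in> V" using V by (simp add: function_subspace_def)
  from scale[OF this, of 0] show ?case by simp
next
  case (Suc N)
  have 1: "(\<lambda>y. \<Sum>j<N. c j *\<^sub>R e j y) \<in> V" using Suc.prems by (intro function_subspace_sum[OF V]) auto
  have 2: "(\<lambda>y. c N *\<^sub>R e N y) \<in> V" using V Suc.prems by (simp add: function_subspace_def)
  show ?case using add[OF 1 2] Suc scale[of "e N" "c N"] by simp
qed

lemma Ck_sum:
  "(\<And>i. i \<in> I \<Longrightarrow> Ck k (f i)) \<Longrightarrow> Ck k (\<lambda>x::real^'n. \<Sum>i\<in>I. f i x)"
proof (induction I rule: infinite_finite_induct)
  case (insert i I)
  then show ?case by (auto intro!: Ck_add)
qed auto

lemma Ck_power: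
  fixes f :: "real^'n \<Rightarrow> real"
  shows "Ck k f \<Longrightarrow> Ck k (\<lambda>x. f x ^ m)"
  by (induction m) (auto intro: Ck_mult)

lemma Ck_poly: "poly_degree_le m (g :: real^'n \<Rightarrow> 'b::real_normed_vector) \<Longrightarrow> Ck k g"
proof -
  assume "poly_degree_le m g"
  then obtain c where c: "g = (\<lambda>x. \<Sum>\<alpha> | sum \<alpha> UNIV \<le> m. (\<Prod>i\<in>UNIV. (x $ i) ^ \<alpha> i) *\<^sub>R c \<alpha>)"
    by (auto simp: poly_degree_le_def)
  show ?thesis unfolding c
    by (intro Ck_sum Ck_scaleR Ck_prod Ck_power Ck_linear bounded_linear_vec_nth Ck_const) auto
qed

lemma finite_multiindices: "finite {\<alpha> :: 'n::finite \<Rightarrow> nat. sum \<alpha> UNIV \<le> k}"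
proof (rule finite_subset)
  show "{\<alpha> :: 'n \<Rightarrow> nat. sum \<alpha> UNIV \<le> k} \<subseteq> {\<alpha>. range \<alpha> \<subseteq> {..k}}"
  proof safe
    fix \<alpha> :: "'n \<Rightarrow> nat" and i
    assume "sum \<alpha> UNIV \<le> k"
    then show "\<alpha> i \<le> k" using member_le_sum[of i UNIV \<alpha>] by simp
  qed
  show "finite {\<alpha> :: 'n \<Rightarrow> nat. range \<alpha> \<subseteq> {..k}}"
    using finite_set_of_finite_funs[of "UNIV :: 'n set" "{..k}" 0] by (auto simp: image_subset_iff elim: finite_subset[rotated])
qed

section \<open>Meshes of a convex domain\<close>

locale convex_dom = bounded_open +
  assumes convex_dom: "convex \<Omega>" and nonempty_dom: "\<Omega> \<noteq> {}"

locale mesh = convex_dom +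
  fixes \<T> :: "(real^'a) set set"
  assumes mesh: "conforming_mesh \<Omega> \<T>"
begin

lemma finite_mesh: "finite \<T>"
  using mesh by (auto simp: conforming_mesh_def triangulation_def)

lemma element_simplex: "T \<in> \<T> \<Longrightarrow> int CARD('a) simplex T"
  using mesh by (auto simp: conforming_mesh_def)

lemma element_compact: "T \<in> \<T> \<Longrightarrow> compact T"
  using element_simplex compact_simplex by blast

lemma element_convex: "T \<in> \<T> \<Longrightarrow> convex T"
  using element_simplex convex_simplex by blast

lemma mesh_cover: "\<Union>\<T> = closure \<Omega>"
  using mesh by (simp add: conforming_mesh_def)

text \<open>An open convex set is the interior of its closure, so the elements, which cover that
  closure, have no interior points outside \<Omega>.\<close>

lemma element_interior: "T \<in> \<T> \<Longrightarrow> interior T \<subseteq> \<Omega>"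
proof -
  assume "T \<in> \<T>"
  then have "T \<subseteq> closure \<Omega>" using mesh_cover by blast
  then have "interior T \<subseteq> interior (closure \<Omega>)" by (rule interior_mono)
  then show ?thesis using convex_dom open_dom by (simp add: convex_interior_closure interior_open)
qed

lemma AE_frontier:
  assumes "T \<in> \<T>"
  shows "AE x in lebesgue. x \<notin> frontier T"
  using negligible_convex_frontier[OF element_convex[OF assms]]
  by (intro AE_not_in) (simp add: negligible_iff_null_sets)

lemma AE_interior: "AE x in M. x \<in> (\<Union>T\<in>\<T>. interior T)"
proof -
  have "AE x in lebesgue. \<forall>T\<in>\<T>. x \<notin> frontier T"
    using finite_mesh AE_frontier by (intro AE_finite_allI) auto
  then have "AE x in lebesgue. x \<in> \<Omega> \<longrightarrow> x \<in> (\<Union>T\<in>\<T>. interior T)"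
  proof eventually_elim
    case (elim x)
    show ?case
    proof
      assume "x \<in> \<Omega>"
      then obtain T where T: "T \<in> \<T>" "x \<in> T" using mesh_cover closure_subset by blast
      then have "x \<in> interior T"
        using elim element_compact[OF T(1)] by (auto simp: frontier_def compact_imp_closed)
      then show "x \<in> (\<Union>T\<in>\<T>. interior T)" using T by blast
    qed
  qed
  then show ?thesis by (simp add: AE_M_iff)
qed

lemma AE_M_interiorI:
  assumes "\<And>T. T \<in> \<T> \<Longrightarrow> AE x\<in>interior T in lebesgue. P x"
  shows "AE x in M. P x"
proof -
  have "AE x in lebesgue. \<forall>T\<in>\<T>. x \<in> interior T \<longrightarrow> P x"
    using finite_mesh assms by (intro AE_finite_allI) auto
  moreover have "AE x in lebesgue. x \<in> \<Omega> \<longrightarrow> x \<in> (\<Union>T\<in>\<T>. interior T)"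
    using AE_interior by (simp add: AE_M_iff)
  ultimately have "AE x\<in>\<Omega> in lebesgue. P x" by eventually_elim blast
  then show ?thesis by (simp add: AE_M_iff)
qed

text \<open>Weak gradients are local: inside an element the restriction is a weak gradient of a
  polynomial and so agrees with the classical one by uniqueness. The element boundaries are
  null.\<close>

lemma piecewise_poly_cgrad:
  fixes v :: "real^'a \<Rightarrow> real^'a"
  assumes v: "piecewise_poly k \<T> v" "continuous_on UNIV v" and wg: "has_weak_grad \<Omega> v G"
  shows "continuous_on (\<Union>T\<in>\<T>. interior T) (cgrad v)" "AE x in M. wgrad \<Omega> v x = cgrad v x"
proof -
  have loc: "\<exists>g. (\<forall>k. Ck k g) \<and> (\<forall>x\<in>interior T. v x = g x \<and> cgrad v x = cgrad g x)" if T: "T \<in> \<T>" for T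
  proof -
    obtain g where g: "poly_degree_le k g" "\<And>x. x \<in> interior T \<Longrightarrow> v x = g x"
      using v(1) T unfolding piecewise_poly_def by blast
    have "pderivative i v x = pderivative i g x" if "x \<in> interior T" for i x
    proof -
      have gd: "g differentiable at x" using Ck_poly[OF g(1), of "Suc 0"] by simp
      have "(v has_derivative frechet_derivative g (at x)) (at x)"
        by (rule has_derivative_transform_within_open[OF has_derivative_frechet[OF gd] open_interior that]) (simp add: g(2))
      from pderivative_eq[OF this] show ?thesis by (simp add: pderivative_def)
    qed
    then show ?thesis using g Ck_poly[OF g(1)] by (intro exI[of _ g]) (auto simp: cgrad_def)
  qed
  show "continuous_on (\<Union>T\<in>\<T>. interior T) (cgrad v)"
  proof (rule continuous_on_open_UN)
    fix T assume "T \<in> \<T>"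
    then obtain g where g: "\<And>k. Ck k g" "\<And>x. x \<in> interior T \<Longrightarrow> cgrad v x = cgrad g x" using loc by blast
    have "continuous_on (interior T) (cgrad g)" using continuous_cgrad[OF g(1)] continuous_on_subset by blast
    then show "continuous_on (interior T) (cgrad v)" by (rule continuous_on_eq) (simp add: g(2))
  qed auto
  show "AE x in M. wgrad \<Omega> v x = cgrad v x"
  proof (rule AE_M_interiorI)
    fix T assume T: "T \<in> \<T>"
    then obtain g where g: "\<And>k. Ck k g" "\<And>x. x \<in> interior T \<Longrightarrow> v x = g x \<and> cgrad v x = cgrad g x" using loc by blast
    have 1: "has_weak_grad (interior T) v (wgrad \<Omega> v)"
      by (rule has_weak_grad_subset[OF has_weak_grad_wgrad[OF wg] element_interior[OF T]])
    have "v \<in> borel_measurable (lebesgue_on (interior T))"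
      using v(2) by (intro measurable_restrict_space1 measurable_completion) (auto intro: borel_measurable_continuous_onI)
    then have 2: "has_weak_grad (interior T) v (cgrad g)"
      by (intro has_weak_grad_AE_cong[OF open_interior has_weak_grad_cgrad[OF g(1)]]) (auto simp: g(2))
    show "AE x\<in>interior T in lebesgue. wgrad \<Omega> v x = cgrad v x"
      using has_weak_grad_unique[OF open_interior 1 2] by eventually_elim (simp add: g(2))
  qed
qed

end

section \<open>Bilinearity of the forms in H^1 and L^2\<close>

context bounded_open begin

abbreviation H1 :: "(real^'n \<Rightarrow> real^'n) set" where "H1 \<equiv> W1p 2 (\<lambda>_. 1) \<Omega>"
abbreviation L2 :: "(real^'n \<Rightarrow> real) set" where "L2 \<equiv> Lp 2 (\<lambda>_. 1) \<Omega>"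

lemma a_integrable:
  assumes "u \<in> H1" "v \<in> H1"
  shows "integrable M (\<lambda>x. wgrad \<Omega> u x \<bullet> wgrad \<Omega> v x)"
  using Lp_inner_le(1)[of 2, OF _ weight_on_one W1pD(3)[OF assms(1)], of "wgrad \<Omega> v"] W1pD(3)[OF assms(2)] by simp

lemma b_integrable:
  assumes "v \<in> H1" "q \<in> L2"
  shows "integrable M (\<lambda>x. q x * wdiv \<Omega> v x)"
  using Lp_inner_le(1)[of 2, OF _ weight_on_one assms(2), of "wdiv \<Omega> v"]
    wdiv_Lp(1)[OF weight_on_one _ W1pD(3)[OF assms(1)]] by simp

lemma wdiv_measurable: "v \<in> H1 \<Longrightarrow> wdiv \<Omega> v \<in> borel_measurable M"
  using wdiv_Lp(1)[OF weight_on_one zero_less_numeral W1pD(3)[of v]] by (simp add: Lp_iff)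

lemma wgrad_measurable_W1p: "v \<in> W1p p \<omega> \<Omega> \<Longrightarrow> wgrad \<Omega> v \<in> borel_measurable M"
  using W1pD(1) wgrad_measurable by blast

lemma wgrad_add_AE:
  assumes "u \<in> W1p p \<omega> \<Omega>" "v \<in> W1p q \<tau> \<Omega>"
  shows "AE x in M. wgrad \<Omega> (\<lambda>x. u x + v x) x = wgrad \<Omega> u x + wgrad \<Omega> v x"
  by (rule wgrad_eq_AE[OF has_weak_grad_add[OF W1pD(1)[OF assms(1)] W1pD(1)[OF assms(2)]]])

lemma wgrad_scale_AE:
  assumes "u \<in> W1p p \<omega> \<Omega>"
  shows "AE x in M. wgrad \<Omega> (\<lambda>x. c *\<^sub>R u x) x = c *\<^sub>R wgrad \<Omega> u x"
  by (rule wgrad_eq_AE[OF has_weak_grad_scaleR[OF W1pD(1)[OF assms]]])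

lemma a_form_add_right:
  assumes "u \<in> H1" "v \<in> H1" "w \<in> H1" "(\<lambda>x. v x + w x) \<in> H1"
  shows "a_form \<Omega> u (\<lambda>x. v x + w x) = a_form \<Omega> u v + a_form \<Omega> u w"
proof -
  have "a_form \<Omega> u (\<lambda>x. v x + w x) = (LINT x|M. wgrad \<Omega> u x \<bullet> wgrad \<Omega> v x + wgrad \<Omega> u x \<bullet> wgrad \<Omega> w x)"
    unfolding a_form_eq
  proof (rule integral_cong_AE)
    show "AE x in M. wgrad \<Omega> u x \<bullet> wgrad \<Omega> (\<lambda>x. v x + w x) x = wgrad \<Omega> u x \<bullet> wgrad \<Omega> v x + wgrad \<Omega> u x \<bullet> wgrad \<Omega> w x"
      using wgrad_add_AE[OF assms(2,3)] by eventually_elim (simp add: inner_add_right)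
  qed (intro borel_measurable_add borel_measurable_inner wgrad_measurable_W1p[OF assms(1)] wgrad_measurable_W1p[OF assms(2)] wgrad_measurable_W1p[OF assms(3)] wgrad_measurable_W1p[OF assms(4)])+
  then show ?thesis using a_integrable assms by (simp add: a_form_eq)
qed

lemma a_form_scale_right:
  assumes "u \<in> H1" "v \<in> H1" "(\<lambda>x. c *\<^sub>R v x) \<in> H1"
  shows "a_form \<Omega> u (\<lambda>x. c *\<^sub>R v x) = c * a_form \<Omega> u v"
proof -
  have "a_form \<Omega> u (\<lambda>x. c *\<^sub>R v x) = (LINT x|M. c * (wgrad \<Omega> u x \<bullet> wgrad \<Omega> v x))"
    unfolding a_form_eq
  proof (rule integral_cong_AE)
    show "AE x in M. wgrad \<Omega> u x \<bullet> wgrad \<Omega> (\<lambda>x. c *\<^sub>R v x) x = c * (wgrad \<Omega> u x \<bullet> wgrad \<Omega> v x)"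
      using wgrad_scale_AE[OF assms(2), of c] by eventually_elim simp
  qed (intro borel_measurable_times borel_measurable_const borel_measurable_inner wgrad_measurable_W1p[OF assms(1)] wgrad_measurable_W1p[OF assms(2)] wgrad_measurable_W1p[OF assms(3)])+
  then show ?thesis by (simp add: a_form_eq)
qed

lemma b_form_add_left:
  assumes "q \<in> L2" "v \<in> H1" "w \<in> H1" "(\<lambda>x. v x + w x) \<in> H1"
  shows "b_form \<Omega> (\<lambda>x. v x + w x) q = b_form \<Omega> v q + b_form \<Omega> w q"
proof -
  have qm: "q \<in> borel_measurable M" using assms(1) by (simp add: Lp_iff)
  have "(LINT x|M. q x * wdiv \<Omega> (\<lambda>x. v x + w x) x) = (LINT x|M. q x * wdiv \<Omega> v x + q x * wdiv \<Omega> w x)"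
  proof (rule integral_cong_AE)
    show "AE x in M. q x * wdiv \<Omega> (\<lambda>x. v x + w x) x = q x * wdiv \<Omega> v x + q x * wdiv \<Omega> w x"
      using wgrad_add_AE[OF assms(2,3)] by eventually_elim (simp add: wdiv_def trace_add distrib_left)
  qed (intro borel_measurable_add borel_measurable_times qm wdiv_measurable assms)+
  then show ?thesis using b_integrable assms by (simp add: b_form_eq)
qed

lemma b_form_scale_left:
  assumes "q \<in> L2" "v \<in> H1" "(\<lambda>x. c *\<^sub>R v x) \<in> H1"
  shows "b_form \<Omega> (\<lambda>x. c *\<^sub>R v x) q = c * b_form \<Omega> v q"
proof -
  have qm: "q \<in> borel_measurable M" using assms(1) by (simp add: Lp_iff)
  have "(LINT x|M. q x * wdiv \<Omega> (\<lambda>x. c *\<^sub>R v x) x) = (LINT x|M. c * (q x * wdiv \<Omega> v x))"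
  proof (rule integral_cong_AE)
    show "AE x in M. q x * wdiv \<Omega> (\<lambda>x. c *\<^sub>R v x) x = c * (q x * wdiv \<Omega> v x)"
      using wgrad_scale_AE[OF assms(2), of c]
      by eventually_elim (simp add: wdiv_def trace_def sum_distrib_left mult_ac)
  qed (intro borel_measurable_times borel_measurable_const qm wdiv_measurable assms)+
  then show ?thesis by (simp add: b_form_eq)
qed

lemma b_form_add_right:
  assumes "v \<in> H1" "q \<in> L2" "r \<in> L2"
  shows "b_form \<Omega> v (\<lambda>x. q x + r x) = b_form \<Omega> v q + b_form \<Omega> v r"
  using b_integrable[OF assms(1,2)] b_integrable[OF assms(1,3)] by (simp add: b_form_eq distrib_right)

lemma b_form_scale_right: "b_form \<Omega> v (\<lambda>x. c * q x) = c * b_form \<Omega> v q"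
  by (simp add: b_form_eq mult.assoc)

lemma AE_zero_wgrad:
  assumes z: "has_weak_grad \<Omega> z G" "z \<in> borel_measurable M" "AE x in M. z x = 0"
  shows "AE x in M. wgrad \<Omega> z x = 0"
proof -
  have "has_weak_grad \<Omega> (\<lambda>x. 0) (\<lambda>x. 0)" using has_weak_grad_scaleR[OF z(1), of 0] by simp
  from has_weak_grad_AE_cong[OF open_dom this _ z(2)] z(3) have "has_weak_grad \<Omega> z (\<lambda>x. 0)" by (simp add: AE_M_iff)
  from wgrad_eq_AE[OF this] show ?thesis .
qed

lemma AE_zero_forms:
  assumes z: "AE x in M. wgrad \<Omega> z x = 0" "z \<in> H1"
  shows "u \<in> W1p p \<omega> \<Omega> \<Longrightarrow> a_form \<Omega> u z = 0" and "q \<in> borel_measurable M \<Longrightarrow> b_form \<Omega> z q = 0"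
proof -
  assume u: "u \<in> W1p p \<omega> \<Omega>"
  have "(LINT x|M. wgrad \<Omega> u x \<bullet> wgrad \<Omega> z x) = (LINT x|M. 0)"
  proof (rule integral_cong_AE)
    show "AE x in M. wgrad \<Omega> u x \<bullet> wgrad \<Omega> z x = 0" using z(1) by eventually_elim simp
  qed (use borel_measurable_inner[OF wgrad_measurable_W1p[OF u] wgrad_measurable_W1p[OF z(2)]] in auto)
  then show "a_form \<Omega> u z = 0" by (simp add: a_form_eq)
next
  assume q: "q \<in> borel_measurable M"
  have "(LINT x|M. q x * wdiv \<Omega> z x) = (LINT x|M. 0)"
  proof (rule integral_cong_AE)
    show "AE x in M. q x * wdiv \<Omega> z x = 0" using z(1) by eventually_elim (simp add: wdiv_def trace_def)
  qed (use borel_measurable_times[OF q wdiv_measurable[OF z(2)]] in auto)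
  then show "b_form \<Omega> z q = 0" by (simp add: b_form_eq)
qed

lemma a_form_self_zero:
  assumes "v \<in> H1" "a_form \<Omega> v v = 0"
  shows "AE x in M. wgrad \<Omega> v x = 0"
  using assms integral_nonneg_eq_0_iff_AE[OF a_integrable[OF assms(1,1)]] by (auto simp: a_form_eq)

end

section \<open>Finite element spaces and existence of the discrete projection\<close>

locale fe = mesh \<Omega> \<T> for \<Omega> :: "(real^'n) set" and \<T> +
  fixes k :: nat and V :: "(real^'n \<Rightarrow> real^'n) set" and Q :: "(real^'n \<Rightarrow> real) set"
  assumes V: "velocity_space \<Omega> \<T> k V" and Q: "pressure_space \<Omega> \<T> k Q"
begin

lemma V_sub: "function_subspace V" and Q_sub: "function_subspace Q"
  using V Q by (simp_all add: velocity_space_def pressure_space_def)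

lemma VD:
  assumes "v \<in> V"
  shows "continuous_on UNIV v" "\<And>x. x \<notin> \<Omega> \<Longrightarrow> v x = 0" "piecewise_poly k \<T> v" "v \<in> W1inf0 \<Omega>"
  using V assms by (simp_all add: velocity_space_def)

lemma V_W1p: "v \<in> V \<Longrightarrow> weight_on \<omega> \<Longrightarrow> 0 < p \<Longrightarrow> v \<in> W1p p \<omega> \<Omega>"
  by (rule W1inf0_W1p[OF VD(4)])

lemma V_H1: "v \<in> V \<Longrightarrow> v \<in> H1"
  by (rule V_W1p[OF _ weight_on_one]) auto

lemma V_cgrad:
  assumes "v \<in> V"
  shows "AE x in M. wgrad \<Omega> v x = cgrad v x"
  by (rule piecewise_poly_cgrad(2)[OF VD(3,1)[OF assms] W1inf0D(5)[OF VD(4)[OF assms]]])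

text \<open>Lets discrete velocities serve as test functions in the continuous problems: for the
  Green's functions with p = 2 and \<omega> = 1, and for the dual problem in the weighted
  space.\<close>

lemma V_W1p0:
  assumes v: "v \<in> V" and w: "weight_on \<omega>" "1 \<le> p"
  shows "v \<in> W1p0 p \<omega> \<Omega>"
proof (rule mollification_W1p0[OF convex_dom nonempty_dom VD(1)[OF v] VD(2)[OF v] VD(4)[OF v]])
  show "open (\<Union>T\<in>\<T>. interior T)" by auto
  show "AE x in M. x \<in> (\<Union>T\<in>\<T>. interior T)" by (rule AE_interior)
  show "continuous_on (\<Union>T\<in>\<T>. interior T) (cgrad v)"
    by (rule piecewise_poly_cgrad(1)[OF VD(3,1)[OF v] W1inf0D(5)[OF VD(4)[OF v]]])
  show "AE x in M. wgrad \<Omega> v x = cgrad v x" by (rule V_cgrad[OF v])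
qed (use w in auto)

lemma QD:
  assumes "q \<in> Q"
  shows "q \<in> Linf \<Omega>" "zero_mean \<Omega> q"
  using Q assms by (simp_all add: pressure_space_def)

lemma Q_Lp:
  assumes "q \<in> Q" "weight_on \<omega>" "0 < p"
  shows "q \<in> Lp p \<omega> \<Omega>"
proof -
  obtain B where "q \<in> borel_measurable M" "AE x in M. norm (q x) \<le> B"
    using QD(1)[OF assms(1)] by (auto simp: Linf_def AE_M_iff)
  then show ?thesis by (rule Lp_bounded[OF assms(2,3)])
qed

lemma Q_L2: "q \<in> Q \<Longrightarrow> q \<in> L2"
  by (rule Q_Lp[OF _ weight_on_one]) auto

text \<open>The moments up to degree k over all elements determine a discrete velocity almost
  everywhere. Unlike polynomial coefficients they presuppose no choice of a local
  representation.\<close>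

definition moment :: "(real^'n) set \<times> ('n \<Rightarrow> nat) \<times> 'n \<Rightarrow> (real^'n \<Rightarrow> real^'n) \<Rightarrow> real" where
  "moment i v = (case i of (T, \<alpha>, j) \<Rightarrow> LINT x:T|lebesgue. (\<Prod>i\<in>UNIV. (x $ i) ^ \<alpha> i) * v x $ j)"

lemma monomial_continuous: "continuous_on UNIV (\<lambda>x::real^'n. \<Prod>i\<in>UNIV. (x $ i) ^ \<alpha> i)"
  by (intro continuous_intros)

lemma moment_integrable:
  assumes "T \<in> \<T>" "continuous_on UNIV (v :: real^'n \<Rightarrow> real^'n)"
  shows "set_integrable lebesgue T (\<lambda>x. (\<Prod>i\<in>UNIV. (x $ i) ^ \<alpha> i) * v x $ j)"
proof -
  have "loc_integrable UNIV (\<lambda>x. (\<Prod>i\<in>UNIV. (x $ i) ^ \<alpha> i) * v x $ j)"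
    using assms(2) by (intro loc_integrable_continuous continuous_on_mult monomial_continuous continuous_on_component)
  then show ?thesis using element_compact[OF assms(1)] by (simp add: loc_integrable_def)
qed

text \<open>On each simplex, \<open>z\<close> is a polynomial orthogonal to all polynomials of its degree.\<close>

lemma AE_zero_if_moments_zero:
  assumes z: "z \<in> V" and 0: "\<And>T \<alpha> j. T \<in> \<T> \<Longrightarrow> sum \<alpha> UNIV \<le> k \<Longrightarrow> moment (T, \<alpha>, j) z = 0"
  shows "AE x in M. z x = 0"
proof (rule AE_M_interiorI)
  fix T assume T: "T \<in> \<T>"
  have Ts: "T \<in> sets lebesgue" using element_compact[OF T] by (simp add: compact_imp_closed)
  obtain g where g: "poly_degree_le k g" "\<And>x. x \<in> interior T \<Longrightarrow> z x = g x"
    using VD(3)[OF z] T unfolding piecewise_poly_def by blast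
  then obtain c where c: "\<And>x. g x = (\<Sum>\<alpha> | sum \<alpha> UNIV \<le> k. (\<Prod>i\<in>UNIV. (x $ i) ^ \<alpha> i) *\<^sub>R c \<alpha>)"
    unfolding poly_degree_le_def by blast
  have "AE x in lebesgue. \<forall>j\<in>UNIV. x \<in> T \<longrightarrow> z x $ j = 0"
  proof (rule AE_finite_allI[OF finite])
    fix j :: 'n
    let ?m = "\<lambda>\<alpha> x. \<Prod>i\<in>UNIV. (x $ i) ^ \<alpha> i"
    have sq: "set_integrable lebesgue T (\<lambda>x. z x $ j * z x $ j)"
    proof -
      have "loc_integrable UNIV (\<lambda>x. z x $ j * z x $ j)"
        using VD(1)[OF z] by (intro loc_integrable_continuous continuous_on_mult continuous_on_component)
      then show ?thesis using element_compact[OF T] by (simp add: loc_integrable_def)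
    qed
    have mi: "integrable lebesgue (\<lambda>x. indicator T x *\<^sub>R (c \<alpha> $ j * (?m \<alpha> x * z x $ j)))" for \<alpha>
      using moment_integrable[OF T VD(1)[OF z], of \<alpha> j] integrable_mult_right[of "c \<alpha> $ j" lebesgue "\<lambda>x. indicator T x *\<^sub>R (?m \<alpha> x * z x $ j)"]
      by (simp add: set_integrable_def mult_ac)
    have "(LINT x|lebesgue. indicator T x *\<^sub>R (z x $ j * z x $ j))
      = (LINT x|lebesgue. (\<Sum>\<alpha> | sum \<alpha> UNIV \<le> k. indicator T x *\<^sub>R (c \<alpha> $ j * (?m \<alpha> x * z x $ j))))"
    proof (rule integral_cong_AE)
      show "AE x in lebesgue. indicator T x *\<^sub>R (z x $ j * z x $ j) = (\<Sum>\<alpha> | sum \<alpha> UNIV \<le> k. indicator T x *\<^sub>R (c \<alpha> $ j * (?m \<alpha> x * z x $ j)))"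
        using AE_frontier[OF T]
      proof eventually_elim
        case (elim x)
        show ?case
        proof (cases "x \<in> T")
          case True
          then have "x \<in> interior T" using elim element_compact[OF T] by (auto simp: frontier_def compact_imp_closed)
          then have "z x $ j = (\<Sum>\<alpha> | sum \<alpha> UNIV \<le> k. ?m \<alpha> x * c \<alpha> $ j)" using g(2) c by simp
          then have "z x $ j * z x $ j = (\<Sum>\<alpha> | sum \<alpha> UNIV \<le> k. ?m \<alpha> x * c \<alpha> $ j) * z x $ j" by simp
          also have "\<dots> = (\<Sum>\<alpha> | sum \<alpha> UNIV \<le> k. c \<alpha> $ j * (?m \<alpha> x * z x $ j))"
            unfolding sum_distrib_right by (intro sum.cong refl) (simp add: mult_ac)
          finally show ?thesis using True by simp
        qed simp
      qed
      show "(\<lambda>x. indicator T x *\<^sub>R (z x $ j * z x $ j)) \<in> borel_measurable lebesgue"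
        using sq by (auto simp: set_integrable_def intro: borel_measurable_integrable)
      show "(\<lambda>x. \<Sum>\<alpha> | sum \<alpha> UNIV \<le> k. indicator T x *\<^sub>R (c \<alpha> $ j * (?m \<alpha> x * z x $ j))) \<in> borel_measurable lebesgue"
        by (intro borel_measurable_sum borel_measurable_integrable mi)
    qed
    also have "\<dots> = (\<Sum>\<alpha> | sum \<alpha> UNIV \<le> k. LINT x|lebesgue. indicator T x *\<^sub>R (c \<alpha> $ j * (?m \<alpha> x * z x $ j)))"
      by (intro Bochner_Integration.integral_sum mi)
    also have "\<dots> = (\<Sum>\<alpha> | sum \<alpha> UNIV \<le> k. c \<alpha> $ j * moment (T, \<alpha>, j) z)"
    proof (intro sum.cong refl)
      fix \<alpha>
      have "(\<lambda>x. indicator T x *\<^sub>R (c \<alpha> $ j * (?m \<alpha> x * z x $ j))) = (\<lambda>x. c \<alpha> $ j * (indicator T x *\<^sub>R (?m \<alpha> x * z x $ j)))"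
        by (simp add: mult_ac fun_eq_iff)
      then show "(LINT x|lebesgue. indicator T x *\<^sub>R (c \<alpha> $ j * (?m \<alpha> x * z x $ j))) = c \<alpha> $ j * moment (T, \<alpha>, j) z"
        by (simp only: moment_def set_lebesgue_integral_def prod.case) (rule integral_mult_right_zero)
    qed
    also have "\<dots> = 0" using 0[OF T] by simp
    finally have "AE x in lebesgue. indicator T x *\<^sub>R (z x $ j * z x $ j) = 0"
      using integral_nonneg_eq_0_iff_AE[OF sq[unfolded set_integrable_def]] by auto
    then show "AE x in lebesgue. x \<in> T \<longrightarrow> z x $ j = 0"
      by eventually_elim (auto simp: indicator_def)
  qed
  then show "AE x\<in>interior T in lebesgue. z x = 0"
    by eventually_elim (use interior_subset in \<open>auto simp: vec_eq_iff\<close>)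
qed

lemma V_finite_dim:
  obtains e :: "nat \<Rightarrow> real^'n \<Rightarrow> real^'n" and N where "\<And>j. j < N \<Longrightarrow> e j \<in> V"
    "\<And>v. v \<in> V \<Longrightarrow> \<exists>c. \<exists>z\<in>V. (AE x in M. z x = 0) \<and> v = (\<lambda>y. (\<Sum>j<N. c j *\<^sub>R e j y) + z y)"
proof -
  let ?I = "\<T> \<times> {\<alpha> :: 'n \<Rightarrow> nat. sum \<alpha> UNIV \<le> k} \<times> (UNIV :: 'n set)"
  have "\<exists>(e :: nat \<Rightarrow> real^'n \<Rightarrow> real^'n) N. (\<forall>j<N. e j \<in> V) \<and>
    (\<forall>v\<in>V. \<exists>c. \<exists>z\<in>V. (\<forall>i\<in>?I. moment i z = 0) \<and> v = (\<lambda>y. (\<Sum>j<N. c j *\<^sub>R e j y) + z y))"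
  proof (rule finite_dim_modulo[OF _ V_sub])
    show "finite ?I" by (intro finite_cartesian_product finite_mesh finite_multiindices finite)
    fix i f g assume i: "i \<in> ?I" and f: "f \<in> V" and g: "g \<in> V"
    obtain T \<alpha> j where ij: "i = (T, \<alpha>, j)" "T \<in> \<T>" using i by auto
    show "moment i (\<lambda>x. f x + g x) = moment i f + moment i g"
      using set_lint_add[OF moment_integrable[OF ij(2) VD(1)[OF f]] moment_integrable[OF ij(2) VD(1)[OF g]]]
      by (simp add: ij moment_def distrib_left)
  next
    fix i c f assume i: "i \<in> ?I" and f: "f \<in> V"
    obtain T \<alpha> j where ij: "i = (T, \<alpha>, j)" "T \<in> \<T>" using i by auto
    have "(\<lambda>x. indicat_real T x *\<^sub>R ((\<Prod>i\<in>UNIV. (x $ i) ^ \<alpha> i) * (c *\<^sub>R f x) $ j))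
      = (\<lambda>x. c * (indicat_real T x *\<^sub>R ((\<Prod>i\<in>UNIV. (x $ i) ^ \<alpha> i) * f x $ j)))" by (simp add: fun_eq_iff mult_ac)
    then show "moment i (\<lambda>x. c *\<^sub>R f x) = c * moment i f"
      by (simp only: ij moment_def set_lebesgue_integral_def prod.case) (rule integral_mult_right_zero)
  qed
  then obtain e :: "nat \<Rightarrow> real^'n \<Rightarrow> real^'n" and N where e: "\<forall>j<N. e j \<in> V"
    "\<forall>v\<in>V. \<exists>c. \<exists>z\<in>V. (\<forall>i\<in>?I. moment i z = 0) \<and> v = (\<lambda>y. (\<Sum>j<N. c j *\<^sub>R e j y) + z y)"
    by (elim exE conjE)
  show thesis
  proof (rule that)
    show "e j \<in> V" if "j < N" for j using e(1) that by blast
    fix v assume "v \<in> V"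
    from bspec[OF e(2) this] obtain c z where z: "z \<in> V" "\<forall>i\<in>?I. moment i z = 0" "v = (\<lambda>y. (\<Sum>j<N. c j *\<^sub>R e j y) + z y)"
      by (elim exE bexE conjE)
    have "AE x in M. z x = 0" using z(2) by (intro AE_zero_if_moments_zero[OF z(1)]) auto
    then show "\<exists>c. \<exists>z\<in>V. (AE x in M. z x = 0) \<and> v = (\<lambda>y. (\<Sum>j<N. c j *\<^sub>R e j y) + z y)"
      using z by blast
  qed
qed

text \<open>The residual of the discrete Stokes problem is a linear functional on a finite-dimensional space.
  If it could not be made to vanish, some \<open>v\<close> would annihilate all discrete residuals, so \<open>a(v,v) = 0\<close>.\<close>

lemma discrete_projection_exists:
  assumes G: "G \<in> H1" and S: "S \<in> L2"
  obtains w q where "is_stokes_projection \<Omega> V Q G S w q"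
proof -
  obtain e :: "nat \<Rightarrow> real^'n \<Rightarrow> real^'n" and N where e: "\<And>j. j < N \<Longrightarrow> e j \<in> V"
    "\<And>v. v \<in> V \<Longrightarrow> \<exists>c. \<exists>z\<in>V. (AE x in M. z x = 0) \<and> v = (\<lambda>y. (\<Sum>j<N. c j *\<^sub>R e j y) + z y)"
    by (rule V_finite_dim) blast
  note Vs = function_subspaceD[OF V_sub] and Qs = function_subspaceD[OF Q_sub]
  define F where "F w q v = a_form \<Omega> w v + b_form \<Omega> v q" for w q v
  have Fadd: "F w q (\<lambda>x. f x + g x) = F w q f + F w q g" if "w \<in> H1" "q \<in> L2" "f \<in> V" "g \<in> V" for w q f g
    using that a_form_add_right[of w f g] b_form_add_left[of q f g] V_H1 Vs(2) by (simp add: F_def)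
  have Fscale: "F w q (\<lambda>x. c *\<^sub>R f x) = c * F w q f" if "w \<in> H1" "q \<in> L2" "f \<in> V" for w q f c
    using that a_form_scale_right[of w f c] b_form_scale_left[of q f c] V_H1 Vs(3)[of f c] by (simp add: F_def distrib_left)
  have Fsum: "F w q (\<lambda>y. \<Sum>j<N. c j *\<^sub>R e j y) = (\<Sum>j<N. c j * F w q (e j))" if "w \<in> H1" "q \<in> L2" for w q c
    by (rule linear_functional_sum[OF V_sub e(1)]) (auto intro: Fadd Fscale that)
  have Fz: "F w q z = 0" if "w \<in> H1" "q \<in> L2" "z \<in> H1" "AE x in M. wgrad \<Omega> z x = 0" for w q z
    using AE_zero_forms[OF that(4,3)] that(1,2) by (simp add: F_def Lp_iff)
  \<comment> \<open>Candidates are discretely divergence-free from the outset, so only the momentum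
    equation remains to be solved.\<close>
  define Z where "Z = {w \<in> V. \<forall>q\<in>Q. b_form \<Omega> w q = 0}"
  define res where "res w q = (\<lambda>j. if j < N then F w q (e j) else 0)" for w q
  \<comment> \<open>The vectors of values on the spanning set that discrete pairs can attain.
    Solvability means that the values of the data functional are among them.\<close>
  define K where "K = {res w q | w q. w \<in> Z \<and> q \<in> Q}"
  have Zs: "(\<lambda>x. 0) \<in> Z" "\<And>v w. v \<in> Z \<Longrightarrow> w \<in> Z \<Longrightarrow> (\<lambda>x. v x + w x) \<in> Z" "\<And>c v. v \<in> Z \<Longrightarrow> (\<lambda>x. c *\<^sub>R v x) \<in> Z"
  proof -
    show "(\<lambda>x. v x + w x) \<in> Z" if "v \<in> Z" "w \<in> Z" for v w
      using that b_form_add_left[of _ v w] V_H1 Q_L2 Vs(2) by (simp add: Z_def)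
    show sc: "(\<lambda>x. c *\<^sub>R v x) \<in> Z" if "v \<in> Z" for v c
      using that b_form_scale_left[of _ v c] V_H1 Q_L2 Vs(3) by (simp add: Z_def)
    have "b_form \<Omega> (\<lambda>x. 0) q = 0" if "q \<in> Q" for q
      using b_form_scale_left[of q "\<lambda>x. 0" 0] V_H1[OF Vs(1)] Q_L2[OF that] by simp
    then show "(\<lambda>x. 0) \<in> Z" using Vs(1) by (simp add: Z_def)
  qed
  have ZH: "w \<in> H1" if "w \<in> Z" for w using that V_H1 by (simp add: Z_def)
  have eH: "e j \<in> H1" if "j < N" for j using e(1)[OF that] V_H1 by blast
  have r0: "res (\<lambda>x. 0) (\<lambda>x. 0) = (\<lambda>x. 0)"
  proof -
    have "a_form \<Omega> (\<lambda>x. 0) v = 0" if "v \<in> H1" for v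
      using a_form_scale_right[of v "\<lambda>x. 0" 0] V_H1[OF Vs(1)] that by (simp add: a_form_commute)
    moreover have "b_form \<Omega> v (\<lambda>x. 0) = 0" for v by (simp add: b_form_eq)
    ultimately show ?thesis using eH by (auto simp: res_def F_def)
  qed
  have radd: "(\<lambda>j. res w q j + res w' q' j) = res (\<lambda>x. w x + w' x) (\<lambda>x. q x + q' x)"
    if "w \<in> Z" "w' \<in> Z" "q \<in> Q" "q' \<in> Q" for w w' q q'
  proof
    fix j
    show "res w q j + res w' q' j = res (\<lambda>x. w x + w' x) (\<lambda>x. q x + q' x) j"
    proof (cases "j < N")
      case True
      have "a_form \<Omega> (\<lambda>x. w x + w' x) (e j) = a_form \<Omega> w (e j) + a_form \<Omega> w' (e j)"
        using a_form_add_right[OF eH[OF True] ZH[OF that(1)] ZH[OF that(2)] ZH[OF Zs(2)[OF that(1,2)]]]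
        by (simp add: a_form_commute)
      then show ?thesis
        using True b_form_add_right[OF eH[OF True] Q_L2[OF that(3)] Q_L2[OF that(4)]] by (simp add: res_def F_def)
    qed (simp add: res_def)
  qed
  have rscale: "(\<lambda>j. c * res w q j) = res (\<lambda>x. c *\<^sub>R w x) (\<lambda>x. c * q x)" if "w \<in> Z" for w q c
  proof
    fix j
    show "c * res w q j = res (\<lambda>x. c *\<^sub>R w x) (\<lambda>x. c * q x) j"
    proof (cases "j < N")
      case True
      have "a_form \<Omega> (\<lambda>x. c *\<^sub>R w x) (e j) = c * a_form \<Omega> w (e j)"
        using a_form_scale_right[OF eH[OF True] ZH[OF that] ZH[OF Zs(3)[OF that]], of c]
        by (simp add: a_form_commute)
      then show ?thesis using True by (simp add: res_def F_def b_form_scale_right distrib_left)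
    qed (simp add: res_def)
  qed
  have "function_subspace K"
    unfolding function_subspace_def
  proof (intro conjI ballI allI)
    show "(\<lambda>x. 0) \<in> K" unfolding K_def using Zs(1) Qs(1) r0 by (intro CollectI exI[of _ "\<lambda>x. 0"]) simp
    fix f assume "f \<in> K"
    then obtain w q where f: "f = res w q" "w \<in> Z" "q \<in> Q" by (auto simp: K_def)
    {
      fix g assume "g \<in> K"
      then obtain w' q' where g: "g = res w' q'" "w' \<in> Z" "q' \<in> Q" by (auto simp: K_def)
      show "(\<lambda>x. f x + g x) \<in> K"
        unfolding f(1) g(1) radd[OF f(2) g(2) f(3) g(3)] K_def using Zs(2)[OF f(2) g(2)] Qs(2)[OF f(3) g(3)] by blast
    next
      fix c :: real
      have "(\<lambda>x. c * q x) \<in> Q" using Qs(3)[OF f(3), of c] by simp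
      then show "(\<lambda>x. c *\<^sub>R f x) \<in> K"
        unfolding f(1) real_scaleR_def rscale[OF f(2)] K_def using Zs(3)[OF f(2)] by blast
    }
  qed
  from subspace_alternative[OF this, of N "\<lambda>j. F G S (e j)"]
  show thesis
  proof
    assume "\<exists>k\<in>K. \<forall>i<N. k i = F G S (e i)"
    then obtain w q where wq: "w \<in> Z" "q \<in> Q" "\<And>i. i < N \<Longrightarrow> F w q (e i) = F G S (e i)"
      by (force simp: K_def res_def)
    have "F w q v = F G S v" if v: "v \<in> V" for v
    proof -
      from e(2)[OF v] obtain c z where z: "z \<in> V" "AE x in M. z x = 0" "v = (\<lambda>y. (\<Sum>j<N. c j *\<^sub>R e j y) + z y)"
        by (elim exE bexE conjE)
      have zg: "AE x in M. wgrad \<Omega> z x = 0"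
        using V_H1[OF z(1)] z(2) by (intro AE_zero_wgrad[OF W1pD(1)]) (auto dest: W1pD simp: Lp_iff)
      have s: "(\<lambda>y. \<Sum>j<N. c j *\<^sub>R e j y) \<in> V" by (intro function_subspace_sum[OF V_sub] e(1))
      have "F w q v = (\<Sum>j<N. c j * F w q (e j))"
        unfolding z(3) using Fadd[OF ZH[OF wq(1)] Q_L2[OF wq(2)] s z(1)] Fsum[OF ZH[OF wq(1)] Q_L2[OF wq(2)]]
          Fz[OF ZH[OF wq(1)] Q_L2[OF wq(2)] V_H1[OF z(1)] zg] by simp
      also have "\<dots> = (\<Sum>j<N. c j * F G S (e j))" by (intro sum.cong refl) (simp add: wq(3))
      also have "\<dots> = F G S v"
        unfolding z(3) using Fadd[OF G S s z(1)] Fsum[OF G S] Fz[OF G S V_H1[OF z(1)] zg] by simp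
      finally show ?thesis .
    qed
    then have "is_stokes_projection \<Omega> V Q G S w q"
      using wq by (simp add: is_stokes_projection_def F_def Z_def)
    then show thesis by (rule that)
  next
    assume "\<exists>x. (\<forall>k\<in>K. (\<Sum>i<N. x i * k i) = 0) \<and> (\<Sum>i<N. x i * F G S (e i)) \<noteq> 0"
    then obtain x where x: "\<And>k. k \<in> K \<Longrightarrow> (\<Sum>i<N. x i * k i) = 0" "(\<Sum>i<N. x i * F G S (e i)) \<noteq> 0" by blast
    define v where "v = (\<lambda>y. \<Sum>j<N. x j *\<^sub>R e j y)"
    have vV: "v \<in> V" unfolding v_def by (intro function_subspace_sum[OF V_sub] e(1))
    have F0: "F w q v = 0" if "w \<in> Z" "q \<in> Q" for w q
    proof -
      have "res w q \<in> K" using that by (auto simp: K_def)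
      from x(1)[OF this] show ?thesis
        unfolding v_def using Fsum[OF ZH[OF that(1)] Q_L2[OF that(2)], of x] by (simp add: res_def)
    qed
    \<comment> \<open>Taking w = 0 shows that v itself is discretely divergence-free; it may then be
      inserted for w, together with q = 0.\<close>
    have b0: "b_form \<Omega> v q = 0" if "q \<in> Q" for q
      using F0[OF Zs(1) that] a_form_scale_right[of v "\<lambda>x. 0" 0] V_H1[OF Vs(1)] V_H1[OF vV]
      by (simp add: F_def a_form_commute)
    then have "v \<in> Z" using vV by (simp add: Z_def)
    from F0[OF this Qs(1)] have "a_form \<Omega> v v = 0" by (simp add: F_def b_form_eq)
    \<comment> \<open>The gradient of v vanishes, so the data functional is zero at v, whereas the
      choice of \<open>x\<close> makes its value there nonzero.\<close>
    from Fz[OF G S V_H1[OF vV] a_form_self_zero[OF V_H1[OF vV] this]]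
    show thesis using x(2) Fsum[OF G S, of x] by (simp add: v_def)
  qed
qed

end

section \<open>Pointwise bounds for the discrete velocity gradient\<close>

lemma sigma_pos: "0 < \<kappa> \<Longrightarrow> 0 < h \<Longrightarrow> 0 < sigma \<kappa> h z x"
  by (rule less_le_trans[OF mult_pos_pos sigma_ge(1)])

lemma kern_pos: "0 < \<kappa> \<Longrightarrow> 0 < h \<Longrightarrow> 0 < kern \<kappa> h l z x"
  using sigma_pos[of \<kappa> h z x] by (simp add: kern_def)

lemma kern_le:
  fixes z x :: "real^'n"
  assumes "0 < \<kappa>" "0 < h" "0 < l"
  shows "kern \<kappa> h l z x \<le> h powr l * (\<kappa> * h) powr (- (real CARD('n) + l))"
  unfolding kern_def using assms sigma_ge(1)[OF assms(1,2), of z x]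
  by (intro mult_left_mono powr_mono2') auto

lemma sigma_le: "0 < \<kappa> \<Longrightarrow> 0 < h \<Longrightarrow> sigma \<kappa> h z x \<le> norm (x - z) + \<kappa> * h"
  using sqrt_add_le_add_sqrt[of "(norm (x - z))\<^sup>2" "(\<kappa> * h)\<^sup>2"] by (simp add: sigma_def)

lemma kern_ge:
  fixes z x :: "real^'n"
  assumes "0 < \<kappa>" "0 < h" "0 < l" "norm (x - z) + \<kappa> * h \<le> r"
  shows "h powr l * r powr (- (real CARD('n) + l)) \<le> kern \<kappa> h l z x"
proof -
  have "0 < sigma \<kappa> h z x" by (rule sigma_pos[OF assms(1,2)])
  then show ?thesis
    unfolding kern_def using assms sigma_le[OF assms(1,2), of z x]
    by (intro mult_left_mono powr_mono2') auto
qed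

context bounded_open begin

lemma L2_norm_square:
  fixes f :: "real^'n \<Rightarrow> 'b::euclidean_space"
  shows "(Lp_norm 2 (\<lambda>_. 1) \<Omega> f)\<^sup>2 = (LINT x|M. (norm (f x))\<^sup>2)"
proof -
  have "(Lp_norm 2 (\<lambda>_. 1) \<Omega> f)\<^sup>2 = Lp_norm 2 (\<lambda>_. 1) \<Omega> f powr 2"
    by (subst powr_numeral[OF Lp_norm_nonneg]) simp
  also have "\<dots> = (LINT x|M. norm (f x) powr 2 * 1)" by (rule Lp_norm_powr[OF weight_on_one]) simp
  finally show ?thesis by (simp add: powr_numeral)
qed

lemma L2_iff: "f \<in> Lp 2 (\<lambda>_. 1) \<Omega> \<longleftrightarrow> f \<in> borel_measurable M \<and> integrable M (\<lambda>x. (norm (f x))\<^sup>2)"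
  by (simp add: Lp_iff powr_numeral)

text \<open>Hoelder's inequality for A/sqrt(s) and sqrt(s) F. With s = \<open>kern\<close> and A the
  Green's function error, the first integral carries \<sigma>^(d+l) as in condition (G), and the
  second is the kernel integral of the data.\<close>

lemma Cauchy_Schwarz_weighted:
  fixes A F s :: "real^'n \<Rightarrow> real"
  assumes m: "A \<in> borel_measurable M" "F \<in> borel_measurable M" "s \<in> borel_measurable M" and s: "\<And>x. 0 < s x"
    and i: "integrable M (\<lambda>x. (A x)\<^sup>2 / s x)" "integrable M (\<lambda>x. s x * (F x)\<^sup>2)"
  shows "integrable M (\<lambda>x. \<bar>A x\<bar> * \<bar>F x\<bar>)"
    and "(LINT x|M. \<bar>A x\<bar> * \<bar>F x\<bar>)\<^sup>2 \<le> (LINT x|M. (A x)\<^sup>2 / s x) * (LINT x|M. s x * (F x)\<^sup>2)"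
proof -
  let ?f = "\<lambda>x. A x / sqrt (s x)" and ?g = "\<lambda>x. sqrt (s x) * F x"
  have sm: "(\<lambda>x. sqrt (s x)) \<in> borel_measurable M"
    by (rule borel_measurable_continuous_on[OF _ m(3)]) (intro continuous_intros)
  have f2: "(norm (?f x))\<^sup>2 = (A x)\<^sup>2 / s x" and g2: "(norm (?g x))\<^sup>2 = s x * (F x)\<^sup>2" for x
    using s[of x] by (simp_all add: power_divide power_mult_distrib)
  have f: "?f \<in> Lp 2 (\<lambda>_. 1) \<Omega>" unfolding L2_iff f2 using i(1) m(1) sm by (intro conjI borel_measurable_divide)
  have g: "?g \<in> Lp 2 (\<lambda>_. 1) \<Omega>" unfolding L2_iff g2 using i(2) m(2) sm by (intro conjI borel_measurable_times)
  have fg: "norm (?f x) * norm (?g x) = \<bar>A x\<bar> * \<bar>F x\<bar>" for x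
    using s[of x] by (simp add: abs_mult)
  note H = Holder_weighted[of 2 "\<lambda>_. 1", OF _ weight_on_one f, of ?g, simplified dual_weight_one conj_exp_2, OF _ g]
  show "integrable M (\<lambda>x. \<bar>A x\<bar> * \<bar>F x\<bar>)" using H(1) unfolding fg by simp
  have "(LINT x|M. \<bar>A x\<bar> * \<bar>F x\<bar>) \<le> Lp_norm 2 (\<lambda>_. 1) \<Omega> ?f * Lp_norm 2 (\<lambda>_. 1) \<Omega> ?g"
    using H(2) unfolding fg by simp
  then have "(LINT x|M. \<bar>A x\<bar> * \<bar>F x\<bar>)\<^sup>2 \<le> (Lp_norm 2 (\<lambda>_. 1) \<Omega> ?f * Lp_norm 2 (\<lambda>_. 1) \<Omega> ?g)\<^sup>2"
    by (intro power_mono Bochner_Integration.integral_nonneg) auto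
  also have "\<dots> = (LINT x|M. (A x)\<^sup>2 / s x) * (LINT x|M. s x * (F x)\<^sup>2)"
    unfolding power_mult_distrib L2_norm_square f2 g2 ..
  finally show "(LINT x|M. \<bar>A x\<bar> * \<bar>F x\<bar>)\<^sup>2 \<le> (LINT x|M. (A x)\<^sup>2 / s x) * (LINT x|M. s x * (F x)\<^sup>2)" .
qed

lemma kern_measurable_M: "(\<lambda>x. kern \<kappa> h l z x) \<in> borel_measurable M"
  by (intro measurable_M kern_measurable) auto

lemma kern_integrable:
  assumes "0 < \<kappa>" "0 < h" "0 < l" "integrable M (f :: real^'n \<Rightarrow> real)"
  shows "integrable M (\<lambda>x. kern \<kappa> h l z x * f x)"
proof (rule Bochner_Integration.integrable_bound)
  let ?c = "h powr l * (\<kappa> * h) powr (- (real CARD('n) + l))"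
  show "integrable M (\<lambda>x. ?c * f x)" using assms(4) by simp
  show "(\<lambda>x. kern \<kappa> h l z x * f x) \<in> borel_measurable M"
    by (rule borel_measurable_times[OF kern_measurable_M borel_measurable_integrable[OF assms(4)]])
  show "AE x in M. norm (kern \<kappa> h l z x * f x) \<le> norm (?c * f x)"
    using kern_le[OF assms(1-3), of z] kern_nonneg[of \<kappa> h l z]
    by (intro AE_I2) (simp add: abs_mult mult_right_mono)
qed

definition data_size :: "(real^'n \<Rightarrow> real^'n) \<Rightarrow> (real^'n \<Rightarrow> real) \<Rightarrow> real^'n \<Rightarrow> real" where
  "data_size u \<pi> x = norm (wgrad \<Omega> u x) + \<bar>\<pi> x\<bar>"

lemma data_size_nonneg: "0 \<le> data_size u \<pi> x"
  by (simp add: data_size_def)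

lemma data_size_Lp:
  assumes w: "weight_on \<omega>" "1 \<le> p" and u: "wgrad \<Omega> u \<in> Lp p \<omega> \<Omega>" and \<pi>: "\<pi> \<in> Lp p \<omega> \<Omega>"
  shows "data_size u \<pi> \<in> Lp p \<omega> \<Omega>"
    and "Lp_norm p \<omega> \<Omega> (data_size u \<pi>) \<le> 4 * (Lp_norm p \<omega> \<Omega> (wgrad \<Omega> u) + Lp_norm p \<omega> \<Omega> \<pi>)"
proof -
  have "(\<lambda>x. norm (wgrad \<Omega> u x)) \<in> Lp p \<omega> \<Omega>" "(\<lambda>x. norm (\<pi> x)) \<in> Lp p \<omega> \<Omega>"
    using u \<pi> Lp_iff_norm by blast+
  from Lp_norm_add[OF w this]
  show "data_size u \<pi> \<in> Lp p \<omega> \<Omega>"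
    "Lp_norm p \<omega> \<Omega> (data_size u \<pi>) \<le> 4 * (Lp_norm p \<omega> \<Omega> (wgrad \<Omega> u) + Lp_norm p \<omega> \<Omega> \<pi>)"
    by (simp_all add: data_size_def[abs_def] Lp_norm_norm Lp_norm_norm[of _ _ \<pi>, simplified])
qed

text \<open>Comparing the integrands directly requires only a pointwise majorant \<open>E\<close> of
  the gradient difference, which can later be paired with the data by Cauchy--Schwarz. The trace in
  \<open>wdiv\<close> contributes the factor d.\<close>

lemma form_difference_le:
  assumes u: "u \<in> H1" and g: "\<pi> \<in> L2" and v: "v \<in> H1" "w \<in> H1"
    and E: "E \<in> borel_measurable M" "AE x in M. norm (wgrad \<Omega> v x - wgrad \<Omega> w x) \<le> E x"
    and i: "integrable M (\<lambda>x. E x * data_size u \<pi> x)"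
  shows "\<bar>(a_form \<Omega> u v + b_form \<Omega> v \<pi>) - (a_form \<Omega> u w + b_form \<Omega> w \<pi>)\<bar>
    \<le> (1 + real CARD('n)) * (LINT x|M. E x * data_size u \<pi> x)"
proof -
  let ?D = "\<lambda>x. wgrad \<Omega> v x - wgrad \<Omega> w x"
  have av: "integrable M (\<lambda>x. wgrad \<Omega> u x \<bullet> wgrad \<Omega> v x)" "integrable M (\<lambda>x. wgrad \<Omega> u x \<bullet> wgrad \<Omega> w x)"
    using a_integrable u v by auto
  have bv: "integrable M (\<lambda>x. \<pi> x * wdiv \<Omega> v x)" "integrable M (\<lambda>x. \<pi> x * wdiv \<Omega> w x)"
    using b_integrable g v by auto
  have "(a_form \<Omega> u v + b_form \<Omega> v \<pi>) - (a_form \<Omega> u w + b_form \<Omega> w \<pi>)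
    = (LINT x|M. (wgrad \<Omega> u x \<bullet> wgrad \<Omega> v x - \<pi> x * wdiv \<Omega> v x) - (wgrad \<Omega> u x \<bullet> wgrad \<Omega> w x - \<pi> x * wdiv \<Omega> w x))"
    using av bv by (simp add: a_form_eq b_form_eq)
  then have "\<bar>(a_form \<Omega> u v + b_form \<Omega> v \<pi>) - (a_form \<Omega> u w + b_form \<Omega> w \<pi>)\<bar>
    = norm (LINT x|M. (wgrad \<Omega> u x \<bullet> wgrad \<Omega> v x - \<pi> x * wdiv \<Omega> v x) - (wgrad \<Omega> u x \<bullet> wgrad \<Omega> w x - \<pi> x * wdiv \<Omega> w x))"
    by (simp only: real_norm_def)
  also have "\<dots> \<le> (LINT x|M. norm ((wgrad \<Omega> u x \<bullet> wgrad \<Omega> v x - \<pi> x * wdiv \<Omega> v x) - (wgrad \<Omega> u x \<bullet> wgrad \<Omega> w x - \<pi> x * wdiv \<Omega> w x)))"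
    by (rule integral_norm_bound)
  also have "\<dots> \<le> (LINT x|M. (1 + real CARD('n)) * (E x * data_size u \<pi> x))"
  proof (rule integral_mono_AE)
    show "integrable M (\<lambda>x. norm (wgrad \<Omega> u x \<bullet> wgrad \<Omega> v x - \<pi> x * wdiv \<Omega> v x - (wgrad \<Omega> u x \<bullet> wgrad \<Omega> w x - \<pi> x * wdiv \<Omega> w x)))"
      by (rule integrable_norm[OF Bochner_Integration.integrable_diff[OF
          Bochner_Integration.integrable_diff[OF av(1) bv(1)] Bochner_Integration.integrable_diff[OF av(2) bv(2)]]])
    show "integrable M (\<lambda>x. (1 + real CARD('n)) * (E x * data_size u \<pi> x))" using i by simp
    show "AE x in M. norm (wgrad \<Omega> u x \<bullet> wgrad \<Omega> v x - \<pi> x * wdiv \<Omega> v x - (wgrad \<Omega> u x \<bullet> wgrad \<Omega> w x - \<pi> x * wdiv \<Omega> w x))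
        \<le> (1 + real CARD('n)) * (E x * data_size u \<pi> x)"
      using E(2)
    proof eventually_elim
      case (elim x)
      have E0: "0 \<le> E x" by (rule order_trans[OF norm_ge_zero elim])
      have "norm (wgrad \<Omega> u x \<bullet> wgrad \<Omega> v x - \<pi> x * wdiv \<Omega> v x - (wgrad \<Omega> u x \<bullet> wgrad \<Omega> w x - \<pi> x * wdiv \<Omega> w x))
        = norm (wgrad \<Omega> u x \<bullet> ?D x - \<pi> x * trace (?D x))"
        by (simp add: inner_diff_right wdiv_def trace_sub algebra_simps)
      also have "\<dots> \<le> \<bar>wgrad \<Omega> u x \<bullet> ?D x\<bar> + \<bar>\<pi> x\<bar> * \<bar>trace (?D x)\<bar>"
        using abs_triangle_ineq4[of "wgrad \<Omega> u x \<bullet> ?D x" "\<pi> x * trace (?D x)"] by (simp add: abs_mult)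
      also have "\<dots> \<le> norm (wgrad \<Omega> u x) * norm (?D x) + \<bar>\<pi> x\<bar> * (real CARD('n) * norm (?D x))"
        by (intro add_mono Cauchy_Schwarz_ineq2 mult_left_mono trace_le_norm) auto
      also have "\<dots> \<le> norm (wgrad \<Omega> u x) * E x + \<bar>\<pi> x\<bar> * (real CARD('n) * E x)"
        using elim by (intro add_mono mult_left_mono) auto
      also have "\<dots> \<le> (1 + real CARD('n)) * (E x * data_size u \<pi> x)"
        using E0 by (simp add: data_size_def algebra_simps)
      finally show ?case .
    qed
  qed
  finally show ?thesis by simp
qed

lemma ball_integral_le:
  assumes "0 < r"
  shows "integrable M (\<lambda>x. indicator (ball z r) x :: real)"
    and "(LINT x|M. indicator (ball z r) x) \<le> unit_ball_vol (real CARD('n)) * r powr real CARD('n)"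
proof -
  have e: "(\<lambda>x. indicator \<Omega> x *\<^sub>R (indicator (ball z r) x :: real)) = indicator (\<Omega> \<inter> ball z r)"
    by (auto simp: indicator_def)
  have fin: "emeasure lebesgue (\<Omega> \<inter> ball z r) \<le> emeasure lebesgue (ball z r)"
    by (intro emeasure_mono) auto
  have fin': "emeasure lebesgue (\<Omega> \<inter> ball z r) < \<infinity>"
    using fin unfolding emeasure_ball_powr(2)[OF assms] by (rule order.strict_trans1) simp
  show "integrable M (\<lambda>x. indicator (ball z r) x :: real)"
  proof (subst integrable_restrict_space)
    show "integrable lebesgue (\<lambda>x. indicator \<Omega> x *\<^sub>R (indicator (ball z r) x :: real))"
      unfolding e using fin' by (intro integrable_real_indicator) auto
  qed simp
  have "(LINT x|M. indicator (ball z r) x) = measure lebesgue (\<Omega> \<inter> ball z r)"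
    by (subst integral_restrict_space) (simp_all only: e, auto)
  also have "\<dots> \<le> unit_ball_vol (real CARD('n)) * r powr real CARD('n)"
    using fin assms unfolding emeasure_ball_powr(2)[OF assms] measure_def
    by (intro enn2real_leI) auto
  finally show "(LINT x|M. indicator (ball z r) x) \<le> unit_ball_vol (real CARD('n)) * r powr real CARD('n)" .
qed

end

context mesh begin

lemma element_dist:
  assumes "T \<in> \<T>" "x \<in> T" "z \<in> T"
  shows "norm (x - z) \<le> diameter T"
  using diameter_bounded_bound[OF compact_imp_bounded[OF element_compact[OF assms(1)]] assms(2,3)] by (simp add: dist_norm)

text \<open>The square of the delta is of size h^(-2d) and lives in a ball of radius 2h. Divided by
  the lower bound \<open>s0\<close> this integrates to h^(-d)/s0: a constant if s is the kernel,
  which is of size h^(-d) on the element, and a negative power of h if s = 1.\<close>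

lemma delta_square:
  fixes d :: "real^'a \<Rightarrow> real" and s :: "real^'a \<Rightarrow> real"
  assumes T: "T \<in> \<T>" "z \<in> interior T" and d: "d \<in> Cc_infinity (interior T)" "\<And>x. \<bar>d x\<bar> \<le> Cd * diameter T powr (- real CARD('a))"
    and h: "0 < h" "diameter T \<le> h" "0 < c" "c * h \<le> diameter T"
    and s: "s \<in> borel_measurable M" "0 < s0" "\<And>x. 0 < s x" "\<And>x. x \<in> T \<Longrightarrow> s0 \<le> s x"
  shows "integrable M (\<lambda>x. (d x)\<^sup>2 / s x)"
    and "(LINT x|M. (d x)\<^sup>2 / s x) \<le> Cd\<^sup>2 * (c * h) powr (- 2 * real CARD('a)) / s0 * (unit_ball_vol (real CARD('a)) * (2 * h) powr real CARD('a))"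
proof -
  let ?d = "real CARD('a)"
  let ?K = "Cd\<^sup>2 * (c * h) powr (- 2 * ?d) / s0"
  have dT: "0 < diameter T" using h by (smt (verit) mult_pos_pos)
  have dm: "d \<in> borel_measurable M" by (rule measurable_M[OF borel_lebesgue_measurable_Cc[OF d(1)]])
  have supp: "d x = 0" if "x \<notin> interior T" for x
    using Cc_infinityE[OF d(1)] that by (metis subsetD)
  have le: "(d x)\<^sup>2 / s x \<le> ?K * indicator (ball z (2 * h)) x" for x
  proof (cases "x \<in> interior T")
    case True
    then have xT: "x \<in> T" using interior_subset by blast
    have "norm (x - z) \<le> h" using element_dist[OF T(1) xT, of z] T(2) interior_subset[of T] h by auto
    then have xb: "x \<in> ball z (2 * h)" using h by (simp add: dist_norm norm_minus_commute)
    have "(d x)\<^sup>2 = \<bar>d x\<bar>\<^sup>2" by simp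
    also have "\<dots> \<le> (Cd * diameter T powr (- ?d))\<^sup>2" by (intro power_mono d(2)) simp
    also have "\<dots> = Cd\<^sup>2 * diameter T powr (- 2 * ?d)"
      by (simp add: power_mult_distrib power2_eq_square[of "_ powr _"] flip: powr_add)
    also have "\<dots> \<le> Cd\<^sup>2 * (c * h) powr (- 2 * ?d)"
      using h by (intro mult_left_mono powr_mono2') auto
    finally have "(d x)\<^sup>2 / s x \<le> Cd\<^sup>2 * (c * h) powr (- 2 * ?d) / s0"
      using s(2) s(4)[of x] xT by (intro frac_le) auto
    then show ?thesis using xb by simp
  next
    case False
    then show ?thesis using supp[OF False] s(2) by simp
  qed
  have r: "0 < 2 * h" using h by simp
  have i: "integrable M (\<lambda>x. ?K * indicator (ball z (2 * h)) x)"
    by (intro integrable_mult_right ball_integral_le(1) r)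
  show i2: "integrable M (\<lambda>x. (d x)\<^sup>2 / s x)"
  proof (rule Bochner_Integration.integrable_bound[OF i])
    show "(\<lambda>x. (d x)\<^sup>2 / s x) \<in> borel_measurable M" by (intro borel_measurable_divide borel_measurable_power dm s(1))
    show "AE x in M. norm ((d x)\<^sup>2 / s x) \<le> norm (?K * indicator (ball z (2 * h)) x)"
    proof (rule AE_I2)
      fix x
      have "norm ((d x)\<^sup>2 / s x) = (d x)\<^sup>2 / s x" using s(3)[of x] by simp
      also have "\<dots> \<le> ?K * indicator (ball z (2 * h)) x" by (rule le)
      also have "\<dots> \<le> norm (?K * indicator (ball z (2 * h)) x)" by (simp only: real_norm_def abs_ge_self)
      finally show "norm ((d x)\<^sup>2 / s x) \<le> norm (?K * indicator (ball z (2 * h)) x)" .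
    qed
  qed
  have "(LINT x|M. (d x)\<^sup>2 / s x) \<le> (LINT x|M. ?K * indicator (ball z (2 * h)) x)"
    by (intro integral_mono i i2 le)
  also have "\<dots> = ?K * (LINT x|M. indicator (ball z (2 * h)) x)" by simp
  also have "\<dots> \<le> ?K * (unit_ball_vol ?d * (2 * h) powr ?d)"
    using s(2) by (intro mult_left_mono ball_integral_le(2) r) auto
  finally show "(LINT x|M. (d x)\<^sup>2 / s x) \<le> ?K * (unit_ball_vol ?d * (2 * h) powr ?d)" .
qed

end

context fe begin

text \<open>The Green problem is tested with \<open>uh\<close>, then the two projection identities
  are applied in turn; each discrete pressure term vanishes by the discrete incompressibility of the
  other velocity. The continuous terms b(u, S) and b(G, \<pi>) are zero and complete the difference
  between \<open>Gh\<close> and \<open>G\<close>.\<close>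

lemma green_representation:
  assumes T: "z \<in> interior T"
    and repr: "\<And>v. v \<in> V \<Longrightarrow> (LINT x:\<Omega>|lebesgue. d x * wgrad \<Omega> v x $ j $ i) = pderivative i v z $ j"
    and G: "is_green_pair \<Omega> d i j G S" and Gh: "is_stokes_projection \<Omega> V Q G S Gh Sh"
    and u: "u \<in> W1p0 2 (\<lambda>_. 1) \<Omega>" "\<And>q. q \<in> Lp_mod_R 2 (\<lambda>_. 1) \<Omega> \<Longrightarrow> b_form \<Omega> u q = 0"
    and \<pi>: "\<pi> \<in> Lp_mod_R 2 (\<lambda>_. 1) \<Omega>" and uh: "is_stokes_projection \<Omega> V Q u \<pi> uh \<pi>h"
  shows "pderivative i uh z $ j = (LINT x|M. d x * wgrad \<Omega> u x $ j $ i)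
    + ((a_form \<Omega> u Gh + b_form \<Omega> Gh \<pi>) - (a_form \<Omega> u G + b_form \<Omega> G \<pi>))"
proof -
  have uhV: "uh \<in> V" "\<pi>h \<in> Q" and GhV: "Gh \<in> V" "Sh \<in> Q"
    using uh Gh by (auto simp: is_stokes_projection_def)
  have "pderivative i uh z $ j = (LINT x:\<Omega>|lebesgue. d x * wgrad \<Omega> uh x $ j $ i)"
    using repr[OF uhV(1)] by simp
  also have "\<dots> = a_form \<Omega> G uh + b_form \<Omega> uh S"
    using G V_W1p0[OF uhV(1) weight_on_one, of 2] by (simp add: is_green_pair_def)
  also have "\<dots> = a_form \<Omega> Gh uh + b_form \<Omega> uh Sh"
    using Gh uhV by (simp add: is_stokes_projection_def)
  also have "b_form \<Omega> uh Sh = 0" using uh GhV by (simp add: is_stokes_projection_def)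
  also have "a_form \<Omega> Gh uh + 0 = a_form \<Omega> uh Gh + b_form \<Omega> Gh \<pi>h"
    using Gh uhV by (simp add: is_stokes_projection_def a_form_commute)
  also have "\<dots> = a_form \<Omega> u Gh + b_form \<Omega> Gh \<pi>"
    using uh GhV by (simp add: is_stokes_projection_def)
  finally have 1: "pderivative i uh z $ j = a_form \<Omega> u Gh + b_form \<Omega> Gh \<pi>" .
  have "a_form \<Omega> G u + b_form \<Omega> u S = (LINT x:\<Omega>|lebesgue. d x * wgrad \<Omega> u x $ j $ i)"
    using G u(1) by (simp add: is_green_pair_def)
  moreover have "b_form \<Omega> u S = 0" using G u(2) by (simp add: is_green_pair_def)
  moreover have "b_form \<Omega> G \<pi> = 0" using G \<pi> by (simp add: is_green_pair_def)
  ultimately show ?thesis using 1 by (simp add: a_form_commute set_lint_eq)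
qed

lemma entry_le_sizeF: "\<bar>wgrad \<Omega> u x $ j $ i\<bar> \<le> data_size u \<pi> x"
proof -
  have "\<bar>wgrad \<Omega> u x $ j $ i\<bar> \<le> norm (wgrad \<Omega> u x)"
    by (intro order_trans[OF component_le_norm_cart Finite_Cartesian_Product.norm_nth_le])
  then show ?thesis by (simp add: data_size_def)
qed

lemma delta_term_le:
  assumes u: "u \<in> H1" and g: "\<pi> \<in> L2" and d: "d \<in> borel_measurable M" and i: "integrable M (\<lambda>x. \<bar>d x\<bar> * \<bar>data_size u \<pi> x\<bar>)"
  shows "\<bar>LINT x|M. d x * wgrad \<Omega> u x $ j $ i\<bar> \<le> (LINT x|M. \<bar>d x\<bar> * \<bar>data_size u \<pi> x\<bar>)"
proof -
  have m: "(\<lambda>x. d x * wgrad \<Omega> u x $ j $ i) \<in> borel_measurable M"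
    by (intro borel_measurable_times d borel_measurable_continuous_on[where f = "\<lambda>A. A $ j $ i", OF _ wgrad_measurable_W1p[OF u]])
       (intro continuous_intros)
  have le: "norm (d x * wgrad \<Omega> u x $ j $ i) \<le> \<bar>d x\<bar> * \<bar>data_size u \<pi> x\<bar>" for x
    using entry_le_sizeF[of u x j i \<pi>] by (auto simp: abs_mult intro!: mult_left_mono)
  have "integrable M (\<lambda>x. d x * wgrad \<Omega> u x $ j $ i)"
    by (rule Bochner_Integration.integrable_bound[OF i m]) (use le in auto)
  then have "norm (LINT x|M. d x * wgrad \<Omega> u x $ j $ i) \<le> (LINT x|M. \<bar>d x\<bar> * \<bar>data_size u \<pi> x\<bar>)"
    using le by (intro Bochner_Integration.integral_norm_bound_integral i) auto
  then show ?thesis by simp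
qed

end

section \<open>The kernel operator in A_1-weighted spaces\<close>

context bounded_open begin

lemma kern_mass:
  fixes z :: "real^'n"
  assumes "0 < \<kappa>" "0 < h" "0 < l"
  defines "A \<equiv> 2 powr (real CARD('n) + l) * \<kappa> powr (- l) * unit_ball_vol (real CARD('n)) / (1 - 2 powr (- l))"
  shows "(LINT x|M. kern \<kappa> h l z x) \<le> A"
proof -
  have A0: "0 \<le> A"
    using assms(3) powr_less_mono[of "- l" 0 "2::real"] by (auto simp: A_def intro!: divide_nonneg_nonneg)
  have "(\<integral>\<^sup>+x. ennreal (kern \<kappa> h l z x) \<partial>M) = (\<integral>\<^sup>+x\<in>\<Omega>. ennreal (kern \<kappa> h l z x) \<partial>lebesgue)"
    by (subst nn_integral_restrict_space) auto
  also have "\<dots> \<le> (\<integral>\<^sup>+x. ennreal (kern \<kappa> h l x z * 1) \<partial>lebesgue)"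
    by (intro nn_integral_mono) (auto simp: kern_commute[of _ _ _ z] split: split_indicator)
  also have "\<dots> \<le> ennreal A"
    unfolding A_def
  proof (rule kern_nn_integral[OF assms(1-3)])
    fix r :: real assume r: "0 < r"
    have "(\<integral>\<^sup>+x\<in>ball z r. ennreal 1 \<partial>lebesgue) = emeasure lebesgue (ball z r)" by simp
    then show "(\<integral>\<^sup>+x\<in>ball z r. ennreal 1 \<partial>lebesgue) \<le> ennreal (unit_ball_vol (real CARD('n)) * r powr real CARD('n))"
      using r by (simp only: emeasure_ball_powr)
  qed auto
  finally have le: "(\<integral>\<^sup>+x. ennreal (kern \<kappa> h l z x) \<partial>M) \<le> ennreal A" .
  have "(LINT x|M. kern \<kappa> h l z x) = enn2real (\<integral>\<^sup>+x. ennreal (kern \<kappa> h l z x) \<partial>M)"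
    by (rule integral_eq_nn_integral) (auto simp: kern_nonneg intro: kern_measurable_M)
  also have "\<dots> \<le> A" using le A0 by (rule enn2real_leI[rotated])
  finally show ?thesis .
qed

text \<open>Hoelder's inequality with exponent p/2 for the measure with density \<open>kern\<close>,
  whose mass is at most A. This step confines the direct argument to p \<ge> 2; at p = 2 the
  conjugate exponent degenerates, and A > 0 makes \<open>A powr 0\<close> equal to 1.\<close>

lemma kern_Jensen:
  fixes F :: "real^'n \<Rightarrow> real"
  assumes k: "0 < \<kappa>" "0 < h" "0 < l" and p: "2 \<le> p" and F: "F \<in> borel_measurable M" "\<And>x. 0 \<le> F x"
    and Fp: "integrable M (\<lambda>x. F x powr p)" and A: "0 < A" "(LINT x|M. kern \<kappa> h l z x) \<le> A"
  shows "(LINT x|M. kern \<kappa> h l z x * (F x)\<^sup>2) powr (p / 2) \<le> A powr (p / 2 - 1) * (LINT x|M. kern \<kappa> h l z x * F x powr p)"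
proof -
  define q where "q = p / 2"
  have F2: "(F x)\<^sup>2 = F x powr 2" for x using F(2)[of x] by (simp add: powr_numeral)
  have T0: "0 \<le> (LINT x|M. kern \<kappa> h l z x * F x powr p)"
    by (intro Bochner_Integration.integral_nonneg) (simp add: kern_nonneg)
  show ?thesis
  proof (cases "p = 2")
    case True
    have "0 \<le> (LINT x|M. kern \<kappa> h l z x * F x powr 2)"
      by (intro Bochner_Integration.integral_nonneg) (simp add: kern_nonneg)
    then show ?thesis using True A(1) by (simp add: F2)
  next
    case False
    then have q: "1 < q" using p by (simp add: q_def)
    let ?f = "\<lambda>x. kern \<kappa> h l z x powr (1/q) * F x powr 2" and ?g = "\<lambda>x. kern \<kappa> h l z x powr (1 / conj_exp q)"
    have c1: "1 < conj_exp q" using q by (rule conj_exp_gt_1)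
    have km: "(\<lambda>x. kern \<kappa> h l z x) \<in> borel_measurable M" by (rule kern_measurable_M)
    have fq: "?f x powr q = kern \<kappa> h l z x * F x powr p" for x
      using q by (simp add: powr_mult powr_powr kern_nonneg q_def)
    have gq: "?g x powr conj_exp q = kern \<kappa> h l z x" for x
      using c1 by (simp add: powr_powr kern_nonneg)
    have "1/q + 1 / conj_exp q = 1" using q by (simp add: conj_exp_def field_simps)
    then have fg: "?f x * ?g x = kern \<kappa> h l z x * F x powr 2" for x
      using kern_nonneg[of \<kappa> h l z x] by (simp add: mult.assoc mult.left_commute[of _ "F x powr 2"] flip: powr_add)
    have i1: "integrable M (\<lambda>x. ?f x powr q)" unfolding fq by (rule kern_integrable[OF k Fp])
    have i2: "integrable M (\<lambda>x. ?g x powr conj_exp q)" unfolding gq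
      using kern_integrable[OF k const_integrable[of 1], of z] by simp
    have "(LINT x|M. ?f x * ?g x) \<le> (LINT x|M. ?f x powr q) powr (1/q) * (LINT x|M. ?g x powr conj_exp q) powr (1 / conj_exp q)"
    proof (rule Holder_powr(2)[OF q refl _ _ i1 _ _ i2])
      show "?f \<in> borel_measurable M" using km F(1) by measurable
      show "?g \<in> borel_measurable M" using km by measurable
    qed auto
    then have "(LINT x|M. kern \<kappa> h l z x * F x powr 2)
      \<le> (LINT x|M. kern \<kappa> h l z x * F x powr p) powr (1/q) * (LINT x|M. kern \<kappa> h l z x) powr (1 / conj_exp q)"
      unfolding fg fq gq .
    also have "\<dots> \<le> (LINT x|M. kern \<kappa> h l z x * F x powr p) powr (1/q) * A powr (1 / conj_exp q)"
      using A c1 by (intro mult_left_mono powr_mono2 Bochner_Integration.integral_nonneg) (auto simp: kern_nonneg)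
    finally have "(LINT x|M. kern \<kappa> h l z x * F x powr 2) powr q
      \<le> ((LINT x|M. kern \<kappa> h l z x * F x powr p) powr (1/q) * A powr (1 / conj_exp q)) powr q"
      using q by (intro powr_mono2 Bochner_Integration.integral_nonneg) (auto simp: kern_nonneg)
    also have "\<dots> = (LINT x|M. kern \<kappa> h l z x * F x powr p) * A powr (q / conj_exp q)"
      using q T0 by (simp add: powr_mult powr_powr)
    also have "q / conj_exp q = q - 1" using q by (simp add: conj_exp_def)
    finally show ?thesis by (simp add: F2 q_def mult.commute)
  qed
qed

text \<open>After Jensen's inequality, Tonelli's theorem isolates the integral of kernel times
  \<omega> in z, which the A_1 estimate bounds by B \<omega>(x). Neither A nor B involves h, which
  makes the constant uniform over the meshes.\<close>

lemma kern_operator_bound: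
  assumes k: "0 < \<kappa>" "0 < l" and p: "2 \<le> p" and w: "weight_on \<omega>" and c: "0 < c" "AE x in M. c \<le> \<omega> x"
    and A1: "\<omega> \<in> A1" and K: "0 \<le> K"
  obtains C where "0 \<le> C" "\<And>h F g. 0 < h \<Longrightarrow> F \<in> Lp p \<omega> \<Omega> \<Longrightarrow> (\<And>x. 0 \<le> F x) \<Longrightarrow> (g :: real^'n \<Rightarrow> real) \<in> borel_measurable M \<Longrightarrow>
     (AE z in M. (g z)\<^sup>2 \<le> K * (LINT x|M. kern \<kappa> h l z x * (F x)\<^sup>2)) \<Longrightarrow> Lp_norm p \<omega> \<Omega> g \<le> C * Lp_norm p \<omega> \<Omega> F"
proof -
  let ?d = "real CARD('n)"
  define A where "A = 1 + 2 powr (?d + l) * \<kappa> powr (- l) * unit_ball_vol ?d / (1 - 2 powr (- l))"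
  have l1: "2 powr (- l) < (1::real)" using k powr_less_mono[of "- l" 0 "2::real"] by simp
  have A: "0 < A" using l1 by (auto simp: A_def intro!: add_pos_nonneg divide_nonneg_nonneg)
  obtain K1 where K1: "0 \<le> K1" "AE y in lebesgue. \<forall>r>0. (\<integral>\<^sup>+z\<in>ball y r. ennreal (\<omega> z) \<partial>lebesgue) \<le> ennreal (K1 * \<omega> y * r powr ?d)"
    by (rule A1_maximal[OF A1])
  define B where "B = 2 powr (?d + l) * \<kappa> powr (- l) * K1 / (1 - 2 powr (- l))"
  have B: "0 \<le> B" using l1 K1 by (auto simp: B_def intro!: divide_nonneg_nonneg)
  define c1 where "c1 = K powr (p/2) * A powr (p/2 - 1)"
  have c10: "0 \<le> c1" by (simp add: c1_def)
  have p0: "0 < p" using p by simp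
  have main: "Lp_norm p \<omega> \<Omega> g \<le> (c1 * B) powr (1/p) * Lp_norm p \<omega> \<Omega> F"
    if h: "0 < h" and F: "F \<in> Lp p \<omega> \<Omega>" "\<And>x. 0 \<le> F x" and g: "g \<in> borel_measurable M"
      and le: "AE z in M. (g z)\<^sup>2 \<le> K * (LINT x|M. kern \<kappa> h l z x * (F x)\<^sup>2)" for h F and g :: "real^'n \<Rightarrow> real"
  proof -
    have Fm: "F \<in> borel_measurable M" and Fi: "integrable M (\<lambda>x. F x powr p * \<omega> x)"
      using F by (auto simp: Lp_iff)
    \<comment> \<open>The lower bound on \<omega> puts F^p into unweighted L^1, so that the kernel
      integrals converge; a divergent Bochner integral would be given the value 0.\<close>
    obtain C0 where "embeds p \<omega> p (\<lambda>_. 1) C0"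
      using embedsI[OF _ order_refl w weight_on_one c(1,2), of p 1] p by auto
    from embedsD(1)[OF this F(1)] have Fp: "integrable M (\<lambda>x. F x powr p)"
      using F(2) by (simp add: Lp_iff)
    have wm: "\<omega> \<in> borel_measurable M" by (rule weight_onD(2)[OF w])
    let ?T = "\<lambda>z. LINT x|M. kern \<kappa> h l z x * F x powr p"
    have gp: "AE z in M. \<bar>g z\<bar> powr p * \<omega> z \<le> c1 * ?T z * \<omega> z"
      using le
    proof eventually_elim
      case (elim z)
      have "\<bar>g z\<bar> powr p = ((g z)\<^sup>2) powr (p/2)"
      proof -
        have "(g z)\<^sup>2 = \<bar>g z\<bar> powr 2" by (simp add: powr_numeral)
        then show ?thesis by (simp only: powr_powr) simp
      qed
      also have "\<dots> \<le> (K * (LINT x|M. kern \<kappa> h l z x * (F x)\<^sup>2)) powr (p/2)"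
        using elim p by (intro powr_mono2) auto
      also have "\<dots> = K powr (p/2) * (LINT x|M. kern \<kappa> h l z x * (F x)\<^sup>2) powr (p/2)"
        by (rule powr_mult)
      also have "\<dots> \<le> K powr (p/2) * (A powr (p/2 - 1) * ?T z)"
      proof (intro mult_left_mono kern_Jensen[OF k(1) h k(2) p Fm F(2) Fp A])
        show "(LINT x|M. kern \<kappa> h l z x) \<le> A" using kern_mass[OF k(1) h k(2), of z] by (simp add: A_def)
      qed simp
      finally have "\<bar>g z\<bar> powr p \<le> c1 * ?T z" by (simp add: c1_def mult_ac)
      then show ?case using weight_onD(1)[OF w] by (intro mult_right_mono)
    qed
    interpret M: finite_measure M by (rule finite_M)
    interpret MM: pair_sigma_finite M M ..
    let ?k = "\<lambda>z x. ennreal (kern \<kappa> h l z x * F x powr p * \<omega> z)"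
    have id1: "(\<lambda>x. fst x) \<in> borel_measurable (M \<Otimes>\<^sub>M M)" "(\<lambda>x. snd x) \<in> borel_measurable (M \<Otimes>\<^sub>M M)"
      by (rule measurable_compose[OF measurable_fst measurable_M[OF id_borel_lebesgue]],
          rule measurable_compose[OF measurable_snd measurable_M[OF id_borel_lebesgue]])
    have Fs: "(\<lambda>x. F (snd x)) \<in> borel_measurable (M \<Otimes>\<^sub>M M)" by (rule measurable_compose[OF measurable_snd Fm])
    have Fsp: "(\<lambda>x. F (snd x) powr p) \<in> borel_measurable (M \<Otimes>\<^sub>M M)" using Fs by measurable
    have wf: "(\<lambda>x. \<omega> (fst x)) \<in> borel_measurable (M \<Otimes>\<^sub>M M)" by (rule measurable_compose[OF measurable_fst wm])
    have km: "(\<lambda>(z, x). ?k z x) \<in> borel_measurable (M \<Otimes>\<^sub>M M)"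
      unfolding case_prod_unfold
      by (intro measurable_compose[OF _ measurable_ennreal] borel_measurable_times kern_measurable id1 wf
          Fsp)
    have inner: "AE x in M. (\<integral>\<^sup>+z. ?k z x \<partial>M) \<le> ennreal (B * (F x powr p * \<omega> x))"
    proof (subst AE_M_iff[symmetric])
      show "AE x\<in>\<Omega> in lebesgue. (\<integral>\<^sup>+z. ?k z x \<partial>M) \<le> ennreal (B * (F x powr p * \<omega> x))"
        using K1(2)
      proof eventually_elim
        case (elim x)
        have "(\<integral>\<^sup>+z. ?k z x \<partial>M) = (\<integral>\<^sup>+z. ennreal (F x powr p) * ennreal (kern \<kappa> h l z x * \<omega> z) \<partial>M)"
          using weight_onD(1)[OF w] by (intro nn_integral_cong) (simp add: ennreal_mult[symmetric] kern_nonneg mult_ac)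
        also have "\<dots> = ennreal (F x powr p) * (\<integral>\<^sup>+z. ennreal (kern \<kappa> h l z x * \<omega> z) \<partial>M)"
          by (intro nn_integral_cmult measurable_compose[OF _ measurable_ennreal] borel_measurable_times wm
              kern_measurable measurable_M[OF id_borel_lebesgue]) auto
        also have "\<dots> \<le> ennreal (F x powr p) * ennreal (B * \<omega> x)"
        proof (rule mult_left_mono)
          have "(\<integral>\<^sup>+z. ennreal (kern \<kappa> h l z x * \<omega> z) \<partial>M) \<le> (\<integral>\<^sup>+z. ennreal (kern \<kappa> h l z x * \<omega> z) \<partial>lebesgue)"
            by (subst nn_integral_restrict_space) (auto intro!: nn_integral_mono split: split_indicator)
          also have "\<dots> \<le> ennreal (2 powr (?d + l) * \<kappa> powr (- l) * (K1 * \<omega> x) / (1 - 2 powr (- l)))"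
            using elim w K1(1) by (intro kern_nn_integral k h) (auto simp: weight_on_def)
          also have "2 powr (?d + l) * \<kappa> powr (- l) * (K1 * \<omega> x) / (1 - 2 powr (- l)) = B * \<omega> x"
            by (simp add: B_def)
          finally show "(\<integral>\<^sup>+z. ennreal (kern \<kappa> h l z x * \<omega> z) \<partial>M) \<le> ennreal (B * \<omega> x)" .
        qed simp
        also have "\<dots> = ennreal (B * (F x powr p * \<omega> x))"
          using B weight_onD(1)[OF w] by (simp add: ennreal_mult[symmetric] mult_ac)
        finally show ?case by simp
      qed
    qed
    have outer: "ennreal (c1 * ?T z * \<omega> z) = ennreal c1 * (\<integral>\<^sup>+x. ?k z x \<partial>M)" for z
    proof -
      have "(\<integral>\<^sup>+x. ?k z x \<partial>M) = ennreal (LINT x|M. kern \<kappa> h l z x * F x powr p * \<omega> z)"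
        using kern_integrable[OF k(1) h k(2) Fp] weight_onD(1)[OF w]
        by (intro nn_integral_eq_integral) (auto simp: kern_nonneg)
      also have "\<dots> = ennreal (?T z * \<omega> z)" by simp
      finally have e: "(\<integral>\<^sup>+x. ?k z x \<partial>M) = ennreal (?T z * \<omega> z)" .
      have "0 \<le> ?T z" by (intro Bochner_Integration.integral_nonneg) (simp add: kern_nonneg)
      then have "0 \<le> ?T z * \<omega> z" using weight_onD(1)[OF w, of z] by simp
      then show ?thesis unfolding e using c10 by (simp add: ennreal_mult mult.assoc)
    qed
    have "(\<integral>\<^sup>+z. ennreal (\<bar>g z\<bar> powr p * \<omega> z) \<partial>M) \<le> (\<integral>\<^sup>+z. ennreal c1 * (\<integral>\<^sup>+x. ?k z x \<partial>M) \<partial>M)"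
      using gp by (intro nn_integral_mono_AE) (auto simp: outer[symmetric] intro: ennreal_leI)
    also have "\<dots> = ennreal c1 * (\<integral>\<^sup>+z. (\<integral>\<^sup>+x. ?k z x \<partial>M) \<partial>M)"
      using km by (intro nn_integral_cmult M.borel_measurable_nn_integral)
    also have "(\<integral>\<^sup>+z. (\<integral>\<^sup>+x. ?k z x \<partial>M) \<partial>M) = (\<integral>\<^sup>+x. (\<integral>\<^sup>+z. ?k z x \<partial>M) \<partial>M)"
      using MM.Fubini'[OF km] by simp
    also have "\<dots> \<le> (\<integral>\<^sup>+x. ennreal (B * (F x powr p * \<omega> x)) \<partial>M)"
      using inner by (rule nn_integral_mono_AE)
    also have "\<dots> = ennreal (B * (LINT x|M. F x powr p * \<omega> x))"
      using Fi B weight_onD(1)[OF w] by (subst nn_integral_eq_integral) auto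
    finally have fin: "(\<integral>\<^sup>+z. ennreal (\<bar>g z\<bar> powr p * \<omega> z) \<partial>M) \<le> ennreal c1 * ennreal (B * (LINT x|M. F x powr p * \<omega> x))"
      by (simp add: mult_left_mono)
    have I0: "0 \<le> (LINT x|M. F x powr p * \<omega> x)" using weight_onD(1)[OF w] by (intro Bochner_Integration.integral_nonneg) auto
    have fin': "(\<integral>\<^sup>+z. ennreal (\<bar>g z\<bar> powr p * \<omega> z) \<partial>M) \<le> ennreal (c1 * B * (LINT x|M. F x powr p * \<omega> x))"
      using fin c10 B I0 by (simp add: ennreal_mult[symmetric] mult.assoc)
    have "(LINT z|M. \<bar>g z\<bar> powr p * \<omega> z) = enn2real (\<integral>\<^sup>+z. ennreal (\<bar>g z\<bar> powr p * \<omega> z) \<partial>M)"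
      using weight_onD(1)[OF w] Lp_integrand_measurable[OF w g, of p] by (intro integral_eq_nn_integral) auto
    also have "\<dots> \<le> c1 * B * (LINT x|M. F x powr p * \<omega> x)"
      using fin' c10 B I0 by (intro enn2real_leI) auto
    finally have "(LINT z|M. \<bar>g z\<bar> powr p * \<omega> z) powr (1/p) \<le> (c1 * B * (LINT x|M. F x powr p * \<omega> x)) powr (1/p)"
      using p0 weight_onD(1)[OF w] by (intro powr_mono2 Bochner_Integration.integral_nonneg) auto
    then show ?thesis using c10 B I0 F(2) by (simp add: Lp_norm_eq powr_mult)
  qed
  show thesis by (rule that[OF _ main]) auto
qed

end

section \<open>The discrete velocity gradient at a point\<close>

context fe begin

lemma sum_square_le: "(a + b)\<^sup>2 \<le> 2 * a\<^sup>2 + 2 * (b::real)\<^sup>2"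
  using zero_le_power2[of "a - b"] by (simp add: power2_eq_square algebra_simps)

text \<open>\<open>Kd\<close> comes from the delta term: on the element \<sigma> \<le>
  (1+\<kappa>)h, so the kernel is at least (1+\<kappa>)^(-d-l) h^(-d), and all powers of h cancel
  against the squared delta and the volume of its support. The Green error contributes the square of
  \<open>Cg\<close>, since h^(-l) (h^(l/2))^2 = 1; the factor (1+d)^2 comes from the forms and 2
  from the square of a sum.\<close>

lemma pointwise_bound_fine_mesh:
  fixes c Cd Cg \<kappa> l :: real
  defines "Kd \<equiv> Cd\<^sup>2 * c powr (- 2 * real CARD('n)) * (1 + \<kappa>) powr (real CARD('n) + l) * (unit_ball_vol (real CARD('n)) * 2 powr real CARD('n))"
  assumes T: "T \<in> \<T>" "z \<in> interior T"
    and d: "d \<in> Cc_infinity (interior T)" "\<And>x. \<bar>d x\<bar> \<le> Cd * diameter T powr (- real CARD('n))"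
    and h: "0 < h" "diameter T \<le> h" "0 < c" "c * h \<le> diameter T" and k: "0 < \<kappa>" "0 < l"
    and repr: "\<And>v. v \<in> V \<Longrightarrow> (LINT x:\<Omega>|lebesgue. d x * wgrad \<Omega> v x $ j $ i) = pderivative i v z $ j"
    and G: "is_green_pair \<Omega> d i j G S" and Gh: "is_stokes_projection \<Omega> V Q G S Gh Sh"
    and est: "Lp_norm 2 (\<lambda>_. 1) \<Omega> (\<lambda>x. sigma \<kappa> h z x powr ((real CARD('n) + l) / 2) *\<^sub>R wgrad \<Omega> (\<lambda>y. G y - Gh y) x) \<le> Cg * h powr (l / 2)"
    and u: "u \<in> W1p0 2 (\<lambda>_. 1) \<Omega>" "\<And>q. q \<in> Lp_mod_R 2 (\<lambda>_. 1) \<Omega> \<Longrightarrow> b_form \<Omega> u q = 0"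
    and \<pi>: "\<pi> \<in> Lp_mod_R 2 (\<lambda>_. 1) \<Omega>" and uh: "is_stokes_projection \<Omega> V Q u \<pi> uh \<pi>h"
  shows "(pderivative i uh z $ j)\<^sup>2 \<le> 2 * (Kd + (1 + real CARD('n))\<^sup>2 * Cg\<^sup>2) * (LINT x|M. kern \<kappa> h l z x * (data_size u \<pi> x)\<^sup>2)"
proof -
  let ?n = "real CARD('n)"
  let ?F = "data_size u \<pi>" and ?s = "\<lambda>x. kern \<kappa> h l z x"
  let ?I = "LINT x|M. ?s x * (?F x)\<^sup>2"
  have I0: "0 \<le> ?I" by (intro Bochner_Integration.integral_nonneg) (simp add: kern_nonneg)
  have uH: "u \<in> H1" using u(1) by (rule W1p0_W1p)
  have \<pi>L: "\<pi> \<in> L2" using \<pi> by (simp add: Lp_mod_R_def)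
  have GH: "G \<in> H1" using G W1p0_W1p by (auto simp: is_green_pair_def)
  have GhV: "Gh \<in> V" using Gh by (simp add: is_stokes_projection_def)
  have GhH: "Gh \<in> H1" using GhV by (rule V_H1)
  have FL: "?F \<in> L2" by (rule data_size_Lp(1)[OF weight_on_one _ W1pD(3)[OF uH] \<pi>L]) simp
  then have Fm: "?F \<in> borel_measurable M" and F2: "integrable M (\<lambda>x. (?F x)\<^sup>2)" by (auto simp: L2_iff)
  have sm: "?s \<in> borel_measurable M" by (rule kern_measurable_M)
  have sp: "0 < ?s x" for x by (rule kern_pos[OF k(1) h(1)])
  have si: "integrable M (\<lambda>x. ?s x * (?F x)\<^sup>2)" by (rule kern_integrable[OF k(1) h(1) k(2) F2])
  have dm: "d \<in> borel_measurable M" by (rule measurable_M[OF borel_lebesgue_measurable_Cc[OF d(1)]])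
  define s0 where "s0 = h powr l * ((1 + \<kappa>) * h) powr (- (?n + l))"
  have s0: "0 < s0" using h k by (simp add: s0_def)
  have s0_le: "s0 \<le> ?s x" if "x \<in> T" for x
  proof -
    have "norm (x - z) \<le> diameter T" using element_dist[OF T(1) that, of z] T(2) interior_subset by blast
    then have "norm (x - z) + \<kappa> * h \<le> (1 + \<kappa>) * h" using h by (simp add: algebra_simps)
    then show ?thesis unfolding s0_def by (rule kern_ge[OF k(1) h(1) k(2)])
  qed
  note D = delta_square[OF T d h sm s0 sp s0_le]
  have Kd: "Cd\<^sup>2 * (c * h) powr (- 2 * ?n) / s0 * (unit_ball_vol ?n * (2 * h) powr ?n) = Kd"
  proof -
    have "1 / s0 = h powr (- l) * ((1 + \<kappa>) * h) powr (?n + l)"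
      unfolding s0_def powr_minus by (simp add: divide_inverse)
    also have "\<dots> = (1 + \<kappa>) powr (?n + l) * (h powr (- l) * h powr (?n + l))"
      by (subst powr_mult) (simp add: mult_ac)
    finally have "Cd\<^sup>2 * (c * h) powr (- 2 * ?n) / s0 * (unit_ball_vol ?n * (2 * h) powr ?n)
      = Cd\<^sup>2 * (c * h) powr (- 2 * ?n) * ((1 + \<kappa>) powr (?n + l) * (h powr (- l) * h powr (?n + l))) * (unit_ball_vol ?n * (2 * h) powr ?n)"
      by (metis (no_types, opaque_lifting) times_divide_eq_right mult.right_neutral)
    also have "\<dots> = Kd * (h powr (- 2 * ?n) * (h powr (- l) * (h powr (?n + l) * h powr ?n)))"
      using h by (simp add: Kd_def powr_mult mult_ac)
    also have "h powr (- 2 * ?n) * (h powr (- l) * (h powr (?n + l) * h powr ?n)) = 1"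
      using h by (simp flip: powr_add)
    finally show ?thesis by simp
  qed
  have d1: "(LINT x|M. \<bar>d x\<bar> * \<bar>?F x\<bar>)\<^sup>2 \<le> Kd * ?I"
  proof -
    have "(LINT x|M. \<bar>d x\<bar> * \<bar>?F x\<bar>)\<^sup>2 \<le> (LINT x|M. (d x)\<^sup>2 / ?s x) * ?I"
      by (rule Cauchy_Schwarz_weighted(2)[OF dm Fm sm sp D(1) si])
    also have "\<dots> \<le> Kd * ?I" using D(2) I0 unfolding Kd by (rule mult_right_mono)
    finally show ?thesis .
  qed
  let ?t1 = "LINT x|M. d x * wgrad \<Omega> u x $ j $ i"
  have t1: "?t1\<^sup>2 \<le> Kd * ?I"
  proof -
    have "\<bar>?t1\<bar> \<le> (LINT x|M. \<bar>d x\<bar> * \<bar>?F x\<bar>)"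
      by (rule delta_term_le[OF uH \<pi>L dm Cauchy_Schwarz_weighted(1)[OF dm Fm sm sp D(1) si]])
    then have "\<bar>?t1\<bar>\<^sup>2 \<le> (LINT x|M. \<bar>d x\<bar> * \<bar>?F x\<bar>)\<^sup>2" by (intro power_mono) auto
    then show ?thesis using d1 by simp
  qed
  define E where "E x = norm (wgrad \<Omega> (\<lambda>y. G y - Gh y) x)" for x
  have WD: "(\<lambda>y. G y - Gh y) \<in> H1" "AE x in M. wgrad \<Omega> (\<lambda>y. G y - Gh y) x = wgrad \<Omega> G x - wgrad \<Omega> Gh x"
    by (rule W1p_diff[OF weight_on_one _ GH GhH]; simp)+
  have WDm: "wgrad \<Omega> (\<lambda>y. G y - Gh y) \<in> borel_measurable M" by (rule wgrad_measurable_W1p[OF WD(1)])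
  have Em: "E \<in> borel_measurable M" unfolding E_def[abs_def] by (rule measurable_compose[OF WDm borel_measurable_norm])
  have EL: "E \<in> L2"
    using W1pD(3)[OF WD(1)] Lp_iff_norm[of "wgrad \<Omega> (\<lambda>y. G y - Gh y)"] by (simp add: E_def[abs_def])
  have Es: "(E x)\<^sup>2 / ?s x = h powr (- l) * (sigma \<kappa> h z x powr (?n + l) * (E x)\<^sup>2)" for x
    unfolding kern_def powr_minus by (simp add: divide_inverse mult_ac)
  have sq: "(norm (sigma \<kappa> h z x powr ((?n + l) / 2) *\<^sub>R wgrad \<Omega> (\<lambda>y. G y - Gh y) x))\<^sup>2 = sigma \<kappa> h z x powr (?n + l) * (E x)\<^sup>2" for x
  proof -
    have "(sigma \<kappa> h z x powr ((?n + l) / 2))\<^sup>2 = sigma \<kappa> h z x powr (?n + l)"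
      by (simp add: power2_eq_square flip: powr_add)
    then show ?thesis by (simp add: power_mult_distrib E_def)
  qed
  obtain r where r: "\<And>x. x \<in> \<Omega> \<Longrightarrow> norm (x - z) \<le> r"
  proof -
    obtain x0 r where "\<Omega> \<subseteq> ball x0 r" by (rule dom_in_ball)
    then have "norm (x - z) \<le> r + norm (x0 - z)" if "x \<in> \<Omega>" for x
      using that norm_triangle_ineq[of "x - x0" "x0 - z"] by (auto simp: dist_norm norm_minus_commute dest!: subsetD)
    then show thesis by (rule that)
  qed
  \<comment> \<open>Only finiteness is at stake: \<sigma> is bounded on the bounded set \<Omega>, by
    a bound that may depend on h. The uniform estimate comes afterwards from (G).\<close>
  have Ei: "integrable M (\<lambda>x. (E x)\<^sup>2 / ?s x)"
  proof (rule Bochner_Integration.integrable_bound)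
    show "integrable M (\<lambda>x. (h powr (- l) * (r + \<kappa> * h) powr (?n + l)) * (E x)\<^sup>2)" using EL by (simp add: L2_iff)
    show "(\<lambda>x. (E x)\<^sup>2 / ?s x) \<in> borel_measurable M" by (intro borel_measurable_divide borel_measurable_power Em sm)
    show "AE x in M. norm ((E x)\<^sup>2 / ?s x) \<le> norm (h powr (- l) * (r + \<kappa> * h) powr (?n + l) * (E x)\<^sup>2)"
      using AE_space[of M]
    proof eventually_elim
      case (elim x)
      then have "sigma \<kappa> h z x \<le> r + \<kappa> * h" using sigma_le[OF k(1) h(1), of z x] r[of x] by simp
      then have "sigma \<kappa> h z x powr (?n + l) \<le> (r + \<kappa> * h) powr (?n + l)"
        using k sigma_pos[OF k(1) h(1), of z x] by (intro powr_mono2) auto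
      then show ?case unfolding Es by (simp add: mult.assoc mult_left_mono mult_right_mono)
    qed
  qed
  have EI: "(LINT x|M. (E x)\<^sup>2 / ?s x) \<le> Cg\<^sup>2"
  proof -
    let ?N = "Lp_norm 2 (\<lambda>_. 1) \<Omega> (\<lambda>x. sigma \<kappa> h z x powr ((?n + l) / 2) *\<^sub>R wgrad \<Omega> (\<lambda>y. G y - Gh y) x)"
    have "(LINT x|M. (E x)\<^sup>2 / ?s x) = h powr (- l) * (LINT x|M. sigma \<kappa> h z x powr (?n + l) * (E x)\<^sup>2)"
      unfolding Es by simp
    also have "(LINT x|M. sigma \<kappa> h z x powr (?n + l) * (E x)\<^sup>2) = ?N\<^sup>2"
      unfolding L2_norm_square sq ..
    also have "h powr (- l) * ?N\<^sup>2 \<le> h powr (- l) * (Cg * h powr (l / 2))\<^sup>2"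
      using est by (intro mult_left_mono power_mono Lp_norm_nonneg) auto
    also have "\<dots> = Cg\<^sup>2 * (h powr (- l) * (h powr (l/2) * h powr (l/2)))"
      by (simp add: power2_eq_square mult_ac)
    also have "h powr (- l) * (h powr (l/2) * h powr (l/2)) = 1"
      using h by (simp flip: powr_add)
    finally show ?thesis by simp
  qed
  let ?t2 = "(a_form \<Omega> u Gh + b_form \<Omega> Gh \<pi>) - (a_form \<Omega> u G + b_form \<Omega> G \<pi>)"
  have t2: "?t2\<^sup>2 \<le> (1 + ?n)\<^sup>2 * Cg\<^sup>2 * ?I"
  proof -
    have ab: "\<bar>E x\<bar> * \<bar>?F x\<bar> = E x * ?F x" for x by (simp add: E_def data_size_nonneg)
    have i: "integrable M (\<lambda>x. E x * ?F x)"
      using Cauchy_Schwarz_weighted(1)[OF Em Fm sm sp Ei si] unfolding ab .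
    have "\<bar>?t2\<bar> \<le> (1 + ?n) * (LINT x|M. E x * ?F x)"
    proof (rule form_difference_le[OF uH \<pi>L GhH GH Em _ i])
      show "AE x in M. norm (wgrad \<Omega> Gh x - wgrad \<Omega> G x) \<le> E x"
        using WD(2) by eventually_elim (simp add: E_def norm_minus_commute)
    qed
    then have "\<bar>?t2\<bar>\<^sup>2 \<le> ((1 + ?n) * (LINT x|M. E x * ?F x))\<^sup>2" by (intro power_mono) auto
    also have "\<dots> = (1 + ?n)\<^sup>2 * (LINT x|M. E x * ?F x)\<^sup>2" by (simp add: power_mult_distrib)
    also have "\<dots> \<le> (1 + ?n)\<^sup>2 * ((LINT x|M. (E x)\<^sup>2 / ?s x) * ?I)"
      using Cauchy_Schwarz_weighted(2)[OF Em Fm sm sp Ei si] unfolding ab by (intro mult_left_mono) auto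
    also have "\<dots> \<le> (1 + ?n)\<^sup>2 * (Cg\<^sup>2 * ?I)"
      using EI I0 by (intro mult_left_mono mult_right_mono) auto
    finally show ?thesis by (simp add: mult.assoc)
  qed
  have "(pderivative i uh z $ j)\<^sup>2 = (?t1 + ?t2)\<^sup>2"
    by (subst green_representation[OF T(2) repr G Gh u \<pi> uh]) auto
  also have "\<dots> \<le> 2 * ?t1\<^sup>2 + 2 * ?t2\<^sup>2" by (rule sum_square_le)
  also have "\<dots> \<le> 2 * (Kd * ?I) + 2 * ((1 + ?n)\<^sup>2 * Cg\<^sup>2 * ?I)" using t1 t2 by simp
  finally show ?thesis by (simp add: algebra_simps)
qed

text \<open>Testing with \<open>uh\<close> itself removes the discrete pressure, because
  \<open>uh\<close> is discretely divergence-free.\<close>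

lemma energy_estimate:
  assumes uH: "u \<in> H1" and \<pi>L: "\<pi> \<in> L2" and uh: "is_stokes_projection \<Omega> V Q u \<pi> uh \<pi>h"
  shows "Lp_norm 2 (\<lambda>_. 1) \<Omega> (wgrad \<Omega> uh) \<le> (1 + real CARD('n)) * Lp_norm 2 (\<lambda>_. 1) \<Omega> (data_size u \<pi>)"
proof -
  let ?n = "real CARD('n)"
  let ?A = "Lp_norm 2 (\<lambda>_. 1) \<Omega> (wgrad \<Omega> uh)" and ?B = "Lp_norm 2 (\<lambda>_. 1) \<Omega> (data_size u \<pi>)"
  have uhV: "uh \<in> V" "\<pi>h \<in> Q" using uh by (auto simp: is_stokes_projection_def)
  have uhH: "uh \<in> H1" using uhV(1) by (rule V_H1)
  have FL: "data_size u \<pi> \<in> L2" by (rule data_size_Lp(1)[OF weight_on_one _ W1pD(3)[OF uH] \<pi>L]) simp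
  have 1: "Lp_norm 2 (\<lambda>_. 1) \<Omega> (wgrad \<Omega> u) \<le> 1 * ?B"
    by (rule Lp_dominated(2)[OF weight_on_one _ _ wgrad_measurable_W1p[OF uH] FL]) (auto simp: data_size_def)
  have 2: "Lp_norm 2 (\<lambda>_. 1) \<Omega> \<pi> \<le> 1 * ?B"
    using \<pi>L by (intro Lp_dominated(2)[OF weight_on_one _ _ _ FL]) (auto simp: data_size_def Lp_iff)
  have "a_form \<Omega> uh uh = a_form \<Omega> u uh + b_form \<Omega> uh \<pi>"
  proof -
    have "a_form \<Omega> uh uh + b_form \<Omega> uh \<pi>h = a_form \<Omega> u uh + b_form \<Omega> uh \<pi>" "b_form \<Omega> uh \<pi>h = 0"
      using uh uhV unfolding is_stokes_projection_def by blast+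
    then show ?thesis by simp
  qed
  moreover have "a_form \<Omega> uh uh = ?A\<^sup>2" by (simp add: a_form_eq L2_norm_square power2_norm_eq_inner)
  moreover have "\<bar>a_form \<Omega> u uh\<bar> \<le> Lp_norm 2 (\<lambda>_. 1) \<Omega> (wgrad \<Omega> u) * ?A"
    using a_form_le[of 2 "\<lambda>_. 1" u uh] weight_on_one W1pD(3)[OF uH] W1pD(3)[OF uhH] by simp
  moreover have "\<bar>b_form \<Omega> uh \<pi>\<bar> \<le> ?n * (Lp_norm 2 (\<lambda>_. 1) \<Omega> \<pi> * ?A)"
    using b_form_le[of 2 "\<lambda>_. 1" \<pi> uh] weight_on_one \<pi>L W1pD(3)[OF uhH] by simp
  moreover have "Lp_norm 2 (\<lambda>_. 1) \<Omega> (wgrad \<Omega> u) * ?A \<le> ?B * ?A" using 1 by (intro mult_right_mono Lp_norm_nonneg) simp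
  moreover have "?n * (Lp_norm 2 (\<lambda>_. 1) \<Omega> \<pi> * ?A) \<le> ?n * (?B * ?A)" using 2 by (intro mult_left_mono mult_right_mono Lp_norm_nonneg) auto
  ultimately have "?A\<^sup>2 \<le> ?B * ?A + ?n * (?B * ?A)" by linarith
  then have "?A * ?A \<le> ((1 + ?n) * ?B) * ?A" by (simp add: power2_eq_square algebra_simps)
  then show ?thesis
    using Lp_norm_nonneg[of 2 "\<lambda>_. 1" "wgrad \<Omega> uh"] Lp_norm_nonneg[of 2 "\<lambda>_. 1" "data_size u \<pi>"]
    by (cases "?A = 0") (auto simp: mult_le_cancel_right)
qed

text \<open>Condition (G) is only available for \<open>\<kappa> h \<le> R\<close>. Otherwise \<open>h\<close> is comparable to the diameter of \<open>\<Omega>\<close>, the kernel is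
  bounded below, and the energy estimate suffices.\<close>

lemma pointwise_bound_coarse_mesh:
  fixes c Cd \<kappa> l R :: real
  defines "k0 \<equiv> (R / \<kappa>) powr l * ((1 + \<kappa>) * R) powr (- (real CARD('n) + l))"
  defines "Kd \<equiv> Cd\<^sup>2 * c powr (- 2 * real CARD('n)) * (R / \<kappa>) powr (- real CARD('n)) * (unit_ball_vol (real CARD('n)) * 2 powr real CARD('n))"
  assumes T: "T \<in> \<T>" "z \<in> interior T"
    and d: "d \<in> Cc_infinity (interior T)" "\<And>x. \<bar>d x\<bar> \<le> Cd * diameter T powr (- real CARD('n))"
    and h: "0 < h" "diameter T \<le> h" "0 < c" "c * h \<le> diameter T" and k: "0 < \<kappa>" "0 < l" "R < \<kappa> * h" "h \<le> R"
    and diam: "\<And>x. x \<in> \<Omega> \<Longrightarrow> norm (x - z) \<le> R"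
    and repr: "\<And>v. v \<in> V \<Longrightarrow> (LINT x:\<Omega>|lebesgue. d x * wgrad \<Omega> v x $ j $ i) = pderivative i v z $ j"
    and uH: "u \<in> H1" and \<pi>L: "\<pi> \<in> L2" and uh: "is_stokes_projection \<Omega> V Q u \<pi> uh \<pi>h"
  shows "(pderivative i uh z $ j)\<^sup>2 \<le> Kd * (1 + real CARD('n))\<^sup>2 / k0 * (LINT x|M. kern \<kappa> h l z x * (data_size u \<pi> x)\<^sup>2)"
proof -
  let ?n = "real CARD('n)"
  have R: "0 < R" using h k by simp
  have k0: "0 < k0" using R k by (simp add: k0_def)
  \<comment> \<open>As h lies between R/\<kappa> and R, powers of h of either sign may be replaced
    by constants; this is the origin of the factors in \<open>Kd\<close> and
    \<open>k0\<close>.\<close>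
  have hR: "R / \<kappa> \<le> h" using k by (simp add: field_simps)
  have uhV: "uh \<in> V" using uh by (auto simp: is_stokes_projection_def)
  have uhH: "uh \<in> H1" using uhV by (rule V_H1)
  have FL: "data_size u \<pi> \<in> L2" by (rule data_size_Lp(1)[OF weight_on_one _ W1pD(3)[OF uH] \<pi>L]) simp
  \<comment> \<open>A zero pressure turns \<open>data_size uh\<close> into the norm of the discrete
    gradient, so that the estimate of the delta term applies to \<open>uh\<close> as well.\<close>
  have zL: "(\<lambda>_. 0::real) \<in> L2" by (simp add: L2_iff)
  have FhL: "data_size uh (\<lambda>_. 0) \<in> L2" by (rule data_size_Lp(1)[OF weight_on_one _ W1pD(3)[OF uhH] zL]) simp
  let ?Fh = "data_size uh (\<lambda>_. 0)" and ?F = "data_size u \<pi>"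
  have dm: "d \<in> borel_measurable M" by (rule measurable_M[OF borel_lebesgue_measurable_Cc[OF d(1)]])
  have m1: "(\<lambda>_. 1::real) \<in> borel_measurable M" by simp
  note D = delta_square[OF T d h m1 zero_less_one zero_less_one order_refl]
  have Kd: "(LINT x|M. (d x)\<^sup>2 / 1) \<le> Kd"
  proof -
    have "(LINT x|M. (d x)\<^sup>2 / 1) \<le> Cd\<^sup>2 * (c * h) powr (- 2 * ?n) / 1 * (unit_ball_vol ?n * (2 * h) powr ?n)"
      by (rule D(2))
    also have "\<dots> = Cd\<^sup>2 * c powr (- 2 * ?n) * (h powr (- 2 * ?n) * h powr ?n) * (unit_ball_vol ?n * 2 powr ?n)"
      using h by (simp add: powr_mult mult_ac)
    also have "h powr (- 2 * ?n) * h powr ?n = h powr (- ?n)" by (simp flip: powr_add)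
    also have "Cd\<^sup>2 * c powr (- 2 * ?n) * h powr (- ?n) * (unit_ball_vol ?n * 2 powr ?n) \<le> Kd"
      unfolding Kd_def using R k hR by (intro mult_right_mono mult_left_mono powr_mono2') auto
    finally show ?thesis .
  qed
  have Fhi: "integrable M (\<lambda>x. 1 * (?Fh x)\<^sup>2)" "?Fh \<in> borel_measurable M" using FhL by (simp_all add: L2_iff)
  have Fi: "integrable M (\<lambda>x. (?F x)\<^sup>2)" using FL by (simp add: L2_iff)
  note CS = Cauchy_Schwarz_weighted[OF dm Fhi(2) m1 zero_less_one D(1) Fhi(1)]
  have "pderivative i uh z $ j = (LINT x|M. d x * wgrad \<Omega> uh x $ j $ i)"
    using repr[OF uhV] by (simp add: set_lint_eq)
  then have "\<bar>pderivative i uh z $ j\<bar> \<le> (LINT x|M. \<bar>d x\<bar> * \<bar>?Fh x\<bar>)"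
    using delta_term_le[OF uhH zL dm CS(1)] by simp
  then have "\<bar>pderivative i uh z $ j\<bar>\<^sup>2 \<le> (LINT x|M. \<bar>d x\<bar> * \<bar>?Fh x\<bar>)\<^sup>2" by (intro power_mono) auto
  also have "\<dots> \<le> (LINT x|M. (d x)\<^sup>2 / 1) * (LINT x|M. 1 * (?Fh x)\<^sup>2)" by (rule CS(2))
  also have "\<dots> \<le> Kd * (LINT x|M. 1 * (?Fh x)\<^sup>2)"
    using Kd by (intro mult_right_mono Bochner_Integration.integral_nonneg) auto
  also have "(LINT x|M. 1 * (?Fh x)\<^sup>2) = (Lp_norm 2 (\<lambda>_. 1) \<Omega> (wgrad \<Omega> uh))\<^sup>2"
    unfolding L2_norm_square by (simp add: data_size_def)
  also have "Kd * (Lp_norm 2 (\<lambda>_. 1) \<Omega> (wgrad \<Omega> uh))\<^sup>2 \<le> Kd * ((1 + ?n) * Lp_norm 2 (\<lambda>_. 1) \<Omega> ?F)\<^sup>2"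
    using energy_estimate[OF uH \<pi>L uh]
    by (intro mult_left_mono power_mono Lp_norm_nonneg) (auto simp: Kd_def)
  also have "\<dots> = Kd * (1 + ?n)\<^sup>2 * (LINT x|M. (?F x)\<^sup>2)"
    unfolding power_mult_distrib L2_norm_square by simp
  also have "\<dots> \<le> Kd * (1 + ?n)\<^sup>2 * ((1 / k0) * (LINT x|M. kern \<kappa> h l z x * (?F x)\<^sup>2))"
  proof (intro mult_left_mono)
    have "(LINT x|M. (?F x)\<^sup>2) \<le> (LINT x|M. (1 / k0) * (kern \<kappa> h l z x * (?F x)\<^sup>2))"
    proof (rule integral_mono_AE[OF Fi])
      show "integrable M (\<lambda>x. (1 / k0) * (kern \<kappa> h l z x * (?F x)\<^sup>2))"
        by (intro integrable_mult_right kern_integrable k h Fi)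
      show "AE x in M. (?F x)\<^sup>2 \<le> (1 / k0) * (kern \<kappa> h l z x * (?F x)\<^sup>2)"
        using AE_space[of M]
      proof eventually_elim
        case (elim x)
        have "norm (x - z) + \<kappa> * h \<le> (1 + \<kappa>) * R"
        proof -
          have "\<kappa> * h \<le> \<kappa> * R" using k by (intro mult_left_mono) auto
          then show ?thesis using diam[of x] elim by (simp add: algebra_simps)
        qed
        from kern_ge[OF k(1) h(1) k(2) this] have "h powr l * ((1 + \<kappa>) * R) powr (- (?n + l)) \<le> kern \<kappa> h l z x" .
        moreover have "k0 \<le> h powr l * ((1 + \<kappa>) * R) powr (- (?n + l))"
          unfolding k0_def using hR R k by (intro mult_right_mono powr_mono2) auto
        ultimately have "k0 * (?F x)\<^sup>2 \<le> kern \<kappa> h l z x * (?F x)\<^sup>2" by (intro mult_right_mono) auto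
        then show ?case using k0 by (simp add: field_simps)
      qed
    qed
    then show "(LINT x|M. (?F x)\<^sup>2) \<le> (1 / k0) * (LINT x|M. kern \<kappa> h l z x * (?F x)\<^sup>2)" by simp
  qed (auto simp: Kd_def)
  finally show ?thesis by simp
qed

text \<open>The Frobenius norm is at most the sum of the moduli of the d^2 entries; squaring that
  sum gives the factor d^4.\<close>

lemma gradient_from_entries:
  assumes v: "v \<in> V" and K: "0 \<le> K"
    and pt: "\<And>T z i j. T \<in> \<T> \<Longrightarrow> z \<in> interior T \<Longrightarrow> (pderivative i v z $ j)\<^sup>2 \<le> K * t z"
  shows "AE z in M. (norm (wgrad \<Omega> v z))\<^sup>2 \<le> (real CARD('n))^4 * K * t z"
  using V_cgrad[OF v] AE_interior
proof eventually_elim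
  case (elim z)
  then obtain T where T: "T \<in> \<T>" "z \<in> interior T" by blast
  let ?n = "real CARD('n)"
  have Kt: "0 \<le> K * t z" using pt[OF T] zero_le_power2 order_trans by blast
  have "\<bar>cgrad v z $ j $ i\<bar> \<le> sqrt (K * t z)" for i j
    using pt[OF T, of i j] by (intro real_le_rsqrt) (simp add: cgrad_def)
  then have "norm (cgrad v z) \<le> (\<Sum>j\<in>(UNIV::'n set). \<Sum>i\<in>(UNIV::'n set). sqrt (K * t z))"
    by (intro order_trans[OF norm_matrix_le] sum_mono)
  also have "\<dots> = ?n\<^sup>2 * sqrt (K * t z)" by (simp add: power2_eq_square)
  finally have "(norm (cgrad v z))\<^sup>2 \<le> (?n\<^sup>2 * sqrt (K * t z))\<^sup>2" by (intro power_mono) auto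
  also have "\<dots> = ?n^4 * (K * t z)"
    using Kt by (simp add: power_mult_distrib)
  finally show ?case using elim by (simp add: mult.assoc)
qed

end

section \<open>Functionals on the weighted Sobolev space\<close>

context bounded_open begin

lemma wgrad_zero_AE: "AE x in M. wgrad \<Omega> (\<lambda>x. 0) x = 0"
proof -
  have z: "has_weak_grad \<Omega> (\<lambda>x. 0) (cgrad (\<lambda>x. 0))" by (rule has_weak_grad_cgrad[OF Ck_const])
  have "has_weak_grad \<Omega> (\<lambda>x. 0) (\<lambda>x. 0)" using has_weak_grad_scaleR[OF z, of 0] by simp
  then show ?thesis by (rule wgrad_eq_AE)
qed

lemma zero_W1p0:
  assumes "weight_on \<omega>" "1 \<le> p"
  shows "(\<lambda>x. 0) \<in> W1p0 p \<omega> \<Omega>" "W1p_norm p \<omega> \<Omega> (\<lambda>x. 0) = 0"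
proof -
  have c: "(\<lambda>x. 0) \<in> Cc_infinity \<Omega>" by (rule Cc_infinityI[of _ "{}"]) auto
  have W: "(\<lambda>x. 0) \<in> W1p p \<omega> \<Omega>" using assms by (intro Cc_W1p[OF c]) auto
  have z: "(\<lambda>x. 0 :: real^'n^'n) \<in> Lp p \<omega> \<Omega>" using assms by (simp add: Lp_iff)
  have "Lp_norm p \<omega> \<Omega> (wgrad \<Omega> (\<lambda>x. 0)) = Lp_norm p \<omega> \<Omega> (\<lambda>x. 0 :: real^'n^'n)"
    using assms by (intro Lp_AE_cong(2)[OF _ _ wgrad_measurable_W1p[OF W] z wgrad_zero_AE]) auto
  then show n: "W1p_norm p \<omega> \<Omega> (\<lambda>x. 0) = 0" using assms by (simp add: W1p_norm_def Lp_norm_eq)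
  show "(\<lambda>x. 0) \<in> W1p0 p \<omega> \<Omega>"
    unfolding W1p0_def using W c n by (intro CollectI conjI exI[of _ "\<lambda>_ x. 0"]) auto
qed

text \<open>Continuity and the bound on the norm follow from Hoelder's inequality. Nonnegativity of
  the dual norm is recorded because it is a real supremum, whose sign rests on boundedness; it later
  allows a constant of unknown sign to be replaced by its absolute value.\<close>

lemma functional_dual:
  assumes p: "1 < p" and w: "weight_on \<omega>" and g: "g \<in> Lp (conj_exp p) (dual_weight p \<omega>) \<Omega>"
  defines "f \<equiv> \<lambda>v. LINT x|M. wgrad \<Omega> v x \<bullet> g x"
  shows "f \<in> W1p0_dual p \<omega> \<Omega>" "0 \<le> W1p0_dual_norm p \<omega> \<Omega> f"
    "W1p0_dual_norm p \<omega> \<Omega> f \<le> Lp_norm (conj_exp p) (dual_weight p \<omega>) \<Omega> g"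
proof -
  let ?N = "Lp_norm (conj_exp p) (dual_weight p \<omega>) \<Omega> g"
  have gm: "g \<in> borel_measurable M" using g by (simp add: Lp_iff)
  have W: "v \<in> W1p p \<omega> \<Omega>" if "v \<in> W1p0 p \<omega> \<Omega>" for v using that by (rule W1p0_W1p)
  have i: "integrable M (\<lambda>x. wgrad \<Omega> v x \<bullet> g x)" if "v \<in> W1p p \<omega> \<Omega>" for v
    by (rule Lp_inner_le(1)[OF p w W1pD(3)[OF that] g])
  have im: "(\<lambda>x. wgrad \<Omega> v x \<bullet> g x) \<in> borel_measurable M" if "has_weak_grad \<Omega> v G" for v G
    by (rule borel_measurable_inner[OF wgrad_measurable[OF that] gm])
  have le: "\<bar>f v\<bar> \<le> ?N * W1p_norm p \<omega> \<Omega> v" if "v \<in> W1p0 p \<omega> \<Omega>" for v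
  proof -
    have "\<bar>f v\<bar> \<le> Lp_norm p \<omega> \<Omega> (wgrad \<Omega> v) * ?N"
      unfolding f_def by (rule Lp_inner_le(2)[OF p w W1pD(3)[OF W[OF that]] g])
    also have "\<dots> \<le> W1p_norm p \<omega> \<Omega> v * ?N"
      using p by (intro mult_right_mono W1p_norm_ge(2) Lp_norm_nonneg) simp
    finally show ?thesis by (simp add: mult.commute)
  qed
  have add: "f (\<lambda>x. v x + u x) = f v + f u" if v: "v \<in> W1p0 p \<omega> \<Omega>" and u: "u \<in> W1p0 p \<omega> \<Omega>" for v u
  proof -
    have "f (\<lambda>x. v x + u x) = (LINT x|M. wgrad \<Omega> v x \<bullet> g x + wgrad \<Omega> u x \<bullet> g x)"
      unfolding f_def
    proof (rule integral_cong_AE)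
      show "AE x in M. wgrad \<Omega> (\<lambda>x. v x + u x) x \<bullet> g x = wgrad \<Omega> v x \<bullet> g x + wgrad \<Omega> u x \<bullet> g x"
        using wgrad_add_AE[OF W[OF v] W[OF u]] by eventually_elim (simp add: inner_add_left)
    qed (intro borel_measurable_add im[OF has_weak_grad_add[OF W1pD(1)[OF W[OF v]] W1pD(1)[OF W[OF u]]]]
        im[OF W1pD(1)[OF W[OF v]]] im[OF W1pD(1)[OF W[OF u]]])+
    then show ?thesis using i[OF W[OF v]] i[OF W[OF u]] by (simp add: f_def)
  qed
  have scale: "f (\<lambda>x. c *\<^sub>R v x) = c * f v" if v: "v \<in> W1p0 p \<omega> \<Omega>" for v c
  proof -
    have "f (\<lambda>x. c *\<^sub>R v x) = (LINT x|M. c * (wgrad \<Omega> v x \<bullet> g x))"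
      unfolding f_def
    proof (rule integral_cong_AE)
      show "AE x in M. wgrad \<Omega> (\<lambda>x. c *\<^sub>R v x) x \<bullet> g x = c * (wgrad \<Omega> v x \<bullet> g x)"
        using wgrad_scale_AE[OF W[OF v], of c] by eventually_elim simp
    qed (intro borel_measurable_times borel_measurable_const im[OF has_weak_grad_scaleR[OF W1pD(1)[OF W[OF v]]]]
        im[OF W1pD(1)[OF W[OF v]]])+
    then show ?thesis by (simp add: f_def)
  qed
  show "f \<in> W1p0_dual p \<omega> \<Omega>"
    unfolding W1p0_dual_def using add scale le by blast
  let ?S = "{v \<in> W1p0 p \<omega> \<Omega>. W1p_norm p \<omega> \<Omega> v \<le> 1}"
  have le1: "\<bar>f v\<bar> \<le> ?N" if "v \<in> ?S" for v
  proof -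
    have "\<bar>f v\<bar> \<le> ?N * W1p_norm p \<omega> \<Omega> v" using le that by blast
    also have "\<dots> \<le> ?N * 1" using that by (intro mult_left_mono Lp_norm_nonneg) auto
    finally show ?thesis by simp
  qed
  have z: "(\<lambda>x. 0) \<in> ?S" using zero_W1p0[OF w, of p] p by simp
  show "W1p0_dual_norm p \<omega> \<Omega> f \<le> ?N"
    unfolding W1p0_dual_norm_def using z le1 by (intro cSUP_least) blast+
  have "bdd_above ((\<lambda>v. \<bar>f v\<bar>) ` ?S)" using le1 by (intro bdd_aboveI2)
  then have "\<bar>f (\<lambda>x. 0)\<bar> \<le> W1p0_dual_norm p \<omega> \<Omega> f"
    unfolding W1p0_dual_norm_def by (rule cSUP_upper[OF z])
  then show "0 \<le> W1p0_dual_norm p \<omega> \<Omega> f" by linarith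
qed

lemma Lp_mod_R_embed:
  assumes "embeds p \<omega> q \<tau> C" "\<pi> \<in> Lp_mod_R p \<omega> \<Omega>"
  shows "\<pi> \<in> Lp_mod_R q \<tau> \<Omega>"
  using embedsD(1)[OF assms(1), of \<pi>] assms(2) by (simp add: Lp_mod_R_def)

lemma AE_zero_Lp_norm:
  fixes q :: "real^'n \<Rightarrow> real"
  assumes "weight_on \<omega>" "0 < p" "q \<in> borel_measurable M" "AE x in M. q x = 0"
  shows "Lp_norm p \<omega> \<Omega> q = 0"
proof -
  have "(\<lambda>_. 0::real) \<in> Lp p \<omega> \<Omega>" by (simp add: Lp_iff)
  from Lp_AE_cong(2)[OF assms(1,2,3) this assms(4)] show ?thesis using assms(2) by (simp add: Lp_norm_eq)
qed

lemma divergence_free_b_form: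
  assumes "AE x\<in>\<Omega> in lebesgue. wdiv \<Omega> u x = 0"
  shows "b_form \<Omega> u q = 0"
proof -
  have "AE x in M. q x * wdiv \<Omega> u x = 0"
    using assms unfolding AE_M_iff by eventually_elim simp
  then have "(LINT x|M. q x * wdiv \<Omega> u x) = 0" by (rule integral_eq_zero_AE)
  then show ?thesis by (simp add: b_form_eq)
qed

end

section \<open>The discrete pressure\<close>

context fe begin

text \<open>The momentum equation expresses b(v, \<open>\<pi>h\<close>) through a(u, v), a(uh, v)
  and b(v, \<pi>), all bounded by the dual norm of the gradient of v; the inf-sup condition converts
  this into a bound for the pressure.\<close>

lemma pressure_estimate:
  assumes p: "1 < p" and w: "weight_on \<omega>" "weight_on (dual_weight p \<omega>)"
    and \<beta>: "0 < \<beta>" "ereal \<beta> \<le> inf_sup_const \<Omega> V Q (conj_exp p) (dual_weight p \<omega>) p \<omega>"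
    and u: "u \<in> W1p p \<omega> \<Omega>" and \<pi>: "\<pi> \<in> Lp p \<omega> \<Omega>" and uh: "is_stokes_projection \<Omega> V Q u \<pi> uh \<pi>h"
  shows "Lp_norm p \<omega> \<Omega> \<pi>h \<le> (1 / \<beta>) * (Lp_norm p \<omega> \<Omega> (wgrad \<Omega> u) + real CARD('n) * Lp_norm p \<omega> \<Omega> \<pi> + Lp_norm p \<omega> \<Omega> (wgrad \<Omega> uh))"
proof -
  let ?q = "conj_exp p" and ?w = "dual_weight p \<omega>"
  define S where "S = Lp_norm p \<omega> \<Omega> (wgrad \<Omega> u) + real CARD('n) * Lp_norm p \<omega> \<Omega> \<pi> + Lp_norm p \<omega> \<Omega> (wgrad \<Omega> uh)"
  have S0: "0 \<le> S" by (simp add: S_def Lp_norm_nonneg)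
  have p0: "0 < p" "0 < ?q" using p conj_exp_gt_1[OF p] by auto
  have uhV: "uh \<in> V" "\<pi>h \<in> Q" using uh by (auto simp: is_stokes_projection_def)
  have uhW: "uh \<in> W1p p \<omega> \<Omega>" by (rule V_W1p[OF uhV(1) w(1) p0(1)])
  have \<pi>hm: "\<pi>h \<in> borel_measurable M" using Q_L2[OF uhV(2)] by (simp add: Lp_iff)
  have b_le: "b_form \<Omega> v \<pi>h \<le> S * Lp_norm ?q ?w \<Omega> (wgrad \<Omega> v)" if v: "v \<in> V" for v
  proof -
    let ?n = "Lp_norm ?q ?w \<Omega> (wgrad \<Omega> v)"
    have vW: "wgrad \<Omega> v \<in> Lp ?q ?w \<Omega>" by (rule W1pD(3)[OF V_W1p[OF v w(2) p0(2)]])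
    have "a_form \<Omega> uh v + b_form \<Omega> v \<pi>h = a_form \<Omega> u v + b_form \<Omega> v \<pi>"
      using uh v unfolding is_stokes_projection_def by blast
    moreover have "\<bar>a_form \<Omega> u v\<bar> \<le> Lp_norm p \<omega> \<Omega> (wgrad \<Omega> u) * ?n"
      by (rule a_form_le[OF p w(1) W1pD(3)[OF u] vW])
    moreover have "\<bar>a_form \<Omega> uh v\<bar> \<le> Lp_norm p \<omega> \<Omega> (wgrad \<Omega> uh) * ?n"
      by (rule a_form_le[OF p w(1) W1pD(3)[OF uhW] vW])
    moreover have "\<bar>b_form \<Omega> v \<pi>\<bar> \<le> real CARD('n) * (Lp_norm p \<omega> \<Omega> \<pi> * ?n)"
      by (rule b_form_le[OF p w \<pi> vW])
    ultimately have "b_form \<Omega> v \<pi>h \<le> Lp_norm p \<omega> \<Omega> (wgrad \<Omega> u) * ?n + real CARD('n) * (Lp_norm p \<omega> \<Omega> \<pi> * ?n) + Lp_norm p \<omega> \<Omega> (wgrad \<Omega> uh) * ?n"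
      by linarith
    then show ?thesis by (simp add: S_def algebra_simps)
  qed
  show ?thesis
  proof (cases "Lp_norm p \<omega> \<Omega> \<pi>h = 0")
    case True
    then show ?thesis using S0 \<beta>(1) by (simp add: S_def)
  next
    case False
    then have pos: "0 < Lp_norm p \<omega> \<Omega> \<pi>h" using Lp_norm_nonneg[of p \<omega> \<pi>h] by simp
    \<comment> \<open>The infimum in the inf-sup constant runs only over pressures that do not
      vanish almost everywhere.\<close>
    have "nonzero_on \<Omega> \<pi>h"
    proof (rule ccontr)
      assume "\<not> nonzero_on \<Omega> \<pi>h"
      then have "AE x in M. \<pi>h x = 0" by (simp add: nonzero_on_def AE_M_iff)
      then show False using AE_zero_Lp_norm[OF w(1) p0(1) \<pi>hm] False by blast
    qed
    then have "ereal \<beta> \<le> (SUP v\<in>{v \<in> V. nonzero_on \<Omega> v}. ereal (b_form \<Omega> v \<pi>h / (Lp_norm ?q ?w \<Omega> (wgrad \<Omega> v) * Lp_norm p \<omega> \<Omega> \<pi>h)))"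
      using \<beta>(2) uhV(2) unfolding inf_sup_const_def by (elim order_trans) (intro INF_lower, simp)
    also have "\<dots> \<le> ereal (S / Lp_norm p \<omega> \<Omega> \<pi>h)"
    proof (rule SUP_least)
      fix v assume "v \<in> {v \<in> V. nonzero_on \<Omega> v}"
      then have v: "v \<in> V" by simp
      let ?n = "Lp_norm ?q ?w \<Omega> (wgrad \<Omega> v)"
      have "b_form \<Omega> v \<pi>h / (?n * Lp_norm p \<omega> \<Omega> \<pi>h) \<le> S / Lp_norm p \<omega> \<Omega> \<pi>h"
      \<comment> \<open>A velocity with zero gradient norm gives the quotient 0, since division by 0
        yields 0; the bound then holds because S is nonnegative.\<close>
      proof (cases "?n = 0")
        case True
        then show ?thesis using S0 pos by simp
      next
        case False
        then have n: "0 < ?n" using Lp_norm_nonneg[of ?q ?w "wgrad \<Omega> v"] by simp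
        have "b_form \<Omega> v \<pi>h / (?n * Lp_norm p \<omega> \<Omega> \<pi>h) \<le> (S * ?n) / (?n * Lp_norm p \<omega> \<Omega> \<pi>h)"
          using b_le[OF v] n pos by (intro divide_right_mono) auto
        then show ?thesis using n by simp
      qed
      then show "ereal (b_form \<Omega> v \<pi>h / (?n * Lp_norm p \<omega> \<Omega> \<pi>h)) \<le> ereal (S / Lp_norm p \<omega> \<Omega> \<pi>h)" by simp
    qed
    finally have "\<beta> * Lp_norm p \<omega> \<Omega> \<pi>h \<le> S" using pos by (simp add: pos_le_divide_eq)
    then have "Lp_norm p \<omega> \<Omega> \<pi>h \<le> (1 / \<beta>) * S" using \<beta>(1) by (simp add: field_simps)
    then show ?thesis unfolding S_def .
  qed
qed

end

section \<open>Stability of the Stokes projection\<close>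

locale stokes_family = convex_dom \<Omega> for \<Omega> :: "(real^'n) set" +
  fixes P R :: real and H :: "real set" and \<T> :: "real \<Rightarrow> (real^'n) set set"
    and V :: "real \<Rightarrow> (real^'n \<Rightarrow> real^'n) set" and Q :: "real \<Rightarrow> (real^'n \<Rightarrow> real) set"
    and \<delta> :: "real \<Rightarrow> real^'n \<Rightarrow> real^'n \<Rightarrow> real" and deg :: nat
  assumes P: "stokes_exponent \<Omega> P"
    and meshes: "quasiuniform_meshes \<Omega> H \<T>"
    and spaces: "\<And>h. h \<in> H \<Longrightarrow> velocity_space \<Omega> (\<T> h) deg (V h)" "\<And>h. h \<in> H \<Longrightarrow> pressure_space \<Omega> (\<T> h) deg (Q h)"
    and R: "0 < R" "\<forall>x\<in>closure \<Omega>. \<Omega> \<subseteq> ball x R"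
    and deltas: "regularized_deltas \<Omega> H \<T> V \<delta>"
    and green: "green_estimate \<Omega> H \<T> V Q \<delta> R"
begin

lemma fe_member: "h \<in> H \<Longrightarrow> fe \<Omega> (\<T> h) deg (V h) (Q h)"
proof -
  assume h: "h \<in> H"
  have "conforming_mesh \<Omega> (\<T> h)" using meshes h by (simp add: quasiuniform_meshes_def)
  then show "fe \<Omega> (\<T> h) deg (V h) (Q h)"
    using spaces[OF h] by unfold_locales
qed

text \<open>Elements lie in the closure of \<Omega>, whose diameter is at most R. The last bound
  makes h comparable to R on the meshes with \<kappa> h > R.\<close>

lemma mesh_size:
  assumes h: "h \<in> H" and T: "T \<in> \<T> h"
  shows "0 < h" "diameter T \<le> h" "h \<le> R"
proof -
  interpret fe \<Omega> "\<T> h" deg "V h" "Q h" by (rule fe_member[OF h])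
  have hm: "0 < h" "h = Max (diameter ` \<T> h)" using meshes h unfolding quasiuniform_meshes_def by blast+
  show "0 < h" by (rule hm(1))
  have fin: "finite (diameter ` \<T> h)" using finite_mesh by simp
  show "diameter T \<le> h" unfolding hm(2)[symmetric] using Max_ge[OF fin, of "diameter T"] T hm(2) by simp
  have "diameter T' \<le> R" if T': "T' \<in> \<T> h" for T'
  proof (rule diameter_le)
    show "T' \<noteq> {} \<or> 0 \<le> R" using R(1) by simp
    fix x y assume xy: "x \<in> T'" "y \<in> T'"
    then have c: "x \<in> closure \<Omega>" "y \<in> closure \<Omega>" using mesh_cover T' by blast+
    have "\<Omega> \<subseteq> cball x R" using R(2) c(1) ball_subset_cball[of x R] by blast
    then have "closure \<Omega> \<subseteq> cball x R" by (intro closure_minimal) auto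
    then have "y \<in> cball x R" using c(2) by blast
    then show "norm (x - y) \<le> R" by (simp add: dist_norm)
  qed
  then have "Max (diameter ` \<T> h) \<le> R" using fin T by (subst Max_le_iff) auto
  then show "h \<le> R" using hm(2) by simp
qed

lemma dist_le_R:
  assumes "z \<in> \<Omega>" "x \<in> \<Omega>"
  shows "norm (x - z) \<le> R"
proof -
  have "x \<in> ball z R" using R(2) assms closure_subset by blast
  then show ?thesis by (simp add: dist_norm norm_minus_commute)
qed

lemma P_bounds: "2 < P" "conj_exp P < 2"
proof -
  show "2 < P" using P by (simp add: stokes_exponent_def)
  then show "conj_exp P < 2" by (simp add: conj_exp_def field_simps)
qed

text \<open>The right-hand side pairs the gradient of v with \<open>d\<close> times the matrix unit
  in row j and column i. It is a bounded functional because \<open>d\<close> is bounded, so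
  well-posedness for p = 2 and \<omega> = 1 applies.\<close>

lemma green_pair_exists:
  assumes d: "d \<in> Cc_infinity \<Omega>"
  obtains G S where "is_green_pair \<Omega> d i j G S"
proof -
  have wp: "stokes_well_posed 2 (\<lambda>_. 1) \<Omega>"
    using P P_bounds one_in_Ap_dom[OF open_dom] unfolding stokes_exponent_def by blast
  let ?g = "\<lambda>x. d x *\<^sub>R (axis j (axis i 1) :: real^'n^'n)"
  define f where "f v = (LINT x|M. wgrad \<Omega> v x \<bullet> ?g x)" for v
  have dm: "d \<in> borel_measurable M" by (rule measurable_M[OF borel_lebesgue_measurable_Cc[OF d]])
  obtain B where B: "\<And>x. norm (d x) \<le> B" using Cc_infinity_bounded[OF d] by metis
  have "?g \<in> Lp 2 (\<lambda>_. 1) \<Omega>"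
  proof (rule Lp_bounded[OF weight_on_one])
    show "?g \<in> borel_measurable M" by (intro borel_measurable_scaleR dm borel_measurable_const)
    show "AE x in M. norm (?g x) \<le> B" using B by (intro AE_I2) simp
  qed simp
  then have "f \<in> W1p0_dual (conj_exp 2) (dual_weight 2 (\<lambda>_. 1)) \<Omega>"
    unfolding f_def[abs_def] using functional_dual(1)[of 2 "\<lambda>_. 1", OF _ weight_on_one, of ?g] by simp
  then obtain G S where GS: "stokes_solution 2 (\<lambda>_. 1) \<Omega> f G S"
    using wp unfolding stokes_well_posed_def by blast
  have "f v = (LINT x:\<Omega>|lebesgue. d x * wgrad \<Omega> v x $ j $ i)" for v
    by (simp add: f_def set_lint_eq inner_axis)
  then have "is_green_pair \<Omega> d i j G S"
    using GS by (simp add: stokes_solution_def is_green_pair_def)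
  then show thesis by (rule that)
qed

end

context stokes_family begin

lemma pointwise_bound:
  obtains \<kappa> l K where "0 < \<kappa>" "0 < l" "0 \<le> K"
    "\<And>h u \<pi> uh \<pi>h T z i j. h \<in> H \<Longrightarrow> u \<in> W1p0 2 (\<lambda>_. 1) \<Omega> \<Longrightarrow> (\<And>q. q \<in> Lp_mod_R 2 (\<lambda>_. 1) \<Omega> \<Longrightarrow> b_form \<Omega> u q = 0) \<Longrightarrow>
      \<pi> \<in> Lp_mod_R 2 (\<lambda>_. 1) \<Omega> \<Longrightarrow> is_stokes_projection \<Omega> (V h) (Q h) u \<pi> uh \<pi>h \<Longrightarrow> T \<in> \<T> h \<Longrightarrow> z \<in> interior T \<Longrightarrow>
      (pderivative i uh z $ j)\<^sup>2 \<le> K * (LINT x|M. kern \<kappa> h l z x * (data_size u \<pi> x)\<^sup>2)"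
proof -
  let ?n = "real CARD('n)"
  \<comment> \<open>Condition (G) is used with \<nu> = 1/4, for which any l strictly between 0 and
    1/8 is admissible.\<close>
  define l :: real where "l = 1/16"
  have l: "0 < l" by (simp add: l_def)
  have "\<exists>\<kappa>\<^sub>1>1. \<forall>\<kappa>\<ge>\<kappa>\<^sub>1. \<exists>C. \<forall>h\<in>H. \<kappa> * h \<le> R \<longrightarrow>
         (\<forall>T\<in>\<T> h. \<forall>z\<in>interior T. \<forall>i j G S G\<^sub>h S\<^sub>h.
            is_green_pair \<Omega> (\<delta> h z) i j G S \<and>
            is_stokes_projection \<Omega> (V h) (Q h) G S G\<^sub>h S\<^sub>h \<longrightarrow>
            Lp_norm 2 (\<lambda>_. 1) \<Omega>
              (\<lambda>x. sigma \<kappa> h z x powr ((?n + l) / 2) *\<^sub>R wgrad \<Omega> (\<lambda>y. G y - G\<^sub>h y) x)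
              \<le> C * h powr (l / 2))"
    using green[unfolded green_estimate_def, rule_format, of "1/4" l "?n + l"] by (simp add: l_def)
  then obtain \<kappa> where \<kappa>: "1 < \<kappa>" and ex: "\<forall>\<kappa>'\<ge>\<kappa>. \<exists>C. \<forall>h\<in>H. \<kappa>' * h \<le> R \<longrightarrow>
         (\<forall>T\<in>\<T> h. \<forall>z\<in>interior T. \<forall>i j G S G\<^sub>h S\<^sub>h.
            is_green_pair \<Omega> (\<delta> h z) i j G S \<and>
            is_stokes_projection \<Omega> (V h) (Q h) G S G\<^sub>h S\<^sub>h \<longrightarrow>
            Lp_norm 2 (\<lambda>_. 1) \<Omega>
              (\<lambda>x. sigma \<kappa>' h z x powr ((?n + l) / 2) *\<^sub>R wgrad \<Omega> (\<lambda>y. G y - G\<^sub>h y) x)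
              \<le> C * h powr (l / 2))"
    by (elim exE conjE)
  \<comment> \<open>The parameter \<kappa> is frozen at its threshold, so that from here on only h
    varies.\<close>
  obtain Cg where Cg': "\<forall>h\<in>H. \<kappa> * h \<le> R \<longrightarrow>
         (\<forall>T\<in>\<T> h. \<forall>z\<in>interior T. \<forall>i j G S G\<^sub>h S\<^sub>h.
            is_green_pair \<Omega> (\<delta> h z) i j G S \<and>
            is_stokes_projection \<Omega> (V h) (Q h) G S G\<^sub>h S\<^sub>h \<longrightarrow>
            Lp_norm 2 (\<lambda>_. 1) \<Omega>
              (\<lambda>x. sigma \<kappa> h z x powr ((?n + l) / 2) *\<^sub>R wgrad \<Omega> (\<lambda>y. G y - G\<^sub>h y) x)
              \<le> Cg * h powr (l / 2))"
    using ex[rule_format, OF order_refl] by (elim exE)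
  have Cg: "\<And>h T z i j G S Gh Sh. h \<in> H \<Longrightarrow> \<kappa> * h \<le> R \<Longrightarrow> T \<in> \<T> h \<Longrightarrow> z \<in> interior T \<Longrightarrow>
      is_green_pair \<Omega> (\<delta> h z) i j G S \<Longrightarrow> is_stokes_projection \<Omega> (V h) (Q h) G S Gh Sh \<Longrightarrow>
      Lp_norm 2 (\<lambda>_. 1) \<Omega> (\<lambda>x. sigma \<kappa> h z x powr ((?n + l) / 2) *\<^sub>R wgrad \<Omega> (\<lambda>y. G y - Gh y) x) \<le> Cg * h powr (l / 2)"
    using Cg' by blast
  have \<kappa>0: "0 < \<kappa>" using \<kappa> by simp
  obtain c where c: "0 < c" "\<And>h T. h \<in> H \<Longrightarrow> T \<in> \<T> h \<Longrightarrow> c * h \<le> diameter T"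
    using meshes unfolding quasiuniform_meshes_def by blast
  obtain Cd where Cd: "\<forall>h\<in>H. \<forall>T\<in>\<T> h. \<forall>z\<in>interior T.
     \<delta> h z \<in> Cc_infinity (interior T) \<and> (LINT x:\<Omega>|lebesgue. \<delta> h z x) = 1 \<and>
     (\<forall>x. \<bar>\<delta> h z x\<bar> \<le> Cd * diameter T powr (- ?n)) \<and>
     (\<forall>v\<in>V h. (LINT x:\<Omega>|lebesgue. \<delta> h z x *\<^sub>R v x) = v z \<and>
        (\<forall>i j. (LINT x:\<Omega>|lebesgue. \<delta> h z x * wgrad \<Omega> v x $ j $ i) = pderivative i v z $ j))"
    using deltas unfolding regularized_deltas_def by (elim exE)
  define K1 where "K1 = 2 * (Cd\<^sup>2 * c powr (- 2 * ?n) * (1 + \<kappa>) powr (?n + l) * (unit_ball_vol ?n * 2 powr ?n) + (1 + ?n)\<^sup>2 * Cg\<^sup>2)"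
  define K2 where "K2 = Cd\<^sup>2 * c powr (- 2 * ?n) * (R / \<kappa>) powr (- ?n) * (unit_ball_vol ?n * 2 powr ?n) * (1 + ?n)\<^sup>2 / ((R / \<kappa>) powr l * ((1 + \<kappa>) * R) powr (- (?n + l)))"
  \<comment> \<open>\<open>K1\<close> serves the meshes with \<kappa> h \<le> R and
    \<open>K2\<close> the others.\<close>
  define K where "K = max 0 (max K1 K2)"
  have "(pderivative i uh z $ j)\<^sup>2 \<le> K * (LINT x|M. kern \<kappa> h l z x * (data_size u \<pi> x)\<^sup>2)"
    if h: "h \<in> H" and u: "u \<in> W1p0 2 (\<lambda>_. 1) \<Omega>" "\<And>q. q \<in> Lp_mod_R 2 (\<lambda>_. 1) \<Omega> \<Longrightarrow> b_form \<Omega> u q = 0"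
      and \<pi>: "\<pi> \<in> Lp_mod_R 2 (\<lambda>_. 1) \<Omega>" and uh: "is_stokes_projection \<Omega> (V h) (Q h) u \<pi> uh \<pi>h"
      and T: "T \<in> \<T> h" "z \<in> interior T" for h u \<pi> uh \<pi>h T z i j
  proof -
    interpret fe \<Omega> "\<T> h" deg "V h" "Q h" by (rule fe_member[OF h])
    note hs = mesh_size[OF h T(1)]
    let ?d = "\<delta> h z"
    have d: "?d \<in> Cc_infinity (interior T)" "\<And>x. \<bar>?d x\<bar> \<le> Cd * diameter T powr (- ?n)"
      and repr: "\<And>v i j. v \<in> V h \<Longrightarrow> (LINT x:\<Omega>|lebesgue. ?d x * wgrad \<Omega> v x $ j $ i) = pderivative i v z $ j"
      using Cd h T by blast+
    have I0: "0 \<le> (LINT x|M. kern \<kappa> h l z x * (data_size u \<pi> x)\<^sup>2)"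
      by (intro Bochner_Integration.integral_nonneg) (simp add: kern_nonneg)
    show ?thesis
    proof (cases "\<kappa> * h \<le> R")
      case True
      have "?d \<in> Cc_infinity \<Omega>" using d(1) Cc_infinity_mono[OF element_interior[OF T(1)]] by blast
      then obtain G S where G: "is_green_pair \<Omega> ?d i j G S" by (rule green_pair_exists)
      have "G \<in> H1" "S \<in> L2" using G W1p0_W1p by (auto simp: is_green_pair_def Lp_mod_R_def)
      then obtain Gh Sh where Gh: "is_stokes_projection \<Omega> (V h) (Q h) G S Gh Sh"
        by (rule discrete_projection_exists)
      have "(pderivative i uh z $ j)\<^sup>2 \<le> K1 * (LINT x|M. kern \<kappa> h l z x * (data_size u \<pi> x)\<^sup>2)"
        unfolding K1_def
        by (rule pointwise_bound_fine_mesh[OF T d hs(1,2) c(1) c(2)[OF h T(1)] \<kappa>0 l repr G Gh Cg[OF h True T G Gh] u \<pi> uh])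
      also have "\<dots> \<le> K * (LINT x|M. kern \<kappa> h l z x * (data_size u \<pi> x)\<^sup>2)"
        using I0 by (intro mult_right_mono) (simp_all add: K_def)
      finally show ?thesis .
    next
      case False
      have zO: "z \<in> \<Omega>" using element_interior[OF T(1)] T(2) by blast
      have "\<pi> \<in> L2" using \<pi> by (simp add: Lp_mod_R_def)
      have "R < \<kappa> * h" using False by simp
      have "(pderivative i uh z $ j)\<^sup>2 \<le> K2 * (LINT x|M. kern \<kappa> h l z x * (data_size u \<pi> x)\<^sup>2)"
        unfolding K2_def
        by (rule pointwise_bound_coarse_mesh[OF T d hs(1,2) c(1) c(2)[OF h T(1)] \<kappa>0 l \<open>R < \<kappa> * h\<close> hs(3) dist_le_R[OF zO] repr
            W1p0_W1p[OF u(1)] \<open>\<pi> \<in> L2\<close> uh])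
      also have "\<dots> \<le> K * (LINT x|M. kern \<kappa> h l z x * (data_size u \<pi> x)\<^sup>2)"
        using I0 by (intro mult_right_mono) (simp_all add: K_def)
      finally show ?thesis .
    qed
  qed
  moreover have "0 \<le> K" by (simp add: K_def)
  ultimately show thesis using that[OF \<kappa>0 l] by blast
qed

text \<open>Incompressibility is required in the form b(u, q) = 0 for zero-mean q in L^2, because
  the duality argument applies the bound to a solution of a Stokes problem, where it is available in
  this form. The lower bound of \<omega> puts u and \<pi> into the unweighted spaces of the
  pointwise bound.\<close>

lemma velocity_bound_A1:
  assumes p: "2 \<le> p" and w: "\<omega> \<in> Ap p" "\<omega> \<in> A1"
  obtains C where "0 \<le> C" "\<And>h u \<pi> uh \<pi>h. h \<in> H \<Longrightarrow> u \<in> W1p0 p \<omega> \<Omega> \<Longrightarrow> (\<And>q. q \<in> Lp_mod_R 2 (\<lambda>_. 1) \<Omega> \<Longrightarrow> b_form \<Omega> u q = 0) \<Longrightarrow>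
      \<pi> \<in> Lp_mod_R p \<omega> \<Omega> \<Longrightarrow> is_stokes_projection \<Omega> (V h) (Q h) u \<pi> uh \<pi>h \<Longrightarrow>
      Lp_norm p \<omega> \<Omega> (wgrad \<Omega> uh) \<le> C * (Lp_norm p \<omega> \<Omega> (wgrad \<Omega> u) + Lp_norm p \<omega> \<Omega> \<pi>)"
proof -
  have wo: "weight_on \<omega>" by (rule weight_on_Ap[OF w(1)])
  obtain c where c: "0 < c" "AE x in M. c \<le> \<omega> x" by (rule A1_bounded_below[OF w(2)])
  obtain \<kappa> l K where k: "0 < \<kappa>" "0 < l" "0 \<le> K" and pt: "\<And>h u \<pi> uh \<pi>h T z i j. h \<in> H \<Longrightarrow> u \<in> W1p0 2 (\<lambda>_. 1) \<Omega> \<Longrightarrow> (\<And>q. q \<in> Lp_mod_R 2 (\<lambda>_. 1) \<Omega> \<Longrightarrow> b_form \<Omega> u q = 0) \<Longrightarrow>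
      \<pi> \<in> Lp_mod_R 2 (\<lambda>_. 1) \<Omega> \<Longrightarrow> is_stokes_projection \<Omega> (V h) (Q h) u \<pi> uh \<pi>h \<Longrightarrow> T \<in> \<T> h \<Longrightarrow> z \<in> interior T \<Longrightarrow>
      (pderivative i uh z $ j)\<^sup>2 \<le> K * (LINT x|M. kern \<kappa> h l z x * (data_size u \<pi> x)\<^sup>2)"
    by (rule pointwise_bound) blast
  let ?K = "(real CARD('n))^4 * K"
  have K0: "0 \<le> ?K" using k by simp
  obtain C where C: "0 \<le> C" and bound: "\<And>h F g. 0 < h \<Longrightarrow> F \<in> Lp p \<omega> \<Omega> \<Longrightarrow> (\<And>x. 0 \<le> F x) \<Longrightarrow> (g :: real^'n \<Rightarrow> real) \<in> borel_measurable M \<Longrightarrow>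
     (AE z in M. (g z)\<^sup>2 \<le> ?K * (LINT x|M. kern \<kappa> h l z x * (F x)\<^sup>2)) \<Longrightarrow> Lp_norm p \<omega> \<Omega> g \<le> C * Lp_norm p \<omega> \<Omega> F"
    by (rule kern_operator_bound[OF k(1,2) p wo c w(2) K0]) blast
  obtain C0 where e: "embeds p \<omega> 2 (\<lambda>_. 1) C0"
    using embedsI[OF _ p wo weight_on_one c, of 1] by auto
  have p1: "1 \<le> p" using p by simp
  have "Lp_norm p \<omega> \<Omega> (wgrad \<Omega> uh) \<le> (4 * C) * (Lp_norm p \<omega> \<Omega> (wgrad \<Omega> u) + Lp_norm p \<omega> \<Omega> \<pi>)"
    if h: "h \<in> H" and u: "u \<in> W1p0 p \<omega> \<Omega>" and div: "\<And>q. q \<in> Lp_mod_R 2 (\<lambda>_. 1) \<Omega> \<Longrightarrow> b_form \<Omega> u q = 0"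
      and \<pi>: "\<pi> \<in> Lp_mod_R p \<omega> \<Omega>" and uh: "is_stokes_projection \<Omega> (V h) (Q h) u \<pi> uh \<pi>h" for h u \<pi> uh \<pi>h
  proof -
    interpret fe \<Omega> "\<T> h" deg "V h" "Q h" by (rule fe_member[OF h])
    have u2: "u \<in> W1p0 2 (\<lambda>_. 1) \<Omega>" by (rule W1p0_embed[OF e wo p1 _ u]) simp
    have \<pi>2: "\<pi> \<in> Lp_mod_R 2 (\<lambda>_. 1) \<Omega>" by (rule Lp_mod_R_embed[OF e \<pi>])
    have \<pi>L: "\<pi> \<in> Lp p \<omega> \<Omega>" using \<pi> by (simp add: Lp_mod_R_def)
    have uhV: "uh \<in> V h" using uh by (simp add: is_stokes_projection_def)
    note F = data_size_Lp[OF wo p1 W1pD(3)[OF W1p0_W1p[OF u]] \<pi>L]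
    have h0: "0 < h" using meshes h unfolding quasiuniform_meshes_def by blast
    have gm: "(\<lambda>x. norm (wgrad \<Omega> uh x)) \<in> borel_measurable M"
      by (rule measurable_compose[OF wgrad_measurable_W1p[OF V_H1[OF uhV]] borel_measurable_norm])
    have "Lp_norm p \<omega> \<Omega> (\<lambda>x. norm (wgrad \<Omega> uh x)) \<le> C * Lp_norm p \<omega> \<Omega> (data_size u \<pi>)"
    proof (rule bound[OF h0 F(1) data_size_nonneg gm])
      show "AE z in M. (norm (wgrad \<Omega> uh z))\<^sup>2 \<le> ?K * (LINT x|M. kern \<kappa> h l z x * (data_size u \<pi> x)\<^sup>2)"
        by (rule gradient_from_entries[OF uhV k(3) pt[OF h u2 div \<pi>2 uh]])
    qed
    also have "\<dots> \<le> C * (4 * (Lp_norm p \<omega> \<Omega> (wgrad \<Omega> u) + Lp_norm p \<omega> \<Omega> \<pi>))"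
      using F(2) C by (intro mult_left_mono)
    finally show ?thesis by (simp add: Lp_norm_norm mult_ac)
  qed
  then show thesis using that[of "4 * C"] C by simp
qed

text \<open>Duality: test the discrete problem with the projection of the solution of the Stokes problem
  whose right-hand side is \<open>- div (|\<nabla>u\<^sub>h|\<^sup>p\<^sup>-\<^sup>2 \<nabla>u\<^sub>h \<omega>)\<close>.\<close>

lemma velocity_bound_dual:
  assumes p: "1 < p" "p \<le> 2" "conj_exp P < p" and w: "\<omega> \<in> Ap p"
    and dw: "dual_weight p \<omega> \<in> Ap_dom (conj_exp p) \<Omega>" "dual_weight p \<omega> \<in> A1"
  obtains C where "0 \<le> C" "\<And>h u \<pi> uh \<pi>h. h \<in> H \<Longrightarrow> u \<in> W1p0 p \<omega> \<Omega> \<Longrightarrow>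
      \<pi> \<in> Lp_mod_R p \<omega> \<Omega> \<Longrightarrow> is_stokes_projection \<Omega> (V h) (Q h) u \<pi> uh \<pi>h \<Longrightarrow>
      Lp_norm p \<omega> \<Omega> (wgrad \<Omega> uh) \<le> C * (Lp_norm p \<omega> \<Omega> (wgrad \<Omega> u) + Lp_norm p \<omega> \<Omega> \<pi>)"
proof -
  let ?p = "conj_exp p" and ?w = "dual_weight p \<omega>" and ?n = "real CARD('n)"
  have wo: "weight_on \<omega>" by (rule weight_on_Ap[OF w])
  have dAp: "?w \<in> Ap ?p" using dw(1) by (simp add: Ap_dom_def)
  have dwo: "weight_on ?w" by (rule weight_on_Ap[OF dAp])
  have p'1: "1 < ?p" and p'2: "2 \<le> ?p" using p by (auto simp: conj_exp_def field_simps)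
  have cc: "conj_exp ?p = p" by (rule conj_exp_conj_exp[OF p(1)])
  have dd: "dual_weight ?p ?w = \<omega>" by (rule dual_weight_dual[OF p(1)]) (rule weight_onD(1)[OF wo])
  \<comment> \<open>P' < p is equivalent to p' < P, so the dual exponent lies in the range of
    well-posedness; at the lower end P' < 2 \<le> p'.\<close>
  have "?p < P"
  proof -
    have "P < p * (P - 1)" using p(3) P_bounds(1) by (simp add: conj_exp_def field_simps)
    then have "p < P * (p - 1)" by (simp add: algebra_simps)
    then show ?thesis using p(1) by (simp add: conj_exp_def pos_divide_less_eq)
  qed
  then have "stokes_well_posed ?p ?w \<Omega>"
    using P dw(1) P_bounds p'2 unfolding stokes_exponent_def by (meson less_le_trans)
  then obtain Cw where Cw: "\<And>f. f \<in> W1p0_dual p \<omega> \<Omega> \<Longrightarrow> \<exists>\<phi> \<psi>. stokes_solution ?p ?w \<Omega> f \<phi> \<psi> \<and>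
      Lp_norm ?p ?w \<Omega> (wgrad \<Omega> \<phi>) + Lp_norm ?p ?w \<Omega> \<psi> \<le> Cw * W1p0_dual_norm p \<omega> \<Omega> f"
    unfolding stokes_well_posed_def cc dd by blast
  obtain C1 where C1: "0 \<le> C1" and vel: "\<And>h u \<pi> uh \<pi>h. h \<in> H \<Longrightarrow> u \<in> W1p0 ?p ?w \<Omega> \<Longrightarrow> (\<And>q. q \<in> Lp_mod_R 2 (\<lambda>_. 1) \<Omega> \<Longrightarrow> b_form \<Omega> u q = 0) \<Longrightarrow>
      \<pi> \<in> Lp_mod_R ?p ?w \<Omega> \<Longrightarrow> is_stokes_projection \<Omega> (V h) (Q h) u \<pi> uh \<pi>h \<Longrightarrow>
      Lp_norm ?p ?w \<Omega> (wgrad \<Omega> uh) \<le> C1 * (Lp_norm ?p ?w \<Omega> (wgrad \<Omega> u) + Lp_norm ?p ?w \<Omega> \<pi>)"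
    by (rule velocity_bound_A1[OF p'2 dAp dw(2)]) blast
  \<comment> \<open>An upper bound on \<omega> embeds L^2 into L^p(\<omega>), so that b(\<phi>, q) =
    0, known for q in L^p(\<omega>), covers the L^2 pressures that the bound for (p', \<omega>')
    asks for.\<close>
  obtain cup where cup: "AE x in M. \<omega> x \<le> cup" by (rule dual_A1_bounded_above[OF p(1) w dw(2)])
  have p1: "1 \<le> p" "0 < p" using p by auto
  obtain C2 where e2: "embeds 2 (\<lambda>_. 1) p \<omega> C2"
    using embedsI[OF p1(1) p(2) weight_on_one wo zero_less_one _ cup] by auto
  obtain c where c: "0 < c" "AE x in M. c \<le> ?w x" by (rule A1_bounded_below[OF dw(2)])
  obtain C3 where e3: "embeds ?p ?w 2 (\<lambda>_. 1) C3"
    using embedsI[OF _ p'2 dwo weight_on_one c, of 1] by auto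
  let ?C = "(1 + ?n) * (C1 * \<bar>Cw\<bar>)"
  have "Lp_norm p \<omega> \<Omega> (wgrad \<Omega> uh) \<le> ?C * (Lp_norm p \<omega> \<Omega> (wgrad \<Omega> u) + Lp_norm p \<omega> \<Omega> \<pi>)"
    if h: "h \<in> H" and u: "u \<in> W1p0 p \<omega> \<Omega>" and \<pi>: "\<pi> \<in> Lp_mod_R p \<omega> \<Omega>"
      and uh: "is_stokes_projection \<Omega> (V h) (Q h) u \<pi> uh \<pi>h" for h u \<pi> uh \<pi>h
  proof -
    interpret fe \<Omega> "\<T> h" deg "V h" "Q h" by (rule fe_member[OF h])
    have \<pi>L: "\<pi> \<in> Lp p \<omega> \<Omega>" using \<pi> by (simp add: Lp_mod_R_def)
    have uhV: "uh \<in> V h" "\<pi>h \<in> Q h" using uh by (auto simp: is_stokes_projection_def)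
    have uhW0: "uh \<in> W1p0 p \<omega> \<Omega>" by (rule V_W1p0[OF uhV(1) wo p1(1)])
    note uhW = W1p0_W1p[OF uhW0]
    have Dm: "wgrad \<Omega> uh \<in> borel_measurable M" by (rule wgrad_measurable_W1p[OF uhW])
    have Di: "integrable M (\<lambda>x. norm (wgrad \<Omega> uh x) powr p * \<omega> x)" using W1pD(3)[OF uhW] by (simp add: Lp_iff)
    let ?A = "Lp_norm p \<omega> \<Omega> (wgrad \<Omega> u)" and ?B = "Lp_norm p \<omega> \<Omega> \<pi>" and ?N = "Lp_norm p \<omega> \<Omega> (wgrad \<Omega> uh)"
    \<comment> \<open>The duality map: its norm in L^p'(\<omega>') is the power p - 1 of the norm of
      the discrete gradient, and its pairing with that gradient is the power p. At zeros of the
      gradient the convention \<open>0 powr a = 0\<close> is harmless, as g vanishes there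
      anyway.\<close>
    define g where "g x = (norm (wgrad \<Omega> uh x) powr (p - 2) * \<omega> x) *\<^sub>R wgrad \<Omega> uh x" for x
    have gn: "norm (g x) = norm (wgrad \<Omega> uh x) powr (p - 1) * \<omega> x" for x
    proof (cases "wgrad \<Omega> uh x = 0")
      case False
      then have "norm (wgrad \<Omega> uh x) powr (p - 2) * norm (wgrad \<Omega> uh x) = norm (wgrad \<Omega> uh x) powr (p - 1)"
        using powr_add[of "norm (wgrad \<Omega> uh x)" "p - 2" 1] by simp
      then show ?thesis using weight_onD(1)[OF wo, of x] by (simp add: g_def mult_ac)
    qed (simp add: g_def)
    have gpow: "norm (g x) powr ?p * ?w x = norm (wgrad \<Omega> uh x) powr p * \<omega> x" for x
    proof (cases "\<omega> x = 0")
      case True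
      then show ?thesis by (simp add: dual_weight_def)
    next
      case False
      then have wx: "0 < \<omega> x" using weight_onD(1)[OF wo, of x] by simp
      have e1: "(p - 1) * ?p = p" using p by (auto simp: conj_exp_def field_simps)
      have "1 / (1 - p) = - (1 / (p - 1))" by (metis minus_diff_eq minus_divide_right)
      moreover have "?p - 1 / (p - 1) = 1" using p by (simp add: conj_exp_def flip: diff_divide_distrib)
      ultimately have "?p + 1 / (1 - p) = 1" by simp
      note e = e1 this
      have "norm (g x) powr ?p * ?w x = norm (wgrad \<Omega> uh x) powr ((p - 1) * ?p) * (\<omega> x powr ?p * \<omega> x powr (1 / (1 - p)))"
        by (simp add: gn powr_mult powr_powr dual_weight_def)
      also have "\<omega> x powr ?p * \<omega> x powr (1 / (1 - p)) = \<omega> x" using wx e(2) by (simp flip: powr_add)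
      finally show ?thesis unfolding e(1) .
    qed
    have gm: "g \<in> borel_measurable M"
    proof -
      have "(\<lambda>x. norm (wgrad \<Omega> uh x)) \<in> borel_measurable M" by (rule measurable_compose[OF Dm borel_measurable_norm])
      then have "(\<lambda>x. norm (wgrad \<Omega> uh x) powr (p - 2)) \<in> borel_measurable M" by measurable
      then show ?thesis unfolding g_def[abs_def]
        by (intro borel_measurable_scaleR borel_measurable_times Dm weight_onD(2)[OF wo])
    qed
    have gL: "g \<in> Lp ?p ?w \<Omega>" using gm Di by (simp add: Lp_iff gpow)
    have gN: "Lp_norm ?p ?w \<Omega> g = ?N powr (p - 1)"
    proof -
      have "Lp_norm ?p ?w \<Omega> g = (?N powr p) powr (1 / ?p)"
        unfolding Lp_norm_powr[OF wo p1(2)] by (simp add: Lp_norm_eq gpow)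
      moreover have "p * (1 / ?p) = p - 1" using p by (simp add: conj_exp_def field_simps)
      ultimately show ?thesis by (simp only: powr_powr)
    qed
    define f where "f v = (LINT x|M. wgrad \<Omega> v x \<bullet> g x)" for v
    note fd = functional_dual[OF p(1) wo gL, folded f_def[abs_def]]
    from Cw[OF fd(1)] obtain \<phi> \<psi> where s: "stokes_solution ?p ?w \<Omega> f \<phi> \<psi>"
      and sb: "Lp_norm ?p ?w \<Omega> (wgrad \<Omega> \<phi>) + Lp_norm ?p ?w \<Omega> \<psi> \<le> Cw * W1p0_dual_norm p \<omega> \<Omega> f" by blast
    have \<phi>: "\<phi> \<in> W1p0 ?p ?w \<Omega>" "\<psi> \<in> Lp_mod_R ?p ?w \<Omega>" and eq: "\<And>v. v \<in> W1p0 p \<omega> \<Omega> \<Longrightarrow> a_form \<Omega> \<phi> v + b_form \<Omega> v \<psi> = f v"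
      and dv: "\<And>q. q \<in> Lp_mod_R p \<omega> \<Omega> \<Longrightarrow> b_form \<Omega> \<phi> q = 0"
      using s unfolding stokes_solution_def cc dd by blast+
    have dv2: "b_form \<Omega> \<phi> q = 0" if "q \<in> Lp_mod_R 2 (\<lambda>_. 1) \<Omega>" for q
      by (rule dv[OF Lp_mod_R_embed[OF e2 that]])
    have "\<phi> \<in> H1" by (rule W1p_embed[OF e3 W1p0_W1p[OF \<phi>(1)]])
    moreover have "\<psi> \<in> L2" using Lp_mod_R_embed[OF e3 \<phi>(2)] by (simp add: Lp_mod_R_def)
    ultimately obtain \<phi>h \<psi>h where ph: "is_stokes_projection \<Omega> (V h) (Q h) \<phi> \<psi> \<phi>h \<psi>h"
      by (rule discrete_projection_exists)
    have phV: "\<phi>h \<in> V h" "\<psi>h \<in> Q h" using ph by (auto simp: is_stokes_projection_def)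
    let ?D = "Lp_norm ?p ?w \<Omega> (wgrad \<Omega> \<phi>h)"
    have phL: "wgrad \<Omega> \<phi>h \<in> Lp ?p ?w \<Omega>" using p'1 by (intro W1pD(3)[OF V_W1p[OF phV(1) dwo]]) simp
    have D: "?D \<le> C1 * (\<bar>Cw\<bar> * ?N powr (p - 1))"
    proof -
      have "?D \<le> C1 * (Lp_norm ?p ?w \<Omega> (wgrad \<Omega> \<phi>) + Lp_norm ?p ?w \<Omega> \<psi>)"
        by (rule vel[OF h \<phi>(1) dv2 \<phi>(2) ph])
      also have "\<dots> \<le> C1 * (Cw * W1p0_dual_norm p \<omega> \<Omega> f)" using sb C1 by (intro mult_left_mono)
      also have "\<dots> \<le> C1 * (\<bar>Cw\<bar> * W1p0_dual_norm p \<omega> \<Omega> f)" using C1 fd(2) by (intro mult_left_mono mult_right_mono) auto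
      also have "\<dots> \<le> C1 * (\<bar>Cw\<bar> * ?N powr (p - 1))" using C1 fd(3) gN by (intro mult_left_mono) auto
      finally show ?thesis .
    qed
    have fuh: "f uh = ?N powr p"
    proof -
      have "wgrad \<Omega> uh x \<bullet> g x = norm (wgrad \<Omega> uh x) powr p * \<omega> x" for x
      proof (cases "wgrad \<Omega> uh x = 0")
        case False
        then have "norm (wgrad \<Omega> uh x) powr (p - 2) * (norm (wgrad \<Omega> uh x))\<^sup>2 = norm (wgrad \<Omega> uh x) powr p"
          using powr_add[of "norm (wgrad \<Omega> uh x)" "p - 2" 2] by simp
        then show ?thesis by (simp add: g_def power2_norm_eq_inner[symmetric] mult_ac)
      qed (simp add: g_def)
      then show ?thesis unfolding f_def Lp_norm_powr[OF wo p1(2)] by simp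
    qed
    \<comment> \<open>The projection identity is used twice, from the dual solution to its
      projection and from \<open>uh\<close> back to u. Each time the discrete pressure term vanishes
      by the discrete incompressibility of the other velocity.\<close>
    have "?N powr p = a_form \<Omega> \<phi> uh + b_form \<Omega> uh \<psi>" using eq[OF uhW0] fuh by simp
    also have "\<dots> = a_form \<Omega> \<phi>h uh + b_form \<Omega> uh \<psi>h"
      using ph uhV(1) unfolding is_stokes_projection_def by metis
    also have "b_form \<Omega> uh \<psi>h = 0" using uh phV unfolding is_stokes_projection_def by blast
    also have "a_form \<Omega> \<phi>h uh + 0 = a_form \<Omega> uh \<phi>h + b_form \<Omega> \<phi>h \<pi>h"
    proof -
      have "b_form \<Omega> \<phi>h \<pi>h = 0" using ph uhV unfolding is_stokes_projection_def by blast
      then show ?thesis by (simp add: a_form_commute)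
    qed
    also have "\<dots> = a_form \<Omega> u \<phi>h + b_form \<Omega> \<phi>h \<pi>"
      using uh phV unfolding is_stokes_projection_def by blast
    also have "\<dots> \<le> ?A * ?D + ?n * (?B * ?D)"
      using a_form_le[OF p(1) wo W1pD(3)[OF W1p0_W1p[OF u]] phL] b_form_le[OF p(1) wo dwo \<pi>L phL] by linarith
    also have "\<dots> \<le> (1 + ?n) * (?A + ?B) * ?D"
    proof -
      have "0 \<le> ?n * ?A * ?D + ?B * ?D" by (intro add_nonneg_nonneg mult_nonneg_nonneg Lp_norm_nonneg) auto
      then show ?thesis by (simp add: algebra_simps)
    qed
    also have "\<dots> \<le> (1 + ?n) * (?A + ?B) * (C1 * (\<bar>Cw\<bar> * ?N powr (p - 1)))"
      using D by (intro mult_left_mono mult_nonneg_nonneg add_nonneg_nonneg Lp_norm_nonneg) auto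
    finally have fin: "?N powr p \<le> ?C * (?A + ?B) * ?N powr (p - 1)" by (simp add: mult_ac)
    show ?thesis
    \<comment> \<open>The power p - 1 of the norm is to be cancelled, which requires the norm to be
      nonzero.\<close>
    proof (cases "?N = 0")
      case True
      then show ?thesis using C1 by (auto intro!: mult_nonneg_nonneg add_nonneg_nonneg Lp_norm_nonneg)
    next
      case False
      then have N: "0 < ?N" using Lp_norm_nonneg[of p \<omega> "wgrad \<Omega> uh"] by simp
      have "?N * ?N powr (p - 1) = ?N powr p" using powr_add[of ?N 1 "p - 1"] N by simp
      then have "?N * ?N powr (p - 1) \<le> ?C * (?A + ?B) * ?N powr (p - 1)" using fin by simp
      then show ?thesis using N by (simp add: mult_le_cancel_right)
    qed
  qed
  moreover have "0 \<le> ?C" using C1 by simp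
  ultimately show thesis using that by blast
qed

end

theorem theorem4p1:
  fixes \<Omega> :: "(real^'n) set" and P p R :: real and \<omega> :: "real^'n \<Rightarrow> real"
    and H :: "real set" and \<T> :: "real \<Rightarrow> (real^'n) set set"
    and V :: "real \<Rightarrow> (real^'n \<Rightarrow> real^'n) set" and Q :: "real \<Rightarrow> (real^'n \<Rightarrow> real) set"
    and \<delta> :: "real \<Rightarrow> real^'n \<Rightarrow> real^'n \<Rightarrow> real"
  assumes dim: "CARD('n) \<in> {2, 3}"
    and dom: "open \<Omega>" "bounded \<Omega>" "convex \<Omega>" "\<Omega> \<noteq> {}" "polytope (closure \<Omega>)"
    and P: "stokes_exponent \<Omega> P"
    and p: "1 < p"
    and \<omega>: "\<omega> \<in> Ap p"
    and weight_cases: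
      "(2 < p \<and> \<omega> \<in> A1) \<or>
       (p = 2 \<and> (\<omega> \<in> A1 \<or> (\<lambda>x. inverse (\<omega> x)) \<in> Ap_dom 2 \<Omega> \<inter> A1)) \<or>
       (conj_exp P < p \<and> p \<le> 2 \<and> dual_weight p \<omega> \<in> Ap_dom (conj_exp p) \<Omega> \<inter> A1)"
    and meshes: "quasiuniform_meshes \<Omega> H \<T>"
    and spaces: "fe_spaces \<Omega> H \<T> V Q"
    and LBB: "LBB \<Omega> H V Q"
    and R: "0 < R" "\<forall>x\<in>closure \<Omega>. \<Omega> \<subseteq> ball x R"
    and deltas: "regularized_deltas \<Omega> H \<T> V \<delta>"
    and green: "green_estimate \<Omega> H \<T> V Q \<delta> R"
  shows "\<exists>C>0. \<forall>h\<in>H. \<forall>u\<in>W1p0 p \<omega> \<Omega>. \<forall>\<pi>\<in>Lp_mod_R p \<omega> \<Omega>.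
      (AE x\<in>\<Omega> in lebesgue. wdiv \<Omega> u x = 0) \<longrightarrow>
      (\<forall>u\<^sub>h \<pi>\<^sub>h. is_stokes_projection \<Omega> (V h) (Q h) u \<pi> u\<^sub>h \<pi>\<^sub>h \<longrightarrow>
         Lp_norm p \<omega> \<Omega> (wgrad \<Omega> u\<^sub>h) + Lp_norm p \<omega> \<Omega> \<pi>\<^sub>h
           \<le> C * (Lp_norm p \<omega> \<Omega> (wgrad \<Omega> u) + Lp_norm p \<omega> \<Omega> \<pi>))"
proof -
  obtain k where k: "\<And>h. h \<in> H \<Longrightarrow> velocity_space \<Omega> (\<T> h) k (V h)" "\<And>h. h \<in> H \<Longrightarrow> pressure_space \<Omega> (\<T> h) k (Q h)"
    using spaces unfolding fe_spaces_def by blast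
  interpret stokes_family \<Omega> P R H \<T> V Q \<delta> k
    by unfold_locales (use dom P meshes k R deltas green in auto)
  let ?n = "real CARD('n)"
  have wo: "weight_on \<omega>" by (rule weight_on_Ap[OF \<omega>])
  have dwo: "weight_on (dual_weight p \<omega>)" by (rule weight_on_dual_Ap[OF \<omega>])
  \<comment> \<open>For p = 2 the dual weight is the reciprocal, so the second alternative of case
    (ii) becomes an instance of case (iii).\<close>
  have inv: "dual_weight 2 \<omega> = (\<lambda>x. inverse (\<omega> x))"
    using weight_onD(1)[OF wo] by (simp add: dual_weight_def fun_eq_iff powr_minus)
  have "\<exists>C\<ge>0. \<forall>h u \<pi> uh \<pi>h. h \<in> H \<longrightarrow> u \<in> W1p0 p \<omega> \<Omega> \<longrightarrow> \<pi> \<in> Lp_mod_R p \<omega> \<Omega> \<longrightarrow> (AE x\<in>\<Omega> in lebesgue. wdiv \<Omega> u x = 0) \<longrightarrow>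
      is_stokes_projection \<Omega> (V h) (Q h) u \<pi> uh \<pi>h \<longrightarrow>
      Lp_norm p \<omega> \<Omega> (wgrad \<Omega> uh) \<le> C * (Lp_norm p \<omega> \<Omega> (wgrad \<Omega> u) + Lp_norm p \<omega> \<Omega> \<pi>)"
  \<comment> \<open>The first branch covers case (i) and the first alternative of (ii). Whatever
    remains satisfies (iii), because P' < 2.\<close>
  proof (cases "2 \<le> p \<and> \<omega> \<in> A1")
    case True
    then obtain C where "0 \<le> C" "\<And>h u \<pi> uh \<pi>h. h \<in> H \<Longrightarrow> u \<in> W1p0 p \<omega> \<Omega> \<Longrightarrow> (\<And>q. q \<in> Lp_mod_R 2 (\<lambda>_. 1) \<Omega> \<Longrightarrow> b_form \<Omega> u q = 0) \<Longrightarrow>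
      \<pi> \<in> Lp_mod_R p \<omega> \<Omega> \<Longrightarrow> is_stokes_projection \<Omega> (V h) (Q h) u \<pi> uh \<pi>h \<Longrightarrow>
      Lp_norm p \<omega> \<Omega> (wgrad \<Omega> uh) \<le> C * (Lp_norm p \<omega> \<Omega> (wgrad \<Omega> u) + Lp_norm p \<omega> \<Omega> \<pi>)"
      using velocity_bound_A1[OF _ \<omega>] by blast
    then show ?thesis using divergence_free_b_form by (intro exI[of _ C]) blast
  next
    case False
    then have "conj_exp P < p \<and> p \<le> 2 \<and> dual_weight p \<omega> \<in> Ap_dom (conj_exp p) \<Omega> \<inter> A1"
      using weight_cases P_bounds(2) inv by auto
    then obtain C where "0 \<le> C" "\<And>h u \<pi> uh \<pi>h. h \<in> H \<Longrightarrow> u \<in> W1p0 p \<omega> \<Omega> \<Longrightarrow>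
      \<pi> \<in> Lp_mod_R p \<omega> \<Omega> \<Longrightarrow> is_stokes_projection \<Omega> (V h) (Q h) u \<pi> uh \<pi>h \<Longrightarrow>
      Lp_norm p \<omega> \<Omega> (wgrad \<Omega> uh) \<le> C * (Lp_norm p \<omega> \<Omega> (wgrad \<Omega> u) + Lp_norm p \<omega> \<Omega> \<pi>)"
      using velocity_bound_dual[OF p _ _ \<omega>] by blast
    then show ?thesis by (intro exI[of _ C]) blast
  qed
  then obtain C where C: "0 \<le> C" and vel: "\<And>h u \<pi> uh \<pi>h. h \<in> H \<Longrightarrow> u \<in> W1p0 p \<omega> \<Omega> \<Longrightarrow> \<pi> \<in> Lp_mod_R p \<omega> \<Omega> \<Longrightarrow>
      (AE x\<in>\<Omega> in lebesgue. wdiv \<Omega> u x = 0) \<Longrightarrow> is_stokes_projection \<Omega> (V h) (Q h) u \<pi> uh \<pi>h \<Longrightarrow>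
      Lp_norm p \<omega> \<Omega> (wgrad \<Omega> uh) \<le> C * (Lp_norm p \<omega> \<Omega> (wgrad \<Omega> u) + Lp_norm p \<omega> \<Omega> \<pi>)" by blast
  \<comment> \<open>The inf-sup constant belongs to the fixed exponent and weight, hence is the same
    for all meshes.\<close>
  obtain \<beta> where \<beta>: "0 < \<beta>" "\<And>h. h \<in> H \<Longrightarrow> ereal \<beta> \<le> inf_sup_const \<Omega> (V h) (Q h) (conj_exp p) (dual_weight p \<omega>) p \<omega>"
    using LBB p \<omega> unfolding LBB_def by blast
  \<comment> \<open>C for the velocity, (1 + d + C)/\<beta> for the pressure after inserting the
    velocity bound, and 1 to make the constant positive.\<close>
  let ?C = "C + (1 / \<beta>) * (1 + ?n + C) + 1"
  have "Lp_norm p \<omega> \<Omega> (wgrad \<Omega> uh) + Lp_norm p \<omega> \<Omega> \<pi>h \<le> ?C * (Lp_norm p \<omega> \<Omega> (wgrad \<Omega> u) + Lp_norm p \<omega> \<Omega> \<pi>)"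
    if h: "h \<in> H" and u: "u \<in> W1p0 p \<omega> \<Omega>" and \<pi>: "\<pi> \<in> Lp_mod_R p \<omega> \<Omega>" and div: "AE x\<in>\<Omega> in lebesgue. wdiv \<Omega> u x = 0"
      and uh: "is_stokes_projection \<Omega> (V h) (Q h) u \<pi> uh \<pi>h" for h u \<pi> uh \<pi>h
  proof -
    interpret fe \<Omega> "\<T> h" k "V h" "Q h" by (rule fe_member[OF h])
    let ?A = "Lp_norm p \<omega> \<Omega> (wgrad \<Omega> u)" and ?B = "Lp_norm p \<omega> \<Omega> \<pi>" and ?N = "Lp_norm p \<omega> \<Omega> (wgrad \<Omega> uh)"
    have AB: "0 \<le> ?A" "0 \<le> ?B" by (simp_all add: Lp_norm_nonneg)
    have \<pi>L: "\<pi> \<in> Lp p \<omega> \<Omega>" using \<pi> by (simp add: Lp_mod_R_def)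
    have N: "?N \<le> C * (?A + ?B)" by (rule vel[OF h u \<pi> div uh])
    have "Lp_norm p \<omega> \<Omega> \<pi>h \<le> (1 / \<beta>) * (?A + ?n * ?B + ?N)"
      by (rule pressure_estimate[OF p wo dwo \<beta>(1) \<beta>(2)[OF h] W1p0_W1p[OF u] \<pi>L uh])
    also have "\<dots> \<le> (1 / \<beta>) * ((1 + ?n + C) * (?A + ?B))"
    proof (intro mult_left_mono)
      have "0 \<le> ?n * ?A" using AB by simp
      moreover have "(1 + ?n + C) * (?A + ?B) = (?A + ?B) + ?n * ?A + ?n * ?B + C * (?A + ?B)" by (simp add: algebra_simps)
      ultimately show "?A + ?n * ?B + ?N \<le> (1 + ?n + C) * (?A + ?B)" using N AB by linarith
    qed (use \<beta> in simp)
    finally have "Lp_norm p \<omega> \<Omega> \<pi>h \<le> (1 / \<beta>) * (1 + ?n + C) * (?A + ?B)" by (simp add: mult.assoc)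
    then have "?N + Lp_norm p \<omega> \<Omega> \<pi>h \<le> (C + (1 / \<beta>) * (1 + ?n + C)) * (?A + ?B)" using N by (simp only: distrib_right)
    also have "\<dots> \<le> ?C * (?A + ?B)" using AB by (intro mult_right_mono) auto
    finally show ?thesis .
  qed
  moreover have "0 < ?C" using C \<beta>(1) by (auto intro!: add_nonneg_pos mult_nonneg_nonneg add_nonneg_nonneg)
  ultimately show ?thesis by (intro exI[of _ ?C]) blast
qed

end
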